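(* Let $\mathcal{M}$ be a von Neumann algebra, let $E_i:\mathcal{M}\to\mathcal{N}_i$, $i=1,\dots,n$, be a finite family of conditional expectations onto von Neumann subalgebras, let $\mathcal{P}=\frac1n\sum_{i=1}^nE_i$, and let $\mathcal{N}=\bigcap_i\mathcal{N}_i$ be the invariant subalgebra of $\mathcal{P}$, with conditional expectation $E_{\mathcal{N}}:\mathcal{M}\to\mathcal{N}$. Let $\mathcal{B}$ be a non-commutative transportation metric on $\mathcal{M}$ with transportation cost $\mathcal{T}_{\mathcal{B}}$. Assume that the triple $(\mathcal{M},\mathcal{B},\mathcal{P})$ has coarse Ricci curvature lower bound $\kappa>0$. Suppose further that $\mathcal{T}_{\mathcal{B}}$ satisfies the triangle inequality and that, for each $i\in\{1,\dots,n\}$ and every normal state $\rho$, $$\mathcal{T}_{\mathcal{B}}(\rho,\rho\circ E_i)\le C\,\|\rho-\rho\circ E_i\|_1 .$$ Then for every normal state $\rho$ on $\mathcal{M}$, $$\mathcal{T}_{\mathcal{B}}(\rho,\rho\circ E_{\mathcal{N}})\le\frac{C}{1-(1-\kappa)^n}\sqrt{2n\,D(\rho\|\rho\circ E_{\mathcal{N}})}.$$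
   Context: $\mathcal{M}$ is semi-finite with normal faithful semi-finite trace $\tau$; $\mathcal{D}(\mathcal{M})$ is the set of normal states and $\mathcal{M}_{\mathbb R}$ the self-adjoint part of $\mathcal{M}$. Conditional expectations are normal, and $E_{\mathcal N}$ is a normal conditional expectation onto $\mathcal{N}$, assumed to exist. A non-commutative transportation metric is a set $\mathcal{B}\subset\mathcal{M}_{\mathbb R}\times\mathcal{M}_{\mathbb R}$ such that (i) $x\le y$ for all $(x,y)\in\mathcal{B}$; (ii) for all $\omega_1,\omega_2\in\mathcal{D}(\mathcal{M})$ there is $(x,y)\in\mathcal{B}$ with $\omega_1(x)-\omega_2(y)\ge0$. Its cost is $\mathcal{T}_{\mathcal{B}}(\omega_1,\omega_2)=\sup_{(x,y)\in\mathcal{B}}\omega_1(x)-\omega_2(y)\in[0,\infty]$. $(\mathcal{M},\mathcal{B},\mathcal{P})$ has coarse Ricci curvature lower bound $\kappa$ if $\mathcal{T}_{\mathcal{B}}(\omega_1\circ\mathcal{P},\omega_2\circ\mathcal{P})\le(1-\kappa)\,\mathcal{T}_{\mathcal{B}}(\omega_1,\omega_2)$ for all normal states $\omega_1,\omega_2$ with $\omega_1\circ E_{\mathcal{N}}=\omega_2\circ E_{\mathcal{N}}$. $\|\cdot\|_1$ is the norm of the predual $\mathcal{M}_*$, and $D(\rho\|\sigma)=\tau(\rho\log\rho-\rho\log\sigma)$ is the quantum relative entropy, with states identified with their densities with respect to $\tau$.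
   Formalization: Two conditions are added, without which the claim fails: the conditional expectation onto N satisfies E_N∘E_i = E_N for every i (it is not unique otherwise), and (1-κ)^n < 1, so that the denominator of the bound is positive (this excludes only κ ≥ 2 with n even). *)

theory Defs
  imports "HOL-Analysis.Analysis"
begin

section \<open>Complex Hilbert spaces and bounded operators\<close>

text \<open>
  A complex Hilbert space is a real Hilbert space with a compatible complex structure, so that
  the norm, the topology and the type of bounded operators come from the library.
  The complex inner product is linear in its second argument.
\<close>

class chilbert_space = real_inner + complete_space +
  fixes scaleC :: "complex \<Rightarrow> 'a \<Rightarrow> 'a" (infixr "*\<^sub>C" 75)
    and cinner :: "'a \<Rightarrow> 'a \<Rightarrow> complex"
  assumes scaleC_add_right: "a *\<^sub>C (x + y) = a *\<^sub>C x + a *\<^sub>C y"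
    and scaleC_add_left: "(a + b) *\<^sub>C x = a *\<^sub>C x + b *\<^sub>C x"
    and scaleC_scaleC: "a *\<^sub>C (b *\<^sub>C x) = (a * b) *\<^sub>C x"
    and scaleR_scaleC: "r *\<^sub>R x = complex_of_real r *\<^sub>C x"
    and cinner_commute: "cinner x y = cnj (cinner y x)"
    and cinner_add_right: "cinner x (y + z) = cinner x y + cinner x z"
    and cinner_scaleC_right: "cinner x (a *\<^sub>C y) = a * cinner x y"
    and Re_cinner: "Re (cinner x y) = inner x y"

instantiation complex :: chilbert_space
begin

definition scaleC_complex :: "complex \<Rightarrow> complex \<Rightarrow> complex"
  where "scaleC_complex a x = a * x"

definition cinner_complex :: "complex \<Rightarrow> complex \<Rightarrow> complex"
  where "cinner_complex x y = cnj x * y"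

instance
  by standard
    (auto simp: scaleC_complex_def cinner_complex_def algebra_simps scaleR_conv_of_real
      inner_complex_def)

end

lemma norm_scaleC: "norm (a *\<^sub>C x) = cmod a * norm (x :: 'h::chilbert_space)"
proof -
  have "cinner (a *\<^sub>C x) (a *\<^sub>C x) = complex_of_real ((cmod a)\<^sup>2) * cinner x x"
    using cinner_commute[of "a *\<^sub>C x" x] cinner_commute[of x x]
    by (simp add: cinner_scaleC_right complex_norm_square mult.assoc del: of_real_power)
  from arg_cong[OF this, of Re] have "inner (a *\<^sub>C x) (a *\<^sub>C x) = (cmod a)\<^sup>2 * inner x x"
    by (simp add: Re_cinner del: of_real_power)
  then show ?thesis
    by (simp add: norm_eq_sqrt_inner real_sqrt_mult)
qed

lemma bounded_linear_scaleC: "bounded_linear ((*\<^sub>C) a :: 'h::chilbert_space \<Rightarrow> 'h)"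
proof (rule bounded_linear_intro[where K = "cmod a"])
  show "a *\<^sub>C (r *\<^sub>R x) = r *\<^sub>R (a *\<^sub>C x)" for r and x :: 'h
    by (simp add: scaleR_scaleC scaleC_scaleC mult.commute)
qed (simp_all add: scaleC_add_right norm_scaleC mult.commute)

text \<open>The elements of \<open>'h \<Rightarrow>\<^sub>L 'h\<close> are bounded and real-linear; \<open>clinear_op\<close> singles out
  the complex-linear ones.\<close>

type_synonym 'h op = "'h \<Rightarrow>\<^sub>L 'h"

definition clinear_op :: "'h::chilbert_space op \<Rightarrow> bool"
  where "clinear_op x \<longleftrightarrow> (\<forall>a u. blinfun_apply x (a *\<^sub>C u) = a *\<^sub>C blinfun_apply x u)"

text \<open>The operator \<open>a \<cdot> 1\<close>, so that \<open>scalar_op a o\<^sub>L x\<close> is the complex multiple \<open>a \<cdot> x\<close>.\<close>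

definition scalar_op :: "complex \<Rightarrow> 'h::chilbert_space op"
  where "scalar_op a = Blinfun ((*\<^sub>C) a)"

lemma scalar_op_apply [simp]: "blinfun_apply (scalar_op a) u = a *\<^sub>C u"
  by (simp add: scalar_op_def bounded_linear_Blinfun_apply bounded_linear_scaleC)

definition is_adjoint :: "'h::chilbert_space op \<Rightarrow> 'h op \<Rightarrow> bool"
  where "is_adjoint x y \<longleftrightarrow>
    (\<forall>u v. cinner (blinfun_apply x u) v = cinner u (blinfun_apply y v))"

definition op_pos :: "'h::chilbert_space op \<Rightarrow> bool"
  where "op_pos x \<longleftrightarrow>
    (\<forall>u. Im (cinner u (blinfun_apply x u)) = 0 \<and> 0 \<le> Re (cinner u (blinfun_apply x u)))"

definition op_le :: "'h::chilbert_space op \<Rightarrow> 'h op \<Rightarrow> bool"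
  where "op_le x y \<longleftrightarrow> op_pos (y - x)"

definition is_projection :: "'h::chilbert_space op \<Rightarrow> bool"
  where "is_projection p \<longleftrightarrow> p o\<^sub>L p = p \<and> is_adjoint p p"


section \<open>Von Neumann algebras\<close>

definition commutant :: "'h::chilbert_space op set \<Rightarrow> 'h op set"
  where "commutant S = {x. clinear_op x \<and> (\<forall>y\<in>S. x o\<^sub>L y = y o\<^sub>L x)}"

definition von_neumann_algebra :: "'h::chilbert_space op set \<Rightarrow> bool"
  where "von_neumann_algebra M \<longleftrightarrow>
    (\<forall>x\<in>M. clinear_op x) \<and> (\<forall>x\<in>M. \<exists>y\<in>M. is_adjoint x y) \<and> commutant (commutant M) = M"

definition sa_part :: "'h::chilbert_space op set \<Rightarrow> 'h op set"
  where "sa_part M = {x \<in> M. is_adjoint x x}"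

definition pos_part :: "'h::chilbert_space op set \<Rightarrow> 'h op set"
  where "pos_part M = {x \<in> M. op_pos x}"

definition op_directed :: "'h::chilbert_space op set \<Rightarrow> bool"
  where "op_directed A \<longleftrightarrow> A \<noteq> {} \<and> (\<forall>x\<in>A. \<forall>y\<in>A. \<exists>z\<in>A. op_le x z \<and> op_le y z)"

definition is_op_lub :: "'h::chilbert_space op set \<Rightarrow> 'h op set \<Rightarrow> 'h op \<Rightarrow> bool"
  where "is_op_lub M A s \<longleftrightarrow>
    s \<in> M \<and> (\<forall>x\<in>A. op_le x s) \<and> (\<forall>t\<in>M. (\<forall>x\<in>A. op_le x t) \<longrightarrow> op_le s t)"

text \<open>Functionals and maps on \<open>M\<close> are total functions; only their values on \<open>M\<close> matter.
  Normality means preservation of suprema of (bounded) increasing nets of positive elements.\<close>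

definition normal_state :: "'h::chilbert_space op set \<Rightarrow> ('h op \<Rightarrow> complex) \<Rightarrow> bool"
  where "normal_state M \<omega> \<longleftrightarrow>
    (\<forall>x\<in>M. \<forall>y\<in>M. \<omega> (x + y) = \<omega> x + \<omega> y) \<and>
    (\<forall>x\<in>M. \<forall>a. \<omega> (scalar_op a o\<^sub>L x) = a * \<omega> x) \<and>
    (\<forall>x\<in>pos_part M. Im (\<omega> x) = 0 \<and> 0 \<le> Re (\<omega> x)) \<and>
    \<omega> id_blinfun = 1 \<and>
    (\<forall>A s. A \<subseteq> pos_part M \<longrightarrow> op_directed A \<longrightarrow> is_op_lub M A s \<longrightarrow>
       (SUP x\<in>A. ereal (Re (\<omega> x))) = ereal (Re (\<omega> s)))"

text \<open>The norm of the predual, for a normal functional \<open>\<phi>\<close>.\<close>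

definition predual_norm :: "'h::chilbert_space op set \<Rightarrow> ('h op \<Rightarrow> complex) \<Rightarrow> real"
  where "predual_norm M \<phi> = (SUP x\<in>{x \<in> M. norm x \<le> 1}. cmod (\<phi> x))"

definition normal_conditional_expectation ::
    "'h::chilbert_space op set \<Rightarrow> 'h op set \<Rightarrow> ('h op \<Rightarrow> 'h op) \<Rightarrow> bool"
  where "normal_conditional_expectation M N E \<longleftrightarrow>
    von_neumann_algebra N \<and> N \<subseteq> M \<and>
    (\<forall>x\<in>M. E x \<in> N) \<and> (\<forall>x\<in>N. E x = x) \<and>
    (\<forall>x\<in>M. \<forall>y\<in>M. E (x + y) = E x + E y) \<and>
    (\<forall>x\<in>M. \<forall>a. E (scalar_op a o\<^sub>L x) = scalar_op a o\<^sub>L E x) \<and>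
    (\<forall>x\<in>pos_part M. op_pos (E x)) \<and>
    (\<forall>a\<in>N. \<forall>b\<in>N. \<forall>x\<in>M. E (a o\<^sub>L x o\<^sub>L b) = a o\<^sub>L E x o\<^sub>L b) \<and>
    (\<forall>A s. A \<subseteq> pos_part M \<longrightarrow> op_directed A \<longrightarrow> is_op_lub M A s \<longrightarrow>
       is_op_lub M (E ` A) (E s))"

text \<open>A trace is a weight on the positive cone; its values off \<open>pos_part M\<close> are irrelevant.\<close>

definition nfs_trace :: "'h::chilbert_space op set \<Rightarrow> ('h op \<Rightarrow> ennreal) \<Rightarrow> bool"
  where "nfs_trace M \<tau> \<longleftrightarrow>
    (\<forall>x\<in>pos_part M. \<forall>y\<in>pos_part M. \<tau> (x + y) = \<tau> x + \<tau> y) \<and>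
    (\<forall>x\<in>pos_part M. \<forall>r\<ge>0. \<tau> (r *\<^sub>R x) = ennreal r * \<tau> x) \<and>
    (\<forall>x\<in>M. \<forall>y\<in>M. is_adjoint x y \<longrightarrow> \<tau> (y o\<^sub>L x) = \<tau> (x o\<^sub>L y)) \<and>
    (\<forall>A s. A \<subseteq> pos_part M \<longrightarrow> op_directed A \<longrightarrow> is_op_lub M A s \<longrightarrow>
       \<tau> s = (SUP x\<in>A. \<tau> x)) \<and>
    (\<forall>x\<in>pos_part M. \<tau> x = 0 \<longrightarrow> x = 0) \<and>
    (\<forall>x\<in>pos_part M. x \<noteq> 0 \<longrightarrow> (\<exists>y\<in>pos_part M. y \<noteq> 0 \<and> op_le y x \<and> \<tau> y < \<infinity>))"


section \<open>Densities and relative entropy\<close>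

text \<open>
  A positive self-adjoint operator \<open>h\<close> affiliated with \<open>M\<close>, which is in general unbounded, is
  encoded by its spectral resolution \<open>e\<close>, a projection-valued measure in \<open>M\<close> that is carried
  by the half line: \<open>h = \<integral> t e(dt)\<close>.
\<close>

definition positive_spectral_resolution ::
    "'h::chilbert_space op set \<Rightarrow> (real set \<Rightarrow> 'h op) \<Rightarrow> bool"
  where "positive_spectral_resolution M e \<longleftrightarrow>
    (\<forall>A\<in>sets borel. e A \<in> M \<and> is_projection (e A)) \<and>
    e UNIV = id_blinfun \<and> e {..<0} = 0 \<and>
    (\<forall>A\<in>sets borel. \<forall>B\<in>sets borel. e (A \<inter> B) = e A o\<^sub>L e B) \<and>
    (\<forall>A::nat \<Rightarrow> real set. range A \<subseteq> sets borel \<longrightarrow> disjoint_family A \<longrightarrow>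
       (\<forall>u. (\<lambda>k. blinfun_apply (e (A k)) u) sums blinfun_apply (e (\<Union>k. A k)) u))"

text \<open>
  \<open>h = \<integral> t e(dt)\<close> is the density of \<open>\<rho>\<close> with respect to \<open>\<tau>\<close> if \<open>\<rho>(x) = \<tau>(h x)\<close> for positive
  \<open>x\<close> in \<open>M\<close>; here \<open>\<tau>(h x) = \<integral> t \<tau>(e(dt) x e(dt))\<close>, where \<open>A \<mapsto> \<tau>(e(A) x e(A))\<close> is a
  measure because \<open>\<tau>\<close> is a normal trace.
\<close>

definition is_density ::
    "'h::chilbert_space op set \<Rightarrow> ('h op \<Rightarrow> ennreal) \<Rightarrow> ('h op \<Rightarrow> complex) \<Rightarrow>
     (real set \<Rightarrow> 'h op) \<Rightarrow> bool"
  where "is_density M \<tau> \<rho> e \<longleftrightarrow>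
    positive_spectral_resolution M e \<and>
    (\<forall>x\<in>pos_part M.
       (\<integral>\<^sup>+ t. ennreal t \<partial>measure_of UNIV (sets borel) (\<lambda>A. \<tau> (e A o\<^sub>L x o\<^sub>L e A))) =
       ennreal (Re (\<rho> x)))"

text \<open>Every normal state has a density, unique on Borel sets; its values on other
  sets are not determined and never used, hence \<open>SOME\<close> rather than \<open>THE\<close>.\<close>

definition density_of ::
    "'h::chilbert_space op set \<Rightarrow> ('h op \<Rightarrow> ennreal) \<Rightarrow> ('h op \<Rightarrow> complex) \<Rightarrow> real set \<Rightarrow> 'h op"
  where "density_of M \<tau> \<rho> = (SOME e. is_density M \<tau> \<rho> e)"

text \<open>
  With densities \<open>h = \<integral> t e(dt)\<close> of \<open>\<rho>\<close> and \<open>k = \<integral> s f(ds)\<close> of \<open>\<sigma>\<close>, expanding both operators gives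
  \<open>\<tau>(h log h - h log k) = \<integral>\<integral> (log t - log s) t \<tau>(e(dt) f(ds)) = \<integral>\<integral> (log t - log s) \<nu>(dt ds)\<close>,
  where \<open>\<nu>(A \<times> B) = \<tau>(h e(A) f(B)) = \<rho>(e(A) f(B))\<close>. This is real and nonnegative since
  \<open>h\<close> commutes with \<open>e(A)\<close>, and \<open>\<nu>\<close> is a probability measure. The expression makes sense for all
  states: the negative part of \<open>log t - log s\<close> is \<open>\<nu>\<close>-integrable, while \<open>\<tau>(h log h)\<close> and
  \<open>\<tau>(h log k)\<close> may be infinite separately. The value is \<open>\<infinity>\<close> if the support of \<open>\<rho>\<close> is not below
  that of \<open>\<sigma>\<close>, because \<open>log 0 = -\<infinity>\<close>; the set \<open>t = 0\<close> is \<open>\<nu>\<close>-null (\<open>0 log 0 = 0\<close>).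
\<close>

definition joint_spectral_measure ::
    "('h::chilbert_space op \<Rightarrow> complex) \<Rightarrow> (real set \<Rightarrow> 'h op) \<Rightarrow> (real set \<Rightarrow> 'h op) \<Rightarrow>
     (real \<times> real) measure"
  where "joint_spectral_measure \<rho> e f =
    (THE \<nu>. sets \<nu> = sets borel \<and>
       (\<forall>A\<in>sets borel. \<forall>B\<in>sets borel. emeasure \<nu> (A \<times> B) = ennreal (Re (\<rho> (e A o\<^sub>L f B)))))"

definition elog :: "real \<Rightarrow> ereal"
  where "elog t = (if t \<le> 0 then - \<infinity> else ereal (ln t))"

definition relative_entropy ::
    "'h::chilbert_space op set \<Rightarrow> ('h op \<Rightarrow> ennreal) \<Rightarrow> ('h op \<Rightarrow> complex) \<Rightarrow>
     ('h op \<Rightarrow> complex) \<Rightarrow> ereal"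
  where "relative_entropy M \<tau> \<rho> \<sigma> =
    (let \<nu> = joint_spectral_measure \<rho> (density_of M \<tau> \<rho>) (density_of M \<tau> \<sigma>)
     in enn2ereal (\<integral>\<^sup>+ (t, s). e2ennreal (elog t - elog s) \<partial>\<nu>)
      - enn2ereal (\<integral>\<^sup>+ (t, s). e2ennreal (elog s - elog t) \<partial>\<nu>))"

definition esqrt :: "ereal \<Rightarrow> ereal"
  where "esqrt x = (if x = \<infinity> then \<infinity> else ereal (sqrt (real_of_ereal x)))"


section \<open>Transportation metrics and coarse Ricci curvature\<close>

definition transportation_metric ::
    "'h::chilbert_space op set \<Rightarrow> ('h op \<times> 'h op) set \<Rightarrow> bool"
  where "transportation_metric M B \<longleftrightarrow>
    B \<subseteq> sa_part M \<times> sa_part M \<and>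
    (\<forall>(x, y)\<in>B. op_le x y) \<and>
    (\<forall>\<omega>\<^sub>1 \<omega>\<^sub>2. normal_state M \<omega>\<^sub>1 \<longrightarrow> normal_state M \<omega>\<^sub>2 \<longrightarrow>
       (\<exists>(x, y)\<in>B. 0 \<le> Re (\<omega>\<^sub>1 x) - Re (\<omega>\<^sub>2 y)))"

definition transportation_cost ::
    "('h::chilbert_space op \<times> 'h op) set \<Rightarrow> ('h op \<Rightarrow> complex) \<Rightarrow> ('h op \<Rightarrow> complex) \<Rightarrow> ereal"
  where "transportation_cost B \<omega>\<^sub>1 \<omega>\<^sub>2 = (SUP (x, y)\<in>B. ereal (Re (\<omega>\<^sub>1 x) - Re (\<omega>\<^sub>2 y)))"

definition cost_triangle_inequality ::
    "'h::chilbert_space op set \<Rightarrow> ('h op \<times> 'h op) set \<Rightarrow> bool"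
  where "cost_triangle_inequality M B \<longleftrightarrow>
    (\<forall>\<omega>\<^sub>1 \<omega>\<^sub>2 \<omega>\<^sub>3. normal_state M \<omega>\<^sub>1 \<longrightarrow> normal_state M \<omega>\<^sub>2 \<longrightarrow> normal_state M \<omega>\<^sub>3 \<longrightarrow>
       transportation_cost B \<omega>\<^sub>1 \<omega>\<^sub>3 \<le> transportation_cost B \<omega>\<^sub>1 \<omega>\<^sub>2 + transportation_cost B \<omega>\<^sub>2 \<omega>\<^sub>3)"

definition coarse_ricci_lower_bound ::
    "'h::chilbert_space op set \<Rightarrow> ('h op \<Rightarrow> 'h op) \<Rightarrow> ('h op \<times> 'h op) set \<Rightarrow>
     ('h op \<Rightarrow> 'h op) \<Rightarrow> real \<Rightarrow> bool"
  where "coarse_ricci_lower_bound M E\<^sub>N B P \<kappa> \<longleftrightarrow>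
    (\<forall>\<omega>\<^sub>1 \<omega>\<^sub>2. normal_state M \<omega>\<^sub>1 \<longrightarrow> normal_state M \<omega>\<^sub>2 \<longrightarrow>
       (\<forall>x\<in>M. (\<omega>\<^sub>1 \<circ> E\<^sub>N) x = (\<omega>\<^sub>2 \<circ> E\<^sub>N) x) \<longrightarrow>
       transportation_cost B (\<omega>\<^sub>1 \<circ> P) (\<omega>\<^sub>2 \<circ> P) \<le> ereal (1 - \<kappa>) * transportation_cost B \<omega>\<^sub>1 \<omega>\<^sub>2)"

end

(*
The relative entropy D(f|g) dominates the variational expression of Kosaki

 V(f|g) = INT_0^oo (1/(1+r) - inf_x (f((1-x)* (1-x)) + g(x x* )/r)) / r dr,

where x ranges over the algebra. To compare the two, the spectral measures of the densities of f
and g are joined to a measure on the plane, with respect to which D is an integral of logarithms.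
V needs no densities: it is lower semicontinuous, it decreases under normal conditional
expectations, and suitable trial operators x give Pinsker's inequality. Donald's inequality for
convex combinations, proved first for states with bounded logarithms, where it is an identity
between traces, then yields the chain rule

 V(f | s) >= V(f o E | s) + 2 sup_a (f(a) - f(E a))^2    (s = s o E, 0 <= a <= 1).

Let s = rho o E_N. Along a word E_(i_1), ..., E_(i_n) the increments in the chain rule telescope
to at most D(rho|s). Averaging over words, the triangle inequality and Cauchy-Schwarz bound
T(rho, rho o P^n) by C sqrt(2 n D(rho|s)). The curvature bound sums the costs between rho o P^(kn) and
rho o P^((k+1)n) to a geometric series, and the mean ergodic theorem for P passes to the
limit rho o E_N.
*)
theory Submission
 imports Defs
begin

section \<open>Adjoints, positivity and weak limits for the real inner product\<close>

section \<open>Operators on a Hilbert space\<close>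

text \<open>Nothing is computed with an unbounded operator: a density enters only through its
  spectral projections, and on the cell where its value lies between \<theta>^k and \<theta>^(k+1)
  it is traded for a number, at the price of a power of \<theta> that tends to 1 in the end. The
  entropy stands on the right of the claim, so it only has to be bounded below by V.

  The obstacle is the chain rule. Its textbook form D(f|s) = D(f|f o E) + D(f o E|s) argues with
  logarithms of densities in the range of E, but the trace need not be semi-finite there and E need
  not preserve it. Donald's inequality avoids this. For m = (1-t) f + t (f o E) it reads V(m|s) +
  (1-t) V(f|m) <= (1-t) V(f|s) + t V(f o E|s). As m o E = f o E, monotonicity bounds V(m|s) below by
  V(f o E|s), which leaves V(f o E|s) + V(f|m) <= V(f|s). Here f - m = t (f - f o E), so Pinsker's
  inequality and t -> 1 give the chain rule with its constant 2.\<close>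

no_notation matrix_matrix_mult (infixl "**" 70)
notation blinfun_compose (infixl "**" 70)
abbreviation id_op :: "'a::real_normed_vector \<Rightarrow>\<^sub>L 'a" ("\<I>") where "\<I> \<equiv> id_blinfun"

lemmas bilinear_simps = blinfun.bilinear_simps inner_simps

lemma op_simps:
 fixes x y z :: "'a::real_normed_vector \<Rightarrow>\<^sub>L 'a"
 shows "(x ** y) ** z = x ** (y ** z)" "(x + y) ** z = x ** z + y ** z" "x ** (y + z) = x ** y + x ** z"
  "(x - y) ** z = x ** z - y ** z" "x ** (y - z) = x ** y - x ** z"
  "(- x) ** z = - (x ** z)" "x ** (- z) = - (x ** z)"
  "(r *\<^sub>R x) ** z = r *\<^sub>R (x ** z)" "x ** (r *\<^sub>R z) = r *\<^sub>R (x ** z)"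
  "\<I> ** x = x" "x ** \<I> = x" "0 ** x = 0" "x ** 0 = 0" by (auto intro!: blinfun_eqI simp: blinfun.bilinear_simps)

lemma op_sum:
 fixes x :: "'a::real_normed_vector \<Rightarrow>\<^sub>L 'a"
 shows "x ** (\<Sum>i\<in>I. y i) = (\<Sum>i\<in>I. x ** y i)" "(\<Sum>i\<in>I. y i) ** x = (\<Sum>i\<in>I. y i ** x)"
 by (induction I rule: infinite_finite_induct) (auto simp: op_simps)

lemma op_ext_inner:
 fixes x y :: "'a::real_inner \<Rightarrow>\<^sub>L 'a"
 assumes "!!u v. inner u (x v) = inner u (y v)"
 shows "x = y"
proof (rule blinfun_eqI)
 fix v
 have "inner (x v - y v) (x v - y v) = 0" using assms[of "x v - y v" v] by (simp add: inner_diff_right)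
 then show "x v = y v" by simp
qed

text \<open>The linear term dominates near 0. This is the first-order condition wherever an extremum
  is turned into an equation.\<close>

lemma quadratic_linear_zero:
 fixes a b :: real
 assumes "!!t. 0 <= a * t\<^sup>2 + b * t"
 shows "b = 0"
proof (rule ccontr)
 assume b: "b ~= 0"
 define k where "k = \<bar>a\<bar> + 1"
 have k: "k > 0" "a < k" by (auto simp: k_def)
 have "0 <= a * (- b / k)\<^sup>2 + b * (- b / k)" by (rule assms)
 also have "... = (b\<^sup>2 / k\<^sup>2) * (a - k)" using k by (simp add: field_simps power2_eq_square)
 also have "... < 0" using b k by (intro mult_pos_neg) auto
 finally show False by simp
qed

lemma quadratic_discriminant:
 fixes A B C :: real
 assumes q: "!!t. 0 <= A + 2 * t * B + t\<^sup>2 * C" and C: "0 <= C"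
 shows "B\<^sup>2 <= A * C"
proof (cases "C = 0")
 case True
 have "B = 0"
 proof (rule ccontr)
  assume B: "B ~= 0"
  have "0 <= A + 2 * (- (A + 1) / (2 * B)) * B" using q[of "- (A + 1) / (2 * B)"] True by simp
  then show False using B by (simp add: field_simps)
 qed
 then show ?thesis using True by simp
next
 case False
 with C have pos: "C > 0" by simp
 from q[of "- B / C"] have "0 <= A - B\<^sup>2 / C" using pos by (simp add: field_simps power2_eq_square)
 then show ?thesis using pos by (simp add: field_simps)
qed

text \<open>The image of S under T need not be closed, so the energy |T x|^2 / 2 - g x is minimized,
  and only the images of a minimizing sequence converge. With T the identity this yields adjoints;
  with T the evaluation at a vector it turns functionals on the algebra into vector
  functionals.\<close>

lemma riesz_seminorm:
 fixes T :: "'a::real_vector => 'h::{real_inner,complete_space}" and g :: "'a => real"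
 assumes S: "subspace S"
  and T: "!!x y. x \<in> S ==> y \<in> S ==> T (x + y) = T x + T y" "!!r x. x \<in> S ==> T (r *\<^sub>R x) = r *\<^sub>R T x"
  and g: "!!x y. x \<in> S ==> y \<in> S ==> g (x + y) = g x + g y" "!!r x. x \<in> S ==> g (r *\<^sub>R x) = r * g x"
  and bnd: "!!x. x \<in> S ==> \<bar>g x\<bar> <= c * norm (T x)"
 shows "\<exists>w. \<forall>x\<in>S. g x = inner w (T x)"
proof -
 define \<Phi> where "\<Phi> x = inner (T x) (T x) / 2 - g x" for x
 have lower: "\<Phi> x \<ge> - c\<^sup>2 / 2" if "x \<in> S" for x
 proof -
  have "g x <= norm (T x) * c" using bnd[OF that] by (auto simp: mult.commute)
  moreover have "0 <= (norm (T x) - c)\<^sup>2" by simp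
  ultimately show ?thesis by (simp add: \<Phi>_def dot_square_norm power2_diff)
 qed
 define m where "m = Inf (\<Phi> ` S)"
 have S0: "S ~= {}" using S subspace_0 by auto
 have bdd: "bdd_below (\<Phi> ` S)" using lower by (auto intro!: bdd_belowI)
 have mle: "m <= \<Phi> x" if "x \<in> S" for x unfolding m_def using that by (intro cINF_lower bdd)
 have "\<exists>x\<in>S. \<Phi> x < m + 1 / (real n + 1)" for n :: nat
 proof -
  have "Inf (\<Phi> ` S) < m + 1 / (real n + 1)" by (simp add: m_def)
  then show ?thesis using S0 bdd by (subst (asm) cInf_less_iff) auto
 qed
 then obtain X where X: "!!n. X n \<in> S" "!!n. \<Phi> (X n) < m + 1 / (real n + 1)" by metis
 \<comment> \<open>The parallelogram law at the midpoint makes the images of a minimizing sequence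
   Cauchy.\<close>
 have dist: "(norm (T (X i) - T (X j)))\<^sup>2 <= 4 / (real i + 1) + 4 / (real j + 1)" for i j
 proof -
  define y where "y = (1/2) *\<^sub>R (X i + X j)"
  have yS: "y \<in> S" unfolding y_def by (intro subspace_scale[OF S] subspace_add[OF S] X)
  have Ty: "T y = (1/2) *\<^sub>R (T (X i) + T (X j))" "g y = (g (X i) + g (X j)) / 2"
   using X(1) subspace_add[OF S X(1) X(1)] by (auto simp: y_def T g)
  have "(norm (T (X i) - T (X j)))\<^sup>2 = 4 * (\<Phi> (X i) + \<Phi> (X j) - 2 * \<Phi> y)"
   unfolding \<Phi>_def Ty by (simp add: power2_norm_eq_inner inner_simps inner_commute field_simps)
  also have "... <= 4 * ((m + 1 / (real i + 1)) + (m + 1 / (real j + 1)) - 2 * m)" using X(2)[of i] X(2)[of j] mle[OF yS] by simp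
  finally show ?thesis by simp
 qed
 have "Cauchy (\<lambda>n. T (X n))"
 proof (rule CauchyI)
  fix e :: real assume e: "e > 0"
  obtain N where N: "8 / e\<^sup>2 < real N" using reals_Archimedean2 by blast
  have "norm (T (X i) - T (X j)) < e" if "i \<ge> N" "j \<ge> N" for i j
  proof -
   have N0: "0 < real N" using N e by (smt (verit) divide_nonneg_pos zero_less_power)
   have "4 / (real i + 1) + 4 / (real j + 1) <= 4 / real N + 4 / real N" using that N0 by (intro add_mono divide_left_mono) auto
   also have "... < e\<^sup>2" using N e N0 by (simp add: field_simps)
   finally have "(norm (T (X i) - T (X j)))\<^sup>2 < e\<^sup>2" using dist[of i j] by linarith
   then show ?thesis using e power_less_imp_less_base by fastforce
  qed
  then show "\<exists>N. \<forall>i\<ge>N. \<forall>j\<ge>N. norm (T (X i) - T (X j)) < e" by blast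
 qed
 then obtain w where w: "(\<lambda>n. T (X n)) \<longlonglongrightarrow> w" using Cauchy_convergent convergent_def by metis
 have "g y = inner w (T y)" if y: "y \<in> S" for y
 proof -
  \<comment> \<open>First variation at \<open>X n\<close> in direction y: being a minimizer up to 1
    / (n + 1) is enough after passing to the limit.\<close>
  have "0 <= (inner (T y) (T y) / 2) * t\<^sup>2 + (inner w (T y) - g y) * t" for t
  proof (rule tendsto_le[OF sequentially_bot _ tendsto_const always_eventually])
   have *: "(\<lambda>n. inner (T y) (T y) / 2 * t\<^sup>2 + (inner (T (X n)) (T y) - g y) * t + 1 / (real n + 1))
    \<longlonglongrightarrow> (inner (T y) (T y) / 2) * t\<^sup>2 + (inner w (T y) - g y) * t + 0"
    by (intro tendsto_intros w) (use LIMSEQ_inverse_real_of_nat in \<open>simp add: inverse_eq_divide add.commute\<close>)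
   then show "(\<lambda>n. inner (T y) (T y) / 2 * t\<^sup>2 + (inner (T (X n)) (T y) - g y) * t + 1 / (real n + 1))
    \<longlonglongrightarrow> (inner (T y) (T y) / 2) * t\<^sup>2 + (inner w (T y) - g y) * t" by simp
   show "\<forall>n. 0 <= inner (T y) (T y) / 2 * t\<^sup>2 + (inner (T (X n)) (T y) - g y) * t + 1 / (real n + 1)"
   proof
    fix n
    have ty: "t *\<^sub>R y \<in> S" and z: "X n + t *\<^sub>R y \<in> S"
     using y X(1) by (auto intro: subspace_scale[OF S] subspace_add[OF S])
    have "\<Phi> (X n + t *\<^sub>R y) - \<Phi> (X n) = inner (T y) (T y) / 2 * t\<^sup>2 + (inner (T (X n)) (T y) - g y) * t"
     unfolding \<Phi>_def using X(1) y ty by (simp add: T g inner_simps inner_commute algebra_simps power2_eq_square)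
    then show "0 <= inner (T y) (T y) / 2 * t\<^sup>2 + (inner (T (X n)) (T y) - g y) * t + 1 / (real n + 1)"
     using mle[OF z] X(2)[of n] by linarith
   qed
  qed
  from quadratic_linear_zero[OF this] show ?thesis by simp
 qed
 then show ?thesis by blast
qed

text \<open>The adjoint for the real inner product, so that it exists for every bounded real-linear
  operator; for complex-linear ones \<open>is_adjoint_iff\<close> identifies it with the complex
  adjoint.\<close>

definition adj :: "'h::{real_inner,complete_space} op => 'h op"
 where "adj x = (SOME y :: 'h op. \<forall>u v. inner (x u) v = inner u (y v))"

lemma inner_adj:
 fixes x :: "'h::{real_inner,complete_space} op"
 shows "inner (x u) v = inner u (adj x v)"
proof -
 have "\<exists>w. \<forall>u\<in>UNIV. inner (x u) v = inner w u" for v by (rule riesz_seminorm[where c = "norm x * norm v"])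
   (auto simp: bilinear_simps intro!: order_trans[OF Cauchy_Schwarz_ineq2]
    order_trans[OF mult_right_mono[OF norm_blinfun]])
 then obtain w where w: "!!u v. inner (x u) v = inner u (w v)" by (metis UNIV_I inner_commute)
 have "bounded_linear w"
 proof (rule bounded_linear_intro)
  show "w (v + v') = w v + w v'" for v v' by (rule vector_eq_ldot[THEN iffD1]) (simp flip: w add: inner_simps)
  show "w (r *\<^sub>R v) = r *\<^sub>R w v" for r v by (rule vector_eq_ldot[THEN iffD1]) (simp flip: w add: inner_simps)
  show "norm (w v) <= norm v * norm x" for v
  proof (cases "w v = 0")
   case False
   have "norm (w v) * norm (w v) = inner (x (w v)) v" by (simp add: w power2_norm_eq_inner flip: power2_eq_square)
   also have "... <= norm (x (w v)) * norm v" by (rule norm_cauchy_schwarz)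
   also have "... <= norm x * norm (w v) * norm v" by (intro mult_right_mono norm_blinfun) auto
   finally show ?thesis using False by (simp add: mult.commute)
  qed simp
 qed
 then have "\<exists>y. \<forall>u v. inner (x u) v = inner u (blinfun_apply y v)"
  using w by (intro exI[of _ "Blinfun w"]) (simp add: bounded_linear_Blinfun_apply)
 then have "\<forall>u v. inner (x u) v = inner u (adj x v)" unfolding adj_def by (rule someI_ex)
 then show ?thesis by blast
qed

lemma inner_adj2: "inner u (blinfun_apply x v) = inner (adj x u) v" using inner_adj[of x v u] by (simp add: inner_commute)

lemma adjI: "(!!u v. inner (blinfun_apply x u) v = inner u (blinfun_apply y v)) ==> adj x = y" by (rule op_ext_inner) (simp flip: inner_adj)

lemma adj_simps [simp]: "adj (adj x) = x" "adj \<I> = \<I>" "adj 0 = 0" by (rule adjI, simp add: inner_adj2)+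

lemma adj_add: "adj (x + y) = adj x + adj y"
 and adj_diff: "adj (x - y) = adj x - adj y"
 and adj_minus: "adj (- x) = - adj x"
 and adj_scaleR: "adj (r *\<^sub>R x) = r *\<^sub>R adj x"
 and adj_compose: "adj (x ** y) = adj y ** adj x" by (rule adjI, simp add: bilinear_simps inner_adj)+

lemma adj_sum: "adj (\<Sum>i\<in>I. x i) = (\<Sum>i\<in>I. adj (x i))" by (induction I rule: infinite_finite_induct) (auto simp: adj_add)

lemmas adj_rules = adj_add adj_diff adj_minus adj_scaleR adj_compose adj_sum

lemma norm_adj_le: "norm (adj x) <= norm x"
proof (rule norm_blinfun_bound)
 fix v
 show "norm (adj x v) <= norm x * norm v"
 proof (cases "adj x v = 0")
  case False
  have "norm (adj x v) * norm (adj x v) = inner (x (adj x v)) v" by (simp add: inner_adj power2_norm_eq_inner flip: power2_eq_square)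
  also have "... <= norm (x (adj x v)) * norm v" by (rule norm_cauchy_schwarz)
  also have "... <= norm x * norm (adj x v) * norm v" by (intro mult_right_mono norm_blinfun) auto
  finally show ?thesis using False by (simp add: mult.commute)
 qed simp
qed simp

lemma norm_adj [simp]: "norm (adj x) = norm x" using norm_adj_le[of x] norm_adj_le[of "adj x"] by simp

text \<open>Self-adjointness is part of the definition because over the reals a nonnegative
  quadratic form does not imply it.\<close>

definition psd :: "'h::{real_inner,complete_space} op => bool"
 where "psd x \<longleftrightarrow> adj x = x \<and> (\<forall>u. 0 <= inner u (x u))"

lemma psd_sa: "psd x ==> adj x = x" by (simp add: psd_def)

lemma psd_0 [simp]: "psd 0" and psd_id [simp]: "psd \<I>" by (auto simp: psd_def)

lemma psd_add: "psd x ==> psd y ==> psd (x + y)" by (auto simp: psd_def adj_rules bilinear_simps)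

lemma psd_scaleR: "psd x ==> 0 <= r ==> psd (r *\<^sub>R x)" by (auto simp: psd_def adj_rules bilinear_simps)

lemma psd_sum: "(!!i. i \<in> I ==> psd (x i)) ==> psd (\<Sum>i\<in>I. x i)"
 by (induction I rule: infinite_finite_induct) (auto simp: psd_add)

lemma psd_conj: "psd y ==> psd (adj x ** y ** x)" by (auto simp: psd_def adj_rules op_simps simp flip: inner_adj)

lemma psd_conj': "psd y ==> psd (x ** y ** adj x)" using psd_conj[of y "adj x"] by simp

lemma psd_conj_sa: "adj x = x ==> psd y ==> psd (x ** y ** x)" using psd_conj[of y x] by simp

lemma psd_square: "psd (adj x ** x)" "psd (x ** adj x)" using psd_conj[of \<I> x] psd_conj'[of \<I> x] by (simp_all add: op_simps)

lemma psd_square_sa: "adj x = x ==> psd (x ** x)" using psd_square(1)[of x] by simp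

text \<open>Polarization; self-adjointness enters because the real form of a skew-adjoint operator
  vanishes.\<close>

lemma sa_eq_0:
 assumes "adj x = x" "!!u. inner u (x u) = 0"
 shows "x = 0"
proof (rule op_ext_inner)
 fix u v
 have "0 = inner (u + v) (x (u + v))" by (simp add: assms)
 also have "... = inner u (x v) + inner v (x u)" by (simp add: bilinear_simps assms)
 also have "inner v (x u) = inner u (x v)" using inner_adj2[of v x u] assms(1) by (simp add: inner_commute)
 finally show "inner u (x v) = inner u ((0::'a op) v)" by simp
qed

lemma sa_eqI:
 assumes "adj x = x" "adj y = y" "!!u. inner u (x u) = inner u (y u)"
 shows "x = y" using sa_eq_0[of "x - y"] assms by (simp add: adj_rules bilinear_simps)

lemma psd_antisym: "psd x ==> psd (- x) ==> x = 0" by (rule sa_eq_0) (auto simp: psd_def bilinear_simps intro: antisym)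

lemma psd_diff_trans: "psd (z - y) ==> psd (y - x) ==> psd (z - x)" using psd_add[of "z - y" "y - x"] by simp

lemma psd_cauchy_schwarz:
 assumes "psd x"
 shows "(inner u (x v))\<^sup>2 <= inner u (x u) * inner v (x v)"
proof -
 have sym: "inner a (x b) = inner b (x a)" for a b using inner_adj2[of a x b] assms by (simp add: inner_commute psd_def)
 have q: "0 <= inner u (x u) + 2 * t * inner u (x v) + t\<^sup>2 * inner v (x v)" for t
 proof -
  have "0 <= inner (u + t *\<^sub>R v) (x (u + t *\<^sub>R v))" using assms psd_def by blast
  then show ?thesis by (simp add: bilinear_simps sym[of v u] power2_eq_square algebra_simps)
 qed
 show ?thesis by (rule quadratic_discriminant[OF q]) (use assms in \<open>simp add: psd_def\<close>)
qed

text \<open>Cauchy-Schwarz for the form of x between x v and v. It upgrades weak to strong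
  convergence for bounded positive operators.\<close>

lemma norm_psd_apply:
 assumes "psd x"
 shows "(norm (x v))\<^sup>2 <= norm x * inner v (x v)"
proof (cases "x v = 0")
 case False
 have "((norm (x v))\<^sup>2)\<^sup>2 <= inner (x v) (x (x v)) * inner v (x v)"
  using psd_cauchy_schwarz[OF assms, of "x v" v] by (simp add: power2_norm_eq_inner)
 also have "inner (x v) (x (x v)) <= norm x * (norm (x v))\<^sup>2"
  using norm_cauchy_schwarz[of "x v" "x (x v)"] mult_left_mono[OF norm_blinfun[of x "x v"] norm_ge_zero[of "x v"]]
  by (simp add: power2_eq_square algebra_simps)
 finally have "(norm (x v))\<^sup>2 * (norm (x v))\<^sup>2 <= (norm x * inner v (x v)) * (norm (x v))\<^sup>2"
  using assms by (simp add: mult_right_mono psd_def power2_eq_square algebra_simps)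
 moreover have "(norm (x v))\<^sup>2 > 0" using False by simp
 ultimately show ?thesis by (rule mult_right_le_imp_le)
qed (use assms in \<open>simp add: psd_def\<close>)

lemma psd_norm_bound:
 assumes "adj x = x" "norm x <= k"
 shows "psd (k *\<^sub>R \<I> - x)" "psd (k *\<^sub>R \<I> + x)"
proof -
 have "\<bar>inner u (x u)\<bar> <= k * inner u u" for u
 proof -
  have "\<bar>inner u (x u)\<bar> <= norm u * norm (x u)" by (rule Cauchy_Schwarz_ineq2)
  also have "... <= norm u * (k * norm u)" by (intro mult_left_mono order_trans[OF norm_blinfun mult_right_mono]) (use assms in auto)
  finally show ?thesis by (simp add: dot_square_norm power2_eq_square algebra_simps)
 qed
 then have "inner u (x u) <= k * inner u u" "- inner u (x u) <= k * inner u u" for u using abs_le_D1 abs_le_D2 by blast+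
 note q = this
 show "psd (k *\<^sub>R \<I> - x)" using q(1) by (simp add: psd_def assms(1) adj_rules bilinear_simps)
 have "0 <= k * inner u u + inner u (x u)" for u using q(2)[of u] by linarith
 then show "psd (k *\<^sub>R \<I> + x)" by (simp add: psd_def assms(1) adj_rules bilinear_simps)
qed

text \<open>The form is polarized between v and the multiple w of x v that has the length of v, so
  that the inner product of w and x v is |v| |x v|.\<close>

lemma norm_le_of_psd:
 assumes "psd (k *\<^sub>R \<I> - x)" "psd (k *\<^sub>R \<I> + x)" "0 <= k"
 shows "norm x <= k"
proof (rule norm_blinfun_bound)
 have sa: "adj x = x" using psd_sa[OF assms(1)] by (simp add: adj_rules)
 have sym: "inner a (x b) = inner b (x a)" for a b using inner_adj2[of a x b] sa by (simp add: inner_commute)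
 have q1: "inner u (x u) <= k * inner u u" "- inner u (x u) <= k * inner u u" for u
 proof -
  have "0 <= inner u ((k *\<^sub>R \<I> - x) u)" "0 <= inner u ((k *\<^sub>R \<I> + x) u)" using assms unfolding psd_def by blast+
  then show "inner u (x u) <= k * inner u u" "- inner u (x u) <= k * inner u u" by (simp_all add: bilinear_simps)
 qed
 fix v
 show "norm (x v) <= k * norm v"
 proof (cases "x v = 0 \<or> v = 0")
  case False
  define w where "w = (norm v / norm (x v)) *\<^sub>R x v"
  have nw: "norm w = norm v" using False by (simp add: w_def)
  have "4 * inner w (x v) = inner (w + v) (x (w + v)) - inner (w - v) (x (w - v))" by (simp add: bilinear_simps sym[of v w])
  also have "... <= k * inner (w + v) (w + v) + k * inner (w - v) (w - v)" using q1(1)[of "w + v"] q1(2)[of "w - v"] by linarith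
  also have "... = k * (2 * inner w w + 2 * inner v v)" by (simp add: inner_simps algebra_simps)
  also have "... = 4 * (k * (norm v)\<^sup>2)" by (simp add: dot_square_norm nw)
  finally have "inner w (x v) <= k * (norm v)\<^sup>2" by simp
  moreover have "inner w (x v) = norm v * norm (x v)" using False by (simp add: w_def dot_square_norm power2_eq_square)
  ultimately show ?thesis using False by (simp add: power2_eq_square)
 qed (use assms in auto)
qed (use assms in auto)

lemma psd_sandwich_norm: "psd x ==> psd (k *\<^sub>R \<I> - x) ==> 0 <= k ==> norm x <= k"
 by (rule norm_le_of_psd, assumption, intro psd_add psd_scaleR psd_id)

lemma psd_adj_self_le: "psd ((norm x)\<^sup>2 *\<^sub>R \<I> - adj x ** x)"
proof -
 have "norm (adj x ** x) <= (norm x)\<^sup>2" using norm_blinfun_compose[of "adj x" x] by (simp add: power2_eq_square)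
 then show ?thesis by (intro psd_norm_bound) (simp add: adj_rules)
qed

lemma norm_le_of_square: assumes "psd (k\<^sup>2 *\<^sub>R \<I> - adj x ** x)" "0 <= k" shows "norm x <= k"
proof (rule norm_blinfun_bound)
 fix v
 have "0 <= inner v ((k\<^sup>2 *\<^sub>R \<I> - adj x ** x) v)" using assms(1) unfolding psd_def by blast
 then have "inner (x v) (x v) <= k\<^sup>2 * inner v v" by (simp add: bilinear_simps inner_adj)
 then have "(norm (x v))\<^sup>2 <= (k * norm v)\<^sup>2" by (simp only: dot_square_norm power_mult_distrib)
 then show "norm (x v) <= k * norm v" by (rule power2_le_imp_le) (use assms(2) in auto)
qed (use assms in auto)

subsection \<open>Complex-linear operators\<close>

lemma cinner_Im: "Im (cinner u v) = - inner u (\<i> *\<^sub>C v)"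
 using Re_cinner[of u "\<i> *\<^sub>C v"] by (simp add: cinner_scaleC_right)

lemma cinner_eq: "cinner u v = Complex (inner u v) (- inner u (\<i> *\<^sub>C v))" by (simp add: complex_eq_iff cinner_Im Re_cinner)

lemma cinner_scaleC_left: "cinner (a *\<^sub>C u) v = cnj a * cinner u v"
 using cinner_commute[of "a *\<^sub>C u" v] cinner_commute[of u v] by (simp add: cinner_scaleC_right)

lemma inner_scaleC_left: "inner (a *\<^sub>C u) v = inner u (cnj a *\<^sub>C (v::'h::chilbert_space))"
 by (simp add: cinner_scaleC_left cinner_scaleC_right flip: Re_cinner)

lemma adj_scalar_op: "adj (scalar_op a) = (scalar_op (cnj a) :: 'h::chilbert_space op)" by (rule adjI) (simp add: inner_scaleC_left)

lemma scalar_op_simps: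
 "scalar_op 0 = (0 :: 'h::chilbert_space op)" "scalar_op (complex_of_real r) = (r *\<^sub>R \<I> :: 'h op)"
 "scalar_op a + scalar_op b = (scalar_op (a + b) :: 'h op)"
 "scalar_op a ** scalar_op b = (scalar_op (a * b) :: 'h op)"
proof -
 show r: "scalar_op (complex_of_real r) = (r *\<^sub>R \<I> :: 'h op)" for r
  by (rule blinfun_eqI) (simp add: scaleR_scaleC blinfun.bilinear_simps)
 show "scalar_op 0 = (0 :: 'h op)" using r[of 0] by simp
qed (auto intro!: blinfun_eqI simp: scaleC_add_left scaleC_scaleC blinfun.bilinear_simps)

lemma clinear_comm: "clinear_op x \<longleftrightarrow> (\<forall>a. x ** scalar_op a = scalar_op a ** x)" unfolding clinear_op_def
 by (metis (no_types, opaque_lifting) blinfun_apply_blinfun_compose blinfun_eqI scalar_op_apply)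

lemma clinear_adj: "clinear_op x ==> clinear_op (adj x)" unfolding clinear_comm
proof
 fix a assume x: "\<forall>a. x ** scalar_op a = scalar_op a ** x"
 have "adj (x ** scalar_op (cnj a)) = adj (scalar_op (cnj a) ** x)" using x by simp
 then show "adj x ** scalar_op a = scalar_op a ** adj x" by (simp add: adj_compose adj_scalar_op)
qed

lemma is_adjoint_iff:
 assumes "clinear_op (x :: 'h::chilbert_space op)"
 shows "is_adjoint x y \<longleftrightarrow> y = adj x"
proof
 assume "is_adjoint x y"
 then show "y = adj x" unfolding is_adjoint_def by (intro adjI[symmetric]) (metis Re_cinner)
next
 assume y: "y = adj x"
 show "is_adjoint x y" unfolding is_adjoint_def y cinner_eq using clinear_adj[OF assms] by (simp add: inner_adj clinear_op_def)
qed

text \<open>\<open>op_pos\<close> asks only that the complex form be real and nonnegative. Realness,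
  polarized at u and i v, forces self-adjointness; this is where complex linearity is used.\<close>

lemma op_pos_iff:
 assumes "clinear_op (x :: 'h::chilbert_space op)"
 shows "op_pos x \<longleftrightarrow> psd x"
proof
 assume p: "psd x"
 show "op_pos x" unfolding op_pos_def
 proof (intro allI conjI)
  fix u
  have "cinner u (x u) = cinner (x u) u" using is_adjoint_iff[OF assms, of x] psd_sa[OF p] by (simp add: is_adjoint_def)
  then show "Im (cinner u (x u)) = 0" using cinner_commute[of u "x u"] by (metis complex_cnj_cancel_iff Reals_cnj_iff complex_is_Real_iff)
  show "0 <= Re (cinner u (x u))" using p by (simp add: psd_def Re_cinner)
 qed
next
 assume p: "op_pos x"
 have z: "inner u (\<i> *\<^sub>C x u) = 0" for u using p by (simp add: op_pos_def cinner_Im)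
 have polar: "inner u (\<i> *\<^sub>C x v) + inner v (\<i> *\<^sub>C x u) = 0" for u v using z[of "u + v"] z[of u] z[of v]
  by (simp add: bilinear_simps scaleC_add_right)
 have "adj x = x"
 proof (rule adjI)
  fix u v
  have one: "1 *\<^sub>C w = w" "- 1 *\<^sub>C w = - w" for w :: 'h using scaleR_scaleC[of 1 w] scaleR_scaleC[of "-1" w] by simp_all
  have "inner u (\<i> *\<^sub>C x (\<i> *\<^sub>C v)) + inner (\<i> *\<^sub>C v) (\<i> *\<^sub>C x u) = 0" by (rule polar)
  then have "- inner u (x v) + inner v (x u) = 0" using assms by (simp add: clinear_op_def inner_scaleC_left scaleC_scaleC one)
  then show "inner (x u) v = inner u (x v)" by (simp add: inner_commute)
 qed
 then show "psd x" using p by (simp add: psd_def op_pos_def Re_cinner)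
qed

subsection \<open>Weak limits\<close>

text \<open>Weak operator convergence along a filter: directed suprema and cluster points of bounded
  sequences are in general not limits of sequences.\<close>

definition wlim :: "'i filter => ('i => 'h::{real_inner,complete_space} op) => 'h op => bool"
 where "wlim F a s \<longleftrightarrow> (\<forall>u v. ((\<lambda>i. inner u (a i v)) \<longlongrightarrow> inner u (s v)) F)"

lemma wlimD: "wlim F a s ==> ((\<lambda>i. inner u (a i v)) \<longlongrightarrow> inner u (s v)) F" by (simp add: wlim_def)

lemma wlim_compose_right: "wlim F a s ==> wlim F (\<lambda>i. a i ** y) (s ** y)" by (simp add: wlim_def)

lemma wlim_compose_left: "wlim F a s ==> wlim F (\<lambda>i. y ** a i) (y ** s)" by (simp add: wlim_def inner_adj2)

lemma wlim_const [simp]: "wlim F (\<lambda>i. s) s" by (simp add: wlim_def)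

lemma wlim_diff: "wlim F a s ==> wlim F b t ==> wlim F (\<lambda>i. a i - b i) (s - t)"
 by (auto simp: wlim_def bilinear_simps intro!: tendsto_add tendsto_diff)

lemma wlim_adj: "wlim F a s ==> wlim F (\<lambda>i. adj (a i)) (adj s)" by (simp add: wlim_def inner_adj[symmetric] inner_commute)

lemma wlim_unique:
 assumes "F ~= bot" "wlim F a s" "wlim F a t" shows "s = t"
 by (rule op_ext_inner) (rule tendsto_unique[OF assms(1) wlimD[OF assms(2)] wlimD[OF assms(3)]])

lemma wlim_psd:
 assumes "F ~= bot" "wlim F a s" "\<forall>\<^sub>F i in F. psd (a i)" shows "psd s"
proof -
 have "wlim F a (adj s)" unfolding wlim_def
 proof (intro allI)
  fix u v
  have "((\<lambda>i. inner u (adj (a i) v)) \<longlongrightarrow> inner u (adj s v)) F" using wlim_adj[OF assms(2)] wlimD by blast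
  then show "((\<lambda>i. inner u (a i v)) \<longlongrightarrow> inner u (adj s v)) F"
   by (rule Lim_transform_eventually) (use assms(3) in \<open>auto elim!: eventually_mono simp: psd_sa\<close>)
 qed
 then have sa: "adj s = s" using wlim_unique assms by blast
 have "0 <= inner u (s u)" for u by (rule tendsto_le[OF assms(1) wlimD[OF assms(2)] tendsto_const])
   (use assms(3) in \<open>auto elim!: eventually_mono simp: psd_def\<close>)
 then show ?thesis by (simp add: psd_def sa)
qed

text \<open>The limits of the matrix coefficients form a bounded bilinear form, which the Riesz
  lemma represents by an operator.\<close>

lemma wot_limit_exists:
 fixes a :: "'i => 'h::{real_inner,complete_space} op"
 assumes F: "F ~= bot" and K: "\<forall>\<^sub>F i in F. norm (a i) <= K"
  and lim: "!!u v. \<exists>l. ((\<lambda>i. inner u (a i v)) \<longlongrightarrow> l) F"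
 shows "\<exists>s. wlim F a s \<and> norm s <= K"
proof -
 obtain B where B: "!!u v. ((\<lambda>i. inner u (a i v)) \<longlongrightarrow> B u v) F" using lim by metis
 have K0: "0 <= K"
 proof (rule ccontr)
  assume "\<not> ?thesis"
  then have "\<forall>\<^sub>F i in F. False" using K by (auto elim!: eventually_mono dest: order_trans[OF norm_ge_zero])
  then show False using F by (simp add: trivial_limit_def)
 qed
 have bnd: "\<bar>B u v\<bar> <= K * norm u * norm v" for u v
 proof (rule tendsto_le[OF F tendsto_const tendsto_rabs[OF B]])
  show "\<forall>\<^sub>F i in F. \<bar>inner u (a i v)\<bar> <= K * norm u * norm v" using K
  proof eventually_elim
   case (elim i)
   have "\<bar>inner u (a i v)\<bar> <= norm u * norm (a i v)" by (rule Cauchy_Schwarz_ineq2)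
   also have "... <= norm u * (K * norm v)" by (intro mult_left_mono order_trans[OF norm_blinfun mult_right_mono]) (use elim in auto)
   finally show ?case by (simp add: algebra_simps)
  qed
 qed
 have add2: "B u (v + v') = B u v + B u v'" and scale2: "B u (r *\<^sub>R v) = r * B u v"
  and add1: "B (u + u') v = B u v + B u' v" and scale1: "B (r *\<^sub>R u) v = r * B u v" for u u' v v' r
 proof -
  show "B u (v + v') = B u v + B u v'" using tendsto_add[OF B[of u v] B[of u v']] B[of u "v + v'"]
   by (intro tendsto_unique[OF F]) (auto simp: bilinear_simps)
  show "B u (r *\<^sub>R v) = r * B u v" using tendsto_mult_left[OF B[of u v], of r] B[of u "r *\<^sub>R v"]
   by (intro tendsto_unique[OF F]) (auto simp: bilinear_simps)
  show "B (u + u') v = B u v + B u' v" using tendsto_add[OF B[of u v] B[of u' v]] B[of "u + u'" v]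
   by (intro tendsto_unique[OF F]) (auto simp: bilinear_simps)
  show "B (r *\<^sub>R u) v = r * B u v" using tendsto_mult_left[OF B[of u v], of r] B[of "r *\<^sub>R u" v]
   by (intro tendsto_unique[OF F]) (auto simp: bilinear_simps)
 qed
 have "\<exists>w. \<forall>u\<in>UNIV. B u v = inner w u" for v by (rule riesz_seminorm[where c = "K * norm v"])
   (use bnd[of _ v] in \<open>auto simp: add1 scale1 algebra_simps\<close>)
 then obtain w where w: "!!u v. B u v = inner u (w v)" by (metis UNIV_I inner_commute)
 have nw: "norm (w v) <= norm v * K" for v
 proof (cases "w v = 0")
  case False
  have "norm (w v) * norm (w v) <= K * norm (w v) * norm v"
   using bnd[of "w v" v] by (simp add: w power2_norm_eq_inner flip: power2_eq_square)
  then show ?thesis using False by (simp add: mult.commute mult.left_commute)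
 qed (use K0 in auto)
 have bl: "bounded_linear w"
 proof (rule bounded_linear_intro[OF _ _ nw])
  show "w (v + v') = w v + w v'" for v v' by (rule vector_eq_ldot[THEN iffD1]) (simp flip: w add: inner_add_right add2)
  show "w (r *\<^sub>R v) = r *\<^sub>R w v" for r v by (rule vector_eq_ldot[THEN iffD1]) (simp flip: w add: inner_scaleR_right scale2)
 qed
 show ?thesis
 proof (intro exI[of _ "Blinfun w"] conjI)
  show "wlim F a (Blinfun w)" unfolding wlim_def using B by (simp add: bl bounded_linear_Blinfun_apply w)
  show "norm (Blinfun w) <= K" using nw K0 by (intro norm_blinfun_bound) (auto simp: bl bounded_linear_Blinfun_apply mult.commute)
 qed
qed

section \<open>Von Neumann algebras: weak closedness, bounded suprema and square roots\<close>

section \<open>Von Neumann algebras as real operator algebras\<close>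

definition directed_ops :: "'h::{real_inner,complete_space} op set => bool"
 where "directed_ops A \<longleftrightarrow> A ~= {} \<and> (\<forall>x\<in>A. \<forall>y\<in>A. \<exists>z\<in>A. psd (z - x) \<and> psd (z - y))"

text \<open>Supremum at the level of quadratic forms. Unlike the order supremum in M it is visibly
  preserved by compressions; \<open>is_op_lub_iff\<close> shows that the two coincide on directed
  sets of positive elements.\<close>

definition form_sup :: "'h::{real_inner,complete_space} op set => 'h op => bool"
 where "form_sup A s \<longleftrightarrow> (\<forall>x\<in>A. psd (s - x)) \<and>
  (\<forall>u. \<forall>d>0. \<exists>x\<in>A. inner u (s u) - d < inner u (x u))"

locale vn_algebra =
 fixes M :: "'h::chilbert_space op set"
 assumes vn: "von_neumann_algebra M"
begin

lemma clinear: "x \<in> M ==> clinear_op x" using vn by (simp add: von_neumann_algebra_def)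

lemma mem_iff: "x \<in> M \<longleftrightarrow> clinear_op x \<and> (\<forall>y\<in>commutant M. x ** y = y ** x)"
 using vn unfolding von_neumann_algebra_def commutant_def[of "commutant M"] by blast

lemma commutant_clinear: "y \<in> commutant M ==> clinear_op y" by (simp add: commutant_def)

lemma scalar_mem: "scalar_op a \<in> M" unfolding mem_iff using commutant_clinear by (auto simp: clinear_comm scalar_op_simps mult.commute)

lemma id_mem [simp]: "\<I> \<in> M" using scalar_mem[of 1] scalar_op_simps(2)[of 1, where 'h = 'h] by simp

lemma compose_mem: "x \<in> M ==> y \<in> M ==> x ** y \<in> M" unfolding mem_iff clinear_op_def
proof (intro conjI ballI allI; elim conjE)
 fix z assume z: "z \<in> commutant M" and "\<forall>z\<in>commutant M. x ** z = z ** x" "\<forall>z\<in>commutant M. y ** z = z ** y"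
 then have "x ** z = z ** x" "y ** z = z ** y" by auto
 then show "x ** y ** z = z ** (x ** y)" by (simp add: op_simps(1)) (simp flip: op_simps(1))
qed simp

lemma add_mem: "x \<in> M ==> y \<in> M ==> x + y \<in> M"
 unfolding mem_iff clinear_op_def by (simp add: op_simps blinfun.bilinear_simps scaleC_add_right)

lemma scaleR_mem: "x \<in> M ==> r *\<^sub>R x \<in> M" using compose_mem[OF scalar_mem[of "complex_of_real r"], of x]
 by (simp add: scalar_op_simps op_simps)

lemma zero_mem [simp]: "0 \<in> M" using scaleR_mem[OF id_mem, of 0] by simp

lemma minus_mem: "x \<in> M ==> - x \<in> M" using scaleR_mem[of x "-1"] by simp

lemma diff_mem: "x \<in> M ==> y \<in> M ==> x - y \<in> M" using add_mem[of x "- y"] minus_mem[of y] by simp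

lemma adj_mem: "x \<in> M ==> adj x \<in> M"
proof -
 assume x: "x \<in> M"
 then obtain y where "y \<in> M" "is_adjoint x y" using vn by (auto simp: von_neumann_algebra_def)
 then show ?thesis using is_adjoint_iff[OF clinear[OF x]] by simp
qed

lemma sum_mem: "(!!i. i \<in> I ==> x i \<in> M) ==> (\<Sum>i\<in>I. x i) \<in> M"
 by (induction I rule: infinite_finite_induct) (auto simp: add_mem)

lemmas mem_rules = compose_mem add_mem scaleR_mem minus_mem diff_mem adj_mem sum_mem id_mem zero_mem

lemma subspace_M: "subspace M" by (auto simp: subspace_def add_mem scaleR_mem)

text \<open>By the bicommutant condition membership means commuting with certain operators, and
  one-sided multiplication is weakly continuous.\<close>

lemma wlim_mem:
 assumes F: "F ~= bot" and w: "wlim F a s" and a: "\<forall>\<^sub>F i in F. a i \<in> M"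
 shows "s \<in> M"
proof -
 have comm: "s ** y = y ** s" if "!!x. x \<in> M ==> x ** y = y ** x" for y
 proof (rule wlim_unique[OF F])
  show "wlim F (\<lambda>i. a i ** y) (s ** y)" by (rule wlim_compose_right[OF w])
  have e: "\<forall>\<^sub>F i in F. y ** a i = a i ** y" using a by (auto elim!: eventually_mono simp: that)
  show "wlim F (\<lambda>i. a i ** y) (y ** s)" unfolding wlim_def
  proof (intro allI)
   fix u v show "((\<lambda>i. inner u ((a i ** y) v)) \<longlongrightarrow> inner u ((y ** s) v)) F"
    by (rule Lim_transform_eventually[OF wlimD[OF wlim_compose_left[OF w]]])
     (use e in \<open>auto elim!: eventually_mono simp flip: blinfun_apply_blinfun_compose\<close>)
  qed
 qed
 have "clinear_op s" unfolding clinear_comm by (intro allI comm) (use clinear clinear_comm in auto)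
 moreover have "\<forall>y\<in>commutant M. s ** y = y ** s" by (intro ballI comm) (auto simp: commutant_def)
 ultimately show ?thesis by (simp add: mem_iff)
qed

lemma op_pos_psd: "x \<in> M ==> op_pos x \<longleftrightarrow> psd x" by (rule op_pos_iff[OF clinear])

lemma op_le_psd: "x \<in> M ==> y \<in> M ==> op_le x y \<longleftrightarrow> psd (y - x)" by (simp add: op_le_def op_pos_psd diff_mem)

lemma pos_part_iff: "x \<in> pos_part M \<longleftrightarrow> x \<in> M \<and> psd x" by (auto simp: pos_part_def op_pos_psd)

lemma is_adjoint_adj: "x \<in> M ==> is_adjoint x y \<longleftrightarrow> y = adj x" by (rule is_adjoint_iff[OF clinear])

lemma directed_iff: "A \<subseteq> M ==> op_directed A \<longleftrightarrow> directed_ops A" unfolding op_directed_def directed_ops_def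
 by (intro conj_cong refl ball_cong bex_cong) (auto simp: op_le_psd subset_iff)

text \<open>Along the filter of upper tails of A every quadratic form increases to its supremum;
  polarization gives all matrix coefficients, hence a weak limit, and M is weakly closed.\<close>

lemma directed_sup_exists:
 assumes A: "A \<subseteq> M" "directed_ops A" and pos: "!!x. x \<in> A ==> psd x"
  and k: "!!x. x \<in> A ==> psd (k *\<^sub>R \<I> - x)" "0 <= k"
 shows "\<exists>s\<in>M. form_sup A s"
proof -
 define F where "F = (INF x\<in>A. principal {y \<in> A. psd (y - x)})"
 have ne: "A ~= {}" using A by (simp add: directed_ops_def)
 have ev: "eventually Q F \<longleftrightarrow> (\<exists>x\<in>A. \<forall>y\<in>A. psd (y - x) --> Q y)" for Q unfolding F_def
 proof (subst eventually_INF_base[OF ne])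
  fix a b assume "a \<in> A" "b \<in> A"
  then obtain z where "z \<in> A" "psd (z - a)" "psd (z - b)" using A(2) unfolding directed_ops_def by blast
  then show "\<exists>x\<in>A. principal {y \<in> A. psd (y - x)} <=
    inf (principal {y \<in> A. psd (y - a)}) (principal {y \<in> A. psd (y - b)})" by (intro bexI[of _ z]) (auto intro: psd_diff_trans)
 qed (auto simp: eventually_principal)
 have F: "F ~= bot" unfolding trivial_limit_def ev
 proof
  assume "\<exists>x\<in>A. \<forall>y\<in>A. psd (y - x) --> False"
  then obtain x where "x \<in> A" "\<not> psd (x - x)" by blast
  then show False by simp
 qed
 have norm: "norm x <= k" if "x \<in> A" for x using psd_sandwich_norm[OF pos k] that by blast
 have q: "\<exists>l. ((\<lambda>x. inner u (blinfun_apply x u)) \<longlongrightarrow> l) F \<and> (\<forall>x\<in>A. inner u (x u) <= l)" for u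
 proof -
  define l where "l = (SUP x\<in>A. inner u (blinfun_apply x u))"
  have bdd: "bdd_above ((\<lambda>x. inner u (blinfun_apply x u)) ` A)" using k(1) by (intro bdd_aboveI[of _ "k * inner u u"])
    (auto simp: psd_def bilinear_simps)
  have up: "inner u (x u) <= l" if "x \<in> A" for x unfolding l_def by (rule cSUP_upper[OF that bdd])
  have "((\<lambda>x. inner u (blinfun_apply x u)) \<longlongrightarrow> l) F"
  proof (rule order_tendstoI)
   fix a assume "a < l"
   then obtain x where x: "x \<in> A" "a < inner u (x u)" unfolding l_def using less_cSUP_iff[OF ne bdd] by blast
   show "\<forall>\<^sub>F x in F. a < inner u (blinfun_apply x u)" unfolding ev
   proof (intro bexI ballI impI)
    fix y assume "y \<in> A" "psd (y - x)"
    then have "0 <= inner u ((y - x) u)" unfolding psd_def by blast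
    then show "a < inner u (y u)" using x by (simp add: bilinear_simps)
   qed (rule x)
  next
   fix a assume "l < a"
   then show "\<forall>\<^sub>F x in F. inner u (blinfun_apply x u) < a" unfolding ev using ne up by fastforce
  qed
  then show ?thesis using up by blast
 qed
 have inA: "\<forall>\<^sub>F x in F. x \<in> A" unfolding ev using ne by auto
 have "\<exists>s. wlim F (\<lambda>x. x) s \<and> norm s <= k"
 proof (rule wot_limit_exists[OF F])
  show "\<forall>\<^sub>F x in F. norm x <= k" using inA by (auto elim!: eventually_mono simp: norm)
  fix u v
  obtain l1 l2 where l: "((\<lambda>x. inner (u + v) (blinfun_apply x (u + v))) \<longlongrightarrow> l1) F"
   "((\<lambda>x. inner (u - v) (blinfun_apply x (u - v))) \<longlongrightarrow> l2) F" using q by blast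
  have "((\<lambda>x. (inner (u + v) (blinfun_apply x (u + v)) - inner (u - v) (blinfun_apply x (u - v))) / 4)
    \<longlongrightarrow> (l1 - l2) / 4) F" by (intro tendsto_intros l) auto
  then have "((\<lambda>x. inner u (blinfun_apply x v)) \<longlongrightarrow> (l1 - l2) / 4) F"
  proof (rule Lim_transform_eventually)
   show "\<forall>\<^sub>F x in F. (inner (u + v) (blinfun_apply x (u + v)) - inner (u - v) (blinfun_apply x (u - v))) / 4
     = inner u (blinfun_apply x v)" using inA
   proof eventually_elim
    case (elim x)
    have "inner v (x u) = inner u (x v)" using psd_sa[OF pos[OF elim]] inner_adj2[of v x u] by (simp add: inner_commute)
    then show ?case by (simp add: bilinear_simps)
   qed
  qed
  then show "\<exists>l. ((\<lambda>x. inner u (blinfun_apply x v)) \<longlongrightarrow> l) F" by blast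
 qed
 then obtain s where s: "wlim F (\<lambda>x. x) s" by blast
 have sM: "s \<in> M" by (rule wlim_mem[OF F s]) (use inA A(1) in \<open>auto elim!: eventually_mono\<close>)
 have "psd (s - x)" if x: "x \<in> A" for x
 proof (rule wlim_psd[OF F wlim_diff[OF s wlim_const]])
  show "\<forall>\<^sub>F y in F. psd (y - x)" unfolding ev using x by blast
 qed
 moreover have "\<exists>x\<in>A. inner u (s u) - d < inner u (x u)" if "d > 0" for u d
 proof -
  have "\<forall>\<^sub>F x in F. inner u (s u) - d < inner u (blinfun_apply x u)"
   using order_tendstoD(1)[OF wlimD[OF s, of u u], of "inner u (s u) - d"] that by simp
  with inA have "\<forall>\<^sub>F x in F. x \<in> A \<and> inner u (s u) - d < inner u (blinfun_apply x u)" by (rule eventually_conj)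
  then show ?thesis using eventually_happens'[OF F] by blast
 qed
 ultimately show ?thesis using sM unfolding form_sup_def by blast
qed

lemma form_sup_psd:
 assumes "form_sup A s" "x \<in> A" "psd x" shows "psd s" using psd_add[of "s - x" x] assms by (simp add: form_sup_def)

lemma form_sup_le:
 assumes s: "form_sup A s" and t: "!!x. x \<in> A ==> psd (t - x)" and A: "x0 \<in> A"
 shows "psd (t - s)"
proof -
 have "adj (s - x0) = s - x0" "adj (t - x0) = t - x0" using s t A by (auto simp: form_sup_def intro: psd_sa)
 then have "adj ((t - x0) - (s - x0)) = (t - x0) - (s - x0)" by (simp only: adj_diff)
 then have sa: "adj (t - s) = t - s" by simp
 moreover have "inner u (s u) <= inner u (t u)" for u
 proof (rule field_le_epsilon)
  fix e :: real assume "e > 0"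
  then obtain x where x: "x \<in> A" "inner u (s u) - e < inner u (x u)" using s unfolding form_sup_def by blast
  have "0 <= inner u ((t - x) u)" using t[OF x(1)] unfolding psd_def by blast
  then show "inner u (s u) <= inner u (t u) + e" using x(2) by (simp add: bilinear_simps)
 qed
 ultimately show ?thesis by (simp add: psd_def bilinear_simps)
qed

text \<open>A directed set with an upper bound has a form supremum in M, and this must equal the
  least upper bound. It translates the normality conditions of the definitions into statements about
  vectors.\<close>

lemma is_op_lub_iff:
 assumes A: "A \<subseteq> pos_part M" "op_directed A"
 shows "is_op_lub M A s \<longleftrightarrow> s \<in> M \<and> form_sup A s"
proof
 have AM: "A \<subseteq> M" "!!x. x \<in> A ==> psd x" using A by (auto simp: pos_part_iff)
 have dir: "directed_ops A" using A(2) directed_iff[OF AM(1)] by simp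
 then obtain x0 where x0: "x0 \<in> A" by (auto simp: directed_ops_def)
 {
  assume "s \<in> M \<and> form_sup A s"
  then show "is_op_lub M A s" unfolding is_op_lub_def using AM form_sup_le[of A s _ x0] x0 by (auto simp: op_le_psd form_sup_def subset_iff)
 }
 assume lub: "is_op_lub M A s"
 have sM: "s \<in> M" and up: "!!x. x \<in> A ==> psd (s - x)" using lub AM by (auto simp: is_op_lub_def op_le_psd subset_iff)
 have sp: "psd s" using psd_add[OF up[OF x0] AM(2)[OF x0]] by simp
 have "psd (norm s *\<^sub>R \<I> - x)" if "x \<in> A" for x
  using psd_add[OF psd_norm_bound(1)[OF psd_sa[OF sp] order_refl] up[OF that]] by simp
 from directed_sup_exists[OF AM(1) dir AM(2) this norm_ge_zero]
 obtain s' where s': "s' \<in> M" "form_sup A s'" by blast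
 have "psd (s' - s)" using lub s' AM sM by (auto simp: is_op_lub_def op_le_psd subset_iff form_sup_def)
 moreover have "psd (s - s')" by (rule form_sup_le[OF s'(2) up x0])
 ultimately have "s' - s = 0" by (intro psd_antisym) auto
 then show "s \<in> M \<and> form_sup A s" using s' by simp
qed

lemma psd_chain:
 fixes c :: "nat => 'h op"
 assumes c: "!!n. psd (c (Suc n) - c n)"
 shows "m <= n ==> psd (c n - c m)" "directed_ops (range c)"
proof -
 show mono: "psd (c n - c m)" if "m <= n" for m n using that
 proof (induction n rule: dec_induct)
  case (step n)
  then show ?case using psd_diff_trans[OF c[of n] step.IH] by simp
 qed simp
 show "directed_ops (range c)" unfolding directed_ops_def
 proof (intro conjI ballI)
  fix x y assume "x \<in> range c" "y \<in> range c"
  then obtain m n where "x = c m" "y = c n" by blast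
  then show "\<exists>z\<in>range c. psd (z - x) \<and> psd (z - y)" using mono[of m "max m n"] mono[of n "max m n"] by auto
 qed auto
qed

lemma mono_seq_form_sup:
 assumes c: "!!n. c n \<in> M" "!!n. psd (c n)" "!!n. psd (c (Suc n) - c n)" "!!n. psd (k *\<^sub>R \<I> - c n)" "0 <= k"
 shows "\<exists>s\<in>M. form_sup (range c) s \<and> wlim sequentially c s"
proof -
 note mono = psd_chain(1)[of c, OF c(3)]
 have "directed_ops (range c)" by (rule psd_chain(2)) (rule c(3))
 then have "\<exists>s\<in>M. form_sup (range c) s" by (rule directed_sup_exists[where k = k, rotated]) (use c in auto)
 then obtain s where s: "s \<in> M" "form_sup (range c) s" by blast
 have q: "(\<lambda>n. inner u (c n u)) \<longlonglongrightarrow> inner u (s u)" for u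
 proof (rule LIMSEQ_I)
  fix r :: real assume "r > 0"
  then obtain N where N: "inner u (s u) - r < inner u (c N u)" using s(2) unfolding form_sup_def by blast
  show "\<exists>no. \<forall>n\<ge>no. norm (inner u (c n u) - inner u (s u)) < r"
  proof (intro exI[of _ N] allI impI)
   fix n assume "N <= n"
   then have "0 <= inner u ((c n - c N) u)" "0 <= inner u ((s - c n) u)" using mono s(2) unfolding form_sup_def psd_def by blast+
   then show "norm (inner u (c n u) - inner u (s u)) < r" using N by (simp add: bilinear_simps)
  qed
 qed
 have sp: "psd s" by (rule form_sup_psd[OF s(2) _ c(2)]) auto
 have pol: "inner u (x v) = (inner (u + v) (x (u + v)) - inner (u - v) (x (u - v))) / 4"
  if "psd x" for x :: "'h op" and u v using psd_sa[OF that] inner_adj2[of v x u] by (simp add: bilinear_simps inner_commute[of v "x u"])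
   (simp add: inner_commute)
 have "wlim sequentially c s" unfolding wlim_def
 proof (intro allI)
  fix u v
  show "(\<lambda>n. inner u (c n v)) \<longlonglongrightarrow> inner u (s v)"
   unfolding pol[OF sp, of u v] pol[OF c(2), where u = u and v = v] by (intro tendsto_intros q) auto
 qed
 then show ?thesis using s by blast
qed

text \<open>The form of the compressed operator at u is the old form at y u.\<close>

lemma sup_compress:
 assumes "form_sup A s"
 shows "form_sup ((\<lambda>x. adj y ** x ** y) ` A) (adj y ** s ** y)"
proof -
 have "psd (adj y ** s ** y - adj y ** x ** y)" if "x \<in> A" for x
  using psd_conj[of "s - x" y] assms that by (simp add: form_sup_def op_simps)
 then show ?thesis using assms by (auto simp: form_sup_def simp flip: inner_adj)
qed

lemma directed_compress:
 assumes "directed_ops A" shows "directed_ops ((\<lambda>x. adj y ** x ** y) ` A)"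
proof -
 have "psd (adj y ** z ** y - adj y ** x ** y)" if "psd (z - x)" for x z using psd_conj[OF that, of y] by (simp add: op_simps)
 then show ?thesis using assms unfolding directed_ops_def by (simp add: ball_simps) blast
qed

subsection \<open>Square roots\<close>

text \<open>With \<open>x = 1 - a\<close>, the iteration \<open>s \<mapsto> (a + s\<^sup>2)/2\<close> started at \<open>0\<close> consists of polynomials in
 \<open>a\<close> with nonnegative coefficients and increases to \<open>1 - sqrt x\<close>.\<close>

fun sqrt_iter :: "'h op => nat => 'h op" where
 "sqrt_iter a 0 = 0"
| "sqrt_iter a (Suc n) = (1/2) *\<^sub>R (a + sqrt_iter a n ** sqrt_iter a n)"

inductive_set nonneg_poly :: "'h op => 'h op set" for a where
 np_id: "\<I> \<in> nonneg_poly a"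
| np_zero: "0 \<in> nonneg_poly a"
| np_mult: "x \<in> nonneg_poly a ==> a ** x \<in> nonneg_poly a"
| np_add: "x \<in> nonneg_poly a ==> y \<in> nonneg_poly a ==> x + y \<in> nonneg_poly a"
| np_scale: "x \<in> nonneg_poly a ==> 0 <= r ==> r *\<^sub>R x \<in> nonneg_poly a"

lemma np_comm: "x \<in> nonneg_poly a ==> y ** a = a ** y ==> y ** x = x ** y"
 by (induction rule: nonneg_poly.induct) (auto simp: op_simps, metis op_simps(1))

text \<open>Positivity of \<open>a ** x\<close> is carried along, since
  \<open>a ** (a ** x) = a ** x ** a\<close> is a conjugate of x.\<close>

lemma np_psd_conj:
 assumes "x \<in> nonneg_poly a" "psd a" shows "psd x \<and> psd (a ** x)" using assms
proof (induction rule: nonneg_poly.induct)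
 case (np_mult x)
 have sa: "adj a = a" using np_mult by (simp add: psd_sa)
 have c: "a ** x = x ** a" using np_comm[OF np_mult(1), of a] by simp
 have "a ** (a ** x) = a ** (x ** a)" by (simp only: c)
 then have "a ** (a ** x) = a ** x ** a" by (simp only: op_simps(1))
 then show ?case using np_mult psd_conj_sa[OF sa, of x] by simp
qed (auto simp: op_simps intro: psd_add psd_scaleR)

lemma np_compose: "x \<in> nonneg_poly a ==> y \<in> nonneg_poly a ==> x ** y \<in> nonneg_poly a"
 by (induction rule: nonneg_poly.induct) (auto simp: op_simps intro: nonneg_poly.intros)

text \<open>An increment is half of s^2 - t^2 = (s - t)(s + t) for the two preceding iterates, which
  commute as polynomials in a.\<close>

lemma sqrt_iter_np: "sqrt_iter a n \<in> nonneg_poly a" "sqrt_iter a (Suc n) - sqrt_iter a n \<in> nonneg_poly a"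
proof -
 have a: "a \<in> nonneg_poly a" using np_mult[OF np_id, of a] by (simp add: op_simps)
 show 1: "sqrt_iter a n \<in> nonneg_poly a" for n by (induction n) (auto intro!: nonneg_poly.intros np_compose a)
 show "sqrt_iter a (Suc n) - sqrt_iter a n \<in> nonneg_poly a"
 proof (induction n)
  case 0
  then show ?case by (auto intro!: np_scale a)
 next
  case (Suc n)
  define s t where "s = sqrt_iter a (Suc n)" and "t = sqrt_iter a n"
  have comm: "s ** t = t ** s"
  proof (rule np_comm)
   show "t \<in> nonneg_poly a" unfolding t_def by (rule 1)
   show "s ** a = a ** s" using np_comm[of s a a] 1[of "Suc n"] by (simp add: s_def)
  qed
  have "sqrt_iter a (Suc (Suc n)) - sqrt_iter a (Suc n) = (1/2) *\<^sub>R (s ** s - t ** t)" by (simp add: s_def t_def algebra_simps)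
  also have "s ** s - t ** t = (s - t) ** (s + t)" by (simp add: op_simps comm)
  finally show ?case using Suc 1 by (auto intro!: np_scale np_compose np_add simp: s_def t_def simp del: sqrt_iter.simps)
 qed
qed

text \<open>The limit s satisfies 2 s = a + s^2 with a = 1 - x, so (1 - s)^2 = x. Squaring is not
  weakly continuous, hence the iteration is shown to converge strongly.\<close>

lemma sqrt_unit:
 assumes x: "x \<in> M" "psd x" "psd (\<I> - x)"
 shows "\<exists>g\<in>M. psd g \<and> g ** g = x"
proof -
 define a where "a = \<I> - x"
 have a: "a \<in> M" "psd a" "psd (\<I> - a)" using x by (auto simp: a_def mem_rules)
 define c where "c = sqrt_iter a"
 have cM: "c n \<in> M" for n unfolding c_def by (induction n) (auto intro!: mem_rules a)
 have cp: "psd (c n)" "psd (c (Suc n) - c n)" for n using np_psd_conj[OF _ a(2)] sqrt_iter_np by (auto simp: c_def)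
 have norm: "norm (c n) <= 1" for n
 proof (induction n)
  case (Suc n)
  have "norm (c (Suc n)) <= (1/2) * (norm a + norm (c n) * norm (c n))" unfolding c_def sqrt_iter.simps norm_scaleR
   by (intro order_trans[OF mult_left_mono[OF order_trans[OF norm_triangle_ineq add_left_mono[OF norm_blinfun_compose]]]]) auto
  also have "norm a <= 1" using psd_sandwich_norm[of a 1] a by simp
  also have "norm (c n) * norm (c n) <= 1" using Suc by (simp add: mult_le_one)
  finally show ?case by simp
 qed (simp add: c_def)
 have c1: "psd (1 *\<^sub>R \<I> - c n)" for n by (rule psd_norm_bound(1)[OF psd_sa[OF cp(1)] norm])
 obtain s where s: "s \<in> M" "form_sup (range c) s" "wlim sequentially c s" using mono_seq_form_sup[of c 1, OF cM cp c1] by auto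
 have sp: "psd s" by (rule form_sup_psd[OF s(2) _ cp(1)]) auto
 have s1: "psd (\<I> - s)" using form_sup_le[OF s(2), of \<I> "c 0"] c1 by auto
 have com: "a ** c n = c n ** a" for n unfolding c_def using np_comm[OF sqrt_iter_np(1), of a a n] by simp
 have sn: "norm (s - c n) <= 1" for n
 proof (rule psd_sandwich_norm)
  show "psd (s - c n)" using s(2) by (auto simp: form_sup_def)
  show "psd (1 *\<^sub>R \<I> - (s - c n))" using psd_add[OF s1 cp(1)[of n]] by (simp add: algebra_simps)
 qed simp
 have strong: "(\<lambda>n. c n v) \<longlonglongrightarrow> s v" for v
 proof -
  have "(\<lambda>n. inner v (s v) - inner v (c n v)) \<longlonglongrightarrow> 0"
   using tendsto_diff[OF tendsto_const wlimD[OF s(3), of v v], of "inner v (s v)"] by simp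
  moreover have "(norm (c n v - s v))\<^sup>2 <= inner v (s v) - inner v (c n v)" for n
  proof -
   have p: "psd (s - c n)" using s(2) by (auto simp: form_sup_def)
   have "(norm ((s - c n) v))\<^sup>2 <= norm (s - c n) * inner v ((s - c n) v)" by (rule norm_psd_apply[OF p])
   also have "... <= 1 * inner v ((s - c n) v)" using p sn by (intro mult_right_mono) (auto simp: psd_def)
   finally show ?thesis by (simp add: bilinear_simps norm_minus_commute)
  qed
  ultimately have "(\<lambda>n. (norm (c n v - s v))\<^sup>2) \<longlonglongrightarrow> 0"
   by (rule_tac tendsto_sandwich[OF _ _ tendsto_const, rotated 2]) auto
  then have "(\<lambda>n. sqrt ((norm (c n v - s v))\<^sup>2)) \<longlonglongrightarrow> sqrt 0" by (rule tendsto_real_sqrt)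
  then show ?thesis by (simp add: LIM_zero_iff tendsto_norm_zero_iff)
 qed
 have "wlim sequentially (\<lambda>n. c (Suc n)) ((1/2) *\<^sub>R (a + s ** s))" unfolding wlim_def
 proof (intro allI)
  fix u v
  have "(\<lambda>n. inner u (a v) / 2 + inner (c n u) (c n v) / 2) \<longlonglongrightarrow> inner u (a v) / 2 + inner (s u) (s v) / 2"
   by (intro tendsto_intros strong) auto
  then show "(\<lambda>n. inner u (c (Suc n) v)) \<longlonglongrightarrow> inner u (((1/2) *\<^sub>R (a + s ** s)) v)"
   using psd_sa[OF cp(1)] psd_sa[OF sp] by (simp add: c_def bilinear_simps inner_adj add_divide_distrib)
 qed
 moreover have "wlim sequentially (\<lambda>n. c (Suc n)) s" using s(3) unfolding wlim_def by (auto intro: LIMSEQ_Suc)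
 ultimately have fix_s: "s = (1/2) *\<^sub>R (a + s ** s)" using wlim_unique[OF sequentially_bot] by blast
 have "2 *\<^sub>R s = a + s ** s" using arg_cong[OF fix_s, of "\<lambda>z. 2 *\<^sub>R z"] by simp
 then have "(\<I> - s) ** (\<I> - s) = x" by (simp add: op_simps a_def scaleR_2 algebra_simps)
 then show ?thesis using s1 s(1) by (intro bexI[of _ "\<I> - s"]) (auto simp: mem_rules)
qed

lemma sqrt_exists:
 assumes x: "x \<in> M" "psd x"
 shows "\<exists>g\<in>M. psd g \<and> g ** g = x"
proof (cases "x = 0")
 case False
 then have n: "norm x > 0" by simp
 have "psd ((1 / norm x) *\<^sub>R (norm x *\<^sub>R \<I> - x))" by (intro psd_scaleR psd_norm_bound psd_sa x) auto
 then have "psd (\<I> - (1 / norm x) *\<^sub>R x)" using n by (simp add: scaleR_diff_right)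
 then obtain g where g: "g \<in> M" "psd g" "g ** g = (1 / norm x) *\<^sub>R x"
  using sqrt_unit[of "(1 / norm x) *\<^sub>R x"] x by (auto simp: mem_rules psd_scaleR)
 have "(sqrt (norm x) *\<^sub>R g) ** (sqrt (norm x) *\<^sub>R g) = x" using n by (simp add: op_simps g)
 then show ?thesis using g by (intro bexI[of _ "sqrt (norm x) *\<^sub>R g"]) (auto simp: mem_rules psd_scaleR)
qed (auto intro!: bexI[of _ 0] simp: op_simps)

definition root_op :: "'h op => 'h op"
 where "root_op x = (SOME g. g \<in> M \<and> psd g \<and> g ** g = x)"

lemma root_op:
 assumes "x \<in> M" "psd x"
 shows "root_op x \<in> M" "psd (root_op x)" "root_op x ** root_op x = x" "adj (root_op x) = root_op x"
proof -
 have "root_op x \<in> M \<and> psd (root_op x) \<and> root_op x ** root_op x = x"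
  unfolding root_op_def by (rule someI_ex) (use sqrt_exists[OF assms] in blast)
 then show "root_op x \<in> M" "psd (root_op x)" "root_op x ** root_op x = x" "adj (root_op x) = root_op x" by (auto simp: psd_sa)
qed

end

section \<open>Normal positive functionals: exhaustion by small pieces, weak continuity, weak
  compactness\<close>

section \<open>Normal positive functionals\<close>

context vn_algebra
begin

text \<open>Models the real part of a positive complex functional: real-linear, and invariant under
  adjoints in place of hermitian symmetry.\<close>

definition pfun :: "('h op => real) => bool"
 where "pfun f \<longleftrightarrow> (\<forall>x\<in>M. \<forall>y\<in>M. f (x + y) = f x + f y) \<and> (\<forall>x\<in>M. \<forall>r. f (r *\<^sub>R x) = r * f x) \<and>
  (\<forall>x\<in>M. f (adj x) = f x) \<and> (\<forall>x\<in>M. psd x --> 0 <= f x)"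

text \<open>Normality as approximation of the value at a form supremum, a shape that compressions,
  sums and positive multiples preserve directly.\<close>

definition nfun :: "('h op => real) => bool"
 where "nfun f \<longleftrightarrow> pfun f \<and> (\<forall>A s. A \<subseteq> M --> (\<forall>x\<in>A. psd x) --> directed_ops A --> s \<in> M -->
  form_sup A s --> (\<forall>d>0. \<exists>x\<in>A. f s - d < f x))"

lemma nfun_pfun: "nfun f ==> pfun f" by (simp add: nfun_def)

lemma nfunD:
 assumes "nfun f" "A \<subseteq> M" "!!x. x \<in> A ==> psd x" "directed_ops A" "s \<in> M" "form_sup A s" "d > 0"
 shows "\<exists>x\<in>A. f s - d < f x" using assms unfolding nfun_def by blast

lemma pfun_add: "pfun f ==> x \<in> M ==> y \<in> M ==> f (x + y) = f x + f y"
 and pfun_scaleR: "pfun f ==> x \<in> M ==> f (r *\<^sub>R x) = r * f x"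
 and pfun_adj: "pfun f ==> x \<in> M ==> f (adj x) = f x"
 and pfun_nonneg: "pfun f ==> x \<in> M ==> psd x ==> 0 <= f x" by (auto simp: pfun_def)

lemma pfun_zero: "pfun f ==> f 0 = 0" using pfun_scaleR[of f 0 0] by simp

lemma pfun_minus: "pfun f ==> x \<in> M ==> f (- x) = - f x" using pfun_scaleR[of f x "-1"] by simp

lemma pfun_diff: "pfun f ==> x \<in> M ==> y \<in> M ==> f (x - y) = f x - f y"
 using pfun_add[of f x "- y"] pfun_minus[of f y] by (simp add: mem_rules)

lemma pfun_sum: "pfun f ==> (!!i. i \<in> I ==> x i \<in> M) ==> f (\<Sum>i\<in>I. x i) = (\<Sum>i\<in>I. f (x i))"
 by (induction I rule: infinite_finite_induct) (auto simp: pfun_zero pfun_add sum_mem)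

lemmas pfun_rules = pfun_add pfun_scaleR pfun_minus pfun_diff pfun_zero

lemma pfun_mono: "pfun f ==> x \<in> M ==> y \<in> M ==> psd (y - x) ==> f x <= f y"
 using pfun_nonneg[of f "y - x"] pfun_diff[of f y x] by (simp add: mem_rules)

lemma pfun_cauchy_schwarz:
 assumes f: "pfun f" and x: "x \<in> M" "y \<in> M"
 shows "(f (adj x ** y))\<^sup>2 <= f (adj x ** x) * f (adj y ** y)"
proof (rule quadratic_discriminant)
 fix t :: real
 have sym: "f (adj y ** x) = f (adj x ** y)" using pfun_adj[OF f, of "adj x ** y"] x by (simp add: mem_rules adj_rules)
 have "0 <= f (adj (x + t *\<^sub>R y) ** (x + t *\<^sub>R y))" using x by (intro pfun_nonneg[OF f] psd_square mem_rules)
 also have "... = f (adj x ** x) + 2 * t * f (adj x ** y) + t\<^sup>2 * f (adj y ** y)"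
  using x by (simp add: adj_rules op_simps pfun_rules[OF f] mem_rules sym power2_eq_square algebra_simps)
 finally show "0 <= f (adj x ** x) + 2 * t * f (adj x ** y) + t\<^sup>2 * f (adj y ** y)" .
qed (use x in \<open>auto intro!: pfun_nonneg[OF f] psd_square mem_rules\<close>)

lemma pfun_abs_bound:
 assumes f: "pfun f" and x: "x \<in> M"
 shows "\<bar>f x\<bar> <= norm x * f \<I>"
proof -
 define y where "y = (1/2) *\<^sub>R (x + adj x)"
 have y: "y \<in> M" "adj y = y" using x by (auto simp: y_def mem_rules adj_rules add.commute)
 have fy: "f y = f x" using x by (simp add: y_def pfun_rules[OF f] pfun_adj[OF f] mem_rules)
 have ny: "norm y <= norm x" using norm_triangle_ineq[of x "adj x"] by (simp add: y_def)
 note p = psd_norm_bound[OF y(2) ny]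
 have "0 <= norm x * f \<I> - f y" "0 <= norm x * f \<I> + f y" using pfun_nonneg[OF f _ p(1)] pfun_nonneg[OF f _ p(2)] y(1)
  by (simp_all add: pfun_rules[OF f] mem_rules)
 then show ?thesis by (simp add: fy)
qed

lemma pfun_conj: "pfun f ==> y \<in> M ==> pfun (\<lambda>x. f (adj y ** x ** y))" unfolding pfun_def[of "\<lambda>x. f (adj y ** x ** y)"]
 using pfun_adj[of f "adj y ** _ ** y"] by (auto simp: op_simps pfun_rules mem_rules adj_rules intro!: pfun_nonneg)
  (metis psd_conj op_simps(1))

lemma nfun_conj:
 assumes f: "nfun f" and y: "y \<in> M" shows "nfun (\<lambda>x. f (adj y ** x ** y))" unfolding nfun_def
proof (intro conjI allI impI)
 fix A s and d :: real
 assume A: "A \<subseteq> M" "\<forall>x\<in>A. psd x" "directed_ops A" "s \<in> M" "form_sup A s" "d > 0"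
 have "\<exists>x\<in>(\<lambda>x. adj y ** x ** y) ` A. f (adj y ** s ** y) - d < f x"
  using A y by (intro nfunD[OF f] directed_compress sup_compress) (auto intro!: mem_rules psd_conj)
 then show "\<exists>x\<in>A. f (adj y ** s ** y) - d < f (adj y ** x ** y)" by blast
qed (intro pfun_conj nfun_pfun f y)

lemma nfun_add: assumes f: "nfun f" and g: "nfun g" shows "nfun (\<lambda>x. f x + g x)" unfolding nfun_def
proof (intro conjI allI impI)
 show "pfun (\<lambda>x. f x + g x)" using nfun_pfun[OF f] nfun_pfun[OF g] unfolding pfun_def by (auto simp: algebra_simps)
 fix A s and d :: real
 assume A: "A \<subseteq> M" "\<forall>x\<in>A. psd x" "directed_ops A" "s \<in> M" "form_sup A s" "d > 0"
 obtain x where x: "x \<in> A" "f s - d / 2 < f x" using nfunD[OF f, of A s "d/2"] A by auto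
 obtain y where y: "y \<in> A" "g s - d / 2 < g y" using nfunD[OF g, of A s "d/2"] A by auto
 obtain z where z: "z \<in> A" "psd (z - x)" "psd (z - y)" using A(3) x y unfolding directed_ops_def by blast
 have "f x <= f z" "g y <= g z" using x y z A by (auto intro!: pfun_mono nfun_pfun f g)
 then show "\<exists>x\<in>A. f s + g s - d < f x + g x" using x y z by (intro bexI[of _ z]) auto
qed

lemma nfun_scale: assumes f: "nfun f" and r: "0 <= r" shows "nfun (\<lambda>x. r * f x)" unfolding nfun_def
proof (intro conjI allI impI)
 show "pfun (\<lambda>x. r * f x)" using nfun_pfun[OF f] r unfolding pfun_def by (auto simp: algebra_simps)
 fix A s and d :: real
 assume A: "A \<subseteq> M" "\<forall>x\<in>A. psd x" "directed_ops A" "s \<in> M" "form_sup A s" "d > 0"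
 \<comment> \<open>The denominator is r + 1 because r may be 0.\<close>
 have "d / (r + 1) > 0" using A r by simp
 then obtain x where x: "x \<in> A" "f s - d / (r + 1) < f x" using nfunD[OF f, of A s] A by blast
 have "r * (f s - f x) <= r * (d / (r + 1))" using x r by (intro mult_left_mono) auto
 also have "... < d" using r A by (simp add: field_simps)
 finally show "\<exists>x\<in>A. r * f s - d < r * f x" using x by (intro bexI[of _ x]) (auto simp: algebra_simps)
qed

lemma vector_nfun: "nfun (\<lambda>x. inner v (blinfun_apply x v))" unfolding nfun_def pfun_def form_sup_def
 by (auto simp: bilinear_simps psd_def inner_commute simp flip: inner_adj)

text \<open>Zorn's lemma on the positive elements below e with property Q: chains have form suprema,
  and a maximal element short of e could be enlarged by \<open>step\<close>. Properties known only
  on small pieces reach the whole algebra this way.\<close>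

lemma exhaust:
 assumes e: "e \<in> M" "psd e" and Q0: "Q 0"
  and sup: "!!C s. (!!c. c \<in> C ==> c \<in> M \<and> psd c \<and> psd (e - c) \<and> Q c) ==> directed_ops C ==> s \<in> M ==>
   form_sup C s ==> psd s ==> psd (e - s) ==> Q s"
  and step: "!!a. a \<in> M ==> psd a ==> psd (e - a) ==> a ~= e ==> Q a ==>
   \<exists>b\<in>M. psd b \<and> b ~= 0 \<and> psd (e - a - b) \<and> Q (a + b)"
 shows "Q e"
proof -
 define X where "X = {a \<in> M. psd a \<and> psd (e - a) \<and> Q a}"
 define P where "P a b = psd (b - a)" for a b :: "'h op"
 have po: "partial_order_on X (relation_of P X)"
 proof (rule partial_order_on_relation_ofI)
  fix a b assume "P a b" "P b a"
  then have "b - a = 0" unfolding P_def by (intro psd_antisym) auto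
  then show "a = b" by simp
 qed (auto simp: P_def intro: psd_diff_trans)
 have "\<exists>m\<in>X. \<forall>a\<in>X. P m a --> a = m"
 proof (rule predicate_Zorn[OF po])
  fix C assume "C \<in> Chains (relation_of P X)"
  then have C: "C \<subseteq> X" "!!a b. a \<in> C ==> b \<in> C ==> P a b \<or> P b a" unfolding Chains_def relation_of_def by auto
  show "\<exists>u\<in>X. \<forall>a\<in>C. P a u"
  proof (cases "C = {}")
   case True
   then show ?thesis using e Q0 by (intro bexI[of _ 0]) (auto simp: X_def)
  next
   case False
   have dir: "directed_ops C" unfolding directed_ops_def
   proof (intro conjI ballI False)
    fix x y assume "x \<in> C" "y \<in> C"
    then consider "psd (y - x)" | "psd (x - y)" using C(2)[of x y] unfolding P_def by blast
    then show "\<exists>z\<in>C. psd (z - x) \<and> psd (z - y)"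
    proof cases
     case 1
     then show ?thesis using \<open>y \<in> C\<close> by (intro bexI[of _ y]) auto
    next
     case 2
     then show ?thesis using \<open>x \<in> C\<close> by (intro bexI[of _ x]) auto
    qed
   qed
   have "\<exists>s\<in>M. form_sup C s"
   proof (rule directed_sup_exists[OF _ dir _ _ norm_ge_zero[of e]])
    fix x assume "x \<in> C"
    then have "psd (e - x)" using C by (auto simp: X_def)
    from psd_add[OF this psd_norm_bound(1)[OF psd_sa[OF e(2)] order_refl]]
    show "psd (norm e *\<^sub>R \<I> - x)" by simp
   qed (use C in \<open>auto simp: X_def\<close>)
   then obtain s where s: "s \<in> M" "form_sup C s" by blast
   obtain x0 where x0: "x0 \<in> C" using False by blast
   have CX: "c \<in> M \<and> psd c \<and> psd (e - c) \<and> Q c" if "c \<in> C" for c using C(1) that by (auto simp: X_def)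
   have sp: "psd s" by (rule form_sup_psd[OF s(2) x0]) (use CX[OF x0] in blast)
   have es: "psd (e - s)" by (rule form_sup_le[OF s(2) _ x0]) (use CX in blast)
   have "Q s" by (rule sup[OF CX dir s sp es])
   then have "s \<in> X" using s sp es by (simp add: X_def)
   then show ?thesis using s by (auto simp: P_def form_sup_def)
  qed
 qed
 then obtain m where m: "m \<in> X" "!!a. a \<in> X ==> P m a ==> a = m" by blast
 have "m = e"
 proof (rule ccontr)
  assume "m ~= e"
  then obtain b where b: "b \<in> M" "psd b" "b ~= 0" "psd (e - m - b)" "Q (m + b)" using step[of m] m(1) by (auto simp: X_def)
  then have "m + b \<in> X" using m(1) by (auto simp: X_def mem_rules psd_add diff_diff_eq)
  then have "m + b = m" using b by (intro m(2)) (auto simp: P_def)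
  then show False using b by simp
 qed
 then show ?thesis using m by (simp add: X_def)
qed

subsection \<open>Weak continuity on bounded sets\<close>

lemma wlim_norm_le:
 assumes F: "F ~= bot" and w: "wlim F a s" and K: "!!i. norm (a i) <= K"
 shows "norm s <= K"
proof -
 have "\<exists>l. ((\<lambda>i. inner u (a i v)) \<longlongrightarrow> l) F" for u v using wlimD[OF w] by blast
 then obtain s' where "wlim F a s'" "norm s' <= K" using wot_limit_exists[OF F, of a K] K by (auto simp: always_eventually)
 then show ?thesis using wlim_unique[OF F w] by simp
qed

text \<open>If \<open>v\<close> is such that \<open>\<langle>v, e v\<rangle> > f e\<close>, exhaustion produces \<open>0 ~= b <= e\<close> below which
 \<open>f\<close> is dominated by the vector functional of \<open>v\<close>.\<close>

lemma dominated_piece: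
 assumes f: "pfun f" and e: "e \<in> M" "psd e" "e ~= 0"
 shows "\<exists>b v. b \<in> M \<and> psd b \<and> b ~= 0 \<and> psd (e - b) \<and>
  (\<forall>c\<in>M. psd c --> psd (b - c) --> f c <= inner v (c v))"
proof -
 obtain v0 where "inner v0 (e v0) ~= 0" using sa_eq_0[of e] e psd_sa by blast
 then have v0: "inner v0 (e v0) > 0" using e by (simp add: psd_def less_le)
 \<comment> \<open>Scaled so that the form of v at e is \<open>f e + 1\<close>, which exceeds
   \<open>f e\<close>.\<close>
 define v where "v = sqrt ((f e + 1) / inner v0 (e v0)) *\<^sub>R v0"
 have "f e \<ge> 0" using pfun_nonneg f e by blast
 then have "inner v (e v) = f e + 1" using v0 by (simp add: v_def blinfun.bilinear_simps flip: power2_eq_square mult.assoc)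
 then have v: "f e < inner v (e v)" by simp
 let ?Q = "\<lambda>c. inner v (blinfun_apply c v) <= f c"
 \<comment> \<open>If every such a could be enlarged, exhaustion would carry \<open>?Q\<close> up to
   e, against the choice of v. Below the complement of a maximal a, the functional f is dominated by
   the form of v.\<close>
 have "\<exists>a. a \<in> M \<and> psd a \<and> psd (e - a) \<and> a ~= e \<and> ?Q a \<and>
   \<not> (\<exists>b\<in>M. psd b \<and> b ~= 0 \<and> psd (e - a - b) \<and> ?Q (a + b))"
 proof (rule ccontr)
  assume no: "\<not> ?thesis"
  have "?Q e"
  proof (rule exhaust[OF e(1,2)])
   fix C s
   assume C: "!!c. c \<in> C ==> c \<in> M \<and> psd c \<and> psd (e - c) \<and> ?Q c" "s \<in> M" "form_sup C s"
   show "?Q s"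
   proof (rule field_le_epsilon)
    fix d :: real assume "d > 0"
    then obtain c where c: "c \<in> C" "inner v (s v) - d < inner v (c v)" using C(3) unfolding form_sup_def by blast
    have "f c <= f s" using C c by (intro pfun_mono[OF f]) (auto simp: form_sup_def)
    then show "inner v (s v) <= f s + d" using C(1)[OF c(1)] c(2) by linarith
   qed
  qed (use no in \<open>auto simp: pfun_zero[OF f]\<close>)
  then show False using v by simp
 qed
 then obtain a where a: "a \<in> M" "psd a" "psd (e - a)" "a ~= e" "?Q a"
  and max: "!!b. b \<in> M ==> psd b ==> b ~= 0 ==> psd (e - a - b) ==> \<not> ?Q (a + b)" by blast
 have "f c <= inner v (c v)" if c: "c \<in> M" "psd c" "psd (e - a - c)" for c
 proof (cases "c = 0")
  case False
  then have "\<not> ?Q (a + c)" using max c by blast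
  then show ?thesis using a c by (simp add: pfun_add[OF f] bilinear_simps)
 qed (simp add: pfun_zero[OF f])
 then show ?thesis using a e by (intro exI[of _ "e - a"] exI[of _ v]) (auto simp: mem_rules)
qed

text \<open>Continuity is localized by a right factor b, which exhaustion then lets grow to the
  identity.\<close>

definition wcont_right :: "('h op => real) => 'h op => bool"
 where "wcont_right f b \<longleftrightarrow> (\<forall>(a :: nat => 'h op) s K F. F ~= bot --> (\<forall>i. a i \<in> M \<and> norm (a i) <= K) -->
  wlim F a s --> ((\<lambda>i. f (a i ** b)) \<longlongrightarrow> f (s ** b)) F)"

lemma wcont_rightD:
 assumes "wcont_right f b" "F ~= bot" "!!i. a i \<in> M" "!!i :: nat. norm (a i) <= K" "wlim F a s"
 shows "((\<lambda>i. f (a i ** b)) \<longlongrightarrow> f (s ** b)) F" using assms unfolding wcont_right_def by blast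

text \<open>With c split into two square roots, Cauchy-Schwarz leaves \<open>f c\<close> as a
  factor, so the bound is small uniformly in x of bounded norm.\<close>

lemma pfun_right_bound:
 assumes f: "pfun f" and x: "x \<in> M" "norm x <= K" and c: "c \<in> M" "psd c" "norm c <= 1"
 shows "\<bar>f (x ** c)\<bar> <= K * sqrt (f \<I> * f c)"
proof -
 have K: "0 <= K" using x norm_ge_zero[of x] by linarith
 note h = root_op[OF c(1,2)]
 have fi: "0 <= f \<I>" and fc: "0 <= f c" using c by (auto intro!: pfun_nonneg[OF f])
 define h' where "h' = root_op c"
 have eq: "x ** c = adj (h' ** adj x) ** h'" using h by (simp add: adj_rules h'_def op_simps(1))
 have "(f (x ** c))\<^sup>2 <= f (adj (h' ** adj x) ** (h' ** adj x)) * f (adj h' ** h')"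
  unfolding eq using h x by (intro pfun_cauchy_schwarz[OF f]) (auto simp: h'_def intro!: mem_rules)
 also have "adj h' ** h' = c" using h by (simp add: h'_def)
 also have "adj (h' ** adj x) ** (h' ** adj x) = x ** (c ** adj x)"
 proof -
  have "h' ** (h' ** y) = c ** y" for y :: "'h op"
  proof -
   have "h' ** (h' ** y) = (h' ** h') ** y" by (simp only: op_simps(1))
   then show ?thesis using h(3) by (simp only: h'_def)
  qed
  then show ?thesis using h by (simp add: adj_rules h'_def op_simps(1))
 qed
 also have "f (x ** (c ** adj x)) <= norm (x ** (c ** adj x)) * f \<I>"
  using pfun_abs_bound[OF f, of "x ** (c ** adj x)"] x c by (auto simp: mem_rules)
 also have "norm (x ** (c ** adj x)) <= K * (1 * K)"
  using x c K by (intro order_trans[OF norm_blinfun_compose] mult_mono) (auto simp: mult_nonneg_nonneg)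
 finally have "(f (x ** c))\<^sup>2 <= (K * (1 * K) * f \<I>) * f c" using fi fc by (auto simp: mult_right_mono)
 then have "(f (x ** c))\<^sup>2 <= (K * sqrt (f \<I> * f c))\<^sup>2"
  using fi fc by (simp add: power_mult_distrib power2_eq_square algebra_simps)
 then show ?thesis using K fi fc by (simp add: power2_abs power2_le_iff_abs_le)
qed

text \<open>Normality speaks of increasing nets only. On a piece b dominated by a vector functional,
  f (x b) is a matrix coefficient of x, because \<open>riesz_seminorm\<close> applies with the root
  of b as right factor. Such pieces exhaust the identity, and at suprema
  \<open>pfun_right_bound\<close> gives a uniform error.\<close>

lemma nfun_wcont:
 fixes a :: "nat => 'h op"
 assumes f: "nfun f" and F: "F ~= bot" and a: "!!i. a i \<in> M" "!!i. norm (a i) <= K" and w: "wlim F a s"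
 shows "((\<lambda>i. f (a i)) \<longlongrightarrow> f s) F"
proof -
 have pf: "pfun f" using f by (rule nfun_pfun)
 have "wcont_right f \<I>"
 proof (rule exhaust)
  show "wcont_right f 0" by (simp add: wcont_right_def op_simps)
  fix C s
  assume C: "!!c. c \<in> C ==> c \<in> M \<and> psd c \<and> psd (\<I> - c) \<and> wcont_right f c" "directed_ops C"
   and s: "s \<in> M" "form_sup C s" "psd s" "psd (\<I> - s)"
  show "wcont_right f s" unfolding wcont_right_def
  proof (intro allI impI)
   fix b :: "nat => 'h op" and t K F
   assume F: "F ~= bot" and b: "\<forall>i. b i \<in> M \<and> norm (b i) <= K" and w: "wlim F b t"
   have tM: "t \<in> M" using wlim_mem[OF F w] b by (auto intro: always_eventually)
   have tK: "norm t <= K" using wlim_norm_le[OF F w] b by blast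
   have K0: "0 <= K" using tK norm_ge_zero[of t] by linarith
   show "((\<lambda>i. f (b i ** s)) \<longlongrightarrow> f (t ** s)) F"
   proof (rule tendstoI)
    fix e :: real assume e: "e > 0"
    \<comment> \<open>Chosen so that \<open>K * sqrt ((f \<I> + 1) * d)\<close> is
      \<open>K * (e / (3 * (K + 1)))\<close>, which is below e / 3.\<close>
    define d where "d = (e / (3 * (K + 1)))\<^sup>2 / (f \<I> + 1)"
    have fi: "0 <= f \<I>" using pfun_nonneg[OF pf] by simp
    have d: "d > 0" using e K0 fi by (simp add: d_def)
    obtain c where c: "c \<in> C" "f s - d < f c" using nfunD[OF f _ _ C(2) s(1,2) d] C(1) by blast
    have cM: "c \<in> M" "psd c" "wcont_right f c" using C(1)[OF c(1)] by auto
    have sc: "psd (s - c)" using s c by (simp add: form_sup_def)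
    have scn: "norm (s - c) <= 1" using psd_add[OF s(4) cM(2)] by (intro psd_sandwich_norm[OF sc]) (auto simp: algebra_simps)
    have bd: "\<bar>f (x ** s) - f (x ** c)\<bar> < e / 3" if x: "x \<in> M" "norm x <= K" for x
    proof -
     have "\<bar>f (x ** (s - c))\<bar> <= K * sqrt (f \<I> * f (s - c))"
      using x s cM sc scn by (intro pfun_right_bound[OF pf]) (auto simp: mem_rules)
     also have "... <= K * sqrt ((f \<I> + 1) * d)" using c s cM fi K0 pfun_nonneg[OF pf _ sc] d
      by (intro mult_left_mono real_sqrt_le_mono mult_mono) (auto simp: pfun_diff[OF pf] mem_rules)
     also have "(f \<I> + 1) * d = (e / (3 * (K + 1)))\<^sup>2" using fi by (simp add: d_def)
     also have "K * sqrt ((e / (3 * (K + 1)))\<^sup>2) = K * (e / (3 * (K + 1)))" using e K0 by simp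
     also have "... < e / 3" using e K0 by (simp add: field_simps)
     finally show ?thesis using x s cM by (simp add: op_simps pfun_diff[OF pf] mem_rules)
    qed
    have "((\<lambda>i. f (b i ** c)) \<longlongrightarrow> f (t ** c)) F" using wcont_rightD[OF cM(3) F _ _ w, of K] b by blast
    then have "\<forall>\<^sub>F i in F. dist (f (b i ** c)) (f (t ** c)) < e / 3" using e by (intro tendstoD) auto
    then show "\<forall>\<^sub>F i in F. dist (f (b i ** s)) (f (t ** s)) < e"
    proof eventually_elim
     case (elim i)
     have "\<bar>f (b i ** s) - f (b i ** c)\<bar> < e / 3" using bd[of "b i"] b by blast
     then show ?case using elim bd[OF tM tK] unfolding dist_real_def by linarith
    qed
   qed
  qed
 next
  fix a0 assume a0: "a0 \<in> M" "psd a0" "psd (\<I> - a0)" "a0 ~= \<I>" "wcont_right f a0"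
  have "\<I> - a0 ~= 0" using a0 by simp
  then obtain b v where b: "b \<in> M" "psd b" "b ~= 0" "psd (\<I> - a0 - b)"
   and dom: "!!c. c \<in> M ==> psd c ==> psd (b - c) ==> f c <= inner v (c v)"
   using dominated_piece[OF pf, of "\<I> - a0"] a0 by (auto simp: mem_rules)
  define g where "g = root_op b"
  have g: "g \<in> M" "psd g" "g ** g = b" "adj g = g" using root_op[OF b(1,2)] by (auto simp: g_def)
  have bnd: "\<bar>f (x ** g)\<bar> <= sqrt (f \<I>) * norm (x (g v))" if x: "x \<in> M" for x
  proof -
   define y where "y = g ** (adj x ** x) ** g"
   have y: "y \<in> M" "psd y" using x g psd_conj_sa[OF g(4) psd_square(1)] by (auto simp: y_def mem_rules)
   \<comment> \<open>Division by k brings y below b, where the domination by v holds; the summand 1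
     keeps k positive.\<close>
   define k where "k = (norm x)\<^sup>2 + 1"
   have k: "k > 0" by (simp add: k_def add_nonneg_pos)
   have "psd ((norm x)\<^sup>2 *\<^sub>R \<I> - adj x ** x + \<I>)" by (intro psd_add psd_adj_self_le psd_id)
   then have "psd (k *\<^sub>R \<I> - adj x ** x)" by (simp add: k_def algebra_simps scaleR_add_left)
   from psd_scaleR[OF psd_conj_sa[OF g(4) this], of "1/k"]
   have le: "psd (b - (1/k) *\<^sub>R y)" using k by (simp add: op_simps y_def g(3) scaleR_diff_right)
   have "f ((1/k) *\<^sub>R y) <= inner v (((1/k) *\<^sub>R y) v)" using y k le by (intro dom) (auto simp: mem_rules psd_scaleR)
   then have "(1/k) * f y <= (1/k) * inner v (y v)" using y by (simp add: pfun_scaleR[OF pf] blinfun.bilinear_simps)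
   then have "f y <= inner v (y v)" using k by (simp add: divide_le_cancel)
   also have "inner v (y v) = (norm (x (g v)))\<^sup>2" using g(4) by (simp add: y_def inner_adj2 power2_norm_eq_inner)
   finally have fy: "f y <= (norm (x (g v)))\<^sup>2" .
   have "(f (adj \<I> ** (x ** g)))\<^sup>2 <= f (adj \<I> ** \<I>) * f (adj (x ** g) ** (x ** g))"
    using x g by (intro pfun_cauchy_schwarz[OF pf]) (auto simp: mem_rules)
   also have "adj (x ** g) ** (x ** g) = y" by (simp add: y_def adj_rules g op_simps)
   finally have "(f (x ** g))\<^sup>2 <= f \<I> * f y" by (simp add: op_simps)
   also have "... <= f \<I> * (norm (x (g v)))\<^sup>2" using fy by (intro mult_left_mono pfun_nonneg[OF pf]) auto
   finally have "sqrt ((f (x ** g))\<^sup>2) <= sqrt (f \<I> * (norm (x (g v)))\<^sup>2)" by (rule real_sqrt_le_mono)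
   then show ?thesis by (simp add: real_sqrt_mult)
  qed
  have "\<exists>w. \<forall>x\<in>M. f (x ** g) = inner w (blinfun_apply x (g v))" by (rule riesz_seminorm[OF subspace_M _ _ _ _ bnd])
    (use g in \<open>auto simp: blinfun.bilinear_simps op_simps pfun_rules[OF pf] mem_rules\<close>)
  then obtain w where w: "!!x. x \<in> M ==> f (x ** g) = inner w (x (g v))" by blast
  have wb: "f (x ** b) = inner w (x (g (g v)))" if "x \<in> M" for x using w[of "x ** g"] that g by (simp add: mem_rules op_simps)
  have "wcont_right f (a0 + b)" unfolding wcont_right_def
  proof (intro allI impI)
   fix c :: "nat => 'h op" and t K F
   assume F: "F ~= bot" and c: "\<forall>i. c i \<in> M \<and> norm (c i) <= K" and wl: "wlim F c t"
   have tM: "t \<in> M" using wlim_mem[OF F wl] c by (auto intro: always_eventually)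
   have "((\<lambda>i. f (c i ** a0) + inner w (c i (g (g v)))) \<longlongrightarrow> f (t ** a0) + inner w (t (g (g v)))) F"
    using wcont_rightD[OF a0(5) F _ _ wl, of K] c by (intro tendsto_add wlimD[OF wl]) blast
   then show "((\<lambda>i. f (c i ** (a0 + b))) \<longlongrightarrow> f (t ** (a0 + b))) F"
    using c tM a0 b by (simp add: op_simps pfun_add[OF pf] mem_rules wb)
  qed
  then show "\<exists>b\<in>M. psd b \<and> b ~= 0 \<and> psd (\<I> - a0 - b) \<and> wcont_right f (a0 + b)" using b by blast
 qed auto
 from wcont_rightD[OF this F a w] show ?thesis by (simp add: op_simps)
qed

text \<open>Tychonoff's theorem: the matrix coefficients lie in a product of compact intervals. A
  filter finer than \<open>sequentially\<close> takes the place of a subsequence, since the space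
  need not be separable.\<close>

lemma weak_cluster:
 fixes a :: "nat => 'h op"
 assumes a: "!!i. a i \<in> M" "!!i. norm (a i) <= K"
 shows "\<exists>F s. F ~= bot \<and> F <= sequentially \<and> s \<in> M \<and> norm s <= K \<and> wlim F a s"
proof -
 define \<phi> where "\<phi> n = (\<lambda>p. inner (fst p) (a n (snd p)))" for n
 define U where "U = Pi\<^sub>E UNIV (\<lambda>p :: 'h \<times> 'h. {- (K * norm (fst p) * norm (snd p)) .. K * norm (fst p) * norm (snd p)})"
 have "compact U"
 proof -
  have "compactin (product_topology (\<lambda>i. euclidean) UNIV) U"
   unfolding U_def by (subst compactin_PiE) (auto simp: compactin_euclidean_iff)
  then show ?thesis by (simp add: euclidean_product_topology compactin_euclidean_iff)
 qed
 have \<phi>U: "\<phi> n \<in> U" for n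
 proof -
  have "\<bar>inner u (a n v)\<bar> <= K * norm u * norm v" for u v
  proof -
   have "\<bar>inner u (a n v)\<bar> <= norm u * norm (a n v)" by (rule Cauchy_Schwarz_ineq2)
   also have "... <= norm u * (K * norm v)" by (intro mult_left_mono order_trans[OF norm_blinfun mult_right_mono] a) auto
   finally show ?thesis by (simp add: algebra_simps)
  qed
  then show ?thesis unfolding U_def \<phi>_def by (auto simp: abs_le_iff minus_le_iff)
 qed
 define G where "G = filtermap \<phi> sequentially"
 have "G ~= bot" "eventually (\<lambda>x. x \<in> U) G" using \<phi>U by (auto simp: G_def filtermap_bot_iff eventually_filtermap)
 then obtain g where g: "inf (nhds g) G ~= bot" using \<open>compact U\<close> unfolding compact_filter by blast
 \<comment> \<open>Large indices whose coefficients approach the cluster point g; the filter is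
   nontrivial because g is a cluster point.\<close>
 define F where "F = inf sequentially (filtercomap \<phi> (nhds g))"
 have F: "F ~= bot"
 proof
  assume "F = bot"
  then have "eventually (\<lambda>_. False) F" by simp
  then obtain P Q where PQ: "eventually P sequentially" "eventually Q (filtercomap \<phi> (nhds g))"
   "!!n. P n ==> Q n ==> False" unfolding F_def eventually_inf by blast
  then obtain R where R: "eventually R (nhds g)" "!!n. R (\<phi> n) ==> Q n" unfolding eventually_filtercomap by blast
  have "eventually (\<lambda>y. \<not> R y) G" unfolding G_def eventually_filtermap using PQ(1) by eventually_elim (use PQ(3) R(2) in blast)
  then have "eventually (\<lambda>_. False) (inf (nhds g) G)" unfolding eventually_inf using R(1) by blast
  then show False using g by (simp add: trivial_limit_def)
 qed
 have lim: "filterlim \<phi> (nhds g) F" unfolding F_def by (rule filterlim_mono[OF filterlim_filtercomap order_refl]) simp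
 have coord: "((\<lambda>n. \<phi> n p) \<longlongrightarrow> g p) F" for p
 proof -
  show ?thesis by (rule continuous_on_tendsto_compose[OF continuous_on_product_coordinates lim]) auto
 qed
 have "\<exists>l. ((\<lambda>n. inner u (a n v)) \<longlongrightarrow> l) F" for u v using coord[of "(u, v)"] by (auto simp: \<phi>_def)
 then obtain s where s: "wlim F a s" "norm s <= K" using wot_limit_exists[OF F, of a K] a by (auto simp: always_eventually)
 have "s \<in> M" using wlim_mem[OF F s(1)] a by (auto intro: always_eventually)
 then show ?thesis using F s by (intro exI[of _ F] exI[of _ s]) (auto simp: F_def)
qed

end

section \<open>Projections and strong limits of positive operators\<close>

section \<open>Projections\<close>

definition proj :: "'h::{real_inner,complete_space} op => bool"
 where "proj p \<longleftrightarrow> adj p = p \<and> p ** p = p"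

lemma proj_simps: "proj p ==> adj p = p" "proj p ==> p ** p = p" by (auto simp: proj_def)

lemma proj_idem: "proj p ==> p ** (p ** (x :: 'h::{real_inner,complete_space} op)) = p ** x" by (metis op_simps(1) proj_def)

lemma proj_psd: "proj p ==> psd p" by (metis proj_def psd_square_sa)

lemma proj_compl: "proj p ==> proj (\<I> - p)" by (auto simp: proj_def adj_rules op_simps)

lemma proj_0 [simp]: "proj 0" and proj_id [simp]: "proj \<I>" by (auto simp: proj_def op_simps)

lemma proj_le_id: "proj p ==> psd (\<I> - p)" by (intro proj_psd proj_compl)

lemma proj_norm: "proj p ==> norm p <= 1" by (rule psd_sandwich_norm) (simp_all add: proj_psd proj_le_id)

lemma square_zero: "adj x ** x = 0 ==> x = 0"
proof (rule blinfun_eqI)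
 fix v assume "adj x ** x = 0"
 then have "inner (x v) (x v) = 0" by (metis blinfun_apply_blinfun_compose inner_adj inner_zero_right zero_blinfun.rep_eq)
 then show "x v = (0::'a op) v" by simp
qed

text \<open>The form of x is squeezed to 0 on the range of y, and a positive operator kills every
  vector on which its form vanishes.\<close>

lemma psd_le_zero:
 fixes x p y :: "'h::{real_inner,complete_space} op"
 assumes "psd x" "psd (r *\<^sub>R p - x)" "p ** y = 0" shows "x ** y = 0"
proof (rule blinfun_eqI)
 fix v
 have py: "p (y v) = 0" by (metis assms(3) blinfun_apply_blinfun_compose zero_blinfun.rep_eq)
 have "0 <= inner (y v) ((r *\<^sub>R p - x) (y v))" using assms(2) unfolding psd_def by blast
 moreover have "0 <= inner (y v) (x (y v))" using assms(1) unfolding psd_def by blast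
 ultimately have "inner (y v) (x (y v)) = 0" by (simp add: bilinear_simps py)
 then have "norm (x (y v)) = 0" using norm_psd_apply[OF assms(1), of "y v"] by simp
 then show "(x ** y) v = (0::'h op) v" by simp
qed

lemma proj_le_compose:
 assumes "proj p" "proj q" "psd (q - p)"
 shows "q ** p = p" "p ** q = p"
proof -
 have "p ** (\<I> - q) = 0"
 proof (rule psd_le_zero[where r = 1 and p = q])
  show "psd (1 *\<^sub>R q - p)" using assms by simp
 qed (use assms in \<open>auto simp: proj_psd op_simps proj_simps\<close>)
 then show pq: "p ** q = p" by (simp add: op_simps)
 show "q ** p = p" using arg_cong[OF pq, of adj] assms by (simp add: adj_rules proj_simps)
qed

lemma proj_diff:
 assumes "proj p" "proj q" "q ** p = p"
 shows "proj (q - p)"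
proof -
 have "p ** q = p" using arg_cong[OF assms(3), of adj] assms(1,2) by (simp only: adj_compose proj_simps)
 then show ?thesis using assms by (simp add: proj_def adj_rules op_simps)
qed

lemma psd_compress_le:
 assumes "psd c" "proj q" "q ** c ** q = c" "norm c <= K"
 shows "psd (K *\<^sub>R q - c)" using psd_conj_sa[OF proj_simps(1)[OF assms(2)] psd_norm_bound(1)[OF psd_sa[OF assms(1)] assms(4)]]
 by (simp add: op_simps assms(3)[unfolded op_simps] proj_simps[OF assms(2)])

lemma psd_strong:
 fixes x :: "'i => 'h::{real_inner,complete_space} op"
 assumes "!!i. psd (x i)" "!!i. norm (x i) <= K" "((\<lambda>i. inner v (x i v)) \<longlongrightarrow> 0) F"
 shows "((\<lambda>i. x i v) \<longlongrightarrow> 0) F"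
proof -
 have b: "(norm (x i v))\<^sup>2 <= K * inner v (x i v)" for i
  using norm_psd_apply[OF assms(1)[of i], of v] mult_right_mono[OF assms(2)[of i], of "inner v (x i v)"] assms(1)[of i]
  unfolding psd_def by (meson order_trans)
 have "((\<lambda>i. K * inner v (x i v)) \<longlongrightarrow> 0) F" using tendsto_mult_left[OF assms(3), of K] by simp
 then have "((\<lambda>i. (norm (x i v))\<^sup>2) \<longlongrightarrow> 0) F"
  by (rule tendsto_sandwich[OF _ _ tendsto_const, rotated 2]) (use b in auto)
 then have "((\<lambda>i. sqrt ((norm (x i v))\<^sup>2)) \<longlongrightarrow> sqrt 0) F" by (rule tendsto_real_sqrt)
 then show ?thesis by (simp add: tendsto_norm_zero_iff)
qed

context vn_algebra
begin

text \<open>b - b^2 is the conjugate of 1 - b by the square root of b.\<close>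

lemma root_contraction_square:
 assumes "b \<in> M" "psd b" "psd (\<I> - b)" shows "psd (b - b ** b)"
proof -
 note g = root_op[OF assms(1,2)]
 have "root_op b ** (\<I> - b) ** root_op b = b - root_op b ** (root_op b ** root_op b) ** root_op b" by (simp add: op_simps g(3))
 also have "root_op b ** (root_op b ** root_op b) ** root_op b = (root_op b ** root_op b) ** (root_op b ** root_op b)"
  by (simp only: op_simps(1))
 finally have "root_op b ** (\<I> - b) ** root_op b = b - b ** b" by (simp only: g(3))
 then show ?thesis using psd_conj_sa[OF g(4) assms(3)] by simp
qed

lemma is_projection_iff: "p \<in> M ==> is_projection p \<longleftrightarrow> proj p"
 unfolding is_projection_def proj_def by (auto simp: is_adjoint_adj)

text \<open>The convergence is strong, so idempotence passes to the limit.\<close>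

lemma proj_seq_sup:
 assumes c: "!!n. c n \<in> M" "!!n. proj (c n)" "!!n. psd (c (Suc n) - c n)"
 shows "\<exists>s\<in>M. proj s \<and> form_sup (range c) s \<and> wlim sequentially c s"
proof -
 obtain s where s: "s \<in> M" "form_sup (range c) s" "wlim sequentially c s"
 proof -
  have "\<exists>s\<in>M. form_sup (range c) s \<and> wlim sequentially c s"
   by (rule mono_seq_form_sup[of c 1]) (simp_all add: c proj_psd proj_le_id)
  then show ?thesis using that by blast
 qed
 have sp: "psd s" by (rule form_sup_psd[OF s(2) _ proj_psd[OF c(2)]]) auto
 have s1: "psd (\<I> - s)" by (rule form_sup_le[OF s(2)]) (use c proj_le_id in auto)
 have strong: "(\<lambda>n. (s - c n) v) \<longlonglongrightarrow> 0" for v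
 proof (rule psd_strong)
  show p: "psd (s - c n)" for n using s(2) by (auto simp: form_sup_def)
  show "norm (s - c n) <= 1" for n
   using psd_add[OF s1 proj_psd[OF c(2)[of n]]] by (intro psd_sandwich_norm[OF p]) (auto simp: algebra_simps)
  show "(\<lambda>n. inner v ((s - c n) v)) \<longlonglongrightarrow> 0"
   using wlimD[OF wlim_diff[OF wlim_const[of _ s] s(3)], of v v] by simp
 qed
 have strong': "(\<lambda>n. c n v) \<longlonglongrightarrow> s v" for v
  using tendsto_diff[OF tendsto_const strong, of "s v" v] by (simp add: blinfun.bilinear_simps)
 have "wlim sequentially c (s ** s)" unfolding wlim_def
 proof (intro allI)
  fix u v
  have "(\<lambda>n. inner (c n u) (c n v)) \<longlonglongrightarrow> inner (s u) (s v)" by (intro tendsto_intros strong')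
  moreover have "inner (c n u) (c n v) = inner u (c n v)" for n using c(2)[of n] by (metis blinfun_apply_blinfun_compose inner_adj proj_def)
  ultimately show "(\<lambda>n. inner u (c n v)) \<longlonglongrightarrow> inner u ((s ** s) v)"
   using psd_sa[OF sp] by (simp add: inner_adj)
 qed
 then have "s = s ** s" using s(3) wlim_unique[OF sequentially_bot] by blast
 then have "proj s" using psd_sa[OF sp] by (simp add: proj_def)
 then show ?thesis using s by blast
qed

subsection \<open>Functionals from the positive cone\<close>

text \<open>A self-adjoint y is the difference of the positive elements y + |y| 1 and |y| 1, with
  |y| the norm; a general x is replaced by its self-adjoint part, as a \<open>pfun\<close> vanishes
  on skew parts.\<close>

lemma cone_extension:
 assumes add: "!!x y. x \<in> M ==> psd x ==> y \<in> M ==> psd y ==> h (x + y) = h x + h y"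
  and scale: "!!x r. x \<in> M ==> psd x ==> 0 <= r ==> h (r *\<^sub>R x) = r * h x"
  and nonneg: "!!x. x \<in> M ==> psd x ==> 0 <= h x"
 shows "\<exists>f. pfun f \<and> (\<forall>x\<in>M. psd x --> f x = h x)"
proof -
 define g where "g y = h (y + norm y *\<^sub>R \<I>) - norm y * h \<I>" for y
 define f where "f x = g ((1/2) *\<^sub>R (x + adj x))" for x
 \<comment> \<open>The value does not depend on the multiple of the identity that is added, which
   makes additivity available with a common shift.\<close>
 have shift: "h (y + l *\<^sub>R \<I>) - l * h \<I> = h (y + k *\<^sub>R \<I>) - k * h \<I>"
  if "y \<in> M" "psd (y + k *\<^sub>R \<I>)" "k <= l" for y k l
 proof -
  have "y + l *\<^sub>R \<I> = (y + k *\<^sub>R \<I>) + (l - k) *\<^sub>R \<I>" by (simp add: algebra_simps)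
  also have "h ... = h (y + k *\<^sub>R \<I>) + (l - k) * h \<I>" using that by (subst add) (auto simp: mem_rules psd_scaleR scale)
  finally show ?thesis by (simp add: algebra_simps)
 qed
 have np: "psd (y + norm y *\<^sub>R \<I>)" if "adj y = y" for y :: "'h op"
  using psd_norm_bound(2)[OF that order_refl] by (simp add: add.commute)
 have gk: "g y = h (y + k *\<^sub>R \<I>) - k * h \<I>" if "y \<in> M" "adj y = y" "norm y <= k" for y k
  unfolding g_def using shift[OF that(1) np[OF that(2)] that(3)] by simp
 have gp: "g y = h y" if "y \<in> M" "psd y" for y unfolding g_def using shift[of y 0 "norm y"] that by simp
 have g_add: "g (x + y) = g x + g y" if "x \<in> M" "adj x = x" "y \<in> M" "adj y = y" for x y
 proof -
  define k where "k = norm x + norm y"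
  have "g (x + y) = h ((x + norm x *\<^sub>R \<I>) + (y + norm y *\<^sub>R \<I>)) - k * h \<I>"
   using that gk[of "x + y" k] norm_triangle_ineq[of x y] by (simp add: k_def mem_rules adj_rules scaleR_add_left algebra_simps)
  also have "... = g x + g y" using that np by (subst add) (auto simp: mem_rules g_def k_def algebra_simps)
  finally show ?thesis .
 qed
 have g_pos: "g (r *\<^sub>R x) = r * g x" if "x \<in> M" "adj x = x" "0 <= r" for x r
 proof -
  have "g (r *\<^sub>R x) = h (r *\<^sub>R (x + norm x *\<^sub>R \<I>)) - r * norm x * h \<I>"
   using that gk[of "r *\<^sub>R x" "r * norm x"] by (simp add: mem_rules adj_rules scaleR_add_right)
  also have "... = r * g x" using that np by (subst scale) (auto simp: mem_rules g_def algebra_simps)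
  finally show ?thesis .
 qed
 have g_0: "g 0 = 0" using g_pos[of 0 0] by simp
 have g_scale: "g (r *\<^sub>R x) = r * g x" if "x \<in> M" "adj x = x" for x r
 proof (cases "0 <= r")
  case False
  have "g (r *\<^sub>R x) + g ((- r) *\<^sub>R x) = g (r *\<^sub>R x + (- r) *\<^sub>R x)"
   using that by (intro g_add[symmetric]) (auto simp: mem_rules adj_rules)
  also have "... = 0" by (simp add: g_0)
  finally show ?thesis using g_pos[OF that, of "- r"] False by simp
 qed (use g_pos that in auto)
 have sa: "adj ((1/2) *\<^sub>R (x + adj x)) = (1/2) *\<^sub>R (x + adj x)" for x :: "'h op" by (simp add: adj_rules add.commute)
 have fp: "f x = h x" if "x \<in> M" "psd x" for x using gp[OF that] psd_sa[OF that(2)] by (simp add: f_def flip: scaleR_2)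
 have "pfun f" unfolding pfun_def
 proof (intro conjI ballI allI impI)
  fix x y assume xy: "x \<in> M" "y \<in> M"
  have e: "(1/2) *\<^sub>R ((x + y) + adj (x + y)) = (1/2) *\<^sub>R (x + adj x) + (1/2) *\<^sub>R (y + adj y)"
   by (simp add: adj_rules algebra_simps)
  show "f (x + y) = f x + f y" unfolding f_def e using xy by (intro g_add sa) (auto simp: mem_rules)
 next
  fix x r assume x: "x \<in> M"
  have e: "(1/2) *\<^sub>R ((r *\<^sub>R x) + adj (r *\<^sub>R x)) = r *\<^sub>R ((1/2) *\<^sub>R (x + adj x))"
   by (simp add: adj_rules algebra_simps)
  show "f (r *\<^sub>R x) = r * f x" unfolding f_def e using x by (intro g_scale sa) (auto simp: mem_rules)
 next
  fix x assume "x \<in> M" then show "f (adj x) = f x" by (simp add: f_def add.commute)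
 next
  fix x assume "x \<in> M" "psd x" then show "0 <= f x" using fp nonneg by simp
 qed
 then show ?thesis using fp by blast
qed

end

section \<open>Normal semi-finite traces and their lower semicontinuity\<close>

section \<open>Traces\<close>

locale traced_algebra = vn_algebra M for M :: "'h::chilbert_space op set" +
 fixes \<tau> :: "'h op => ennreal"
 assumes trace: "nfs_trace M \<tau>"
begin

lemma tau_add: "x \<in> M ==> psd x ==> y \<in> M ==> psd y ==> \<tau> (x + y) = \<tau> x + \<tau> y"
 using trace[unfolded nfs_trace_def, THEN conjunct1] by (simp add: pos_part_iff)

lemma tau_scale: "x \<in> M ==> psd x ==> 0 <= r ==> \<tau> (r *\<^sub>R x) = ennreal r * \<tau> x"
 using trace[unfolded nfs_trace_def, THEN conjunct2, THEN conjunct1] by (simp add: pos_part_iff)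

lemma tau_square: "x \<in> M ==> \<tau> (adj x ** x) = \<tau> (x ** adj x)"
 using trace[unfolded nfs_trace_def, THEN conjunct2, THEN conjunct2, THEN conjunct1] by (simp add: is_adjoint_adj adj_mem)

lemma tau_faithful: "x \<in> M ==> psd x ==> \<tau> x = 0 ==> x = 0"
 using trace[unfolded nfs_trace_def, THEN conjunct2, THEN conjunct2, THEN conjunct2, THEN conjunct2, THEN conjunct1]
 by (simp add: pos_part_iff)

lemma tau_semifinite:
 assumes "x \<in> M" "psd x" "x ~= 0"
 shows "\<exists>y\<in>M. psd y \<and> y ~= 0 \<and> psd (x - y) \<and> \<tau> y < \<infinity>"
proof -
 have "x \<in> pos_part M" using assms by (simp add: pos_part_iff)
 then obtain y where "y \<in> pos_part M" "y ~= 0" "op_le y x" "\<tau> y < \<infinity>"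
  using trace[unfolded nfs_trace_def, THEN conjunct2, THEN conjunct2, THEN conjunct2, THEN conjunct2, THEN conjunct2]
   assms(3) by blast
 then show ?thesis using assms by (auto simp: pos_part_iff op_le_psd)
qed

lemma tau_sup:
 assumes "A \<subseteq> M" "!!x. x \<in> A ==> psd x" "directed_ops A" "s \<in> M" "form_sup A s"
 shows "\<tau> s = (SUP x\<in>A. \<tau> x)"
proof -
 have A: "A \<subseteq> pos_part M" "op_directed A" using assms directed_iff by (auto simp: pos_part_iff)
 then have "is_op_lub M A s" using is_op_lub_iff assms by blast
 then show ?thesis using trace[unfolded nfs_trace_def, THEN conjunct2, THEN conjunct2, THEN conjunct2, THEN conjunct1] A by blast
qed

lemma tau_zero [simp]: "\<tau> 0 = 0" using tau_scale[of 0 0] by simp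

lemma tau_mono: "x \<in> M ==> psd x ==> y \<in> M ==> psd (y - x) ==> \<tau> x <= \<tau> y"
 using tau_add[of x "y - x"] by (simp add: mem_rules)

text \<open>Cyclicity of the weight is available only in the form of \<open>tau_square\<close>; it
  is applied to \<open>root_op c ** y\<close>.\<close>

lemma tau_conj:
 assumes "c \<in> M" "psd c" "y \<in> M"
 shows "\<tau> (adj y ** c ** y) = \<tau> (root_op c ** (y ** adj y) ** root_op c)"
proof -
 note g = root_op[OF assms(1,2)]
 have "adj (root_op c ** y) ** (root_op c ** y) = adj y ** (root_op c ** root_op c) ** y" by (simp only: adj_rules g(4) op_simps(1))
 moreover have "(root_op c ** y) ** adj (root_op c ** y) = root_op c ** (y ** adj y) ** root_op c"
  by (simp only: adj_rules g(4) op_simps(1))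
 ultimately show ?thesis using tau_square[of "root_op c ** y"] g assms by (simp add: mem_rules)
qed

lemma tau_swap:
 assumes "c \<in> M" "psd c" "x \<in> M" "psd x"
 shows "\<tau> (root_op c ** x ** root_op c) = \<tau> (root_op x ** c ** root_op x)"
 using tau_conj[OF assms(3,4), of "root_op c"] root_op[OF assms(1,2)] by simp

lemma tau_proj_swap:
 assumes "proj p" "p \<in> M" "x \<in> M" "psd x"
 shows "\<tau> (p ** x ** p) = \<tau> (root_op x ** p ** root_op x)" using tau_conj[OF assms(3,4,2)] assms by (simp add: proj_simps)

lemma psd_root_conj: "x \<in> M ==> psd x ==> psd c ==> psd (root_op x ** c ** root_op x)" using psd_conj_sa root_op by blast

text \<open>This is x |-> \<tau>(c x). Finite trace of c makes it finite on the cone, where it is at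
  most |x| \<tau>(c), and the extension is normal because \<tau> is.\<close>

lemma trace_functional:
 assumes c: "c \<in> M" "psd c" "\<tau> c < \<infinity>"
 shows "\<exists>f. nfun f \<and> (\<forall>x\<in>M. psd x --> ennreal (f x) = \<tau> (root_op c ** x ** root_op c))"
proof -
 note g = root_op[OF c(1,2)]
 define S where "S x = root_op c ** x ** root_op c" for x
 have SM: "S x \<in> M" if "x \<in> M" for x using that g by (simp add: S_def mem_rules)
 have Sp: "psd (S x)" if "psd x" for x using that g psd_conj_sa by (simp add: S_def)
 have fin: "\<tau> (S x) < \<infinity>" if x: "x \<in> M" "psd x" for x
 proof -
  have "psd (S (norm x *\<^sub>R \<I> - x))" using x by (intro Sp psd_norm_bound psd_sa) auto
  then have "psd (norm x *\<^sub>R c - S x)" by (simp add: S_def op_simps g(3))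
  then have "\<tau> (S x) <= \<tau> (norm x *\<^sub>R c)" using x c by (intro tau_mono SM Sp) (auto simp: mem_rules)
  also have "... = ennreal (norm x) * \<tau> c" using c by (simp add: tau_scale)
  also have "... < \<infinity>" using c by (simp add: ennreal_mult_less_top)
  finally show ?thesis .
 qed
 define h where "h x = enn2real (\<tau> (S x))" for x
 have hS: "ennreal (h x) = \<tau> (S x)" if "x \<in> M" "psd x" for x using fin[OF that] by (simp add: h_def)
 have Sl: "S (x + y) = S x + S y" "S (r *\<^sub>R x) = r *\<^sub>R S x" for x y r by (simp_all add: S_def op_simps)
 obtain f where f: "pfun f" "!!x. x \<in> M ==> psd x ==> f x = h x"
 proof -
  have "\<exists>f. pfun f \<and> (\<forall>x\<in>M. psd x --> f x = h x)"
  proof (rule cone_extension)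
   fix x y assume "x \<in> M" "psd x" "y \<in> M" "psd y"
   then show "h (x + y) = h x + h y" using fin by (simp add: h_def Sl tau_add SM Sp enn2real_plus)
  next
   fix x and r :: real assume "x \<in> M" "psd x" "0 <= r"
   then show "h (r *\<^sub>R x) = r * h x" by (simp add: h_def Sl tau_scale SM Sp enn2real_mult)
  qed (simp add: h_def)
  then show ?thesis using that by blast
 qed
 have "nfun f" unfolding nfun_def
 proof (intro conjI allI impI)
  fix A s and d :: real
  assume A: "A \<subseteq> M" "\<forall>x\<in>A. psd x" "directed_ops A" "s \<in> M" "form_sup A s" "d > 0"
  obtain x0 where x0: "x0 \<in> A" using A(3) by (auto simp: directed_ops_def)
  have sp: "psd s" using form_sup_psd[OF A(5) x0] A x0 by blast
  have "\<tau> (S s) = (SUP x\<in>S ` A. \<tau> x)"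
   using A SM Sp sup_compress[OF A(5), of "root_op c"] directed_compress[OF A(3), of "root_op c"] g(4)
   by (intro tau_sup) (auto simp: S_def[abs_def])
  then have eq: "ennreal (f s) = (SUP x\<in>A. ennreal (f x))" using A sp f hS by (auto simp: image_comp o_def intro!: SUP_cong)
  show "\<exists>x\<in>A. f s - d < f x"
  proof (cases "f s - d < 0")
   case True
   have "0 <= f x0" using x0 A by (intro pfun_nonneg[OF f(1)]) auto
   then show ?thesis using True x0 by (intro bexI[of _ x0]) auto
  next
   case False
   then have "ennreal (f s - d) < ennreal (f s)" using A by (intro ennreal_lessI) auto
   then obtain x where "x \<in> A" "ennreal (f s - d) < ennreal (f x)" unfolding eq less_SUP_iff by blast
   then show ?thesis using False by (intro bexI[of _ x]) (auto simp: ennreal_less_iff)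
  qed
 qed (rule f)
 then show ?thesis using f hS by (auto simp: S_def)
qed

text \<open>The trace is a supremum of the functionals \<open>x \<mapsto> \<tau> (root_op c ** x ** root_op c)\<close> with \<open>\<tau> c < \<infinity>\<close>.\<close>

lemma tau_lsc:
 fixes a :: "nat => 'h op"
 assumes F: "F ~= bot" and a: "!!i. a i \<in> M" "!!i. psd (a i)" "!!i. norm (a i) <= K"
  and w: "wlim F a s" and y: "y < \<tau> s"
 shows "\<forall>\<^sub>F i in F. y < \<tau> (a i)"
proof -
 \<comment> \<open>A symmetric expression for \<tau>(c x), additive in c; exhaustion enlarges c from
   0 to the identity.\<close>
 define T where "T c x = \<tau> (root_op x ** c ** root_op x)" for c x
 define Q where "Q c \<longleftrightarrow> (\<forall>(a :: nat => 'h op) s K F y. F ~= bot --> (\<forall>i. a i \<in> M \<and> psd (a i) \<and> norm (a i) <= K) -->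
  wlim F a s --> y < T c s --> (\<forall>\<^sub>F i in F. y < T c (a i)))" for c
 have lim: "s \<in> M \<and> psd s" if "F ~= bot" "\<forall>i. a i \<in> M \<and> psd (a i) \<and> norm (a i) <= K" "wlim F a s"
  for a :: "nat => 'h op" and s K F using wlim_mem[OF that(1,3)] wlim_psd[OF that(1,3)] that(2) by (simp add: always_eventually)
 have Tadd: "T (c + b) x = T c x + T b x" if "c \<in> M" "psd c" "b \<in> M" "psd b" "x \<in> M" "psd x" for c b x
  using that by (auto simp: T_def op_simps(2,3) tau_add mem_rules root_op psd_root_conj)
 have Tmono: "T c x <= T b x" if "c \<in> M" "psd c" "b \<in> M" "psd (b - c)" "x \<in> M" "psd x" for c b x
 proof -
  have "psd (root_op x ** (b - c) ** root_op x)" using that psd_root_conj by blast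
  then show ?thesis using that unfolding T_def by (intro tau_mono) (auto simp: op_simps(2-5) mem_rules root_op psd_root_conj)
 qed
 have "Q \<I>"
 proof (rule exhaust)
  show "Q 0" by (simp add: Q_def T_def op_simps)
  fix C s
  assume C: "!!c. c \<in> C ==> c \<in> M \<and> psd c \<and> psd (\<I> - c) \<and> Q c" "directed_ops C"
   and s: "s \<in> M" "form_sup C s" "psd s" "psd (\<I> - s)"
  show "Q s" unfolding Q_def
  proof (intro allI impI)
   fix b :: "nat => 'h op" and t K F y
   assume F: "F ~= bot" and b: "\<forall>i. b i \<in> M \<and> psd (b i) \<and> norm (b i) <= K" and w: "wlim F b t"
    and y: "y < T s t"
   note t = lim[OF F b w]
   note rt = root_op[OF conjunct1[OF t] conjunct2[OF t]]
   have "T s t = (SUP x\<in>(\<lambda>c. root_op t ** c ** root_op t) ` C. \<tau> x)" unfolding T_def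
    using C rt s sup_compress[OF s(2), of "root_op t"] directed_compress[OF C(2), of "root_op t"] t
    by (intro tau_sup) (auto simp: mem_rules intro!: psd_root_conj)
   then have "T s t = (SUP c\<in>C. T c t)" by (simp add: T_def image_comp o_def)
   then obtain c where c: "c \<in> C" "y < T c t" using y by (auto simp: less_SUP_iff)
   have "\<forall>\<^sub>F i in F. y < T c (b i)" using C(1)[OF c(1)] F b w c(2) unfolding Q_def by blast
   then show "\<forall>\<^sub>F i in F. y < T s (b i)"
   proof eventually_elim
    case (elim i)
    have "T c (b i) <= T s (b i)" using C(1)[OF c(1)] s b c(1) by (intro Tmono) (auto simp: form_sup_def)
    then show ?case using elim by simp
   qed
  qed
 next
  fix a0 assume a0: "a0 \<in> M" "psd a0" "psd (\<I> - a0)" "a0 ~= \<I>" "Q a0"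
  then obtain b where b: "b \<in> M" "psd b" "b ~= 0" "psd (\<I> - a0 - b)" "\<tau> b < \<infinity>"
   using tau_semifinite[of "\<I> - a0"] by (auto simp: mem_rules)
  obtain f where f: "nfun f" "!!x. x \<in> M ==> psd x ==> ennreal (f x) = T b x"
   using trace_functional[OF b(1,2,5)] tau_swap[OF b(1,2)] unfolding T_def by fastforce
  have "Q (a0 + b)" unfolding Q_def
  proof (intro allI impI)
   fix c :: "nat => 'h op" and t K F y
   assume F: "F ~= bot" and c: "\<forall>i. c i \<in> M \<and> psd (c i) \<and> norm (c i) <= K" and w: "wlim F c t"
    and y: "y < T (a0 + b) t"
   note t = lim[OF F c w]
   have ft: "((\<lambda>i. f (c i)) \<longlongrightarrow> f t) F" using nfun_wcont[OF f(1) F _ _ w, of K] c by blast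
   have y': "y < T a0 t + ennreal (f t)" using y t a0 b f by (simp add: Tadd)
   have eq: "T (a0 + b) (c i) = T a0 (c i) + ennreal (f (c i))" for i using c a0 b f by (simp add: Tadd)
   show "\<forall>\<^sub>F i in F. y < T (a0 + b) (c i)"
   proof (cases "y < ennreal (f t)")
    case True
    have "\<forall>\<^sub>F i in F. y < ennreal (f (c i))" by (rule order_tendstoD(1)[OF tendsto_ennrealI[OF ft] True])
    then show ?thesis unfolding eq by eventually_elim (simp add: add_increasing less_le_trans)
   next
    case False
    then have "y - ennreal (f t) < T a0 t" using y' by (simp add: minus_less_iff_ennreal add.commute)
    \<comment> \<open>A level strictly in between leaves room for the convergence of the finite part
      on one side and for the semicontinuity of \<open>T a0\<close> on the other.\<close>
    then obtain z where z: "y - ennreal (f t) < z" "z < T a0 t" using dense by blast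
    have "y < z + ennreal (f t)" using z(1) False by (simp add: minus_less_iff_ennreal add.commute)
    then have e1: "\<forall>\<^sub>F i in F. y < z + ennreal (f (c i))"
     by (rule order_tendstoD(1)[OF tendsto_add[OF tendsto_const tendsto_ennrealI[OF ft]]])
    have e2: "\<forall>\<^sub>F i in F. z < T a0 (c i)" using a0(5) F c w z(2) unfolding Q_def by blast
    show ?thesis unfolding eq using e1 e2 by eventually_elim (meson add_right_mono less_imp_le order_less_le_trans)
   qed
  qed
  then show "\<exists>b\<in>M. psd b \<and> b ~= 0 \<and> psd (\<I> - a0 - b) \<and> Q (a0 + b)" using b by blast
 qed auto
 have TI: "T \<I> x = \<tau> x" if "x \<in> M" "psd x" for x using root_op[OF that] by (simp add: T_def op_simps)
 have aK: "\<forall>i. a i \<in> M \<and> psd (a i) \<and> norm (a i) <= K" using a by blast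
 have "y < T \<I> s" using y TI lim[OF F aK w] by simp
 then have "\<forall>\<^sub>F i in F. y < T \<I> (a i)" using \<open>Q \<I>\<close> F aK w unfolding Q_def by blast
 then show ?thesis using TI aK by simp
qed

text \<open>Semi-finiteness supplies a nonzero piece of finite trace below every nonzero remainder,
  so exhaustion applies.\<close>

lemma nfun_zero_semifinite:
 assumes f: "nfun f" and p: "p \<in> M" "psd p"
  and z: "!!y. y \<in> M ==> psd y ==> psd (p - y) ==> \<tau> y < \<infinity> ==> f y = 0"
 shows "f p = 0"
proof (rule exhaust[OF p])
 note pf = nfun_pfun[OF f]
 show "f 0 = 0" by (rule pfun_zero[OF pf])
 fix C s
 assume C: "!!c. c \<in> C ==> c \<in> M \<and> psd c \<and> psd (p - c) \<and> f c = 0" "directed_ops C"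
  and s: "s \<in> M" "form_sup C s" "psd s"
 have "\<not> 0 < f s"
 proof
  assume "0 < f s"
  then have "\<exists>x\<in>C. f s - f s < f x" using C s by (intro nfunD[OF f]) auto
  then show False using C by auto
 qed
 then show "f s = 0" using pfun_nonneg[OF pf s(1,3)] by simp
next
 fix a assume a: "a \<in> M" "psd a" "psd (p - a)" "a ~= p" "f a = 0"
 then obtain b where b: "b \<in> M" "psd b" "b ~= 0" "psd (p - a - b)" "\<tau> b < \<infinity>"
  using tau_semifinite[of "p - a"] p by (auto simp: mem_rules)
 have "psd (p - b)" using psd_add[OF b(4) a(2)] by simp
 then have "f b = 0" using z b by blast
 then show "\<exists>b\<in>M. psd b \<and> b ~= 0 \<and> psd (p - a - b) \<and> f (a + b) = 0"
  using a b by (intro bexI[of _ b]) (auto simp: pfun_add[OF nfun_pfun[OF f]])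
qed

end

section \<open>Level projections of a density, found by maximizing f - \<gamma> \<tau>\<close>

section \<open>Hahn decompositions relative to the trace\<close>

lemma ennreal_mult_enn2real: "x < \<infinity> ==> 0 <= r ==> ennreal r * x = ennreal (r * enn2real x)"
 by (cases x) (auto simp: ennreal_mult)

context traced_algebra
begin

text \<open>Here q is a spectral projection at level \<gamma> of the density of f: under q the
  functional is at least \<gamma> \<tau>, under 1 - q at most \<gamma> \<tau>, and it has no
  off-diagonal part.\<close>

definition hahn :: "('h op => real) => real => 'h op => bool"
 where "hahn f \<gamma> q \<longleftrightarrow> q \<in> M \<and> proj q \<and> \<tau> q < \<infinity> \<and> (\<forall>x\<in>M. f ((\<I> - q) ** x ** q) = 0) \<and>
  (\<forall>c\<in>M. psd c --> q ** c ** q = c --> ennreal \<gamma> * \<tau> c <= ennreal (f c)) \<and>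
  (\<forall>c\<in>M. psd c --> (\<I> - q) ** c ** (\<I> - q) = c --> ennreal (f c) <= ennreal \<gamma> * \<tau> c)"

text \<open>A maximizing sequence clusters weakly; f is continuous and \<tau> lower semicontinuous,
  so the cluster point is optimal. Iterated squaring then leads to a projection: 2 x - x^2 is
  admissible along with x, hence the functional is at most 0 at x - x^2 when x is optimal, and does
  not drop from x to x^2.\<close>

lemma hahn_maximum:
 assumes f: "nfun f" and \<gamma>: "\<gamma> > 0"
 shows "\<exists>q\<in>M. proj q \<and> \<tau> q < \<infinity> \<and>
  (\<forall>a\<in>M. psd a --> psd (\<I> - a) --> \<tau> a < \<infinity> --> f a - \<gamma> * enn2real (\<tau> a) <= f q - \<gamma> * enn2real (\<tau> q))"
proof -
 note pf = nfun_pfun[OF f]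
 define X where "X = {a \<in> M. psd a \<and> psd (\<I> - a) \<and> \<tau> a < \<infinity>}"
 define \<Phi> where "\<Phi> a = f a - \<gamma> * enn2real (\<tau> a)" for a
 define S where "S = (SUP a\<in>X. \<Phi> a)"
 have ub: "\<Phi> a <= f \<I>" if "a \<in> X" for a
 proof -
  have "f a <= f \<I>" using that by (intro pfun_mono[OF pf]) (auto simp: X_def)
  moreover have "0 <= \<gamma> * enn2real (\<tau> a)" using \<gamma> by simp
  ultimately show ?thesis by (simp add: \<Phi>_def)
 qed
 have X0: "0 \<in> X" by (simp add: X_def)
 have bdd: "bdd_above (\<Phi> ` X)" using ub by (auto intro!: bdd_aboveI)
 have le_S: "\<Phi> a <= S" if "a \<in> X" for a unfolding S_def by (intro cSUP_upper that bdd)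
 have "\<exists>a\<in>X. S - 1 / (real n + 1) < \<Phi> a" for n :: nat
 proof -
  have "S - 1 / (real n + 1) < (SUP a\<in>X. \<Phi> a)" by (simp add: S_def)
  then show ?thesis using X0 bdd by (subst (asm) less_cSUP_iff) auto
 qed
 then obtain a where a: "!!n. a n \<in> X" "!!n :: nat. S - 1 / (real n + 1) < \<Phi> (a n)" by metis
 have aM: "a n \<in> M" "psd (a n)" "psd (\<I> - a n)" "\<tau> (a n) < \<infinity>" "norm (a n) <= 1" for n
  using a(1)[of n] psd_sandwich_norm[of "a n" 1] by (auto simp: X_def)
 obtain F s where F: "F ~= bot" "F <= sequentially" "s \<in> M" "wlim F a s" using weak_cluster[of a 1] aM by blast
 have sp: "psd s" by (rule wlim_psd[OF F(1,4)]) (simp add: aM)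
 have s1: "psd (\<I> - s)" by (rule wlim_psd[OF F(1) wlim_diff[OF wlim_const F(4)]]) (simp add: aM)
 have fs: "((\<lambda>n. f (a n)) \<longlongrightarrow> f s) F" by (rule nfun_wcont[OF f F(1) aM(1,5) F(4)])
 have "(\<lambda>n. 1 / (real n + 1)) \<longlonglongrightarrow> 0"
  using LIMSEQ_inverse_real_of_nat by (simp add: inverse_eq_divide add.commute)
 then have z: "((\<lambda>n. 1 / (real n + 1)) \<longlongrightarrow> 0) F" by (rule tendsto_mono[OF F(2)])
 \<comment> \<open>The trace of s is not yet known to be finite, so it is tested by reals y below
   it.\<close>
 have key: "S + \<gamma> * y <= f s" if y: "0 <= y" "y = 0 \<or> ennreal y < \<tau> s" for y
 proof (rule tendsto_le[OF F(1) fs])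
  show "((\<lambda>n. S - 1 / (real n + 1) + \<gamma> * y) \<longlongrightarrow> S + \<gamma> * y) F"
   using tendsto_add[OF tendsto_diff[OF tendsto_const z] tendsto_const, of S "\<gamma> * y"] by simp
  have "\<forall>\<^sub>F n in F. y <= enn2real (\<tau> (a n))"
  proof (cases "y = 0")
   case False
   then have "\<forall>\<^sub>F n in F. ennreal y < \<tau> (a n)" using y(2) by (intro tau_lsc[OF F(1) aM(1,2,5) F(4)]) auto
   then show ?thesis
   proof eventually_elim
    case (elim n)
    have "enn2real (ennreal y) <= enn2real (\<tau> (a n))" using elim aM(4)[of n] by (intro enn2real_mono) auto
    then show ?case using y by simp
   qed
  qed simp
  then show "\<forall>\<^sub>F n in F. S - 1 / (real n + 1) + \<gamma> * y <= f (a n)"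
  proof eventually_elim
   case (elim n)
   then have "\<gamma> * y <= \<gamma> * enn2real (\<tau> (a n))" using \<gamma> by simp
   then show ?case using a(2)[of n] by (simp add: \<Phi>_def)
  qed
 qed
 have "\<tau> s <= ennreal ((f s - S) / \<gamma>)"
 proof (rule ccontr)
  assume "\<not> ?thesis"
  then have lt: "ennreal ((f s - S) / \<gamma>) < \<tau> s" by simp
  then obtain w where w: "ennreal ((f s - S) / \<gamma>) < w" "w < \<tau> s" using dense by blast
  have wt: "w < \<infinity>" using w(2) by (rule less_le_trans) simp
  have "S + \<gamma> * enn2real w <= f s" using w wt by (intro key) auto
  then have "enn2real w <= (f s - S) / \<gamma>" using \<gamma> by (simp add: field_simps)
  then have "w <= ennreal ((f s - S) / \<gamma>)" using wt ennreal_leI[of "enn2real w" "(f s - S) / \<gamma>"] by simp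
  then show False using w(1) by simp
 qed
 moreover have S0: "S <= f s" using key[of 0] by simp
 ultimately have ts: "\<tau> s < \<infinity>" "enn2real (\<tau> s) <= (f s - S) / \<gamma>"
  using \<gamma> by (auto intro: le_less_trans enn2real_leI)
 then have sX: "s \<in> X" "S <= \<Phi> s" using \<gamma> F(3) sp s1 by (auto simp: X_def \<Phi>_def field_simps)
 \<comment> \<open>The squares s, s^2, s^4, ... decrease to a projection.\<close>
 define b where "b n = ((\<lambda>x. x ** x) ^^ n) s" for n
 have b0: "b 0 = s" and bS: "b (Suc n) = b n ** b n" for n by (simp_all add: b_def)
 have b: "b n \<in> X \<and> S <= \<Phi> (b n)" for n
 proof (induction n)
  case (Suc n)
  define x where "x = b n"
  have x: "x \<in> M" "psd x" "psd (\<I> - x)" "\<tau> x < \<infinity>" "S <= \<Phi> x" using Suc by (auto simp: x_def X_def)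
  have sq: "psd (x - x ** x)" by (rule root_contraction_square[OF x(1-3)])
  have xx: "psd (x ** x)" using psd_square_sa psd_sa x by blast
  \<comment> \<open>2 x - x^2 stays below the identity, since the difference is the square of 1 -
    x.\<close>
  have sq2: "psd (\<I> - x - (x - x ** x))"
  proof -
   have "\<I> - x - (x - x ** x) = (\<I> - x) ** (\<I> - x)" by (simp add: op_simps)
   then show ?thesis using psd_square_sa[OF psd_sa[OF x(3)]] by simp
  qed
  have t1: "\<tau> (x ** x) <= \<tau> x" "\<tau> (x - x ** x) <= \<tau> x" using x sq xx by (auto intro!: tau_mono simp: mem_rules)
  then have fin: "\<tau> (x ** x) < \<infinity>" "\<tau> (x - x ** x) < \<infinity>" using x(4) by auto
  have "\<tau> x = \<tau> (x ** x) + \<tau> (x - x ** x)" using tau_add[of "x ** x" "x - x ** x"] x sq xx by (simp add: mem_rules)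
  then have \<Phi>1: "\<Phi> x = \<Phi> (x ** x) + \<Phi> (x - x ** x)"
   using fin x by (simp add: \<Phi>_def enn2real_plus pfun_diff[OF pf] mem_rules algebra_simps)
  have "\<tau> (x + (x - x ** x)) = \<tau> x + \<tau> (x - x ** x)" using tau_add[of x "x - x ** x"] x sq by (simp add: mem_rules)
  moreover have "f (x + (x - x ** x)) = f x + f (x - x ** x)" using x by (intro pfun_add[OF pf]) (auto simp: mem_rules)
  ultimately have "\<Phi> (x + (x - x ** x)) = \<Phi> x + \<Phi> (x - x ** x)"
   using fin x by (simp add: \<Phi>_def enn2real_plus algebra_simps)
  moreover have "x + (x - x ** x) \<in> X"
   using fin x sq sq2 psd_add[OF x(2) sq] \<open>\<tau> (x + (x - x ** x)) = \<tau> x + \<tau> (x - x ** x)\<close>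
   by (auto simp: mem_rules X_def diff_diff_eq)
  ultimately have "\<Phi> (x + (x - x ** x)) = \<Phi> x + \<Phi> (x - x ** x)" "x + (x - x ** x) \<in> X" by blast+
  then have "\<Phi> (x - x ** x) <= 0" using le_S[of "x + (x - x ** x)"] x(5) by simp
  then have "S <= \<Phi> (x ** x)" using \<Phi>1 x(5) by simp
  moreover have "x ** x \<in> X" using psd_add[OF x(3) sq] xx x fin by (simp add: X_def mem_rules)
  ultimately show ?case by (simp add: bS x_def)
 qed (use sX in \<open>simp add: b0\<close>)
 then have bX: "b n \<in> M" "psd (b n)" "psd (\<I> - b n)" "\<tau> (b n) < \<infinity>" "S <= \<Phi> (b n)" for n by (auto simp: X_def)
 have "\<exists>t\<in>M. form_sup (range (\<lambda>n. \<I> - b n)) t \<and> wlim sequentially (\<lambda>n. \<I> - b n) t"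
 proof (rule mono_seq_form_sup[of _ 1])
  show "psd (\<I> - b (Suc n) - (\<I> - b n))" for n using root_contraction_square[OF bX(1-3)[of n]] by (simp add: bS)
 qed (use bX in \<open>auto simp: mem_rules\<close>)
 then obtain t where t: "t \<in> M" "form_sup (range (\<lambda>n. \<I> - b n)) t" "wlim sequentially (\<lambda>n. \<I> - b n) t" by blast
 define q where "q = \<I> - t"
 have qM: "q \<in> M" using t by (simp add: q_def mem_rules)
 have qw: "wlim sequentially b q" using wlim_diff[OF wlim_const[of _ \<I>] t(3)] by (simp add: q_def)
 have bq: "psd (b n - q)" for n using t(2) by (auto simp: form_sup_def q_def algebra_simps)
 have qp: "psd q" by (rule wlim_psd[OF sequentially_bot qw]) (simp add: bX)
 have strong: "(\<lambda>n. (b n - q) v) \<longlonglongrightarrow> 0" for v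
 proof (rule psd_strong[OF bq])
  show "norm (b n - q) <= 1" for n using psd_add[OF bX(3)[of n] qp] by (intro psd_sandwich_norm[OF bq]) (auto simp: algebra_simps)
  show "(\<lambda>n. inner v ((b n - q) v)) \<longlonglongrightarrow> 0" using wlimD[OF wlim_diff[OF qw wlim_const[of _ q]], of v v] by simp
 qed
 have strong': "(\<lambda>n. b n v) \<longlonglongrightarrow> q v" for v
  using tendsto_add[OF strong[of v] tendsto_const[of "q v"]] by (simp add: blinfun.bilinear_simps)
 have "wlim sequentially (\<lambda>n. b (Suc n)) (q ** q)" unfolding wlim_def
 proof (intro allI)
  fix u v
  have "(\<lambda>n. inner (b n u) (b n v)) \<longlonglongrightarrow> inner (q u) (q v)" by (intro tendsto_intros strong')
  then show "(\<lambda>n. inner u (b (Suc n) v)) \<longlonglongrightarrow> inner u ((q ** q) v)"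
   using psd_sa[OF bX(2)] psd_sa[OF qp] by (simp add: bS inner_adj)
 qed
 moreover have "wlim sequentially (\<lambda>n. b (Suc n)) q" using qw unfolding wlim_def by (auto intro: LIMSEQ_Suc)
 ultimately have "q ** q = q" using wlim_unique[OF sequentially_bot] by blast
 then have pq: "proj q" using psd_sa[OF qp] by (simp add: proj_def)
 have tq: "\<tau> q <= \<tau> (b n)" for n using qM qp bX bq by (intro tau_mono) auto
 then have tqf: "\<tau> q < \<infinity>" using bX(4)[of 0] le_less_trans by blast
 have bn: "norm (b n) <= 1" for n using psd_sandwich_norm[of "b n" 1] bX by simp
 have "(\<lambda>n. f (b n)) \<longlonglongrightarrow> f q" by (rule nfun_wcont[OF f sequentially_bot bX(1) bn qw])
 then have "S + \<gamma> * enn2real (\<tau> q) <= f q"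
 proof (rule tendsto_le[OF sequentially_bot _ tendsto_const always_eventually], intro allI)
  fix n
  have "enn2real (\<tau> q) <= enn2real (\<tau> (b n))" using tq bX(4) by (intro enn2real_mono) auto
  then have "\<gamma> * enn2real (\<tau> q) <= \<gamma> * enn2real (\<tau> (b n))" using \<gamma> by simp
  then show "S + \<gamma> * enn2real (\<tau> q) <= f (b n)" using bX(5)[of n] by (simp add: \<Phi>_def)
 qed
 then have "\<Phi> a <= \<Phi> q" if "a \<in> X" for a using le_S[OF that] by (simp add: \<Phi>_def)
 then show ?thesis using qM pq tqf by (intro bexI[of _ q]) (auto simp: X_def \<Phi>_def)
qed

text \<open>The maximality of q is tested by removing a piece below q, by adding a piece below 1 -
  q, and by tilting q in an off-diagonal direction z. The tilt changes the trace only to second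
  order, so the first-order term of f must vanish.\<close>

lemma hahn_exists:
 assumes f: "nfun f" and \<gamma>: "\<gamma> > 0"
 shows "\<exists>q. hahn f \<gamma> q"
proof -
 note pf = nfun_pfun[OF f]
 obtain q where q: "q \<in> M" "proj q" "\<tau> q < \<infinity>" and
  max: "!!a. a \<in> M ==> psd a ==> psd (\<I> - a) ==> \<tau> a < \<infinity> ==>
   f a - \<gamma> * enn2real (\<tau> a) <= f q - \<gamma> * enn2real (\<tau> q)" using hahn_maximum[OF f \<gamma>] by blast
 note qs = proj_simps[OF q(2)] and qi = proj_idem[OF q(2)]
 define S where "S = f q - \<gamma> * enn2real (\<tau> q)"
 have lower: "ennreal \<gamma> * \<tau> c <= ennreal (f c)" if c: "c \<in> M" "psd c" "q ** c ** q = c" for c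
 proof (cases "c = 0")
  case False
  then have n: "norm c > 0" by simp
  define d where "d = (1 / norm c) *\<^sub>R c"
  have d: "d \<in> M" "psd d" using c by (auto simp: d_def mem_rules psd_scaleR)
  have dq: "psd (q - d)" using psd_compress_le[OF d(2) q(2), of 1] c(3) n by (simp add: d_def op_simps)
  have td: "\<tau> q = \<tau> (q - d) + \<tau> d" using tau_add[of "q - d" d] q d dq by (simp add: mem_rules)
  then have fin: "\<tau> d < \<infinity>" "\<tau> (q - d) < \<infinity>" using q(3) by (auto simp: less_top)
  have "f (q - d) - \<gamma> * enn2real (\<tau> (q - d)) <= S" unfolding S_def
   using q d dq fin psd_add[OF proj_le_id[OF q(2)] d(2)] by (intro max) (auto simp: mem_rules algebra_simps)
  moreover have "enn2real (\<tau> q) = enn2real (\<tau> (q - d)) + enn2real (\<tau> d)" unfolding td using fin by (intro enn2real_plus) auto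
  ultimately have "\<gamma> * enn2real (\<tau> d) <= f d" using q d by (simp add: S_def pfun_diff[OF pf] algebra_simps)
  then have "ennreal \<gamma> * \<tau> d <= ennreal (f d)"
   using ennreal_mult_enn2real[OF fin(1), of \<gamma>] \<gamma> by (simp add: ennreal_leI)
  then have "ennreal (norm c) * (ennreal \<gamma> * \<tau> d) <= ennreal (norm c) * ennreal (f d)" by (rule mult_left_mono) simp
  moreover have "ennreal (norm c) * \<tau> d = \<tau> c" "norm c * f d = f c"
   using tau_scale[OF d, of "norm c"] pfun_scaleR[OF pf d(1), of "norm c"] n by (simp_all add: d_def)
  ultimately show ?thesis using pfun_nonneg[OF pf d] by (simp add: ennreal_mult[symmetric] mult.left_commute)
 qed (simp add: pfun_zero[OF pf])
 have upper: "ennreal (f c) <= ennreal \<gamma> * \<tau> c" if c: "c \<in> M" "psd c" "(\<I> - q) ** c ** (\<I> - q) = c" for c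
 proof (cases "c = 0 \<or> \<tau> c = \<infinity>")
  case False
  then have n: "norm c > 0" by simp
  define d where "d = (1 / norm c) *\<^sub>R c"
  have d: "d \<in> M" "psd d" using c by (auto simp: d_def mem_rules psd_scaleR)
  have dq: "psd (\<I> - (q + d))"
  proof -
   have "(\<I> - q) ** d ** (\<I> - q) = d" unfolding d_def op_simps(8,9) c(3) ..
   moreover have "norm d <= 1" using n by (simp add: d_def)
   ultimately show ?thesis using psd_compress_le[OF d(2) proj_compl[OF q(2)], of 1] by (simp add: diff_diff_eq)
  qed
  have fin: "\<tau> d < \<infinity>" using False c by (auto simp: d_def tau_scale ennreal_mult_less_top less_top)
  have td: "\<tau> (q + d) = \<tau> q + \<tau> d" using q d by (simp add: tau_add proj_psd)
  have "f (q + d) - \<gamma> * enn2real (\<tau> (q + d)) <= S" unfolding S_def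
   using q d dq fin td by (intro max) (auto simp: mem_rules psd_add proj_psd)
  moreover have "enn2real (\<tau> (q + d)) = enn2real (\<tau> q) + enn2real (\<tau> d)"
   unfolding td using fin q by (intro enn2real_plus) auto
  ultimately have "f d <= \<gamma> * enn2real (\<tau> d)" using q d by (simp add: S_def pfun_add[OF pf] algebra_simps)
  then have "ennreal (f d) <= ennreal \<gamma> * \<tau> d"
   using ennreal_mult_enn2real[OF fin(1), of \<gamma>] \<gamma> by (simp add: ennreal_leI)
  then have "ennreal (norm c) * ennreal (f d) <= ennreal (norm c) * (ennreal \<gamma> * \<tau> d)" by (rule mult_left_mono) simp
  moreover have "ennreal (norm c) * \<tau> d = \<tau> c" "norm c * f d = f c"
   using tau_scale[OF d, of "norm c"] pfun_scaleR[OF pf d(1), of "norm c"] n by (simp_all add: d_def)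
  ultimately show ?thesis using pfun_nonneg[OF pf d] by (simp add: ennreal_mult[symmetric] mult.left_commute)
 qed (use \<gamma> in \<open>auto simp: pfun_zero[OF pf] ennreal_mult_top\<close>)
 have off: "f ((\<I> - q) ** y ** q) = 0" if y: "y \<in> M" for y
 proof -
  define z where "z = (\<I> - q) ** y ** q"
  have z: "z \<in> M" "z ** q = z" "q ** z = 0" using y q by (auto simp: z_def mem_rules op_simps qs qi)
  have z': "q ** adj z = adj z" "adj z ** q = 0" using arg_cong[OF z(2), of adj] arg_cong[OF z(3), of adj] qs by (auto simp: adj_rules)
  define K where "K = (norm z)\<^sup>2"
  have zz: "psd (K *\<^sub>R q - adj z ** z)"
  proof (rule psd_compress_le[OF psd_square(1) q(2)])
   have "q ** (adj z ** z) ** q = (q ** adj z) ** (z ** q)" by (simp only: op_simps(1))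
   then show "q ** (adj z ** z) ** q = adj z ** z" by (simp only: z z')
   show "norm (adj z ** z) <= K" using norm_blinfun_compose[of "adj z" z] by (simp add: K_def power2_eq_square)
  qed
  have tz: "\<tau> (adj z ** z) < \<infinity>"
  proof -
   have "\<tau> (adj z ** z) <= \<tau> (K *\<^sub>R q)" using z q zz by (intro tau_mono psd_square) (auto simp: mem_rules)
   also have "... = ennreal K * \<tau> q" using q by (simp add: K_def tau_scale proj_psd)
   also have "... < \<infinity>" using q by (simp add: ennreal_mult_less_top)
   finally show ?thesis .
  qed
  define B where "B = f (z ** adj z) - \<gamma> * enn2real (\<tau> (adj z ** z)) - K * S"
  have "0 <= (- B) * t\<^sup>2 + (- 2 * f z) * t" for t
  proof -
   define w where "w = q + t *\<^sub>R z"
   \<comment> \<open>k bounds the norm of \<open>w ** adj w\<close>, so dividing by it gives an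
     admissible competitor.\<close>
   define k where "k = 1 + t\<^sup>2 * K"
   have k: "k > 0" by (simp add: k_def K_def add_pos_nonneg)
   have wM: "w \<in> M" using q z by (simp add: w_def mem_rules)
   \<comment> \<open>There is no term linear in t, because z maps into the range of 1 - q.\<close>
   have ww: "adj w ** w = q + t\<^sup>2 *\<^sub>R (adj z ** z)" by (simp add: w_def adj_rules op_simps qs z z' power2_eq_square)
   have "psd (t\<^sup>2 *\<^sub>R (K *\<^sub>R q - adj z ** z) + (\<I> - q) + (t\<^sup>2 * K) *\<^sub>R (\<I> - q))"
    using zz q by (intro psd_add psd_scaleR) (auto simp: proj_le_id K_def)
   also have "t\<^sup>2 *\<^sub>R (K *\<^sub>R q - adj z ** z) + (\<I> - q) + (t\<^sup>2 * K) *\<^sub>R (\<I> - q) = (sqrt k)\<^sup>2 *\<^sub>R \<I> - adj w ** w"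
    using k by (simp add: ww k_def algebra_simps)
   finally have nw: "norm w <= sqrt k" using k by (intro norm_le_of_square) auto
   have "psd (k *\<^sub>R \<I> - w ** adj w)"
   proof (rule psd_norm_bound(1))
    have "norm (w ** adj w) <= sqrt k * sqrt k" using norm_blinfun_compose[of w "adj w"] mult_mono[OF nw nw] k by simp
    then show "norm (w ** adj w) <= k" using k by simp
   qed (simp add: adj_rules)
   then have a1: "psd (\<I> - (1/k) *\<^sub>R (w ** adj w))"
    using psd_scaleR[of "k *\<^sub>R \<I> - w ** adj w" "1/k"] k by (simp add: scaleR_diff_right)
   have tw: "\<tau> (w ** adj w) = \<tau> q + ennreal (t\<^sup>2) * \<tau> (adj z ** z)"
    using q z by (simp add: tau_square[OF wM, symmetric] ww tau_add tau_scale mem_rules psd_scaleR psd_square proj_psd)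
   have tw': "\<tau> ((1/k) *\<^sub>R (w ** adj w)) = ennreal (1/k) * (\<tau> q + ennreal (t\<^sup>2) * \<tau> (adj z ** z))"
    using wM k by (simp add: tau_scale mem_rules psd_square tw)
   have fin: "\<tau> ((1/k) *\<^sub>R (w ** adj w)) < \<infinity>" unfolding tw' using q tz by (simp add: ennreal_mult_less_top)
   have tr: "enn2real (\<tau> ((1/k) *\<^sub>R (w ** adj w))) = (1/k) * (enn2real (\<tau> q) + t\<^sup>2 * enn2real (\<tau> (adj z ** z)))"
    unfolding tw' using q tz k by (simp add: enn2real_mult enn2real_plus ennreal_mult_less_top)
   have "f (w ** adj w) = f q + 2 * t * f z + t\<^sup>2 * f (z ** adj z)" using q z pfun_adj[OF pf z(1)]
    by (simp add: w_def adj_rules op_simps qs z z' pfun_rules[OF pf] mem_rules power2_eq_square algebra_simps)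
   then have fw: "f ((1/k) *\<^sub>R (w ** adj w)) = (1/k) * (f q + 2 * t * f z + t\<^sup>2 * f (z ** adj z))"
    using wM by (simp add: pfun_scaleR[OF pf] mem_rules)
   have "f ((1/k) *\<^sub>R (w ** adj w)) - \<gamma> * enn2real (\<tau> ((1/k) *\<^sub>R (w ** adj w))) <= S"
    unfolding S_def using wM k a1 fin by (intro max) (auto simp: mem_rules psd_scaleR psd_square)
   then have "(1/k) * (f q + 2 * t * f z + t\<^sup>2 * f (z ** adj z) - \<gamma> * (enn2real (\<tau> q) + t\<^sup>2 * enn2real (\<tau> (adj z ** z)))) <= S"
    unfolding tr fw by (simp add: algebra_simps)
   then have "f q + 2 * t * f z + t\<^sup>2 * f (z ** adj z) - \<gamma> * (enn2real (\<tau> q) + t\<^sup>2 * enn2real (\<tau> (adj z ** z))) <= S * k"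
    using k by (simp add: field_simps)
   then show ?thesis by (simp add: k_def B_def S_def algebra_simps)
  qed
  from quadratic_linear_zero[OF this] show ?thesis by (simp add: z_def)
 qed
 show ?thesis unfolding hahn_def using q lower upper off by blast
qed

lemma offdiag_commute:
 assumes f: "pfun f" and q: "q \<in> M" "proj q" and off: "!!x. x \<in> M ==> f ((\<I> - q) ** x ** q) = 0" and x: "x \<in> M"
 shows "f (q ** x) = f (q ** x ** q)" "f (x ** q) = f (q ** x ** q)"
proof -
 have "f (adj ((\<I> - q) ** adj x ** q)) = 0" using off[of "adj x"] x q by (subst pfun_adj[OF f]) (auto simp: mem_rules)
 then show "f (q ** x) = f (q ** x ** q)" using x q by (simp add: adj_rules op_simps proj_simps pfun_diff[OF f] mem_rules)
 show "f (x ** q) = f (q ** x ** q)" using off[OF x] x q by (simp add: op_simps pfun_diff[OF f] mem_rules)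
qed

text \<open>With r = 1 - p the elements p' r p' and r p' r have equal trace, and equal value under f
  because f has no off-diagonal parts. The bounds at the two levels then say that \<gamma>' times
  this finite trace is at most \<gamma> times it, so it is 0.\<close>

lemma hahn_nested:
 assumes f: "nfun f" and p: "hahn f \<gamma> p" and p': "hahn f \<gamma>' p'" and lt: "0 < \<gamma>" "\<gamma> < \<gamma>'"
 shows "psd (p - p')"
proof -
 note pf = nfun_pfun[OF f]
 have P: "p \<in> M" "proj p" "!!x. x \<in> M ==> f ((\<I> - p) ** x ** p) = 0"
  "!!c. c \<in> M ==> psd c ==> (\<I> - p) ** c ** (\<I> - p) = c ==> ennreal (f c) <= ennreal \<gamma> * \<tau> c"
  using p unfolding hahn_def by blast+
 have P': "p' \<in> M" "proj p'" "\<tau> p' < \<infinity>" "!!x. x \<in> M ==> f ((\<I> - p') ** x ** p') = 0"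
  "!!c. c \<in> M ==> psd c ==> p' ** c ** p' = c ==> ennreal \<gamma>' * \<tau> c <= ennreal (f c)" using p' unfolding hahn_def by blast+
 define r where "r = \<I> - p"
 have r: "r \<in> M" "proj r" using P by (auto simp: r_def mem_rules proj_compl)
 note rs = proj_simps[OF r(2)] proj_idem[OF r(2)] and ps = proj_simps[OF P'(2)] proj_idem[OF P'(2)]
 define a where "a = p' ** r ** p'"
 define b where "b = r ** p' ** r"
 have a: "a \<in> M" "psd a" and b: "b \<in> M" "psd b"
  using r P' psd_conj_sa[OF ps(1) proj_psd[OF r(2)]] psd_conj_sa[OF rs(1) proj_psd[OF P'(2)]] by (auto simp: a_def b_def mem_rules)
 have fr: "f (r ** x) = f (r ** x ** r)" if "x \<in> M" for x
 proof -
  have "f (r ** x ** p) = 0" using P(3)[OF that] by (simp add: r_def)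
  then have "f (r ** x ** (\<I> - p)) = f (r ** x)" using that r P by (simp add: op_simps pfun_diff[OF pf] mem_rules)
  then show ?thesis by (simp add: r_def)
 qed
 have "f a = f (p' ** r)" using offdiag_commute(1)[OF pf P'(1,2,4) r(1)] by (simp add: a_def)
 also have "... = f (adj (p' ** r))" using P' r by (simp add: pfun_adj[OF pf] mem_rules)
 also have "... = f (r ** p')" by (simp add: adj_rules rs ps)
 also have "... = f b" using fr[OF P'(1)] by (simp add: b_def)
 finally have fab: "f a = f b" .
 have tab: "\<tau> a = \<tau> b"
 proof -
  have "a = adj (r ** p') ** (r ** p')" "b = (r ** p') ** adj (r ** p')" by (simp_all add: a_def b_def adj_rules op_simps rs ps)
  then show ?thesis using tau_square[of "r ** p'"] r P' by (simp add: mem_rules)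
 qed
 have fin: "\<tau> a < \<infinity>"
 proof -
  have "psd (p' ** (\<I> - r) ** p')" using psd_conj_sa[OF ps(1) proj_le_id[OF r(2)]] .
  then have "psd (p' - a)" by (simp add: a_def op_simps ps)
  then have "\<tau> a <= \<tau> p'" using a P' by (intro tau_mono) auto
  then show ?thesis using P'(3) by (rule le_less_trans)
 qed
 have "ennreal \<gamma>' * \<tau> a <= ennreal (f a)" using a by (intro P'(5)) (auto simp: a_def op_simps ps)
 also have "... <= ennreal \<gamma> * \<tau> a" unfolding fab tab using b by (intro P(4)) (auto simp: b_def op_simps rs simp flip: r_def)
 finally have le: "ennreal \<gamma>' * \<tau> a <= ennreal \<gamma> * \<tau> a" .
 have "enn2real (\<tau> a) = 0"
 proof (rule ccontr)
  assume "\<not> ?thesis"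
  then have pos: "enn2real (\<tau> a) > 0" using enn2real_nonneg[of "\<tau> a"] by (simp add: less_le)
  have "ennreal (\<gamma>' * enn2real (\<tau> a)) <= ennreal (\<gamma> * enn2real (\<tau> a))" using le lt fin by (simp add: ennreal_mult)
  then have "\<gamma>' * enn2real (\<tau> a) <= \<gamma> * enn2real (\<tau> a)" using lt pos by (subst (asm) ennreal_le_iff) auto
  then show False using lt pos by simp
 qed
 then have "\<tau> a = 0" using fin by (auto simp: enn2real_eq_0_iff)
 then have "a = 0" by (rule tau_faithful[OF a])
 have "adj (r ** p') ** (r ** p') = a" by (simp add: a_def adj_rules op_simps rs ps)
 then have "adj (r ** p') ** (r ** p') = 0" using \<open>a = 0\<close> by simp
 then have "r ** p' = 0" by (rule square_zero)
 then have "p ** p' = p'" by (simp add: r_def op_simps)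
 then show ?thesis using proj_psd[OF proj_diff[OF P'(2) P(2)]] by simp
qed

end

section \<open>Spectral measures from decreasing families of projections\<close>

section \<open>Spectral resolutions\<close>

lemma psr_binary_disjoint: "A \<inter> B = {} ==> disjoint_family (binaryset A B)" by (auto simp: disjoint_family_on_def binaryset_def)

lemma wlim_of_forms:
 fixes s :: "'h::{real_inner,complete_space} op"
 assumes "!!i. adj (a i) = a i" "adj s = s" "!!u. ((\<lambda>i. inner u (a i u)) \<longlongrightarrow> inner u (s u)) F"
 shows "wlim F a s"
proof -
 have pol: "inner u (x v) = (inner (u + v) (x (u + v)) - inner (u - v) (x (u - v))) / 4"
  if "adj x = x" for x :: "'h op" and u v using that inner_adj2[of v x u] by (simp add: bilinear_simps inner_commute[of v "x u"])
   (simp add: inner_commute)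
 show ?thesis unfolding wlim_def
 proof (intro allI)
  fix u v
  show "((\<lambda>i. inner u (a i v)) \<longlongrightarrow> inner u (s v)) F"
   unfolding pol[OF assms(1), where u = u and v = v] pol[OF assms(2), where u = u and v = v] by (intro tendsto_intros assms(3)) auto
 qed
qed

context vn_algebra
begin

definition psr :: "(real set => 'h op) => bool"
 where "psr e \<longleftrightarrow> (\<forall>A\<in>sets borel. e A \<in> M \<and> proj (e A)) \<and> e UNIV = \<I> \<and> e {..<0} = 0 \<and>
  (\<forall>A\<in>sets borel. \<forall>B\<in>sets borel. e (A \<inter> B) = e A ** e B) \<and>
  (\<forall>A::nat => real set. range A \<subseteq> sets borel --> disjoint_family A -->
    (\<forall>u. (\<lambda>k. e (A k) u) sums e (\<Union>k. A k) u))"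

lemma psr_iff: "positive_spectral_resolution M e \<longleftrightarrow> psr e" unfolding positive_spectral_resolution_def psr_def
 by (intro conj_cong refl ball_cong) (auto simp: is_projection_iff)

lemma psr_mem: "psr e ==> A \<in> sets borel ==> e A \<in> M"
 and psr_proj: "psr e ==> A \<in> sets borel ==> proj (e A)"
 and psr_UNIV: "psr e ==> e UNIV = \<I>"
 and psr_neg: "psr e ==> e {..<0} = 0"
 and psr_Int: "psr e ==> A \<in> sets borel ==> B \<in> sets borel ==> e A ** e B = e (A \<inter> B)" by (simp_all add: psr_def)

lemma psr_sums:
 assumes "psr e" "range A \<subseteq> sets borel" "disjoint_family A"
 shows "(\<lambda>k. e (A k) u) sums e (\<Union>k. A k) u" using assms unfolding psr_def by blast

lemma psr_psd: "psr e ==> A \<in> sets borel ==> psd (e A)" by (intro proj_psd psr_proj)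

lemma psr_norm: "psr e ==> A \<in> sets borel ==> norm (e A) <= 1" by (intro proj_norm psr_proj)

lemma psr_empty: "psr e ==> e {} = 0" using psr_Int[of e "{..<0}" "{}"] by (simp add: psr_neg op_simps)

lemma psr_Un:
 assumes e: "psr e" and AB: "A \<in> sets borel" "B \<in> sets borel" "A \<inter> B = {}"
 shows "e (A \<union> B) = e A + e B"
proof (rule blinfun_eqI)
 fix u
 have "(\<lambda>k. e (binaryset A B k) u) sums e (\<Union>k. binaryset A B k) u"
  using AB by (intro psr_sums[OF e] psr_binary_disjoint) (auto simp: range_binaryset_eq)
 moreover have "(\<lambda>k. e (binaryset A B k) u) sums (e A u + e B u)" by (rule binaryset_sums) (simp add: psr_empty[OF e])
 ultimately show "e (A \<union> B) u = (e A + e B) u" using sums_unique2 by (simp add: UN_binaryset_eq blinfun.bilinear_simps) blast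
qed

lemma psr_Compl: "psr e ==> A \<in> sets borel ==> e (- A) = \<I> - e A"
 using psr_Un[of e A "- A"] by (auto simp: psr_UNIV Compl_partition borel_comp algebra_simps)

lemma psr_finite_UN:
 assumes e: "psr e" and A: "!!i. i \<in> I ==> A i \<in> sets borel" "disjoint_family_on A I" "finite I"
 shows "e (\<Union>i\<in>I. A i) = (\<Sum>i\<in>I. e (A i))" using A(3,1,2)
proof (induction I rule: finite_induct)
 case (insert i I)
 have "e (A i \<union> (\<Union>i\<in>I. A i)) = e (A i) + e (\<Union>i\<in>I. A i)" using insert.prems insert.hyps
  by (intro psr_Un[OF e]) (auto intro!: sets.finite_UN simp: disjoint_family_on_def)
 then show ?case using insert by (simp add: disjoint_family_on_insert disjoint_family_on_mono[of I "insert i I"])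
qed (simp add: psr_empty[OF e])

lemma psr_wlim:
 assumes e: "psr e" and A: "range A \<subseteq> sets borel" "disjoint_family A"
 shows "wlim sequentially (\<lambda>n. e (\<Union>k<n. A k)) (e (\<Union>k. A k))" unfolding wlim_def
proof (intro allI)
 fix u v
 have "(\<lambda>n. \<Sum>k<n. e (A k) v) \<longlonglongrightarrow> e (\<Union>k. A k) v" using psr_sums[OF e A] by (simp add: sums_def)
 moreover have "(\<Sum>k<n. e (A k) v) = e (\<Union>k<n. A k) v" for n
  using A by (subst psr_finite_UN[OF e]) (auto simp: blinfun.sum_left intro: disjoint_family_on_mono)
 ultimately show "(\<lambda>n. inner u (e (\<Union>k<n. A k) v)) \<longlonglongrightarrow> inner u (e (\<Union>k. A k) v)"
  by (intro tendsto_inner tendsto_const) simp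
qed

text \<open>P s is to be the projection of the half-line above s. Each vector u gives a Stieltjes
  measure; the sets on which these measures come from one operator form a Dynkin system, and so do
  the sets on which the operators multiply.\<close>

lemma spectral_measure_exists:
 assumes P: "!!s. P s \<in> M" "!!s. proj (P s)" and mono: "!!s t. s <= t ==> psd (P s - P t)"
  and rc: "!!s u d. d > 0 ==> \<exists>t>s. inner u (P s u) - d < inner u (P t u)"
  and neg: "!!s. s < 0 ==> P s = \<I>" and top: "!!u d. d > 0 ==> \<exists>s. inner u (P s u) < d"
 shows "\<exists>e. psr e \<and> (\<forall>s. e {s<..} = P s)"
proof -
 \<comment> \<open>The sign turns the decreasing form into a right-continuous distribution
   function.\<close>
 define F where "F u s = - inner u (P s u)" for u s
 have dec: "inner u (P t u) <= inner u (P s u)" if "s <= t" for s t u using mono[OF that] by (auto simp: psd_def bilinear_simps)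
 have Pn: "0 <= inner u (P s u)" "inner u (P s u) <= inner u u" for s u
  using proj_psd[OF P(2)] proj_le_id[OF P(2)] by (auto simp: psd_def bilinear_simps)
 have F_mono: "F u s <= F u t" if "s <= t" for u s t using dec[OF that] by (simp add: F_def)
 have F_rc: "continuous (at_right a) (F u)" for u a unfolding continuous_within
 proof (rule order_tendstoI)
  fix y assume y: "y < F u a"
  show "\<forall>\<^sub>F x in at_right a. y < F u x"
  proof (rule eventually_mono[OF eventually_at_right_less])
   fix x assume "a < x"
   then have "F u a <= F u x" by (intro F_mono) simp
   then show "y < F u x" using y by simp
  qed
 next
  fix y assume "F u a < y"
  then obtain t where t: "t > a" "inner u (P a u) - (y - F u a) < inner u (P t u)" using rc[of "y - F u a" a u] by auto
  show "\<forall>\<^sub>F x in at_right a. F u x < y" unfolding eventually_at_right[OF t(1)]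
  proof (intro exI[of _ t] conjI allI impI t)
   fix x assume "a < x" "x < t"
   then show "F u x < y" using t(2) dec[of x t u] by (simp add: F_def)
  qed
 qed
 define \<mu> where "\<mu> u = interval_measure (F u)" for u
 have Ioc: "emeasure (\<mu> u) {a<..b} = ennreal (inner u (P a u) - inner u (P b u))" if "a <= b" for u a b
  using emeasure_interval_measure_Ioc[OF that, of "F u"] F_mono F_rc by (simp add: \<mu>_def F_def)
 have lim0: "(\<lambda>n. inner u (P (real n) u)) \<longlonglongrightarrow> 0" for u
 proof (rule LIMSEQ_I)
  fix r :: real assume "r > 0"
  then obtain s where s: "inner u (P s u) < r" using top by blast
  show "\<exists>no. \<forall>n\<ge>no. norm (inner u (P (real n) u) - 0) < r"
  proof (intro exI[of _ "nat \<lceil>s\<rceil>"] allI impI)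
   fix n assume "nat \<lceil>s\<rceil> <= n"
   then have "s <= real n" by linarith
   then show "norm (inner u (P (real n) u) - 0) < r" using dec[of s "real n" u] s Pn[of u] by auto
  qed
 qed
 have Ioi: "emeasure (\<mu> u) {s<..} = ennreal (inner u (P s u))" for u s
 proof -
  define k where "k = nat \<lceil>s\<rceil>"
  have k: "s <= real (n + k)" for n unfolding k_def by linarith
  have "(\<lambda>n. emeasure (\<mu> u) {s<..real (n + k)}) \<longlonglongrightarrow> emeasure (\<mu> u) (\<Union>n. {s<..real (n + k)})"
   by (rule Lim_emeasure_incseq) (auto simp: \<mu>_def incseq_def)
  also have "(\<Union>n. {s<..real (n + k)}) = {s<..}"
  proof -
   have "\<exists>n. x <= real (n + k)" for x by (rule exI[of _ "nat \<lceil>x\<rceil>"]) linarith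
   then show ?thesis by auto
  qed
  finally have l1: "(\<lambda>n. ennreal (inner u (P s u) - inner u (P (real (n + k)) u))) \<longlonglongrightarrow> emeasure (\<mu> u) {s<..}"
   using Ioc[OF k] by simp
  have "(\<lambda>n. inner u (P s u) - inner u (P (real (n + k)) u)) \<longlonglongrightarrow> inner u (P s u) - 0"
   by (intro tendsto_intros LIMSEQ_ignore_initial_segment[OF lim0])
  then have "(\<lambda>n. ennreal (inner u (P s u) - inner u (P (real (n + k)) u))) \<longlonglongrightarrow> ennreal (inner u (P s u))"
   by (intro tendsto_ennrealI) simp
  with l1 show ?thesis using LIMSEQ_unique by blast
 qed
 have sp[simp]: "space (\<mu> u) = UNIV" and se[simp]: "sets (\<mu> u) = sets borel" for u by (simp_all add: \<mu>_def)
 have UN: "emeasure (\<mu> u) UNIV = ennreal (inner u u)" for u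
 proof -
  have "(\<lambda>n. emeasure (\<mu> u) {- real n - 1<..}) \<longlonglongrightarrow> emeasure (\<mu> u) (\<Union>n. {- real n - 1<..})"
   by (rule Lim_emeasure_incseq) (auto simp: incseq_def)
  also have "(\<Union>n. {- real n - 1<..}) = UNIV"
  proof -
   have "\<exists>n. - real n - 1 < x" for x by (rule exI[of _ "nat \<lceil>- x\<rceil>"]) linarith
   then show ?thesis by auto
  qed
  finally show ?thesis unfolding Ioi using neg LIMSEQ_unique[OF tendsto_const] by fastforce
 qed
 have fin: "finite_measure (\<mu> u)" for u by (rule finite_measureI) (simp add: UN)
 define m where "m u A = measure (\<mu> u) A" for u A
 have m_Ioi: "m u {s<..} = inner u (P s u)" and m_UN: "m u UNIV = inner u u" for u s using Ioi UN Pn by (simp_all add: m_def measure_def)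
 have m_compl: "m u (UNIV - A) = inner u u - m u A" if "A \<in> sets borel" for u A
  using finite_measure.finite_measure_compl[OF fin, of A u] that by (simp add: m_def m_UN[unfolded m_def])
 have m_UNION: "(\<lambda>k. m u (A k)) sums m u (\<Union>k. A k)" if "range A \<subseteq> sets borel" "disjoint_family A" for u A
  unfolding m_def by (rule finite_measure.finite_measure_UNION[OF fin]) (use that in auto)
 have borel_gen: "sets borel = sigma_sets UNIV (range greaterThan :: real set set)" by (subst borel_Ioi) simp
 have gp: "range greaterThan \<subseteq> Pow (UNIV :: real set)" by simp
 have gi: "{s<..} \<inter> {t<..} = {max s t<..}" for s t :: real by auto
 have Ist: "Int_stable (range greaterThan :: real set set)" by (auto simp: Int_stable_def gi)
 \<comment> \<open>Half-lines are stable under intersection and generate the Borel sets, so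
   complements and disjoint unions suffice.\<close>
 have op: "\<exists>T\<in>M. psd T \<and> psd (\<I> - T) \<and> (\<forall>u. inner u (T u) = m u A)" if "A \<in> sets borel" for A
 proof -
  from Ist gp that[unfolded borel_gen]
  show ?thesis
  proof (induction rule: sigma_sets_induct_disjoint)
   case (basic A)
   then obtain s where "A = {s<..}" by auto
   then show ?case using P proj_psd proj_le_id m_Ioi by (intro bexI[of _ "P s"]) auto
  next
   case empty
   then show ?case by (intro bexI[of _ 0]) (auto simp: m_def)
  next
   case (compl A)
   then obtain T where "T \<in> M" "psd T" "psd (\<I> - T)" "!!u. inner u (T u) = m u A" by blast
   then show ?case using compl m_compl by (intro bexI[of _ "\<I> - T"]) (auto simp: mem_rules borel_gen bilinear_simps)
  next
   case (union A)
   then obtain T where T: "!!i. T i \<in> M" "!!i. psd (T i)" "!!i u. inner u (T i u) = m u (A i)" by metis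
   have Ab: "range A \<subseteq> sets borel" using union by (simp add: borel_gen)
   define S where "S n = (\<Sum>i<n. T i)" for n
   have qS: "inner u (S n u) = (\<Sum>i<n. m u (A i))" for n u by (simp add: S_def blinfun.sum_left inner_sum_right T)
   have SM: "S n \<in> M" "psd (S n)" for n using T by (auto simp: S_def mem_rules psd_sum)
   have S1: "psd (1 *\<^sub>R \<I> - S n)" for n
   proof -
    have "(\<Sum>i<n. m u (A i)) <= inner u u" for u
    proof -
     have "(\<Sum>i<n. m u (A i)) <= m u (\<Union>k. A k)"
      using sum_le_suminf[OF sums_summable[OF m_UNION[OF Ab union(1), of u]], of "{..<n}"]
       sums_unique[OF m_UNION[OF Ab union(1), of u]] by (simp add: m_def)
     also have "... <= m u UNIV" unfolding m_def by (rule finite_measure.finite_measure_mono[OF fin]) auto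
     finally show ?thesis by (simp add: m_UN)
    qed
    then show ?thesis using psd_sa[OF SM(2)] by (simp add: psd_def adj_rules bilinear_simps qS)
   qed
   obtain s where s: "s \<in> M" "form_sup (range S) s" "wlim sequentially S s"
   proof -
    have "\<exists>s\<in>M. form_sup (range S) s \<and> wlim sequentially S s" by (rule mono_seq_form_sup[OF SM _ S1]) (auto simp: S_def T)
    then show ?thesis using that by blast
   qed
   have "inner u (s u) = m u (\<Union>k. A k)" for u
    using LIMSEQ_unique[OF wlimD[OF s(3), of u u]] m_UNION[OF Ab union(1), of u] by (simp add: qS sums_def)
   moreover have "psd s" by (rule form_sup_psd[OF s(2) _ SM(2)]) auto
   moreover have "psd (\<I> - s)" by (rule form_sup_le[OF s(2)]) (use S1 in auto)
   ultimately show ?case using s by blast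
  qed
 qed
 define e where "e A = (SOME T. T \<in> M \<and> psd T \<and> psd (\<I> - T) \<and> (\<forall>u. inner u (T u) = m u A))" for A
 have e: "e A \<in> M" "psd (e A)" "psd (\<I> - e A)" "inner u (e A u) = m u A" if "A \<in> sets borel" for A u
 proof -
  have "e A \<in> M \<and> psd (e A) \<and> psd (\<I> - e A) \<and> (\<forall>u. inner u (e A u) = m u A)"
   unfolding e_def by (rule someI_ex) (use op[OF that] in blast)
  then show "e A \<in> M" "psd (e A)" "psd (\<I> - e A)" "inner u (e A u) = m u A" by auto
 qed
 have esa: "adj (e A) = e A" if "A \<in> sets borel" for A using e(2)[OF that] psd_sa by blast
 have e_Ioi: "e {s<..} = P s" for s by (rule sa_eqI) (auto simp: esa e P proj_simps m_Ioi)
 have e_compl: "e (UNIV - A) = \<I> - e A" if "A \<in> sets borel" for A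
 proof (rule sa_eqI)
  have c: "UNIV - A \<in> sets borel" using that by (simp add: Compl_eq_Diff_UNIV[symmetric] borel_comp)
  show "adj (e (UNIV - A)) = e (UNIV - A)" by (rule esa[OF c])
  show "adj (\<I> - e A) = \<I> - e A" using esa[OF that] by (simp add: adj_rules)
  show "inner u (e (UNIV - A) u) = inner u ((\<I> - e A) u)" for u
   using e(4)[OF c] e(4)[OF that] m_compl[OF that] by (simp add: bilinear_simps)
 qed
 have e_union: "wlim sequentially (\<lambda>n. \<Sum>k<n. e (A k)) (e (\<Union>k. A k))"
  if A: "range A \<subseteq> sets borel" "disjoint_family A" for A
 proof (rule wlim_of_forms)
  have Ak: "A k \<in> sets borel" for k using A by auto
  have U: "(\<Union>k. A k) \<in> sets borel" using Ak by auto
  show "adj (\<Sum>k<n. e (A k)) = (\<Sum>k<n. e (A k))" for n using esa[OF Ak] by (simp add: adj_sum)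
  show "adj (e (\<Union>k. A k)) = e (\<Union>k. A k)" by (rule esa[OF U])
  show "(\<lambda>n. inner u ((\<Sum>k<n. e (A k)) u)) \<longlonglongrightarrow> inner u (e (\<Union>k. A k) u)" for u
   using m_UNION[OF A, of u] by (simp add: blinfun.sum_left inner_sum_right e(4)[OF Ak] e(4)[OF U] sums_def)
 qed
 have e_empty: "e {} = 0" by (rule sa_eqI) (auto simp: esa e m_def)
 \<comment> \<open>Multiplicativity against a fixed Y spreads from half-lines to all Borel sets. It
   is applied twice: with Y a half-line, then, after taking adjoints, with Y arbitrary.\<close>
 have dynkin: "e A ** e Y = e (A \<inter> Y)"
  if Y: "Y \<in> sets borel" and base: "!!s. e {s<..} ** e Y = e ({s<..} \<inter> Y)" and A: "A \<in> sets borel" for A Y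
 proof -
  from Ist gp A[unfolded borel_gen]
  show ?thesis
  proof (induction rule: sigma_sets_induct_disjoint)
   case (basic A)
   then show ?case using base by auto
  next
   case empty
   then show ?case by (simp add: e_empty op_simps)
  next
   case (compl A)
   have A: "A \<in> sets borel" using compl by (simp add: borel_gen)
   have i: "A \<inter> Y \<in> sets borel" "(UNIV - A) \<inter> Y \<in> sets borel" using A Y by (auto simp: Diff_eq borel_comp)
   have "e ((UNIV - A) \<inter> Y) = e Y - e (A \<inter> Y)"
   proof (rule sa_eqI)
    show "inner u (e ((UNIV - A) \<inter> Y) u) = inner u ((e Y - e (A \<inter> Y)) u)" for u
    proof -
     have "(UNIV - A) \<inter> Y = Y - (A \<inter> Y)" by auto
     then have "m u ((UNIV - A) \<inter> Y) = m u Y - m u (A \<inter> Y)"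
      unfolding m_def using finite_measure.finite_measure_Diff[OF fin, of Y u "A \<inter> Y"] i Y by simp
     then show ?thesis using e(4)[OF i(1)] e(4)[OF i(2)] e(4)[OF Y] by (simp add: bilinear_simps)
    qed
   qed (use esa i Y in \<open>auto simp: adj_rules\<close>)
   then show ?case using compl.IH by (simp add: e_compl[OF A] op_simps)
  next
   case (union A)
   have Ab: "range A \<subseteq> sets borel" using union by (simp add: borel_gen)
   have AY: "range (\<lambda>k. A k \<inter> Y) \<subseteq> sets borel" "disjoint_family (\<lambda>k. A k \<inter> Y)"
    using Ab Y union(1) by (auto simp: disjoint_family_on_def)
   have "wlim sequentially (\<lambda>n. (\<Sum>k<n. e (A k)) ** e Y) (e (\<Union>k. A k) ** e Y)"
    by (rule wlim_compose_right[OF e_union[OF Ab union(1)]])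
   moreover have "(\<Sum>k<n. e (A k)) ** e Y = (\<Sum>k<n. e (A k \<inter> Y))" for n by (simp add: op_sum union.IH)
   ultimately have "wlim sequentially (\<lambda>n. \<Sum>k<n. e (A k \<inter> Y)) (e (\<Union>k. A k) ** e Y)" by simp
   then have "e (\<Union>k. A k) ** e Y = e (\<Union>k. A k \<inter> Y)" using e_union[OF AY] wlim_unique[OF sequentially_bot] by blast
   then show ?case by simp
  qed
 qed
 have e_Int: "e A ** e B = e (A \<inter> B)" if A: "A \<in> sets borel" and B: "B \<in> sets borel" for A B
 proof -
  have PP: "P s ** P t = P (max s t)" for s t
  proof (cases "s <= t")
   case True
   then show ?thesis using proj_le_compose(1)[OF P(2) P(2) mono[OF True]] by (simp add: max_def)
  next
   case False
   then show ?thesis using proj_le_compose(2)[OF P(2) P(2) mono[of t s]] by (simp add: max_def)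
  qed
  have ray: "e A ** e {s<..} = e (A \<inter> {s<..})" if "A \<in> sets borel" for A s by (rule dynkin[OF _ _ that]) (auto simp: e_Ioi PP gi)
  show ?thesis
  proof (rule dynkin[OF B _ A])
   fix s
   have i: "B \<inter> {s<..} \<in> sets borel" using B by auto
   have "adj (e B ** e {s<..}) = adj (e (B \<inter> {s<..}))" using ray[OF B] by simp
   then show "e {s<..} ** e B = e ({s<..} \<inter> B)" using esa B i by (simp add: adj_rules Int_commute)
  qed
 qed
 have e_proj: "proj (e A)" if "A \<in> sets borel" for A using esa[OF that] e_Int[OF that that] by (simp add: proj_def)
 have e_sums: "(\<lambda>k. e (A k) u) sums e (\<Union>k. A k) u" if A: "range A \<subseteq> sets borel" "disjoint_family A" for A u
 proof -
  have Ak: "A k \<in> sets borel" for k using A by auto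
  have U: "(\<Union>k. A k) \<in> sets borel" using Ak by auto
  have UU: "(\<Union>k<n. A k) \<in> sets borel" "(\<Union>k. A k) - (\<Union>k<n. A k) \<in> sets borel" for n using Ak by (auto intro!: sets.Diff)
  have mf: "(\<Sum>k<n. m u (A k)) = m u (\<Union>k<n. A k)" for n u unfolding m_def using Ak A(2)
   by (intro finite_measure.finite_measure_finite_Union[OF fin, symmetric]) (auto intro: disjoint_family_on_mono)
  have diff: "e (\<Union>k. A k) - (\<Sum>k<n. e (A k)) = e ((\<Union>k. A k) - (\<Union>k<n. A k))" for n
  proof (rule sa_eqI)
   show "inner u ((e (\<Union>k. A k) - (\<Sum>k<n. e (A k))) u) = inner u (e ((\<Union>k. A k) - (\<Union>k<n. A k)) u)" for u
   proof -
    have "m u ((\<Union>k. A k) - (\<Union>k<n. A k)) = m u (\<Union>k. A k) - m u (\<Union>k<n. A k)"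
     unfolding m_def by (intro finite_measure.finite_measure_Diff[OF fin]) (use Ak in auto)
    then show ?thesis using e(4)[OF UU(2)] e(4)[OF U] e(4)[OF Ak] mf by (simp add: bilinear_simps blinfun.sum_left inner_sum_right)
   qed
  qed (use esa UU U Ak in \<open>auto simp: adj_rules\<close>)
  have "(\<lambda>n. (e (\<Union>k. A k) - (\<Sum>k<n. e (A k))) u) \<longlonglongrightarrow> 0"
  proof (rule psd_strong[of _ 1])
   show "psd (e (\<Union>k. A k) - (\<Sum>k<n. e (A k)))" for n unfolding diff by (rule e(2)[OF UU(2)])
   show "norm (e (\<Union>k. A k) - (\<Sum>k<n. e (A k))) <= 1" for n unfolding diff by (rule proj_norm[OF e_proj[OF UU(2)]])
   show "(\<lambda>n. inner u ((e (\<Union>k. A k) - (\<Sum>k<n. e (A k))) u)) \<longlonglongrightarrow> 0"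
    using wlimD[OF wlim_diff[OF wlim_const[of _ "e (\<Union>k. A k)"] e_union[OF A]], of u u] by simp
  qed
  then have "(\<lambda>n. e (\<Union>k. A k) u - (\<Sum>k<n. e (A k) u)) \<longlonglongrightarrow> 0"
   by (simp add: blinfun.bilinear_simps blinfun.sum_left)
  from tendsto_diff[OF tendsto_const[of "e (\<Union>k. A k) u"] this]
  show ?thesis by (simp add: sums_def)
 qed
 have e_neg: "e {..<0} = 0"
 proof (rule sa_eqI)
  show "inner u (e {..<0} u) = inner u ((0::'h op) u)" for u
  proof -
   have "emeasure (\<mu> u) {..s} = 0" if "s < 0" for s
   proof -
    have "{..s} = UNIV - {s<..}" by auto
    then have "m u {..s} = 0" using m_compl[of "{s<..}" u] m_Ioi neg[OF that] by simp
    then show ?thesis using finite_measure.emeasure_eq_measure[OF fin] by (simp add: m_def)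
   qed
   then have "emeasure (\<mu> u) (\<Union>n. {.. - 1 / real (Suc n)}) = 0" by (intro emeasure_UN_eq_0) auto
   moreover have "(\<Union>n. {.. - 1 / real (Suc n)}) = {..<0::real}"
   proof safe
    fix x :: real assume "x < 0"
    then obtain n where "inverse (real (Suc n)) < - x" using reals_Archimedean[of "- x"] by auto
    then show "x \<in> (\<Union>n. {.. - 1 / real (Suc n)})" by (auto simp: inverse_eq_divide intro!: exI[of _ n])
   qed (auto intro: le_less_trans)
   ultimately have "m u {..<0} = 0" by (simp add: m_def measure_def)
   then show ?thesis by (simp add: e(4))
  qed
 qed (auto simp: esa)
 have e_UN: "e UNIV = \<I>" by (rule sa_eqI) (auto simp: esa e(4) m_UN)
 have "psr e" unfolding psr_def using e(1) e_proj e_UN e_neg e_Int e_sums by auto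
 then show ?thesis using e_Ioi by blast
qed

end

context traced_algebra
begin

lemma tau_seq_sup:
 fixes c :: "nat => 'h op"
 assumes c: "!!n. c n \<in> M" "!!n. psd (c n)" "!!n. psd (c (Suc n) - c n)" and s: "s \<in> M" "wlim sequentially c s"
 shows "\<tau> s = (SUP n. \<tau> (c n))"
proof -
 note inc = psd_chain[of c, OF c(3)]
 have "form_sup (range c) s" unfolding form_sup_def
 proof (intro conjI ballI allI impI)
  fix x assume "x \<in> range c"
  then obtain n where n: "x = c n" by blast
  have "\<forall>\<^sub>F m in sequentially. psd (c m - c n)" using inc(1) eventually_sequentially by blast
  then show "psd (s - x)" unfolding n by (rule wlim_psd[OF sequentially_bot wlim_diff[OF s(2) wlim_const]])
 next
  fix u and d :: real assume "d > 0"
  then have "\<forall>\<^sub>F n in sequentially. inner u (s u) - d < inner u (c n u)" by (intro order_tendstoD(1)[OF wlimD[OF s(2)]]) simp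
  then show "\<exists>x\<in>range c. inner u (s u) - d < inner u (x u)" using eventually_happens'[OF sequentially_bot] by blast
 qed
 then have "\<tau> s = (SUP x\<in>range c. \<tau> x)" using c s inc(2) by (intro tau_sup) auto
 then show ?thesis by (simp add: image_comp o_def)
qed

text \<open>The operators \<open>e A ** x ** e A\<close> are not additive in A, but their trace is
  that of \<open>root_op x ** e A ** root_op x\<close>, which is.\<close>

lemma psr_conj_sup:
 assumes e: "psr e" and x: "x \<in> M" "psd x" and A: "range A \<subseteq> sets borel" "disjoint_family A"
 shows "(\<Sum>k. \<tau> (e (A k) ** x ** e (A k))) = \<tau> (e (\<Union>k. A k) ** x ** e (\<Union>k. A k))"
proof -
 note g = root_op[OF x]
 have Ak: "A k \<in> sets borel" for k using A by auto
 have U: "(\<Union>k. A k) \<in> sets borel" "!!n. (\<Union>k<n. A k) \<in> sets borel" using Ak by auto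
 define T where "T B = root_op x ** e B ** root_op x" for B
 have TM: "T B \<in> M" "psd (T B)" if "B \<in> sets borel" for B
  using psr_mem[OF e that] psr_psd[OF e that] g x by (auto simp: T_def mem_rules psd_root_conj)
 have tT: "\<tau> (e B ** x ** e B) = \<tau> (T B)" if "B \<in> sets borel" for B
  using tau_proj_swap[OF psr_proj[OF e that] psr_mem[OF e that] x] by (simp add: T_def)
 define c where "c n = T (\<Union>k<n. A k)" for n
 have cs: "c n = (\<Sum>k<n. T (A k))" for n unfolding c_def T_def using Ak A(2)
  by (subst psr_finite_UN[OF e]) (auto simp: op_sum intro: disjoint_family_on_mono)
 have "\<tau> (T (\<Union>k. A k)) = (SUP n. \<tau> (c n))"
 proof (rule tau_seq_sup)
  show "wlim sequentially c (T (\<Union>k. A k))" unfolding c_def T_def by (intro wlim_compose_left wlim_compose_right psr_wlim[OF e A])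
  show "psd (c (Suc n) - c n)" for n using TM Ak by (simp add: cs)
  show "c n \<in> M" "psd (c n)" for n using TM U by (auto simp: c_def)
 qed (use TM U in auto)
 also have "... = (SUP n. \<Sum>k<n. \<tau> (T (A k)))"
 proof -
  have "\<tau> (c n) = (\<Sum>k<n. \<tau> (T (A k)))" for n
   unfolding cs using TM[OF Ak] by (induction n) (auto simp: tau_add sum_mem psd_sum)
  then show ?thesis by simp
 qed
 also have "... = (\<Sum>k. \<tau> (T (A k)))" by (rule suminf_eq_SUP[symmetric])
 finally show ?thesis using tT Ak U by simp
qed

definition spec_measure :: "(real set => 'h op) => 'h op => real measure"
 where "spec_measure e x = measure_of UNIV (sets borel) (\<lambda>A. \<tau> (e A ** x ** e A))"

lemma space_spec_measure [simp]: "space (spec_measure e x) = UNIV"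
 and sets_spec_measure [simp, measurable_cong]: "sets (spec_measure e x) = sets borel"
 by (auto simp: spec_measure_def space_measure_of_conv sets_measure_of_conv sets.sigma_sets_eq[of borel, simplified])

lemma emeasure_spec_measure:
 assumes e: "psr e" and x: "x \<in> M" "psd x" and A: "A \<in> sets borel"
 shows "emeasure (spec_measure e x) A = \<tau> (e A ** x ** e A)" unfolding spec_measure_def
proof (rule emeasure_measure_of_sigma)
 show "sigma_algebra UNIV (sets (borel :: real measure))" using sets.sigma_algebra_axioms[of borel] by simp
 show "positive (sets borel) (\<lambda>A. \<tau> (e A ** x ** e A))" by (simp add: positive_def psr_empty[OF e] op_simps)
 show "countably_additive (sets borel) (\<lambda>A. \<tau> (e A ** x ** e A))"
  unfolding countably_additive_def using psr_conj_sup[OF e x] by blast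
qed (rule A)

end

section \<open>Existence and properties of densities\<close>

section \<open>Densities of normal functionals\<close>

text \<open>Multiplicative cells of the positive half-line: on each of them a density is constant up
  to the factor \<theta>.\<close>

definition geo :: "real => int => real set"
 where "geo \<theta> k = {\<theta> powr real_of_int k <.. \<theta> powr (real_of_int k + 1)}"

lemma geo_borel [simp]: "geo \<theta> k \<in> sets borel" by (simp add: geo_def)

lemma geo_cover: assumes "\<theta> > 1" "t > 0" shows "\<exists>k. t \<in> geo \<theta> k"
proof (intro exI[of _ "\<lceil>log \<theta> t\<rceil> - 1"])
 define k where "k = \<lceil>log \<theta> t\<rceil> - 1"
 have k: "real_of_int k < log \<theta> t" "log \<theta> t <= real_of_int k + 1" unfolding k_def by linarith+
 have "\<theta> powr real_of_int k < \<theta> powr log \<theta> t" by (rule powr_less_mono[OF k(1) assms(1)])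
 moreover have "\<theta> powr log \<theta> t <= \<theta> powr (real_of_int k + 1)" by (rule powr_mono[OF k(2) less_imp_le[OF assms(1)]])
 moreover have "\<theta> powr log \<theta> t = t" using assms by simp
 ultimately show "t \<in> geo \<theta> (\<lceil>log \<theta> t\<rceil> - 1)" unfolding geo_def k_def[symmetric] by simp
qed

lemma geo_disjoint: assumes "\<theta> > 1" "k ~= l" shows "geo \<theta> k \<inter> geo \<theta> l = {}"
proof -
 have "geo \<theta> k \<inter> geo \<theta> l = {}" if "k < l" for k l
 proof -
  have "\<theta> powr (real_of_int k + 1) <= \<theta> powr real_of_int l" using assms that by simp
  then show ?thesis by (auto simp: geo_def)
 qed
 then show ?thesis using assms(2) by (metis Int_commute linorder_neqE)
qed

lemma geo_pos: "\<theta> > 1 ==> t \<in> geo \<theta> k ==> t > 0" unfolding geo_def by (auto intro: less_trans[rotated])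

lemma geo_UN: assumes "\<theta> > 1" shows "(\<Union>n. geo \<theta> (int_decode n)) = {0<..}"
proof safe
 fix t :: real assume "t > 0"
 then obtain k where "t \<in> geo \<theta> k" using geo_cover assms by blast
 then show "t \<in> (\<Union>n. geo \<theta> (int_decode n))" by (intro UN_I[of "int_encode k"]) auto
qed (use geo_pos assms in auto)

lemma geo_disjoint_family: "\<theta> > 1 ==> disjoint_family (\<lambda>n. geo \<theta> (int_decode n))"
 using geo_disjoint by (auto simp: disjoint_family_on_def inj_eq[OF inj_int_decode])

context traced_algebra
begin

definition has_density :: "(real set => 'h op) => ('h op => real) => bool"
 where "has_density e f \<longleftrightarrow> psr e \<and>
  (\<forall>x\<in>M. psd x --> (\<integral>\<^sup>+ t. ennreal t \<partial>spec_measure e x) = ennreal (f x))"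

lemma is_density_iff: "is_density M \<tau> \<rho> e \<longleftrightarrow> has_density e (\<lambda>x. Re (\<rho> x))"
 unfolding is_density_def has_density_def psr_iff spec_measure_def by (auto simp: pos_part_iff)

lemma hahn_compress_le:
 assumes f: "pfun f" and q: "q \<in> M" "proj q" "!!x. x \<in> M ==> f ((\<I> - q) ** x ** q) = 0" and c: "c \<in> M" "psd c"
 shows "f (q ** c ** q) <= f c"
proof -
 have "0 <= f ((\<I> - q) ** c ** (\<I> - q))"
  using q c by (intro pfun_nonneg[OF f] psd_conj_sa proj_simps proj_compl) (auto simp: mem_rules)
 also have "... = f c - f (q ** c ** q)" using offdiag_commute[OF f q c(1)] q c by (simp add: op_simps pfun_diff[OF f] mem_rules)
 finally show ?thesis by simp
qed

text \<open>The chosen level projections need not be right continuous in the level, so for s >= 0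
  the projection of the half-line above s is their supremum over levels above s. The upper bound is
  therefore stated with an arbitrary \<gamma> > s.\<close>

lemma spectral_family:
 assumes f: "nfun f"
 shows "\<exists>e. psr e \<and> (\<forall>s. \<forall>x\<in>M. f ((\<I> - e {s<..}) ** x ** e {s<..}) = 0) \<and>
  (\<forall>s\<ge>0. \<forall>c\<in>M. psd c --> e {s<..} ** c ** e {s<..} = c --> ennreal s * \<tau> c <= ennreal (f c)) \<and>
  (\<forall>s\<ge>0. \<forall>c\<in>M. \<forall>\<gamma>>s. psd c --> (\<I> - e {s<..}) ** c ** (\<I> - e {s<..}) = c --> ennreal (f c) <= ennreal \<gamma> * \<tau> c)"
proof -
 note pf = nfun_pfun[OF f]
 define h where "h \<gamma> = (SOME q. hahn f \<gamma> q)" for \<gamma>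
 have h: "hahn f \<gamma> (h \<gamma>)" if "\<gamma> > 0" for \<gamma> unfolding h_def using hahn_exists[OF f that] by (rule someI_ex)
 have hM: "h \<gamma> \<in> M" "proj (h \<gamma>)" "\<tau> (h \<gamma>) < \<infinity>" "!!x. x \<in> M ==> f ((\<I> - h \<gamma>) ** x ** h \<gamma>) = 0"
  "!!c. c \<in> M ==> psd c ==> h \<gamma> ** c ** h \<gamma> = c ==> ennreal \<gamma> * \<tau> c <= ennreal (f c)"
  "!!c. c \<in> M ==> psd c ==> (\<I> - h \<gamma>) ** c ** (\<I> - h \<gamma>) = c ==> ennreal (f c) <= ennreal \<gamma> * \<tau> c"
  if "\<gamma> > 0" for \<gamma> using h[OF that] unfolding hahn_def by blast+
 have hn: "psd (h \<gamma> - h \<gamma>')" if "0 < \<gamma>" "\<gamma> < \<gamma>'" for \<gamma> \<gamma>'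
  by (rule hahn_nested[OF f h h]) (use that in auto)
 define c where "c s n = h (s + 1 / (real n + 1))" for s and n :: nat
 have cp: "0 < s + 1 / (real n + 1)" if "0 <= s" for s and n :: nat using that by (simp add: add_nonneg_pos)
 have "\<exists>t\<in>M. proj t \<and> form_sup (range (c s)) t \<and> wlim sequentially (c s) t" if s: "0 <= s" for s
 proof (rule proj_seq_sup)
  show "c s n \<in> M" "proj (c s n)" for n using hM(1,2)[OF cp[OF s, of n]] by (auto simp: c_def)
  show "psd (c s (Suc n) - c s n)" for n unfolding c_def using cp[OF s, of "Suc n"]
   by (intro hn add_strict_left_mono divide_strict_left_mono) auto
 qed
 then obtain Q where Q: "!!s. 0 <= s ==> Q s \<in> M \<and> proj (Q s) \<and> form_sup (range (c s)) (Q s) \<and> wlim sequentially (c s) (Q s)"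
  by metis
 define P where "P s = (if s < 0 then \<I> else Q s)" for s
 have P: "P s \<in> M" "proj (P s)" for s using Q[of s] by (auto simp: P_def)
 have Pf: "form_sup (range (c s)) (P s)" "wlim sequentially (c s) (P s)" if "0 <= s" for s using Q[OF that] that by (auto simp: P_def)
 have hP: "psd (P s - h \<gamma>)" if s\<gamma>: "0 <= s" "s < \<gamma>" for s \<gamma>
 proof -
  obtain n where "inverse (real (Suc n)) < \<gamma> - s" using reals_Archimedean[of "\<gamma> - s"] s\<gamma>(2) by auto
  then have n: "s + 1 / (real n + 1) < \<gamma>" by (simp add: inverse_eq_divide add.commute)
  have "psd (c s n - h \<gamma>)" unfolding c_def by (rule hn[OF cp[OF s\<gamma>(1)] n])
  moreover have "psd (P s - c s n)" using Pf(1)[OF s\<gamma>(1)] by (auto simp: form_sup_def)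
  ultimately show ?thesis using psd_diff_trans by blast
 qed
 have Ph: "psd (h \<gamma> - P s)" if "0 < \<gamma>" "\<gamma> <= s" for s \<gamma>
 proof -
  have s: "0 <= s" using that by simp
  show ?thesis
  proof (rule form_sup_le[OF Pf(1)[OF s]])
   show "c s 0 \<in> range (c s)" by simp
   fix x assume "x \<in> range (c s)"
   then obtain n where n: "x = c s n" by blast
   have "\<gamma> < s + 1 / (real n + 1)" using that by (simp add: add_le_less_mono[of \<gamma> s 0, simplified])
   then show "psd (h \<gamma> - x)" unfolding n c_def by (intro hn that)
  qed
 qed
 have mono: "psd (P s - P t)" if st: "s <= t" for s t
 proof -
  consider "s = t" | "s < 0" | "0 <= s" "s < t" using st by linarith
  then show ?thesis
  proof cases
   case 2
   then show ?thesis using proj_le_id[OF P(2)[of t]] by (simp add: P_def[of s])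
  next
   case 3
   then have "psd (P s - h t)" "psd (h t - P t)" by (auto intro!: hP Ph)
   then show ?thesis using psd_diff_trans by blast
  qed simp
 qed
 have rc: "\<exists>t>s. inner u (P s u) - d < inner u (P t u)" if d: "d > 0" for s u d
 proof (cases "s < 0")
  case True
  then have "P (s / 2) = P s" by (simp add: P_def)
  then show ?thesis using True d by (intro exI[of _ "s / 2"]) auto
 next
  case False
  then have s: "0 <= s" by simp
  obtain n where n: "inner u (P s u) - d < inner u (c s n u)" using Pf(1)[OF s] d unfolding form_sup_def by blast
  obtain t where t': "s < t" "t < s + 1 / (real n + 1)" using dense[of s "s + 1 / (real n + 1)"] by auto
  then have t: "s < t" "0 <= t" "t < s + 1 / (real n + 1)" using s by auto
  have "psd (P t - c s n)" unfolding c_def by (rule hP[OF t(2,3)])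
  then have "inner u (c s n u) <= inner u (P t u)" by (auto simp: psd_def bilinear_simps)
  then show ?thesis using n t by (intro exI[of _ t]) auto
 qed
 \<comment> \<open>A positive operator below all P s has trace at most f 1 / n for every n, by the
   lower bound at level n, and \<tau> is faithful.\<close>
 have top: "\<exists>s. inner u (P s u) < d" if d: "d > 0" for u d
 proof -
  define b where "b n = \<I> - P (real (Suc n))" for n
  have "\<exists>t\<in>M. form_sup (range b) t \<and> wlim sequentially b t"
  proof (rule mono_seq_form_sup[where k = 1])
   show "b n \<in> M" "psd (b n)" for n using P proj_le_id[OF P(2)] by (auto simp: b_def mem_rules)
   show "psd (b (Suc n) - b n)" for n using mono[of "real (Suc n)" "real (Suc (Suc n))"] by (simp add: b_def)
   show "psd (1 *\<^sub>R \<I> - b n)" for n using proj_psd[OF P(2)] by (simp add: b_def)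
  qed simp
  then obtain t where t: "t \<in> M" "form_sup (range b) t" "wlim sequentially b t" by blast
  have tp: "psd (\<I> - t)" by (rule form_sup_le[OF t(2) _ rangeI]) (use proj_psd[OF P(2)] in \<open>auto simp: b_def\<close>)
  have small: "\<tau> (\<I> - t) <= ennreal (f \<I> / real (Suc n))" for n
  proof -
   let ?\<gamma> = "real (Suc n)"
   have g: "?\<gamma> > 0" by simp
   note H = hM[OF g]
   have "psd (t - b n)" using t(2) by (auto simp: form_sup_def)
   then have "psd (P ?\<gamma> - (\<I> - t))" by (simp add: b_def algebra_simps)
   then have le: "psd (h ?\<gamma> - (\<I> - t))" using Ph[of ?\<gamma> ?\<gamma>] psd_diff_trans by simp
   have "f (h ?\<gamma>) <= f \<I>" using H by (intro pfun_mono[OF pf]) (auto simp: proj_le_id)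
   have "ennreal ?\<gamma> * \<tau> (\<I> - t) <= ennreal ?\<gamma> * \<tau> (h ?\<gamma>)"
    by (intro mult_left_mono tau_mono diff_mem id_mem t(1) tp H(1) le) simp
   also have "... <= ennreal (f (h ?\<gamma>))" by (rule H(5)[OF H(1) proj_psd[OF H(2)]]) (simp only: proj_simps[OF H(2)])
   also have "... <= ennreal (f \<I>)" by (intro ennreal_leI) fact
   finally have "ennreal (1 / ?\<gamma>) * (ennreal ?\<gamma> * \<tau> (\<I> - t)) <= ennreal (1 / ?\<gamma>) * ennreal (f \<I>)"
    by (rule mult_left_mono) simp
   moreover have "ennreal (1 / ?\<gamma>) * (ennreal ?\<gamma> * \<tau> (\<I> - t)) = \<tau> (\<I> - t)"
   proof -
    have "ennreal (1 / r) * (ennreal r * T) = T" if "r > 0" for r :: real and T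
    proof -
     have "ennreal (1 / r) * ennreal r = 1" using that by (simp flip: ennreal_mult)
     then show ?thesis by (simp flip: mult.assoc)
    qed
    from this[OF g] show ?thesis .
   qed
   moreover have "ennreal (1 / ?\<gamma>) * ennreal (f \<I>) = ennreal (f \<I> / ?\<gamma>)"
    using ennreal_mult[of "1 / ?\<gamma>" "f \<I>"] pfun_nonneg[OF pf id_mem psd_id] by simp
   ultimately show ?thesis by simp
  qed
  have "(\<lambda>n. ennreal (f \<I> / real (Suc n))) \<longlonglongrightarrow> ennreal 0"
   by (intro tendsto_ennrealI LIMSEQ_Suc lim_const_over_n)
  then have "\<tau> (\<I> - t) <= ennreal 0" by (rule LIMSEQ_le_const) (use small in auto)
  then have "\<I> - t = 0" using tp t by (intro tau_faithful) (auto simp: mem_rules)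
  then have "wlim sequentially b \<I>" using t(3) by simp
  from wlim_diff[OF wlim_const[of _ \<I>] this]
  have "wlim sequentially (\<lambda>n. P (real (Suc n))) 0" by (simp add: b_def)
  from order_tendstoD(2)[OF wlimD[OF this, of u u], of d] d
  have "\<forall>\<^sub>F n in sequentially. inner u (P (real (Suc n)) u) < d" by simp
  then show ?thesis using eventually_happens'[OF sequentially_bot] by blast
 qed
 have "\<exists>e. psr e \<and> (\<forall>s. e {s<..} = P s)" by (rule spectral_measure_exists[OF P mono rc _ top]) (auto simp: P_def)
 then obtain e where e: "psr e" "!!s. e {s<..} = P s" by blast
 have off: "f ((\<I> - P s) ** x ** P s) = 0" if x: "x \<in> M" for s x
 proof (cases "s < 0")
  case True
  then show ?thesis by (simp add: P_def op_simps pfun_zero[OF pf])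
 next
  case False
  then have s: "0 <= s" by simp
  have H: "c s n \<in> M" "proj (c s n)" "!!x. x \<in> M ==> f ((\<I> - c s n) ** x ** c s n) = 0" for n
   using hM[OF cp[OF s, of n]] by (auto simp: c_def)
  have Pc: "P s ** c s n = c s n" for n using Pf(1)[OF s] by (intro proj_le_compose H P) (auto simp: form_sup_def)
  have z: "f ((\<I> - P s) ** x ** c s n) = 0" for n
  proof -
   have "f ((\<I> - c s n) ** ((\<I> - P s) ** x) ** c s n) = 0" using H(3)[of "(\<I> - P s) ** x"] x P by (simp add: mem_rules)
   moreover have "c s n ** P s = c s n" using arg_cong[OF Pc[of n], of adj] H P by (simp add: adj_rules proj_simps)
   then have "(\<I> - c s n) ** ((\<I> - P s) ** x) ** c s n = (\<I> - P s) ** x ** c s n"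
    by (simp add: op_simps op_simps(1)[symmetric, of "c s n" "P s"])
   ultimately show ?thesis by simp
  qed
  have "(\<lambda>n. f ((\<I> - P s) ** x ** c s n)) \<longlonglongrightarrow> f ((\<I> - P s) ** x ** P s)"
  proof (rule nfun_wcont[OF f sequentially_bot])
   show "(\<I> - P s) ** x ** c s n \<in> M" for n using x P H by (simp add: mem_rules)
   show "norm ((\<I> - P s) ** x ** c s n) <= norm ((\<I> - P s) ** x) * 1" for n
    by (intro order_trans[OF norm_blinfun_compose] mult_left_mono proj_norm H) auto
   show "wlim sequentially (\<lambda>n. (\<I> - P s) ** x ** c s n) ((\<I> - P s) ** x ** P s)" by (intro wlim_compose_left Pf s)
  qed
  then show ?thesis unfolding z using LIMSEQ_unique tendsto_const by metis
 qed
 have low: "ennreal s * \<tau> k <= ennreal (f k)" if s: "0 <= s" and k: "k \<in> M" "psd k" "P s ** k ** P s = k" for s k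
 proof -
  note g = root_op[OF k(1,2)]
  have H: "c s n \<in> M" "proj (c s n)" "!!x. x \<in> M ==> f ((\<I> - c s n) ** x ** c s n) = 0" for n
   using hM[OF cp[OF s, of n]] by (auto simp: c_def)
  have "\<tau> k = \<tau> (root_op k ** P s ** root_op k)" using tau_proj_swap[OF P(2,1) k(1,2), of s] k(3) by simp
  also have "... = (SUP n. \<tau> (root_op k ** c s n ** root_op k))"
  proof (rule tau_seq_sup)
   show "wlim sequentially (\<lambda>n. root_op k ** c s n ** root_op k) (root_op k ** P s ** root_op k)"
    by (intro wlim_compose_left wlim_compose_right Pf s)
   show "psd (root_op k ** c s (Suc n) ** root_op k - root_op k ** c s n ** root_op k)" for n
    using psd_root_conj[OF k(1,2), of "c s (Suc n) - c s n"] hn[OF cp[OF s, of "Suc n"], of "s + 1 / (real n + 1)"]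
    by (simp add: c_def op_simps frac_less2)
  qed (use g P H k psd_root_conj[OF k(1,2) proj_psd[OF H(2)]] in \<open>auto simp: mem_rules\<close>)
  also have "... = (SUP n. \<tau> (c s n ** k ** c s n))" using tau_proj_swap[OF H(2,1) k(1,2)] by simp
  finally have "ennreal s * \<tau> k = (SUP n. ennreal s * \<tau> (c s n ** k ** c s n))" by (simp add: SUP_mult_left_ennreal)
  also have "... <= ennreal (f k)"
  proof (rule SUP_least)
   fix n
   have "ennreal s * \<tau> (c s n ** k ** c s n) <= ennreal (s + 1 / (real n + 1)) * \<tau> (c s n ** k ** c s n)"
    by (intro mult_right_mono ennreal_leI) auto
   also have "... <= ennreal (f (c s n ** k ** c s n))" unfolding c_def
   proof (rule hM(5)[OF cp[OF s]])
    show "h (s + 1 / (real n + 1)) ** k ** h (s + 1 / (real n + 1)) \<in> M"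
     "psd (h (s + 1 / (real n + 1)) ** k ** h (s + 1 / (real n + 1)))"
     using H(1)[of n] k psd_conj_sa[OF proj_simps(1)[OF H(2)[of n]] k(2)] by (auto simp: c_def mem_rules)
    show "h (s + 1 / (real n + 1)) ** (h (s + 1 / (real n + 1)) ** k ** h (s + 1 / (real n + 1))) ** h (s + 1 / (real n + 1))
     = h (s + 1 / (real n + 1)) ** k ** h (s + 1 / (real n + 1))" using H(2)[of n] by (simp add: c_def op_simps proj_idem proj_simps)
   qed
   also have "... <= ennreal (f k)" by (intro ennreal_leI hahn_compress_le[OF pf H k(1,2)])
   finally show "ennreal s * \<tau> (c s n ** k ** c s n) <= ennreal (f k)" .
  qed
  finally show ?thesis .
 qed
 \<comment> \<open>Since h \<gamma> lies below P s, the complement of P s lies below that of h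
   \<gamma>.\<close>
 have up: "ennreal (f k) <= ennreal \<gamma> * \<tau> k"
  if s: "0 <= s" "s < \<gamma>" and k: "k \<in> M" "psd k" "(\<I> - P s) ** k ** (\<I> - P s) = k" for s \<gamma> k
 proof -
  have g: "0 < \<gamma>" using s by simp
  note H = hM[OF g]
  have 1: "P s ** h \<gamma> = h \<gamma>" "h \<gamma> ** P s = h \<gamma>" using proj_le_compose[OF H(2) P(2) hP[OF s]] by auto
  have 2: "(\<I> - h \<gamma>) ** (\<I> - P s) = \<I> - P s" "(\<I> - P s) ** (\<I> - h \<gamma>) = \<I> - P s"
   using 1 by (simp_all add: op_simps)
  have "(\<I> - h \<gamma>) ** k ** (\<I> - h \<gamma>) = (\<I> - h \<gamma>) ** ((\<I> - P s) ** k ** (\<I> - P s)) ** (\<I> - h \<gamma>)" by (simp only: k(3))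
  also have "... = ((\<I> - h \<gamma>) ** (\<I> - P s)) ** k ** ((\<I> - P s) ** (\<I> - h \<gamma>))" by (simp only: op_simps(1))
  also have "... = k" by (simp only: 2 k(3))
  finally show ?thesis using H(6) k by blast
 qed
 show ?thesis using e off low up by (intro exI[of _ e]) auto
qed

text \<open>Cauchy-Schwarz with f (1 - p) = 0 removes every term with a factor 1 - p.\<close>

lemma support_eq:
 assumes f: "pfun f" and p: "proj p" "p \<in> M" "f (\<I> - p) = 0" and x: "x \<in> M"
 shows "f (p ** x) = f x" "f (x ** p) = f x" "f (p ** x ** p) = f x"
proof -
 have left: "f (p ** x) = f x" if x: "x \<in> M" for x
 proof -
  have "(f (adj (\<I> - p) ** x))\<^sup>2 <= f (adj (\<I> - p) ** (\<I> - p)) * f (adj x ** x)"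
   using p x by (intro pfun_cauchy_schwarz f) (auto simp: mem_rules)
  moreover have "adj (\<I> - p) = \<I> - p" "(\<I> - p) ** (\<I> - p) = \<I> - p" using proj_simps[OF proj_compl[OF p(1)]] by auto
  ultimately have "f ((\<I> - p) ** x) = 0" using p(3) by simp
  then show ?thesis using p x by (simp add: op_simps pfun_diff[OF f] mem_rules)
 qed
 have right: "f (x ** p) = f x" if x: "x \<in> M" for x
  using left[of "adj x"] pfun_adj[OF f, of "p ** adj x"] pfun_adj[OF f x] p x by (simp add: adj_rules proj_simps mem_rules)
 show "f (p ** x) = f x" "f (x ** p) = f x" "f (p ** x ** p) = f x"
  using left[OF x] right[OF x] right[of "p ** x"] p x by (simp_all add: mem_rules)
qed

lemma commute_compress:
 assumes e: "psr e" "A \<in> sets borel" and c: "\<forall>x\<in>M. f (e A ** x) = f (x ** e A)" and x: "x \<in> M"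
 shows "f (e A ** x ** e A) = f (e A ** x)"
proof -
 have "f (e A ** (x ** e A)) = f ((x ** e A) ** e A)" using c x psr_mem[OF e] by (simp add: mem_rules)
 also have "(x ** e A) ** e A = x ** e A" using psr_proj[OF e] by (simp add: op_simps proj_simps)
 also have "f (x ** e A) = f (e A ** x)" using c x by simp
 finally show ?thesis by (simp add: op_simps)
qed

lemma nfun_psr_sums:
 assumes f: "nfun f" and e: "psr e" and A: "range A \<subseteq> sets borel" "disjoint_family A" and x: "x \<in> M"
 shows "(\<lambda>k. f (e (A k) ** x)) sums f (e (\<Union>k. A k) ** x)"
proof -
 have Ak: "A k \<in> sets borel" for k using A by auto
 then have U: "(\<Union>k<n. A k) \<in> sets borel" "(\<Union>k. A k) \<in> sets borel" for n by auto
 have "(\<lambda>n. f (e (\<Union>k<n. A k) ** x)) \<longlonglongrightarrow> f (e (\<Union>k. A k) ** x)"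
 proof (rule nfun_wcont[OF f sequentially_bot])
  show "norm (e (\<Union>k<n. A k) ** x) <= 1 * norm x" for n
   by (intro order_trans[OF norm_blinfun_compose] mult_right_mono psr_norm[OF e] U) auto
 qed (use x U psr_mem[OF e] in \<open>auto simp: mem_rules intro!: wlim_compose_right psr_wlim[OF e A]\<close>)
 moreover have "f (e (\<Union>k<n. A k) ** x) = (\<Sum>k<n. f (e (A k) ** x))" for n using A x Ak psr_mem[OF e]
  by (subst psr_finite_UN[OF e]) (auto simp: op_sum pfun_sum[OF nfun_pfun[OF f]] mem_rules intro: disjoint_family_on_mono)
 ultimately show ?thesis by (simp add: sums_def)
qed

text \<open>On a cell, the value of f and the integral of t over the cell agree up to a power of
  \<theta>. The projections of cells commute with f, so both sides add up over the cells, and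
  \<theta> -> 1 closes the gap.\<close>

theorem density_exists:
 assumes f: "nfun f"
 shows "\<exists>e. has_density e f"
proof -
 note pf = nfun_pfun[OF f]
 obtain e where e: "psr e"
  and off': "\<forall>s. \<forall>x\<in>M. f ((\<I> - e {s<..}) ** x ** e {s<..}) = 0"
  and low': "\<forall>s\<ge>0. \<forall>c\<in>M. psd c --> e {s<..} ** c ** e {s<..} = c --> ennreal s * \<tau> c <= ennreal (f c)"
  and up': "\<forall>s\<ge>0. \<forall>c\<in>M. \<forall>\<gamma>>s. psd c --> (\<I> - e {s<..}) ** c ** (\<I> - e {s<..}) = c --> ennreal (f c) <= ennreal \<gamma> * \<tau> c"
  using spectral_family[OF f] by (elim exE conjE)
 have off: "f ((\<I> - e {s<..}) ** x ** e {s<..}) = 0" if "x \<in> M" for s x using off' that by simp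
 have low: "ennreal s * \<tau> c <= ennreal (f c)" if "s \<ge> 0" "c \<in> M" "psd c" "e {s<..} ** c ** e {s<..} = c" for s c
  using low' that by simp
 have up: "ennreal (f c) <= ennreal \<gamma> * \<tau> c"
  if "s \<ge> 0" "c \<in> M" "\<gamma> > s" "psd c" "(\<I> - e {s<..}) ** c ** (\<I> - e {s<..}) = c" for s c \<gamma>
  using up' that by simp
 have com: "f (e (geo \<theta> k) ** y) = f (y ** e (geo \<theta> k))" if y: "y \<in> M" and \<theta>: "\<theta> > 1" for \<theta> k y
 proof -
  define a b where "a = \<theta> powr real_of_int k" and "b = \<theta> powr (real_of_int k + 1)"
  have "a < b" using \<theta> by (simp add: a_def b_def powr_add)
  then have "geo \<theta> k \<union> {b<..} = {a<..}" "geo \<theta> k \<inter> {b<..} = {}" by (auto simp: geo_def simp flip: a_def b_def)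
  then have "e (geo \<theta> k) = e {a<..} - e {b<..}" using psr_Un[OF e, of "geo \<theta> k" "{b<..}"] by simp
  moreover have "f (e {s<..} ** y) = f (y ** e {s<..})" for s
   using offdiag_commute[OF pf psr_mem[OF e, of "{s<..}"] psr_proj[OF e, of "{s<..}"] off y] by simp
  ultimately show ?thesis using psr_mem[OF e] y by (simp add: op_simps pfun_diff[OF pf] mem_rules)
 qed
 \<comment> \<open>The choice \<theta> = 1 + d / (s + 1) gives \<theta> s <= s + d.\<close>
 have limit: "r <= s" if "0 <= s" "!!\<theta>. \<theta> > 1 ==> r <= \<theta> * s" for r s :: real
 proof (rule field_le_epsilon)
  fix d :: real assume "d > 0"
  then have "1 + d / (s + 1) > 1" using that(1) by simp
  from that(2)[OF this] have "r <= s + d * (s / (s + 1))" by (simp add: algebra_simps)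
  also have "d * (s / (s + 1)) <= d * 1" using \<open>d > 0\<close> that(1) by (intro mult_left_mono) auto
  finally show "r <= s + d" by simp
 qed
 have sub: "e B ** c ** e B = c" if "e A ** c ** e A = c" "A \<subseteq> B" "A \<in> sets borel" "B \<in> sets borel" for A B c
 proof -
  have AB: "e B ** e A = e A" "e A ** e B = e A"
   using psr_Int[OF e that(3,4)] psr_Int[OF e that(4,3)] that(2) by (simp_all add: Int_absorb1 Int_absorb2)
  have "e B ** (e A ** c ** e A) ** e B = (e B ** e A) ** c ** (e A ** e B)" by (simp only: op_simps(1))
  then show ?thesis by (simp only: AB that(1))
 qed
 have cmp: "\<I> - e {s<..} = e {..s}" for s using psr_Compl[OF e, of "{s<..}"] by (simp add: Compl_greaterThan)
 \<comment> \<open>An element y of finite trace below the kernel projection satisfies f y <=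
   \<gamma> \<tau> y for all \<gamma> > 0; semi-finiteness covers the rest.\<close>
 have e0: "f (e {..0}) = 0"
 proof (rule nfun_zero_semifinite[OF f])
  show "e {..0} \<in> M" "psd (e {..0})" using psr_mem[OF e] psr_psd[OF e] by auto
  fix y assume y: "y \<in> M" "psd y" "psd (e {..0} - y)" "\<tau> y < \<infinity>"
  have ye: "y ** (\<I> - e {..0}) = 0" by (rule psd_le_zero[where r = 1 and p = "e {..0}"])
    (use y psr_proj[OF e, of "{..0}"] in \<open>auto simp: op_simps proj_simps\<close>)
  then have ye1: "y ** e {..0} = y" by (simp add: op_simps)
  have ye2: "e {..0} ** y = y" using arg_cong[OF ye1, of adj] psd_sa[OF y(2)] psr_proj[OF e, of "{..0}"] by (simp add: adj_rules proj_simps)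
  have le\<gamma>: "ennreal (f y) <= ennreal \<gamma> * \<tau> y" if "\<gamma> > 0" for \<gamma>
   by (rule up[of 0]) (use y that ye1 ye2 in \<open>auto simp: cmp op_simps\<close>)
  have le: "f y <= \<gamma> * enn2real (\<tau> y)" if "\<gamma> > 0" for \<gamma>
  proof -
   have "ennreal (f y) <= ennreal (\<gamma> * enn2real (\<tau> y))"
    using le\<gamma>[OF that] that ennreal_mult_enn2real[OF y(4), of \<gamma>] by simp
   then show ?thesis using that by (simp add: ennreal_le_iff)
  qed
  have "f y <= 0"
  proof (rule field_le_epsilon)
   fix d :: real assume "d > 0"
   have "d / (enn2real (\<tau> y) + 1) > 0" using \<open>d > 0\<close> by (simp add: add_nonneg_pos)
   from le[OF this] have "f y <= d * (enn2real (\<tau> y) / (enn2real (\<tau> y) + 1))" by simp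
   also have "... <= d * 1" using \<open>d > 0\<close> by (intro mult_left_mono) (auto simp: add_nonneg_pos)
   finally show "f y <= 0 + d" by simp
  qed
  then show "f y = 0" using pfun_nonneg[OF pf y(1,2)] by simp
 qed
 have main: "(\<integral>\<^sup>+ t. ennreal t \<partial>spec_measure e x) = ennreal (f x)" if x: "x \<in> M" "psd x" for x
 proof -
  define \<phi> where "\<phi> A = f (e A ** x ** e A)" for A
  define \<mu> where "\<mu> = spec_measure e x"
  define \<nu> where "\<nu> A = (\<integral>\<^sup>+ t. ennreal t * indicator A t \<partial>\<mu>)" for A
  have [measurable_cong]: "sets \<mu> = sets borel" by (simp add: \<mu>_def)
  have em: "emeasure \<mu> A = \<tau> (e A ** x ** e A)" if "A \<in> sets borel" for A
   using emeasure_spec_measure[OF e x that] by (simp add: \<mu>_def)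
  have xA: "e A ** x ** e A \<in> M" "psd (e A ** x ** e A)" "e A ** (e A ** x ** e A) ** e A = e A ** x ** e A"
   if "A \<in> sets borel" for A using psr_mem[OF e that] psr_proj[OF e that] x psd_conj_sa[OF proj_simps(1)[OF psr_proj[OF e that]] x(2)]
   by (auto simp: mem_rules op_simps proj_simps proj_idem)
  have \<phi>0: "0 <= \<phi> A" if "A \<in> sets borel" for A using xA[OF that] pfun_nonneg[OF pf] by (simp add: \<phi>_def)
  have piece: "\<nu> (geo \<theta> k) <= ennreal (\<theta> * \<phi> (geo \<theta> k))" "ennreal (\<phi> (geo \<theta> k)) <= ennreal (\<theta>\<^sup>2) * \<nu> (geo \<theta> k)"
   if \<theta>: "\<theta> > 1" for \<theta> k
  proof -
   define a b where "a = \<theta> powr real_of_int k" and "b = \<theta> powr (real_of_int k + 1)"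
   define A where "A = geo \<theta> k"
   have ab: "0 < a" "b = \<theta> * a" "a < b" using \<theta> by (auto simp: a_def b_def powr_add)
   have A: "A \<in> sets borel" "A = {a<..b}" by (auto simp: A_def geo_def a_def b_def)
   have l1: "ennreal a * emeasure \<mu> A <= ennreal (\<phi> A)" unfolding em[OF A(1)] \<phi>_def
    by (rule low) (use ab xA[OF A(1)] A in \<open>auto intro!: sub[where A = A]\<close>)
   have l2: "ennreal (\<phi> A) <= ennreal (\<theta> * b) * emeasure \<mu> A" unfolding em[OF A(1)] \<phi>_def
    by (rule up[of b]) (use \<theta> ab xA[OF A(1)] A in \<open>auto simp: cmp intro!: sub[where A = A]\<close>)
   have l3: "\<nu> A <= ennreal b * emeasure \<mu> A"
   proof -
    have "\<nu> A <= (\<integral>\<^sup>+ t. ennreal b * indicator A t \<partial>\<mu>)"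
     unfolding \<nu>_def by (intro nn_integral_mono) (auto simp: A(2) split: split_indicator intro!: ennreal_leI)
    then show ?thesis using A(1) by (simp add: nn_integral_cmult_indicator)
   qed
   have l4: "ennreal a * emeasure \<mu> A <= \<nu> A"
   proof -
    have "(\<integral>\<^sup>+ t. ennreal a * indicator A t \<partial>\<mu>) <= \<nu> A"
     unfolding \<nu>_def by (intro nn_integral_mono) (auto simp: A(2) split: split_indicator intro!: ennreal_leI)
    then show ?thesis using A(1) by (simp add: nn_integral_cmult_indicator)
   qed
   have bm: "ennreal b * emeasure \<mu> A = ennreal \<theta> * (ennreal a * emeasure \<mu> A)"
    "ennreal (\<theta> * b) * emeasure \<mu> A = ennreal (\<theta>\<^sup>2) * (ennreal a * emeasure \<mu> A)"
    using ab \<theta> by (simp_all add: ennreal_mult mult.assoc power2_eq_square)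
   have "ennreal (\<theta> * \<phi> A) = ennreal \<theta> * ennreal (\<phi> A)" using \<theta> \<phi>0[OF A(1)] by (simp add: ennreal_mult)
   then show "\<nu> (geo \<theta> k) <= ennreal (\<theta> * \<phi> (geo \<theta> k))"
    using order_trans[OF l3[unfolded bm(1)] mult_left_mono[OF l1]] by (simp add: A_def)
   show "ennreal (\<phi> (geo \<theta> k)) <= ennreal (\<theta>\<^sup>2) * \<nu> (geo \<theta> k)"
    using order_trans[OF l2[unfolded bm(2)] mult_left_mono[OF l4]] by (simp add: A_def)
  qed
  have total: "\<nu> {0<..} = (\<integral>\<^sup>+ t. ennreal t \<partial>\<mu>)"
   unfolding \<nu>_def by (intro nn_integral_cong) (auto split: split_indicator simp: ennreal_neg)
  have sum\<nu>: "(\<Sum>n. \<nu> (geo \<theta> (int_decode n))) = \<nu> {0<..}" if \<theta>: "\<theta> > 1" for \<theta>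
  proof -
   have "(\<Sum>n. \<nu> (geo \<theta> (int_decode n))) = (\<integral>\<^sup>+ t. (\<Sum>n. ennreal t * indicator (geo \<theta> (int_decode n)) t) \<partial>\<mu>)"
   proof -
    have [measurable]: "geo \<theta> k \<in> sets borel" for k by simp
    show ?thesis unfolding \<nu>_def by (rule nn_integral_suminf[symmetric]) measurable
   qed
   also have "... = \<nu> {0<..}" unfolding \<nu>_def
    by (intro nn_integral_cong) (simp add: suminf_indicator[OF geo_disjoint_family[OF \<theta>]] geo_UN[OF \<theta>])
   finally show ?thesis .
  qed
  have sum\<phi>: "(\<lambda>n. \<phi> (geo \<theta> (int_decode n))) sums f x" if \<theta>: "\<theta> > 1" for \<theta>
  proof -
   have "range (\<lambda>n. geo \<theta> (int_decode n)) \<subseteq> sets borel" using geo_borel by blast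
   from nfun_psr_sums[OF f e this geo_disjoint_family[OF \<theta>] x(1)] have "(\<lambda>n. \<phi> (geo \<theta> (int_decode n))) sums f (e {0<..} ** x)"
    using com[OF _ \<theta>] by (simp add: geo_UN[OF \<theta>] \<phi>_def commute_compress[OF e _ _ x(1)])
   then show ?thesis using support_eq(1)[OF pf psr_proj[OF e] psr_mem[OF e] _ x(1), of "{0<..}"] by (simp add: cmp e0)
  qed
  have fx: "0 <= f x" using pfun_nonneg[OF pf x] .
  have S: "(\<Sum>n. ennreal (c * \<phi> (geo \<theta> (int_decode n)))) = ennreal (c * f x)" if "\<theta> > 1" "0 <= c" for \<theta> c
   using sums_mult[OF sum\<phi>[OF that(1)], of c] that \<phi>0 by (intro sums_unique[symmetric] sums_ennreal[THEN iffD2]) (auto simp: fx)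
  have le1: "\<nu> {0<..} <= ennreal (\<theta> * f x)" if \<theta>: "\<theta> > 1" for \<theta>
   unfolding sum\<nu>[OF \<theta>, symmetric] using S[OF \<theta>, of \<theta>, symmetric] \<theta> piece(1)[OF \<theta>] by (auto intro!: suminf_le)
  have le2: "ennreal (f x) <= ennreal (\<theta>\<^sup>2) * \<nu> {0<..}" if \<theta>: "\<theta> > 1" for \<theta>
  proof -
   have "ennreal (f x) = (\<Sum>n. ennreal (\<phi> (geo \<theta> (int_decode n))))" using S[OF \<theta>, of 1] by simp
   also have "... <= (\<Sum>n. ennreal (\<theta>\<^sup>2) * \<nu> (geo \<theta> (int_decode n)))"
    by (intro suminf_le piece(2)[OF \<theta>]) auto
   also have "... = ennreal (\<theta>\<^sup>2) * \<nu> {0<..}" by (simp add: sum\<nu>[OF \<theta>])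
   finally show ?thesis .
  qed
  obtain r where r: "\<nu> {0<..} = ennreal r" "0 <= r" using le1[of 2] by (cases "\<nu> {0<..}") (auto simp: top_unique)
  have "r <= f x"
  proof (rule limit[OF fx])
   fix \<theta> :: real assume "\<theta> > 1"
   then show "r <= \<theta> * f x" using le1[of \<theta>] r fx by (simp add: ennreal_le_iff)
  qed
  moreover have "f x <= r"
  proof (rule limit[OF r(2)])
   fix \<theta> :: real assume "\<theta> > 1"
   \<comment> \<open>The square root absorbs the square in \<open>le2\<close>.\<close>
   then show "f x <= \<theta> * r" using le2[of "sqrt \<theta>"] r by (simp add: ennreal_le_iff flip: ennreal_mult)
  qed
  ultimately show ?thesis using r total by (simp add: \<mu>_def)
 qed
 then show ?thesis using e by (auto simp: has_density_def)
qed

subsection \<open>Properties of densities\<close>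

lemma spec_measure_restrict:
 assumes e: "psr e" and x: "x \<in> M" "psd x" and A: "A \<in> sets borel"
 shows "(\<integral>\<^sup>+ t. ennreal t \<partial>spec_measure e (e A ** x ** e A)) = (\<integral>\<^sup>+ t. ennreal t * indicator A t \<partial>spec_measure e x)"
proof -
 have p: "proj (e A)" "e A \<in> M" using psr_proj[OF e A] psr_mem[OF e A] by auto
 have "spec_measure e (e A ** x ** e A) = density (spec_measure e x) (indicator A)"
 proof (rule measure_eqI)
  fix B assume "B \<in> sets (spec_measure e (e A ** x ** e A))"
  then have B: "B \<in> sets borel" by simp
  have "e B ** (e A ** x ** e A) ** e B = (e B ** e A) ** x ** (e A ** e B)" by (simp only: op_simps(1))
  also have "... = e (A \<inter> B) ** x ** e (A \<inter> B)" using psr_Int[OF e A B] psr_Int[OF e B A] by (simp add: Int_commute)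
  finally show "emeasure (spec_measure e (e A ** x ** e A)) B =
    emeasure (density (spec_measure e x) (indicator A)) B" using A B x p psd_conj_sa[OF proj_simps(1)[OF p(1)] x(2)]
   by (simp add: emeasure_spec_measure[OF e] mem_rules emeasure_density indicator_inter_arith[symmetric])
 qed simp
 then show ?thesis using A by (simp add: nn_integral_density mult.commute)
qed

lemma density_psr: "has_density e f ==> psr e" by (simp add: has_density_def)

text \<open>Proved for every density, as \<open>density_of\<close> is an unspecified choice. The
  integral splits over A and its complement, so f sees only the diagonal blocks of positive
  elements; the positive element \<open>adj w ** w\<close> with w = p + z (1 - p) then isolates the
  off-diagonal value f (p z (1 - p)).\<close>

lemma density_commute:
 assumes d: "has_density e f" and f: "pfun f" and A: "A \<in> sets borel" and x: "x \<in> M"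
 shows "f (e A ** x) = f (x ** e A)"
proof -
 note e = density_psr[OF d]
 define p where "p = e A"
 have p: "proj p" "p \<in> M" using psr_proj[OF e A] psr_mem[OF e A] by (auto simp: p_def)
 have q: "e (- A) = \<I> - p" "- A \<in> sets borel" using psr_Compl[OF e A] A by (auto simp: p_def borel_comp)
 have diag: "f y = f (p ** y ** p) + f ((\<I> - p) ** y ** (\<I> - p))" if y: "y \<in> M" "psd y" for y
 proof -
  have P: "p ** y ** p \<in> M" "psd (p ** y ** p)" "(\<I> - p) ** y ** (\<I> - p) \<in> M" "psd ((\<I> - p) ** y ** (\<I> - p))"
   using p y psd_conj_sa proj_simps(1) proj_compl by (auto simp: mem_rules)
  have "ennreal (f y) = (\<integral>\<^sup>+ t. ennreal t * indicator A t + ennreal t * indicator (- A) t \<partial>spec_measure e y)"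
  proof -
   have "(\<integral>\<^sup>+ t. ennreal t \<partial>spec_measure e y) =
     (\<integral>\<^sup>+ t. ennreal t * indicator A t + ennreal t * indicator (- A) t \<partial>spec_measure e y)"
    by (intro nn_integral_cong) (auto split: split_indicator)
   then show ?thesis using d y by (simp add: has_density_def)
  qed
  also have "... = (\<integral>\<^sup>+ t. ennreal t * indicator A t \<partial>spec_measure e y) + (\<integral>\<^sup>+ t. ennreal t * indicator (- A) t \<partial>spec_measure e y)"
   using A q(2) by (intro nn_integral_add) simp_all
  also have "... = ennreal (f (p ** y ** p)) + ennreal (f ((\<I> - p) ** y ** (\<I> - p)))"
   using spec_measure_restrict[OF e y A] spec_measure_restrict[OF e y q(2)] d P by (simp add: has_density_def q(1) flip: p_def)
  finally show ?thesis using pfun_nonneg[OF f] P y by (simp flip: ennreal_plus)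
 qed
 have off: "f (p ** z ** (\<I> - p)) = 0" if z: "z \<in> M" for z
 proof -
  define q where "q = \<I> - p"
  have qM: "q \<in> M" "proj q" "p ** q = 0" "q ** p = 0" using p by (auto simp: q_def mem_rules proj_compl op_simps proj_simps)
  define w where "w = p + z ** q"
  have w: "w \<in> M" "adj w = p + q ** adj z" using z p qM by (auto simp: w_def mem_rules adj_rules proj_simps)
  have sq: "adj w ** w = p + p ** z ** q + adj (p ** z ** q) + q ** (adj z ** z) ** q"
   unfolding w(2) w_def using p qM by (simp add: adj_rules op_simps proj_simps)
  have "p ** (adj w ** w) ** p = p" "q ** (adj w ** w) ** q = q ** (adj z ** z) ** q"
  proof -
   have wp: "w ** p = p" and wq: "w ** q = z ** q" using p qM by (simp_all add: w_def op_simps proj_simps)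
   have "adj (w ** p) ** (w ** p) = p" "adj (w ** q) ** (w ** q) = q ** (adj z ** z) ** q"
    unfolding wp wq using p qM by (simp_all add: adj_rules proj_simps op_simps)
   then show "p ** (adj w ** w) ** p = p" "q ** (adj w ** w) ** q = q ** (adj z ** z) ** q"
    using p qM by (simp_all add: adj_compose proj_simps op_simps(1))
  qed
  then have "f (adj w ** w) = f p + f (q ** (adj z ** z) ** q)"
   using diag[of "adj w ** w"] w(1) by (simp add: mem_rules psd_square flip: q_def)
  moreover have "f (adj w ** w) = f p + f (p ** z ** q) + f (p ** z ** q) + f (q ** (adj z ** z) ** q)"
   unfolding sq using p qM z by (simp add: pfun_add[OF f] pfun_adj[OF f] mem_rules del: adj_compose)
  ultimately show ?thesis by (simp add: q_def)
 qed
 have "f (p ** x) = f (p ** x ** p)" using off[OF x] p x by (simp add: op_simps pfun_diff[OF f] mem_rules)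
 moreover have "f (x ** p) = f (p ** x ** p)"
 proof -
  have "f (adj (p ** adj x ** (\<I> - p))) = 0" using off[of "adj x"] p x by (subst pfun_adj[OF f]) (auto simp: mem_rules)
  then show ?thesis using p x by (simp add: adj_rules op_simps proj_simps pfun_diff[OF f] mem_rules)
 qed
 ultimately show ?thesis by (simp add: p_def)
qed

lemma density_compress:
 assumes d: "has_density e f" and f: "pfun f" and A: "A \<in> sets borel" and x: "x \<in> M"
 shows "f (e A ** x ** e A) = f (e A ** x)" by (rule commute_compress[OF density_psr[OF d] A _ x]) (use density_commute[OF d f A] in blast)

lemma density_bounds:
 assumes d: "has_density e f" and A: "A \<in> sets borel" "A \<subseteq> {a..b}" "0 <= a"
  and c: "c \<in> M" "psd c" "e A ** c ** e A = c"
 shows "ennreal a * \<tau> c <= ennreal (f c)" "ennreal (f c) <= ennreal b * \<tau> c"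
proof -
 note e = density_psr[OF d]
 have fc: "ennreal (f c) = (\<integral>\<^sup>+ t. ennreal t * indicator A t \<partial>spec_measure e c)"
  using spec_measure_restrict[OF e c(1,2) A(1)] d c by (simp add: has_density_def)
 have em: "emeasure (spec_measure e c) A = \<tau> c" using emeasure_spec_measure[OF e c(1,2) A(1)] c(3) by simp
 have "ennreal a * \<tau> c = (\<integral>\<^sup>+ t. ennreal a * indicator A t \<partial>spec_measure e c)"
  using A by (simp add: nn_integral_cmult_indicator em)
 also have "... <= ennreal (f c)" unfolding fc using A(2) by (intro nn_integral_mono) (auto split: split_indicator intro!: ennreal_leI)
 finally show "ennreal a * \<tau> c <= ennreal (f c)" .
 have "ennreal (f c) <= (\<integral>\<^sup>+ t. ennreal b * indicator A t \<partial>spec_measure e c)"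
  unfolding fc using A(2) by (intro nn_integral_mono) (auto split: split_indicator intro!: ennreal_leI)
 also have "... = ennreal b * \<tau> c" using A by (simp add: nn_integral_cmult_indicator em)
 finally show "ennreal (f c) <= ennreal b * \<tau> c" .
qed

lemma density_nonpos:
 assumes d: "has_density e f" and f: "pfun f"
 shows "f (e {..0}) = 0"
proof -
 note e = density_psr[OF d]
 let ?p = "e {..0}"
 have p: "?p \<in> M" "psd ?p" "proj ?p" using psr_mem[OF e] psr_psd[OF e] psr_proj[OF e] by auto
 have "ennreal (f ?p) = (\<integral>\<^sup>+ t. ennreal t * indicator {..0} t \<partial>spec_measure e ?p)"
  using spec_measure_restrict[OF e p(1,2), of "{..0}"] d p by (simp add: has_density_def proj_simps)
 also have "... = (\<integral>\<^sup>+ t. 0 \<partial>spec_measure e ?p)"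
  by (intro nn_integral_cong) (auto split: split_indicator simp: ennreal_neg)
 finally show ?thesis using pfun_nonneg[OF f p(1,2)] by simp
qed

end

section \<open>From positive bimeasures to Borel measures on the plane\<close>

section \<open>Bimeasures\<close>

definition set_measure :: "(real set => real) => real measure"
 where "set_measure \<gamma> = measure_of UNIV (sets borel) (\<lambda>A. ennreal (\<gamma> A))"

lemma set_measure:
 assumes nonneg: "!!A. A \<in> sets borel ==> 0 <= \<gamma> A"
  and sums: "!!A :: nat => real set. range A \<subseteq> sets borel ==> disjoint_family A ==> (\<lambda>k. \<gamma> (A k)) sums \<gamma> (\<Union>k. A k)"
 shows "space (set_measure \<gamma>) = UNIV" "sets (set_measure \<gamma>) = sets borel"
  "A \<in> sets borel ==> emeasure (set_measure \<gamma>) A = ennreal (\<gamma> A)" "finite_measure (set_measure \<gamma>)"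
proof -
 show s: "space (set_measure \<gamma>) = UNIV" "sets (set_measure \<gamma>) = sets borel"
  by (auto simp: set_measure_def space_measure_of_conv sets_measure_of_conv sets.sigma_sets_eq[of borel, simplified])
 have "(\<lambda>k :: nat. \<gamma> {}) sums \<gamma> {}" using sums[of "\<lambda>_. {}"] by (simp add: disjoint_family_on_def)
 then have "\<gamma> {} = 0" using sums_summable summable_const_iff by blast
 show e: "emeasure (set_measure \<gamma>) A = ennreal (\<gamma> A)" if "A \<in> sets borel" for A unfolding set_measure_def
 proof (rule emeasure_measure_of_sigma[OF _ _ _ that])
  show "sigma_algebra UNIV (sets (borel :: real measure))" using sets.sigma_algebra_axioms[of borel] by simp
  show "positive (sets borel) (\<lambda>A. ennreal (\<gamma> A))" by (simp add: positive_def \<open>\<gamma> {} = 0\<close>)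
  show "countably_additive (sets borel) (\<lambda>A. ennreal (\<gamma> A))" unfolding countably_additive_def
  proof (intro allI impI)
   fix A :: "nat => real set" assume A: "range A \<subseteq> sets borel" "disjoint_family A" "(\<Union>i. A i) \<in> sets borel"
   have "!!k. A k \<in> sets borel" using A by auto
   then show "(\<Sum>i. ennreal (\<gamma> (A i))) = ennreal (\<gamma> (\<Union>i. A i))"
    using sums[OF A(1,2)] A(3) nonneg by (intro sums_unique[symmetric]) (simp add: sums_ennreal)
  qed
 qed
 show "finite_measure (set_measure \<gamma>)" by (rule finite_measureI) (simp add: s e)
qed

lemma regular_approx:
 fixes m :: "real measure"
 assumes "finite_measure m" "sets m = sets borel" and A: "A \<in> sets borel" and d: "d > 0"
 shows "\<exists>K. compact K \<and> K \<subseteq> A \<and> emeasure m (A - K) <= ennreal d" "\<exists>U. open U \<and> A \<subseteq> U \<and> emeasure m (U - A) <= ennreal d"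
proof -
 interpret finite_measure m by fact
 have fin: "emeasure m X ~= \<infinity>" for X by (simp add: emeasure_eq_measure)
 have "\<exists>K\<in>{K. K \<subseteq> A \<and> compact K}. emeasure m A < emeasure m K + ennreal d"
  by (rule SUP_approx_ennreal[OF d _ inner_regular[OF assms(2) _ A] fin]) (auto simp: fin)
 then obtain K where K: "K \<subseteq> A" "compact K" "emeasure m A <= emeasure m K + ennreal d" by (auto intro: less_imp_le)
 then have "emeasure m (A - K) <= ennreal d" using A assms(2) fin by (subst emeasure_Diff) (auto simp: ennreal_minus_le_iff borel_compact)
 then show "\<exists>K. compact K \<and> K \<subseteq> A \<and> emeasure m (A - K) <= ennreal d" using K by blast
 have "\<exists>U\<in>{U. A \<subseteq> U \<and> open U}. emeasure m U < emeasure m A + ennreal d"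
  by (rule INF_approx_ennreal[OF d outer_regular[OF assms(2) _ A] fin]) (simp add: fin)
 then obtain U where U: "A \<subseteq> U" "open U" "emeasure m U <= emeasure m A + ennreal d" by (auto intro: less_imp_le)
 then have "emeasure m (U - A) <= ennreal d" using A assms(2) fin by (subst emeasure_Diff) (auto simp: ennreal_minus_le_iff)
 then show "\<exists>U. open U \<and> A \<subseteq> U \<and> emeasure m (U - A) <= ennreal d" using U by blast
qed

text \<open>Countable additivity is assumed in each variable separately. Over rectangles it is a
  theorem, which rests on the regularity of the two marginals on the line.\<close>

locale bimeasure =
 fixes \<beta> :: "real set => real set => real"
 assumes nonneg: "!!A B. A \<in> sets borel ==> B \<in> sets borel ==> 0 <= \<beta> A B"
  and sums1: "!!A B. range A \<subseteq> sets borel ==> disjoint_family A ==> B \<in> sets borel ==>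
   (\<lambda>k::nat. \<beta> (A k) B) sums \<beta> (\<Union>k. A k) B"
  and sums2: "!!A B. A \<in> sets borel ==> range B \<subseteq> sets borel ==> disjoint_family B ==>
   (\<lambda>k::nat. \<beta> A (B k)) sums \<beta> A (\<Union>k. B k)"
begin

definition b :: "real set => real set => ennreal" where "b A B = ennreal (\<beta> A B)"

lemma left:
 assumes "B \<in> sets borel" obtains m where "space m = UNIV" "sets m = sets borel" "finite_measure m" "!!A. A \<in> sets borel ==> emeasure m A = b A B"
 using set_measure[of "\<lambda>A. \<beta> A B", OF nonneg[OF _ assms] sums1[OF _ _ assms]] unfolding b_def by blast

lemma right:
 assumes "A \<in> sets borel" obtains m where "space m = UNIV" "sets m = sets borel" "finite_measure m" "!!B. B \<in> sets borel ==> emeasure m B = b A B"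
 using set_measure[of "\<beta> A", OF nonneg[OF assms] sums2[OF assms]] unfolding b_def by blast

lemma b_empty: "A \<in> sets borel ==> b {} A = 0" "A \<in> sets borel ==> b A {} = 0"
 by (metis left emeasure_empty sets.empty_sets, metis right emeasure_empty sets.empty_sets)

lemma b_mono1: "A \<in> sets borel ==> C \<in> sets borel ==> B \<in> sets borel ==> A \<subseteq> C ==> b A B <= b C B"
 by (metis left emeasure_mono)

text \<open>What is lost by passing to the rectangle with sides C and D is charged to the two
  marginals.\<close>

lemma b_cut:
 assumes s: "A \<in> sets borel" "B \<in> sets borel" "C \<in> sets borel" "D \<in> sets borel"
 shows "b A B <= b C D + (b (A - C) UNIV + b UNIV (B - D))"
proof -
 obtain m where m: "sets m = sets borel" "!!A. A \<in> sets borel ==> emeasure m A = b A B" using left[OF s(2)] by metis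
 obtain l where l: "sets l = sets borel" "!!B. B \<in> sets borel ==> emeasure l B = b (A - C) B" using right[of "A - C"] s by (metis sets.Diff)
 obtain r where r: "sets r = sets borel" "!!B. B \<in> sets borel ==> emeasure r B = b C B" using right[OF s(3)] by metis
 have "emeasure m A <= emeasure m (C \<union> (A - C))" using s m by (intro emeasure_mono) auto
 also have "... <= emeasure m C + emeasure m (A - C)" using s m by (intro emeasure_subadditive) auto
 finally have "b A B <= b C B + b (A - C) B" using s m by simp
 also have "b C B <= b C D + b UNIV (B - D)"
 proof -
  have "emeasure r B <= emeasure r (D \<union> (B - D))" using s r by (intro emeasure_mono) auto
  also have "... <= emeasure r D + emeasure r (B - D)" using s r by (intro emeasure_subadditive) auto
  finally have "b C B <= b C D + b C (B - D)" using s r by simp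
  also have "b C (B - D) <= b UNIV (B - D)" using s by (intro b_mono1) auto
  finally show ?thesis by simp
 qed
 also have "b (A - C) B <= b (A - C) UNIV" using emeasure_mono[of B UNIV l] l s by simp
 finally show ?thesis by (simp add: add_ac)
qed

text \<open>Finitely many rectangles are compared with \<open>A \<times> B\<close> on the atoms \<open>S \<inter> cell I A J\<close> of the algebra generated by
 their first sides, where only the second sides matter.\<close>

definition cell :: "nat set => (nat => real set) => nat set => real set"
 where "cell I A J = {x. \<forall>n\<in>I. x \<in> A n \<longleftrightarrow> n \<in> J}"

lemma atoms:
 assumes I: "finite (I :: nat set)" "!!n. n \<in> I ==> A n \<in> sets borel"
 shows "!!J. cell I A J \<in> sets borel" "!!S B. S \<in> sets borel ==> B \<in> sets borel ==> b S B = (\<Sum>J\<in>Pow I. b (S \<inter> cell I A J) B)"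
  "!!S. S \<in> sets borel ==> (!!n. n \<in> I ==> B n \<in> sets borel) ==>
   (\<Sum>n\<in>I. b (S \<inter> A n) (B n)) = (\<Sum>J\<in>Pow I. \<Sum>n\<in>J. b (S \<inter> cell I A J) (B n))"
proof -
 have "{x \<in> space borel. \<forall>n\<in>I. x \<in> A n \<longleftrightarrow> n \<in> J} \<in> sets borel" for J using I by measurable
 then show cell: "cell I A J \<in> sets borel" for J by (simp add: cell_def)
 show sum: "b S B = (\<Sum>J\<in>Pow I. b (S \<inter> cell I A J) B)" if s: "S \<in> sets borel" "B \<in> sets borel" for S B
 proof -
  obtain m where m: "sets m = sets borel" "!!A. A \<in> sets borel ==> emeasure m A = b A B" using left[OF s(2)] by metis
  have "S \<subseteq> (\<Union>J\<in>Pow I. cell I A J)"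
  proof
   fix x show "x \<in> (\<Union>J\<in>Pow I. cell I A J)" by (rule UN_I[of "{n \<in> I. x \<in> A n}"]) (auto simp: cell_def)
  qed
  moreover have "disjoint_family_on (cell I A) (Pow I)" unfolding disjoint_family_on_def cell_def
  proof (intro ballI impI)
   fix J J' assume "J \<in> Pow I" "J' \<in> Pow I" "J ~= J'"
   then obtain n where "n \<in> I" "n \<in> J \<longleftrightarrow> n \<notin> J'" by blast
   then show "{x. \<forall>n\<in>I. x \<in> A n \<longleftrightarrow> n \<in> J} \<inter> {x. \<forall>n\<in>I. x \<in> A n \<longleftrightarrow> n \<in> J'} = {}" by blast
  qed
  ultimately have "emeasure m S = (\<Sum>J\<in>Pow I. emeasure m (S \<inter> cell I A J))"
   using s cell m I by (intro sum_emeasure_cover) auto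
  then show ?thesis using s cell m by simp
 qed
 show "(\<Sum>n\<in>I. b (S \<inter> A n) (B n)) = (\<Sum>J\<in>Pow I. \<Sum>n\<in>J. b (S \<inter> cell I A J) (B n))"
  if s: "S \<in> sets borel" "!!n. n \<in> I ==> B n \<in> sets borel" for S
 proof -
  have "(\<Sum>n\<in>I. b (S \<inter> A n) (B n)) = (\<Sum>n\<in>I. \<Sum>J\<in>Pow I. b (S \<inter> A n \<inter> cell I A J) (B n))"
   using s I by (intro sum.cong refl sum) auto
  also have "... = (\<Sum>J\<in>Pow I. \<Sum>n\<in>I. b (S \<inter> A n \<inter> cell I A J) (B n))" by (rule sum.swap)
  also have "... = (\<Sum>J\<in>Pow I. \<Sum>n\<in>J. b (S \<inter> cell I A J) (B n))"
  proof (rule sum.cong[OF refl], rule sum.mono_neutral_cong_right)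
   fix J assume J: "J \<in> Pow I"
   show "\<forall>n\<in>I - J. b (S \<inter> A n \<inter> cell I A J) (B n) = 0"
   proof
    fix n assume n: "n \<in> I - J"
    then have "S \<inter> A n \<inter> cell I A J = {}" by (auto simp: cell_def)
    then show "b (S \<inter> A n \<inter> cell I A J) (B n) = 0" using b_empty(1) s(2)[of n] n by simp
   qed
   fix n assume "n \<in> J"
   then have "S \<inter> A n \<inter> cell I A J = S \<inter> cell I A J" using J by (auto simp: cell_def)
   then show "b (S \<inter> A n \<inter> cell I A J) (B n) = b (S \<inter> cell I A J) (B n)" by simp
  qed (use I in auto)
  finally show ?thesis .
 qed
qed

text \<open>Over a nonempty atom the second sides of those rectangles whose first sides contain it
  must cover R.\<close>

lemma b_subadditive:
 assumes I: "finite (I :: nat set)" "!!n. n \<in> I ==> A n \<in> sets borel" "!!n. n \<in> I ==> B n \<in> sets borel"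
  and s: "S \<in> sets borel" "R \<in> sets borel" and cover: "S \<times> R \<subseteq> (\<Union>n\<in>I. A n \<times> B n)"
 shows "b S R <= (\<Sum>n\<in>I. b (A n) (B n))"
proof -
 have "b S R = (\<Sum>J\<in>Pow I. b (S \<inter> cell I A J) R)" using I s by (intro atoms(2))
 also have "... <= (\<Sum>J\<in>Pow I. \<Sum>n\<in>J. b (S \<inter> cell I A J) (B n))"
 proof (rule sum_mono)
  fix J assume J: "J \<in> Pow I"
  show "b (S \<inter> cell I A J) R <= (\<Sum>n\<in>J. b (S \<inter> cell I A J) (B n))"
  proof (cases "S \<inter> cell I A J = {}")
   case False
   then have R: "R \<subseteq> (\<Union>n\<in>J. B n)" using cover by (fastforce simp: cell_def)
   have "S \<inter> cell I A J \<in> sets borel" using s atoms(1)[OF I(1,2)] by auto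
   then obtain m where m: "sets m = sets borel" "!!B. B \<in> sets borel ==> emeasure m B = b (S \<inter> cell I A J) B" using right by metis
   have fJ: "finite J" "!!n. n \<in> J ==> B n \<in> sets borel" using J I finite_subset by auto
   have "emeasure m R <= emeasure m (\<Union>n\<in>J. B n)" using R fJ m by (intro emeasure_mono) auto
   also have "... <= (\<Sum>n\<in>J. emeasure m (B n))" using fJ m by (intro emeasure_subadditive_finite) auto
   finally show ?thesis using m fJ s by simp
  qed (simp add: b_empty(1)[OF s(2)])
 qed
 also have "... = (\<Sum>n\<in>I. b (S \<inter> A n) (B n))" using I s atoms(3)[of I A S B] by simp
 also have "... <= (\<Sum>n\<in>I. b (A n) (B n))" using I s by (intro sum_mono b_mono1) auto
 finally show ?thesis .
qed

text \<open>Disjoint rectangles whose first sides share a point have disjoint second sides.\<close>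

lemma b_superadditive:
 assumes I: "finite (I :: nat set)" "!!n. n \<in> I ==> A n \<in> sets borel" "!!n. n \<in> I ==> B n \<in> sets borel"
  and s: "S \<in> sets borel" "R \<in> sets borel" and sub: "!!n. n \<in> I ==> A n \<times> B n \<subseteq> S \<times> R"
  and disj: "disjoint_family_on (\<lambda>n. A n \<times> B n) I"
 shows "(\<Sum>n\<in>I. b (A n) (B n)) <= b S R"
proof -
 have "b (A n) (B n) = b (S \<inter> A n) (B n)" if n: "n \<in> I" for n
 proof (cases "B n = {}")
  case True
  then show ?thesis using b_empty(2) I(2)[OF n] s by simp
 next
  case False
  then have "S \<inter> A n = A n" using sub[OF n] by auto
  then show ?thesis by simp
 qed
 then have "(\<Sum>n\<in>I. b (A n) (B n)) = (\<Sum>J\<in>Pow I. \<Sum>n\<in>J. b (S \<inter> cell I A J) (B n))" using I s atoms(3)[of I A S B] by simp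
 also have "... <= (\<Sum>J\<in>Pow I. b (S \<inter> cell I A J) R)"
 proof (rule sum_mono)
  fix J assume J: "J \<in> Pow I"
  have fJ: "finite J" "!!n. n \<in> J ==> B n \<in> sets borel" using J I finite_subset by auto
  show "(\<Sum>n\<in>J. b (S \<inter> cell I A J) (B n)) <= b (S \<inter> cell I A J) R"
  proof (cases "S \<inter> cell I A J = {}")
   case False
   then obtain x where x: "x \<in> S" "!!n. n \<in> J ==> x \<in> A n" using J by (auto simp: cell_def)
   then have R: "(\<Union>n\<in>J. B n) \<subseteq> R" using sub J by fastforce
   have d: "disjoint_family_on B J" unfolding disjoint_family_on_def
   proof (intro ballI impI)
    fix n k assume nk: "n \<in> J" "k \<in> J" "n ~= k"
    then have "(A n \<times> B n) \<inter> (A k \<times> B k) = {}" using disj J unfolding disjoint_family_on_def by blast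
    then show "B n \<inter> B k = {}" using x(2)[OF nk(1)] x(2)[OF nk(2)] by blast
   qed
   have "S \<inter> cell I A J \<in> sets borel" using s atoms(1)[OF I(1,2)] by auto
   then obtain m where m: "sets m = sets borel" "!!B. B \<in> sets borel ==> emeasure m B = b (S \<inter> cell I A J) B" using right by metis
   have "(\<Sum>n\<in>J. emeasure m (B n)) = emeasure m (\<Union>n\<in>J. B n)" using fJ m d by (intro sum_emeasure) auto
   also have "... <= emeasure m R" using R s m by (intro emeasure_mono) auto
   finally show ?thesis using m fJ s by simp
  qed (simp add: b_empty(1) fJ)
 qed
 also have "... = b S R" using I s atoms(2)[of I A S R] by simp
 finally show ?thesis .
qed

text \<open>The bound on \<open>b S R\<close> is a compactness argument: S and R are shrunk to
  compact sets, the pieces are enlarged to open ones, and finitely many of these suffice.\<close>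

lemma b_countably_additive:
 assumes AB: "!!n :: nat. A n \<in> sets borel" "!!n. B n \<in> sets borel" and s: "S \<in> sets borel" "R \<in> sets borel"
  and disj: "disjoint_family (\<lambda>n. A n \<times> B n)" and U: "(\<Union>n. A n \<times> B n) = S \<times> R"
 shows "(\<Sum>n. b (A n) (B n)) = b S R"
proof (rule antisym)
 show "(\<Sum>n. b (A n) (B n)) <= b S R" by (intro suminf_le_const[OF summableI] b_superadditive AB s)
   (use disj U in \<open>auto intro: disjoint_family_on_mono\<close>)
 show "b S R <= (\<Sum>n. b (A n) (B n))"
 proof (rule ennreal_le_epsilon)
  fix d :: real assume d: "0 < d"
  obtain l where l: "sets l = sets borel" "finite_measure l" "!!A. A \<in> sets borel ==> emeasure l A = b A UNIV" using left[of UNIV] by (metis sets.top space_borel)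
  obtain r where r: "sets r = sets borel" "finite_measure r" "!!A. A \<in> sets borel ==> emeasure r A = b UNIV A" using right[of UNIV] by (metis sets.top space_borel)
  \<comment> \<open>Enlarging both sides of the n-th piece costs 2 c n, in total d / 2; the compact
    sets use the other half.\<close>
  define c where "c n = d / 8 * (1 / 2) ^ n" for n
  have c: "c n > 0" for n using d by (simp add: c_def)
  obtain K where K: "compact K" "K \<subseteq> S" "emeasure l (S - K) <= ennreal (d / 4)" using regular_approx(1)[OF l(2,1) s(1), of "d / 4"] d by auto
  obtain L where L: "compact L" "L \<subseteq> R" "emeasure r (R - L) <= ennreal (d / 4)" using regular_approx(1)[OF r(2,1) s(2), of "d / 4"] d by auto
  obtain V where V: "!!n. open (V n)" "!!n. A n \<subseteq> V n" "!!n. emeasure l (V n - A n) <= ennreal (c n)"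
  proof -
   have "\<exists>U. open U \<and> A n \<subseteq> U \<and> emeasure l (U - A n) <= ennreal (c n)" for n
    by (rule regular_approx(2)[OF l(2,1) AB(1) c])
   then show thesis using that by metis
  qed
  obtain W where W: "!!n. open (W n)" "!!n. B n \<subseteq> W n" "!!n. emeasure r (W n - B n) <= ennreal (c n)"
  proof -
   have "\<exists>U. open U \<and> B n \<subseteq> U \<and> emeasure r (U - B n) <= ennreal (c n)" for n
    by (rule regular_approx(2)[OF r(2,1) AB(2) c])
   then show thesis using that by metis
  qed
  have bor: "K \<in> sets borel" "L \<in> sets borel" "V n \<in> sets borel" "W n \<in> sets borel" for n
   using K L V W by (auto simp: borel_compact)
  have "K \<times> L \<subseteq> (\<Union>n. A n \<times> B n)" unfolding U using K(2) L(2) by (rule Sigma_mono)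
  also have "... \<subseteq> (\<Union>n. V n \<times> W n)" using V(2) W(2) by (intro UN_mono Sigma_mono) auto
  finally have "K \<times> L \<subseteq> (\<Union>n. V n \<times> W n)" .
  then obtain I where I: "finite I" "K \<times> L \<subseteq> (\<Union>n\<in>I. V n \<times> W n)"
  proof (rule compactE_image[OF compact_Times[OF K(1) L(1)], rotated])
   show "open (V n \<times> W n)" for n by (rule open_Times[OF V(1) W(1)])
  qed
  have "b S R <= b K L + (b (S - K) UNIV + b UNIV (R - L))" using s bor by (intro b_cut)
  also have "b (S - K) UNIV + b UNIV (R - L) <= ennreal (d / 4) + ennreal (d / 4)" using K(3) L(3) l(3) r(3) s bor by (intro add_mono) auto
  also have "... = ennreal (d / 2)" using d by (simp flip: ennreal_plus)
  also have "b K L <= (\<Sum>n\<in>I. b (V n) (W n))" using I bor by (intro b_subadditive) auto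
  also have "... <= (\<Sum>n\<in>I. b (A n) (B n) + ennreal (2 * c n))"
  proof (rule sum_mono)
   fix n
   have "b (V n) (W n) <= b (A n) (B n) + (b (V n - A n) UNIV + b UNIV (W n - B n))" using AB bor by (intro b_cut)
   also have "b (V n - A n) UNIV + b UNIV (W n - B n) <= ennreal (c n) + ennreal (c n)"
    using V(3)[of n] W(3)[of n] l(3) r(3) AB bor by (intro add_mono) auto
   also have "... = ennreal (2 * c n)" using c[of n] by (simp flip: ennreal_plus)
   finally show "b (V n) (W n) <= b (A n) (B n) + ennreal (2 * c n)" by simp
  qed
  also have "... <= (\<Sum>n. b (A n) (B n) + ennreal (2 * c n))" using I(1) by (intro sum_le_suminf) auto
  also have "... = (\<Sum>n. b (A n) (B n)) + (\<Sum>n. ennreal (2 * c n))" by (rule suminf_add[symmetric]) auto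
  also have "(\<Sum>n. ennreal (2 * c n)) = ennreal (d / 2)"
  proof (rule suminf_ennreal_eq)
   have "(\<lambda>n. d / 4 * (1 / 2) ^ n) sums (d / 4 * (1 / (1 - 1 / 2)))" by (intro sums_mult geometric_sums) simp
   then show "(\<lambda>n. 2 * c n) sums (d / 2)" by (simp add: c_def)
  qed (use c in \<open>simp add: less_imp_le\<close>)
  finally show "b S R <= (\<Sum>n. b (A n) (B n)) + ennreal d" using d by (simp add: add.assoc flip: ennreal_plus)
 qed
qed

lemma extension_exists:
 "\<exists>\<nu> :: (real \<times> real) measure. sets \<nu> = sets borel \<and>
  (\<forall>A\<in>sets borel. \<forall>B\<in>sets borel. emeasure \<nu> (A \<times> B) = ennreal (\<beta> A B))"
proof -
 define Q where "Q A B \<longleftrightarrow> A \<in> sets borel \<and> B \<in> sets borel" for A B :: "real set"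
 define \<nu> where "\<nu> = extend_measure UNIV {(A, B). Q A B} (\<lambda>(A, B). A \<times> B) (\<lambda>(A, B). b A B)"
 have im: "(\<lambda>(A, B). A \<times> B) ` {(A, B). Q A B} = {A \<times> B | A B. A \<in> sets borel \<and> B \<in> sets borel}" by (auto simp: Q_def)
 have "sets \<nu> = sigma_sets UNIV {A \<times> B | A B. A \<in> sets borel \<and> B \<in> sets borel}"
  unfolding \<nu>_def im[symmetric] by (rule sets_extend_measure) simp
 also have "... = sets borel" unfolding borel_prod[symmetric] sets_pair_measure by simp
 finally have sets: "sets \<nu> = sets borel" .
 have semi: "semiring_of_sets UNIV {A \<times> B | A B. Q A B}"
 proof
  show "{} \<in> {A \<times> B | A B. Q A B}" by (auto simp: Q_def intro!: exI[of _ "{}"])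
  fix X Y assume "X \<in> {A \<times> B | A B. Q A B}" "Y \<in> {A \<times> B | A B. Q A B}"
  then obtain A B C D where XY: "X = A \<times> B" "Y = C \<times> D" "Q A B" "Q C D" by blast
  have q: "Q (A \<inter> C) (B \<inter> D)" "Q (A - C) B" "Q (A \<inter> C) (B - D)" using XY by (auto simp: Q_def)
  show "X \<inter> Y \<in> {A \<times> B | A B. Q A B}" using q(1) by (auto simp: XY Times_Int_Times)
  have "X - Y = \<Union>{(A - C) \<times> B, (A \<inter> C) \<times> (B - D)}" by (auto simp: XY)
  moreover have "disjoint {(A - C) \<times> B, (A \<inter> C) \<times> (B - D)}" by (auto simp: disjoint_def)
  ultimately show "\<exists>F\<subseteq>{A \<times> B | A B. Q A B}. finite F \<and> disjoint F \<and> X - Y = \<Union>F"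
   using q by (intro exI[of _ "{(A - C) \<times> B, (A \<inter> C) \<times> (B - D)}"]) auto
 qed auto
 have "emeasure \<nu> (A \<times> B) = b A B" if "Q A B" for A B
 proof (rule extend_measure_caratheodory_pair[OF \<nu>_def that semi])
  show "b A B = 0" if "Q A B" "A \<times> B = {}" for A B using that b_empty by (auto simp: Q_def)
  show "b A B = b C D" if "Q A B" "Q C D" "A \<times> B = C \<times> D" for A B C D using that b_empty by (auto simp: Q_def times_eq_iff)
  show "(\<Sum>n. b (A n) (B n)) = b S R"
   if "!!n. Q (A n) (B n)" "Q S R" "disjoint_family (\<lambda>n. A n \<times> B n)" "(\<Union>n. A n \<times> B n) = S \<times> R" for A B S R
   using that by (intro b_countably_additive) (auto simp: Q_def)
 qed simp
 then show ?thesis using sets by (auto simp: Q_def b_def)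
qed

lemma extension_unique:
 assumes "sets \<nu> = sets borel" "!!A B. A \<in> sets borel ==> B \<in> sets borel ==> emeasure \<nu> (A \<times> B) = ennreal (\<beta> A B)"
  and "sets \<nu>' = sets borel" "!!A B. A \<in> sets borel ==> B \<in> sets borel ==> emeasure \<nu>' (A \<times> B) = ennreal (\<beta> A B)"
 shows "\<nu> = \<nu>'"
proof (rule measure_eqI_generator_eq[where E = "{a \<times> b | a b. a \<in> sets borel \<and> b \<in> sets borel}" and \<Omega> = UNIV and A = "\<lambda>_. UNIV"])
 have s: "sets (borel :: (real \<times> real) measure) = sigma_sets UNIV {a \<times> b | a b. a \<in> sets borel \<and> b \<in> sets borel}"
  unfolding borel_prod[symmetric] sets_pair_measure by simp
 then show "sets \<nu> = sigma_sets UNIV {a \<times> b | a b. a \<in> sets borel \<and> b \<in> sets borel}"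
  "sets \<nu>' = sigma_sets UNIV {a \<times> b | a b. a \<in> sets borel \<and> b \<in> sets borel}" using assms by simp_all
 show "Int_stable {a \<times> b | a b. a \<in> sets (borel :: real measure) \<and> b \<in> sets (borel :: real measure)}"
  by (simp add: Int_stable_pair_measure_generator)
 show "range (\<lambda>_::nat. UNIV) \<subseteq> {a \<times> b | a b. a \<in> sets (borel :: real measure) \<and> b \<in> sets (borel :: real measure)}"
  by (auto intro!: exI[of _ UNIV])
 show "emeasure \<nu> UNIV ~= \<infinity>" using assms(2)[of UNIV UNIV] by simp
qed (use assms in auto)

text \<open>The body agrees with that of \<open>joint_spectral_measure\<close>, so the two are
  identified by unfolding.\<close>

definition ext :: "(real \<times> real) measure"
 where "ext = (THE \<nu>. sets \<nu> = sets borel \<and>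
    (\<forall>A\<in>sets borel. \<forall>B\<in>sets borel. emeasure \<nu> (A \<times> B) = ennreal (\<beta> A B)))"

lemma ext: "sets ext = sets borel" "A \<in> sets borel ==> B \<in> sets borel ==> emeasure ext (A \<times> B) = ennreal (\<beta> A B)"
proof -
 have "\<exists>!\<nu>. sets \<nu> = sets borel \<and>
    (\<forall>A\<in>sets borel. \<forall>B\<in>sets borel. emeasure \<nu> (A \<times> B) = ennreal (\<beta> A B))"
  by (rule ex_ex1I[OF extension_exists]) (use extension_unique in blast)
 from theI'[OF this] show "sets ext = sets borel"
  "A \<in> sets borel ==> B \<in> sets borel ==> emeasure ext (A \<times> B) = ennreal (\<beta> A B)" unfolding ext_def by blast+
qed

end

section \<open>Monotonicity and semicontinuity of the variational entropy, and Pinsker's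
  inequality\<close>

section \<open>A variational form of the relative entropy\<close>

context vn_algebra
begin

definition nstate :: "('h op => real) => bool"
 where "nstate f \<longleftrightarrow> nfun f \<and> f \<I> = 1"

lemma nstate_pfun: "nstate f ==> pfun f" and nstate_nfun: "nstate f ==> nfun f" and nstate_id: "nstate f ==> f \<I> = 1"
 by (simp_all add: nstate_def nfun_pfun)

definition kform :: "('h op => real) => ('h op => real) => real => 'h op => real"
 where "kform f g r x = f (adj (\<I> - x) ** (\<I> - x)) + g (x ** adj x) / r"

definition kval :: "('h op => real) => ('h op => real) => real => real"
 where "kval f g r = (INF x\<in>M. kform f g r x)"

text \<open>With densities \<open>h\<close>, \<open>k\<close> of \<open>f\<close>, \<open>g\<close> and the relative modular operator \<open>\<Delta> x = k x h\<^sup>-\<^sup>1\<close>,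
 \<open>kval f g r\<close> is the value of \<open>\<Delta> (r + \<Delta>)\<^sup>-\<^sup>1\<close> at the vector of \<open>f\<close>, and
 \<open>- log \<lambda> = \<integral>\<^sub>0\<^sup>\<infinity> (1 / (1 + r) - \<lambda> / (r + \<lambda>)) / r dr\<close>.\<close>

definition var_entropy :: "('h op => real) => ('h op => real) => ennreal"
 where "var_entropy f g = (\<integral>\<^sup>+ r. ennreal ((1 / (1 + r) - kval f g r) / r) * indicator {0<..} r \<partial>lborel)"

lemma kform_nonneg: "pfun f ==> pfun g ==> x \<in> M ==> r > 0 ==> 0 <= kform f g r x"
 unfolding kform_def by (intro add_nonneg_nonneg divide_nonneg_pos pfun_nonneg psd_square mem_rules)

lemma kval_le: "pfun f ==> pfun g ==> x \<in> M ==> r > 0 ==> kval f g r <= kform f g r x"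
 unfolding kval_def by (intro cINF_lower bdd_belowI2[where m = 0] kform_nonneg)

lemma kval_ge: "(!!x. x \<in> M ==> c <= kform f g r x) ==> c <= kval f g r"
 unfolding kval_def by (rule cINF_greatest) (use id_mem in blast, auto)

lemma kval_nonneg: "pfun f ==> pfun g ==> r > 0 ==> 0 <= kval f g r" by (intro kval_ge kform_nonneg)

text \<open>The scalar trial operator s = r / (1 + r) minimizes (1 - s)^2 + s^2 / r. The resulting
  bound makes the integrand of \<open>var_entropy\<close> nonnegative.\<close>

lemma kval_scalar:
 assumes f: "nstate f" "nstate g" and r: "r > 0"
 shows "kval f g r <= 1 / (1 + r)"
proof -
 define s where "s = r / (1 + r)"
 have "\<I> - s *\<^sub>R \<I> = (1 / (1 + r)) *\<^sub>R (\<I> :: 'h op)"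
 proof -
  have "1 / (1 + r) = 1 - s" using r by (simp add: s_def field_simps)
  then show ?thesis by (simp add: scaleR_diff_left)
 qed
 then have "kform f g r (s *\<^sub>R \<I>) = (1 / (1 + r))\<^sup>2 + s\<^sup>2 / r"
  using f by (simp add: kform_def adj_rules op_simps pfun_scaleR[OF nstate_pfun] mem_rules nstate_id power2_eq_square)
 also have "... = 1 / (1 + r)"
 proof -
  have n: "r ~= 0" "1 + r ~= 0" using r by auto
  have "(1 / (1 + r))\<^sup>2 + s\<^sup>2 / r = (1 + r) / (1 + r)\<^sup>2" using n by (simp add: s_def power2_eq_square add_divide_distrib)
  then show ?thesis using n by (simp add: power2_eq_square)
 qed
 finally show ?thesis using kval_le[OF nstate_pfun[OF f(1)] nstate_pfun[OF f(2)] _ r, of "s *\<^sub>R \<I>"] by (simp add: mem_rules)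
qed

lemma kval_antimono:
 assumes f: "pfun f" "pfun g" and r: "0 < r" "r <= r'"
 shows "kval f g r' <= kval f g r"
proof (rule kval_ge)
 fix x assume x: "x \<in> M"
 have "kval f g r' <= kform f g r' x" using f x r by (intro kval_le) auto
 also have "... <= kform f g r x"
  unfolding kform_def using r x by (intro add_left_mono divide_left_mono pfun_nonneg[OF f(2)] psd_square mem_rules) auto
 finally show "kval f g r' <= kform f g r x" .
qed

lemma var_entropy_measurable:
 assumes f: "nstate f" "nstate g"
 shows "(\<lambda>r. ennreal ((1 / (1 + r) - kval f g r) / r) * indicator {0<..} r) \<in> borel_measurable borel"
proof -
 \<comment> \<open>The value 1 on r <= 0 keeps the function antimonotone on the whole line, hence
   Borel.\<close>
 define k where "k r = (if r <= 0 then 1 else kval f g r)" for r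
 have "mono (\<lambda>r. - k r)"
 proof (rule monoI)
  fix r r' :: real assume rr: "r <= r'"
  have "kval f g r' <= 1" if "r' > 0" by (rule order_trans[OF kval_scalar[OF f that]]) (use that in simp)
  then show "- k r <= - k r'" using rr kval_antimono[OF nstate_pfun[OF f(1)] nstate_pfun[OF f(2)], of r r'] by (auto simp: k_def)
 qed
 then have "(\<lambda>r. - k r) \<in> borel_measurable borel" by (rule borel_measurable_mono)
 then have "(\<lambda>r. - (- k r)) \<in> borel_measurable borel" by (rule borel_measurable_uminus)
 then have k[measurable]: "k \<in> borel_measurable borel" by simp
 have "(\<lambda>r. ennreal ((1 / (1 + r) - k r) / r) * indicator {0<..} r) \<in> borel_measurable borel" by measurable
 also have "(\<lambda>r. ennreal ((1 / (1 + r) - k r) / r) * indicator {0<..} r) =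
   (\<lambda>r. ennreal ((1 / (1 + r) - kval f g r) / r) * indicator {0<..} r)" by (auto simp: k_def split: split_indicator)
 finally show ?thesis .
qed

lemma var_entropy_mono:
 assumes "!!r. r > 0 ==> kval f g r <= kval f' g' r"
 shows "var_entropy f' g' <= var_entropy f g" unfolding var_entropy_def
 by (intro nn_integral_mono) (auto split: split_indicator intro!: ennreal_leI divide_right_mono assms)

text \<open>The Kadison-Schwarz inequality on both sides, because \<open>kform\<close> contains a
  square of each kind.\<close>

definition schwarz_map :: "('h op => 'h op) => bool"
 where "schwarz_map \<Phi> \<longleftrightarrow> (\<forall>x\<in>M. \<Phi> x \<in> M \<and> \<Phi> (\<I> - x) = \<I> - \<Phi> x \<and>
  psd (\<Phi> (adj x ** x) - adj (\<Phi> x) ** \<Phi> x) \<and> psd (\<Phi> (x ** adj x) - \<Phi> x ** adj (\<Phi> x)))"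

text \<open>If x is a trial operator for the composed states, then \<Phi> x is one for the original
  states, and by the Schwarz inequalities its value is no larger.\<close>

lemma data_processing:
 assumes f: "pfun f" "pfun g" and \<Phi>: "schwarz_map \<Phi>"
 shows "var_entropy (\<lambda>x. f (\<Phi> x)) (\<lambda>x. g (\<Phi> x)) <= var_entropy f g"
proof (rule var_entropy_mono, rule kval_ge)
 fix r :: real and x assume r: "r > 0" and x: "x \<in> M"
 have S: "\<Phi> y \<in> M" "\<Phi> (\<I> - y) = \<I> - \<Phi> y" "psd (\<Phi> (adj y ** y) - adj (\<Phi> y) ** \<Phi> y)"
  "psd (\<Phi> (y ** adj y) - \<Phi> y ** adj (\<Phi> y))" if "y \<in> M" for y using \<Phi> that unfolding schwarz_map_def by blast+
 have y: "\<I> - x \<in> M" using x by (simp add: mem_rules)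
 have "kval f g r <= kform f g r (\<Phi> x)" using f S(1)[OF x] r by (intro kval_le)
 also have "... <= kform (\<lambda>x. f (\<Phi> x)) (\<lambda>x. g (\<Phi> x)) r x" unfolding kform_def S(2)[OF x, symmetric]
  using r x y S(3)[OF y] S(4)[OF x] S(1) by (intro add_mono divide_right_mono pfun_mono[OF f(1)] pfun_mono[OF f(2)]) (auto simp: mem_rules)
 finally show "kval f g r <= kform (\<lambda>x. f (\<Phi> x)) (\<lambda>x. g (\<Phi> x)) r x" .
qed

text \<open>\<open>kval\<close> is an infimum of expressions continuous in the states, so it is
  upper semicontinuous; Fatou's lemma does the rest.\<close>

lemma var_entropy_lsc:
 assumes fn: "!!n. nstate (fn n)" "!!n. nstate (gn n)" and fg: "nstate f" "nstate g"
  and lim: "!!x. x \<in> M ==> (\<lambda>n. fn n x) \<longlonglongrightarrow> f x" "!!x. x \<in> M ==> (\<lambda>n. gn n x) \<longlonglongrightarrow> g x"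
 shows "var_entropy f g <= liminf (\<lambda>n. var_entropy (fn n) (gn n))"
proof -
 have "var_entropy f g <= (\<integral>\<^sup>+ r. liminf (\<lambda>n. ennreal ((1 / (1 + r) - kval (fn n) (gn n) r) / r) * indicator {0<..} r) \<partial>lborel)"
  unfolding var_entropy_def
 proof (rule nn_integral_mono)
  fix r :: real
  show "ennreal ((1 / (1 + r) - kval f g r) / r) * indicator {0<..} r
   <= liminf (\<lambda>n. ennreal ((1 / (1 + r) - kval (fn n) (gn n) r) / r) * indicator {0<..} r)"
  proof (cases "r > 0")
   case True
   have "ennreal ((1 / (1 + r) - kval f g r) / r) <= liminf (\<lambda>n. ennreal ((1 / (1 + r) - kval (fn n) (gn n) r) / r))"
    unfolding le_Liminf_iff
   proof (intro allI impI)
    fix y assume y: "y < ennreal ((1 / (1 + r) - kval f g r) / r)"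
    then obtain z where z: "y = ennreal z" "0 <= z" by (cases y) auto
    have "z < (1 / (1 + r) - kval f g r) / r" using y z by (simp add: ennreal_less_iff)
    then have "kval f g r < 1 / (1 + r) - r * z" using True by (simp only: pos_less_divide_eq mult.commute[of r z])
    then obtain x where x: "x \<in> M" "kform f g r x < 1 / (1 + r) - r * z" unfolding kval_def
     using cINF_less_iff[of M "kform f g r"] id_mem kform_nonneg[OF nstate_pfun[OF fg(1)] nstate_pfun[OF fg(2)] _ True]
     by (metis (mono_tags, lifting) bdd_belowI2 empty_iff)
    have "(\<lambda>n. kform (fn n) (gn n) r x) \<longlonglongrightarrow> kform f g r x"
     unfolding kform_def using x True by (intro tendsto_intros lim mem_rules) auto
    from order_tendstoD(2)[OF this x(2)]
    show "\<forall>\<^sub>F n in sequentially. y < ennreal ((1 / (1 + r) - kval (fn n) (gn n) r) / r)"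
    proof eventually_elim
     case (elim n)
     have "kval (fn n) (gn n) r <= kform (fn n) (gn n) r x" using x True nstate_pfun[OF fn(1)] nstate_pfun[OF fn(2)] by (intro kval_le)
     then have "z * r < 1 / (1 + r) - kval (fn n) (gn n) r" using elim by (simp add: mult.commute)
     then have "z < (1 / (1 + r) - kval (fn n) (gn n) r) / r" using True by (simp only: pos_less_divide_eq)
     then show ?case using z by (simp add: ennreal_less_iff)
    qed
   qed
   then show ?thesis using True by simp
  qed simp
 qed
 also have "... <= liminf (\<lambda>n. var_entropy (fn n) (gn n))"
  unfolding var_entropy_def using var_entropy_measurable[OF fn] by (intro nn_integral_liminf) simp
 finally show ?thesis .
qed

end

subsection \<open>The logarithm as an integral\<close>

text \<open>The primitive ln (r + a) - ln (r + b) vanishes at infinity; the case l > 1 follows by a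
  change of sign.\<close>

lemma log_integral:
 fixes l :: real assumes l: "l > 0"
 shows "has_bochner_integral lborel (\<lambda>r. (1 / (r + l) - 1 / (1 + r)) * indicator {0<..} r) (- ln l)"
proof -
 have base: "has_bochner_integral lborel (\<lambda>r. (1 / (r + a) - 1 / (r + b)) * indicator {0<..} r) (ln (b / a))"
  if ab: "0 < a" "a <= b" for a b :: real
 proof (rule has_bochner_integral_nn_integral)
  have "(\<integral>\<^sup>+ r. ennreal ((1 / (r + a) - 1 / (r + b)) * indicator {0<..} r) \<partial>lborel) =
   (\<integral>\<^sup>+ r. ennreal (1 / (r + a) - 1 / (r + b)) * indicator {0..} r \<partial>lborel)"
   by (intro nn_integral_cong_AE, use AE_lborel_singleton[of 0] in eventually_elim) (auto split: split_indicator)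
  also have "... = ennreal (0 - (ln (0 + a) - ln (0 + b)))"
  proof (rule nn_integral_FTC_atLeast)
   fix x :: real assume x: "0 <= x"
   show "((\<lambda>x. ln (x + a) - ln (x + b)) has_real_derivative 1 / (x + a) - 1 / (x + b)) (at x)"
    using x ab by (auto intro!: derivative_eq_intros)
   show "0 <= 1 / (x + a) - 1 / (x + b)" using x ab by (simp add: frac_le)
  next
   have "((\<lambda>x. ln ((x + a) / (x + b))) \<longlongrightarrow> ln 1) at_top"
   proof (rule tendsto_ln)
    have "((\<lambda>x. 1 - (b - a) / (b + x)) \<longlongrightarrow> 1 - 0) at_top"
     by (intro tendsto_diff tendsto_const tendsto_divide_0[OF tendsto_const]
      filterlim_at_top_imp_at_infinity filterlim_tendsto_add_at_top[OF tendsto_const filterlim_ident])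
    then have "((\<lambda>x. 1 - (b - a) / (x + b)) \<longlongrightarrow> 1) at_top" by (simp add: add.commute)
    then show "((\<lambda>x. (x + a) / (x + b)) \<longlongrightarrow> 1) at_top"
    proof (rule Lim_transform_eventually)
     show "\<forall>\<^sub>F x in at_top. 1 - (b - a) / (x + b) = (x + a) / (x + b)"
      using eventually_ge_at_top[of 0] by eventually_elim (use ab in \<open>auto simp: field_simps\<close>)
    qed
   qed simp
   then have "((\<lambda>x. ln ((x + a) / (x + b))) \<longlongrightarrow> 0) at_top" by simp
   then show "((\<lambda>x. ln (x + a) - ln (x + b)) \<longlongrightarrow> 0) at_top" by (rule Lim_transform_eventually)
     (use eventually_ge_at_top[of 0] in \<open>eventually_elim, use ab in \<open>simp add: ln_div\<close>\<close>)
  qed simp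
  also have "0 - (ln (0 + a) - ln (0 + b)) = ln (b / a)" using ab by (simp add: ln_div)
  finally show "(\<integral>\<^sup>+ r. ennreal ((1 / (r + a) - 1 / (r + b)) * indicator {0<..} r) \<partial>lborel) = ennreal (ln (b / a))" .
  show "0 <= ln (b / a)" using ab by simp
  show "AE r in lborel. 0 <= (1 / (r + a) - 1 / (r + b)) * indicator {0<..} r" using ab by (auto split: split_indicator simp: frac_le)
 qed measurable
 show ?thesis
 proof (cases "l <= 1")
  case True
  then show ?thesis using base[OF l True] l by (simp add: ln_div add.commute)
 next
  case False
  then have "has_bochner_integral lborel (\<lambda>r. - ((1 / (r + 1) - 1 / (r + l)) * indicator {0<..} r)) (- ln (l / 1))"
   by (intro has_bochner_integral_minus base) auto
  then show ?thesis by (simp add: algebra_simps)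
 qed
qed

lemma log_integrand: "r > 0 ==> l > 0 ==> (1 / (1 + r) - l / (r + l)) / r = 1 / (r + l) - (1 / (1 + r) :: real)"
proof -
 assume r: "r > 0" "l > 0"
 then have n: "r ~= 0" "1 + r ~= 0" "r + l ~= 0" by auto
 have "(1 / (1 + r) - l / (r + l)) / r = (r * (1 - l) / ((1 + r) * (r + l))) / r"
  unfolding diff_frac_eq[OF n(2,3)] by (simp add: algebra_simps)
 also have "... = (1 - l) / ((1 + r) * (r + l))" using n by simp
 also have "... = 1 / (r + l) - 1 / (1 + r)" unfolding diff_frac_eq[OF n(3,2)] by (simp add: mult.commute)
 finally show ?thesis .
qed

lemma log_sum_integral:
 fixes w l :: "'i => real"
 assumes I: "finite I" and l: "!!i. i \<in> I ==> l i > 0" and w: "(\<Sum>i\<in>I. w i) = 1"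
 shows "has_bochner_integral lborel (\<lambda>r. ((1 / (1 + r) - (\<Sum>i\<in>I. w i * (l i / (r + l i)))) / r) * indicator {0<..} r)
  (\<Sum>i\<in>I. w i * (- ln (l i)))"
proof -
 have "has_bochner_integral lborel (\<lambda>r. \<Sum>i\<in>I. w i * ((1 / (r + l i) - 1 / (1 + r)) * indicator {0<..} r))
  (\<Sum>i\<in>I. w i * (- ln (l i)))" by (intro has_bochner_integral_sum has_bochner_integral_mult_right log_integral l)
 also have "(\<lambda>r. \<Sum>i\<in>I. w i * ((1 / (r + l i) - 1 / (1 + r)) * indicator {0<..} r)) =
  (\<lambda>r. ((1 / (1 + r) - (\<Sum>i\<in>I. w i * (l i / (r + l i)))) / r) * indicator {0<..} r)"
 proof
  fix r :: real
  show "(\<Sum>i\<in>I. w i * ((1 / (r + l i) - 1 / (1 + r)) * indicator {0<..} r)) =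
   ((1 / (1 + r) - (\<Sum>i\<in>I. w i * (l i / (r + l i)))) / r) * indicator {0<..} r"
  proof (cases "r > 0")
   case True
   have "(1 / (1 + r) - (\<Sum>i\<in>I. w i * (l i / (r + l i)))) / r = (\<Sum>i\<in>I. w i * ((1 / (1 + r) - l i / (r + l i)) / r))"
   proof -
    have "(\<Sum>i\<in>I. w i * ((1 / (1 + r) - l i / (r + l i)) / r)) = (\<Sum>i\<in>I. w i * (1 / (1 + r)) - w i * (l i / (r + l i))) / r"
     by (simp add: sum_divide_distrib right_diff_distrib)
    also have "(\<Sum>i\<in>I. w i * (1 / (1 + r)) - w i * (l i / (r + l i))) = 1 / (1 + r) - (\<Sum>i\<in>I. w i * (l i / (r + l i)))"
     by (simp add: sum_subtractf flip: sum_divide_distrib add: w)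
    finally show ?thesis by simp
   qed
   also have "... = (\<Sum>i\<in>I. w i * (1 / (r + l i) - 1 / (1 + r)))"
    using True l by (intro sum.cong refl arg_cong[where f = "\<lambda>z. _ * z"] log_integrand)
   finally show ?thesis using True by simp
  qed simp
 qed
 finally show ?thesis .
qed

context vn_algebra
begin

lemma var_entropy_ge:
 assumes fg: "nstate f" "nstate g"
  and I: "finite I" and l: "!!i. i \<in> I ==> l i > 0" and w: "(\<Sum>i\<in>I. w i) = 1"
  and le: "!!r. r > 0 ==> kval f g r <= (\<Sum>i\<in>I. w i * (l i / (r + l i)))"
 shows "ennreal (\<Sum>i\<in>I. w i * (- ln (l i))) <= var_entropy f g"
proof -
 define G where "G r = ((1 / (1 + r) - (\<Sum>i\<in>I. w i * (l i / (r + l i)))) / r) * indicator {0<..} r" for r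
 have G: "has_bochner_integral lborel G (\<Sum>i\<in>I. w i * (- ln (l i)))" unfolding G_def by (rule log_sum_integral[OF I l w])
 \<comment> \<open>The comparison function may be negative where the integrand of
   \<open>var_entropy\<close> is not, so its positive part is used.\<close>
 have int: "integrable lborel (\<lambda>r. max 0 (G r))" using G by (simp add: has_bochner_integral_iff)
 have "(\<Sum>i\<in>I. w i * (- ln (l i))) <= (\<integral>r. max 0 (G r) \<partial>lborel)"
 proof -
  have "(\<integral>r. G r \<partial>lborel) <= (\<integral>r. max 0 (G r) \<partial>lborel)"
   by (rule integral_mono[OF _ int]) (use G in \<open>auto simp: has_bochner_integral_iff\<close>)
  then show ?thesis using G by (simp add: has_bochner_integral_iff)
 qed
 then have "ennreal (\<Sum>i\<in>I. w i * (- ln (l i))) <= ennreal (\<integral>r. max 0 (G r) \<partial>lborel)" by (rule ennreal_leI)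
 also have "... = (\<integral>\<^sup>+ r. ennreal (max 0 (G r)) \<partial>lborel)" by (rule nn_integral_eq_integral[symmetric, OF int]) simp
 also have "... <= var_entropy f g" unfolding var_entropy_def
 proof (rule nn_integral_mono)
  fix r :: real
  show "ennreal (max 0 (G r)) <= ennreal ((1 / (1 + r) - kval f g r) / r) * indicator {0<..} r"
  proof (cases "r > 0")
   case True
   have "G r <= (1 / (1 + r) - kval f g r) / r" using True le[OF True] by (auto simp: G_def intro!: divide_right_mono)
   moreover have "0 <= (1 / (1 + r) - kval f g r) / r" using kval_scalar[OF fg True] True by simp
   ultimately show ?thesis using True by (simp add: ennreal_leI)
  qed (simp add: G_def)
 qed
 finally show ?thesis .
qed

lemma var_entropy_le:
 assumes fg: "nstate f" "nstate g"
  and I: "finite I" and l: "!!i. i \<in> I ==> l i > 0" and w: "(\<Sum>i\<in>I. w i) = 1"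
  and ge: "!!r. r > 0 ==> (\<Sum>i\<in>I. w i * (l i / (r + l i))) <= kval f g r"
 shows "var_entropy f g <= ennreal (\<Sum>i\<in>I. w i * (- ln (l i)))" "0 <= (\<Sum>i\<in>I. w i * (- ln (l i)))"
proof -
 define G where "G r = ((1 / (1 + r) - (\<Sum>i\<in>I. w i * (l i / (r + l i)))) / r) * indicator {0<..} r" for r
 have G: "has_bochner_integral lborel G (\<Sum>i\<in>I. w i * (- ln (l i)))" unfolding G_def by (rule log_sum_integral[OF I l w])
 have Gk: "(1 / (1 + r) - kval f g r) / r <= G r" if "r > 0" for r using that ge[OF that] by (auto simp: G_def intro!: divide_right_mono)
 have G0: "0 <= G r" for r
 proof (cases "r > 0")
  case True
  have "0 <= (1 / (1 + r) - kval f g r) / r" using kval_scalar[OF fg True] True by simp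
  then show ?thesis using Gk[OF True] by linarith
 qed (simp add: G_def)
 have "var_entropy f g <= (\<integral>\<^sup>+ r. ennreal (G r) \<partial>lborel)"
  unfolding var_entropy_def using Gk by (intro nn_integral_mono) (auto split: split_indicator intro: ennreal_leI)
 also have "... = ennreal (\<integral>r. G r \<partial>lborel)"
  using G G0 by (intro nn_integral_eq_integral) (auto simp: has_bochner_integral_iff)
 also have "(\<integral>r. G r \<partial>lborel) = (\<Sum>i\<in>I. w i * (- ln (l i)))" using G by (simp add: has_bochner_integral_iff)
 finally show "var_entropy f g <= ennreal (\<Sum>i\<in>I. w i * (- ln (l i)))" .
 show "0 <= (\<Sum>i\<in>I. w i * (- ln (l i)))"
 proof -
  have "0 <= (\<integral>r. G r \<partial>lborel)" using G0 by simp
  then show ?thesis using G by (simp add: has_bochner_integral_iff)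
 qed
qed

end

subsection \<open>Pinsker's inequality\<close>

text \<open>Origin of the constant 2 in Pinsker's inequality.\<close>

lemma pinsker_integral:
 fixes c :: real assumes c: "0 <= c"
 shows "(\<integral>\<^sup>+ r. ennreal (4 * c / (1 + r) ^ 3) * indicator {0..} r \<partial>lborel) = ennreal (2 * c)"
proof -
 have "(\<integral>\<^sup>+ r. ennreal (4 * c / (1 + r) ^ 3) * indicator {0..} r \<partial>lborel) = ennreal (0 - (- 2 * c / (1 + 0)\<^sup>2))"
 proof (rule nn_integral_FTC_atLeast)
  show "((\<lambda>r. - 2 * c / (1 + r)\<^sup>2) has_real_derivative 4 * c / (1 + r) ^ 3) (at r)" if "0 <= r" for r
  proof -
   define q where "q = 1 + r"
   have q: "q ~= 0" using that by (simp add: q_def)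
   then have "((\<lambda>r. - 2 * c / (1 + r)\<^sup>2) has_real_derivative - (- 2 * c * (2 * q)) / (q\<^sup>2 * q\<^sup>2)) (at r)"
    unfolding q_def by (auto intro!: derivative_eq_intros)
   also have "- (- 2 * c * (2 * q)) / (q\<^sup>2 * q\<^sup>2) = 4 * c / q ^ 3" using q by (simp add: power2_eq_square power3_eq_cube)
   finally show ?thesis by (simp add: q_def)
  qed
  show "((\<lambda>r. - 2 * c / (1 + r)\<^sup>2) \<longlongrightarrow> 0) at_top"
  proof (rule tendsto_divide_0[OF tendsto_const])
   have "filterlim (\<lambda>r :: real. (1 + r)\<^sup>2) at_top at_top"
    by (intro filterlim_pow_at_top filterlim_tendsto_add_at_top[OF tendsto_const] filterlim_ident) simp
   then show "filterlim (\<lambda>r :: real. (1 + r)\<^sup>2) at_infinity at_top" by (rule filterlim_at_top_imp_at_infinity)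
  qed
 qed (use c in auto)
 then show ?thesis by simp
qed

context vn_algebra
begin

text \<open>The trial operators \<open>x = s + u (2 a - 1)\<close> with \<open>s = r / (1 + r)\<close> and \<open>u = 2 r (f a - g a) / (1 + r)\<^sup>2\<close>.\<close>

lemma pinsker:
 assumes fg: "nstate f" "nstate g" and a: "a \<in> M" "psd a" "psd (\<I> - a)"
 shows "ennreal (2 * (f a - g a)\<^sup>2) <= var_entropy f g"
proof -
 note pf = nstate_pfun[OF fg(1)] and pg = nstate_pfun[OF fg(2)]
 define d where "d = f a - g a"
 define w where "w = 2 *\<^sub>R a - \<I>"
 have w: "w \<in> M" "adj w = w" using a psd_sa[OF a(2)] by (auto simp: w_def mem_rules adj_rules)
 \<comment> \<open>As a lies between 0 and 1, the square of w is at most 1: the deficit is 4 (a -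
   a^2).\<close>
 have "\<I> - w ** w = 4 *\<^sub>R (a - a ** a)" by (rule op_ext_inner) (simp add: w_def bilinear_simps algebra_simps)
 then have ww: "psd (\<I> - w ** w)" using root_contraction_square[OF a] by (simp add: psd_scaleR)
 have wle: "h (w ** w) <= 1" and hw: "h w = 2 * h a - 1" if "nstate h" for h
  using pfun_mono[OF nstate_pfun[OF that] _ id_mem ww] nstate_id[OF that] w a
  by (simp_all add: w_def pfun_rules[OF nstate_pfun[OF that]] mem_rules)
 have k: "4 * d\<^sup>2 / (1 + r) ^ 3 <= (1 / (1 + r) - kval f g r) / r" if r: "r > 0" for r
 proof -
  define t where "t = 1 / (1 + r)"
  \<comment> \<open>The minimizer of the quadratic that remains after \<open>f (w ** w)\<close> and
    \<open>g (w ** w)\<close> are replaced by their bound 1.\<close>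
  define u where "u = 2 * r * t\<^sup>2 * d"
  define x where "x = (r * t) *\<^sub>R \<I> + u *\<^sub>R w"
  have t: "t > 0" "r * t = 1 - t" using r by (auto simp: t_def field_simps)
  have x: "x \<in> M" "adj x = x" "\<I> - x = t *\<^sub>R \<I> - u *\<^sub>R w"
   using w by (auto simp: x_def t(2) mem_rules adj_rules scaleR_diff_left)
  have "f (adj (\<I> - x) ** (\<I> - x)) = t\<^sup>2 - 2 * t * u * f w + u\<^sup>2 * f (w ** w)" unfolding x(3) using w
   by (simp add: adj_rules op_simps pfun_rules[OF pf] mem_rules nstate_id[OF fg(1)] power2_eq_square algebra_simps)
  moreover have "g (x ** adj x) = (r * t)\<^sup>2 + 2 * (r * t) * u * g w + u\<^sup>2 * g (w ** w)" unfolding x(2) unfolding x_def using w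
   by (simp add: op_simps pfun_rules[OF pg] mem_rules nstate_id[OF fg(2)] power2_eq_square algebra_simps)
  ultimately have "kval f g r <= (t\<^sup>2 - 2 * t * u * f w + u\<^sup>2 * f (w ** w)) + ((r * t)\<^sup>2 + 2 * (r * t) * u * g w + u\<^sup>2 * g (w ** w)) / r"
   using kval_le[OF pf pg x(1) r] by (simp add: kform_def)
  also have "... <= (t\<^sup>2 - 2 * t * u * f w + u\<^sup>2 * 1) + ((r * t)\<^sup>2 + 2 * (r * t) * u * g w + u\<^sup>2 * 1) / r"
   using r by (intro add_mono divide_right_mono mult_left_mono wle fg order_refl) auto
  also have "... = t - r * (4 * d\<^sup>2 * t ^ 3)"
  proof -
   have "((r * t)\<^sup>2 + 2 * (r * t) * u * g w + u\<^sup>2 * 1) / r = r * t\<^sup>2 + 2 * t * u * g w + u * (2 * t\<^sup>2 * d)"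
    using r by (simp add: add_divide_distrib power2_eq_square u_def)
   moreover have "t\<^sup>2 + r * t\<^sup>2 = t" using arg_cong[OF t(2), of "\<lambda>z. t * (z + t)"] by (simp add: power2_eq_square algebra_simps)
   moreover have "u\<^sup>2 + u * (2 * t\<^sup>2 * d) = 4 * r * t ^ 3 * d\<^sup>2"
   proof -
    have "u\<^sup>2 + u * (2 * t\<^sup>2 * d) = 4 * r * t ^ 3 * d\<^sup>2 * (r * t + t)"
     by (simp add: u_def power2_eq_square power3_eq_cube algebra_simps)
    then show ?thesis by (simp add: t(2))
   qed
   moreover have "2 * t * u * f w - 2 * t * u * g w = 8 * r * t ^ 3 * d\<^sup>2"
    by (simp add: hw[OF fg(1)] hw[OF fg(2)] u_def d_def power2_eq_square power3_eq_cube algebra_simps)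
   ultimately show ?thesis by (simp add: algebra_simps)
  qed
  finally have "r * (4 * d\<^sup>2 * t ^ 3) <= t - kval f g r" by simp
  then have "4 * d\<^sup>2 * t ^ 3 <= (t - kval f g r) / r" using r by (simp add: pos_le_divide_eq mult.commute)
  then show ?thesis by (simp add: t_def power_divide)
 qed
 have "ennreal (2 * d\<^sup>2) = (\<integral>\<^sup>+ r. ennreal (4 * d\<^sup>2 / (1 + r) ^ 3) * indicator {0..} r \<partial>lborel)"
  by (rule pinsker_integral[symmetric]) simp
 also have "... <= var_entropy f g" unfolding var_entropy_def
  by (intro nn_integral_mono_AE, use AE_lborel_singleton[of 0] in eventually_elim)
   (auto intro!: ennreal_leI k split: split_indicator)
 finally show ?thesis by (simp add: d_def)
qed

end

section \<open>Two-sided estimates of the variational integrand by finite spectral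
  partitions\<close>

section \<open>Comparison with spectral partitions\<close>

context vn_algebra
begin

text \<open>Finitely many orthogonal projections in the centralizer of f.\<close>

definition orth_family :: "('h op => real) => 'i set => ('i => 'h op) => bool"
 where "orth_family f I e \<longleftrightarrow> finite I \<and> (\<forall>i\<in>I. e i \<in> M \<and> proj (e i)) \<and>
  (\<forall>i\<in>I. \<forall>k\<in>I. i ~= k --> e i ** e k = 0) \<and> (\<forall>i\<in>I. \<forall>x\<in>M. f (e i ** x) = f (x ** e i))"

lemma orth_familyD:
 assumes "orth_family f I e"
 shows "finite I" "!!i. i \<in> I ==> e i \<in> M" "!!i. i \<in> I ==> proj (e i)"
  "!!i k. i \<in> I ==> k \<in> I ==> i ~= k ==> e i ** e k = 0" "!!i x. i \<in> I ==> x \<in> M ==> f (e i ** x) = f (x ** e i)"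
 using assms unfolding orth_family_def by blast+

lemma orth_family_sum_proj:
 assumes e: "orth_family f I e" shows "proj (\<Sum>i\<in>I. e i)"
proof -
 note E = orth_familyD[OF e]
 have "(\<Sum>i\<in>I. e i) ** (\<Sum>i\<in>I. e i) = (\<Sum>i\<in>I. \<Sum>k\<in>I. e i ** e k)" unfolding op_sum by (rule sum.swap)
 also have "... = (\<Sum>i\<in>I. \<Sum>k\<in>I. if i = k then e i else 0)" using E by (intro sum.cong refl) (auto simp: proj_simps)
 also have "... = (\<Sum>i\<in>I. e i)" using E(1) by simp
 finally have "(\<Sum>i\<in>I. e i) ** (\<Sum>i\<in>I. e i) = (\<Sum>i\<in>I. e i)" .
 moreover have "adj (\<Sum>i\<in>I. e i) = (\<Sum>i\<in>I. e i)" unfolding adj_rules by (intro sum.cong refl proj_simps E)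
 ultimately show ?thesis unfolding proj_def by blast
qed

lemma orth_family_compress:
 assumes e: "orth_family f I e" and i: "i \<in> I" and x: "x \<in> M"
 shows "f (e i ** x ** e i) = f (e i ** x)"
proof -
 note E = orth_familyD[OF e]
 have "f ((e i ** x) ** e i) = f (e i ** (e i ** x))" using E(5)[OF i, of "e i ** x"] E(2)[OF i] x by (simp add: mem_rules)
 then show ?thesis using E(3)[OF i] by (simp add: proj_idem)
qed

lemma orth_family_sum_le:
 assumes f: "pfun f" and e: "orth_family f I e" and Y: "Y \<in> M" "psd Y"
 shows "(\<Sum>i\<in>I. f (e i ** Y ** e i)) <= f Y"
proof -
 note E = orth_familyD[OF e]
 define p where "p = (\<Sum>i\<in>I. e i)"
 have p: "proj p" "p \<in> M" using orth_family_sum_proj[OF e] E by (auto simp: p_def mem_rules)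
 have comm: "f (p ** x) = f (x ** p)" if "x \<in> M" for x using that E by (simp add: p_def op_sum pfun_sum[OF f] mem_rules)
 have "(\<Sum>i\<in>I. f (e i ** Y ** e i)) = f (p ** Y)"
  using orth_family_compress[OF e _ Y(1)] E Y by (simp add: p_def op_sum pfun_sum[OF f] mem_rules)
 moreover have "0 <= f ((\<I> - p) ** Y ** (\<I> - p))"
  using p Y by (intro pfun_nonneg[OF f] psd_conj_sa proj_simps proj_compl) (auto simp: mem_rules)
 moreover have "f ((\<I> - p) ** Y ** (\<I> - p)) = f Y - f (p ** Y)" using comm[of "p ** Y"] comm[OF Y(1)] p Y
  by (simp add: op_simps pfun_diff[OF f] mem_rules proj_idem)
 ultimately show ?thesis by simp
qed

text \<open>Bessel's inequality for the blocks of y: on the left by operator order, on the right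
  because the e i commute with f.\<close>

lemma orth_family_double_sum:
 assumes f: "pfun f" and e: "orth_family f I e" and h: "orth_family g J h" and y: "y \<in> M"
 shows "(\<Sum>i\<in>I. \<Sum>j\<in>J. f (adj (h j ** y ** e i) ** (h j ** y ** e i))) <= f (adj y ** y)"
proof -
 note E = orth_familyD[OF e] and H = orth_familyD[OF h]
 have "(\<Sum>j\<in>J. f (adj (h j ** y ** e i) ** (h j ** y ** e i))) <= f (e i ** (adj y ** y) ** e i)" if i: "i \<in> I" for i
 proof -
  have ye: "y ** e i \<in> M" using y E(2)[OF i] by (simp add: mem_rules)
  note c = pfun_conj[OF f ye]
  have "f (adj (y ** e i) ** (\<Sum>j\<in>J. h j) ** (y ** e i)) <= f (adj (y ** e i) ** \<I> ** (y ** e i))"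
   using H(2) by (intro pfun_mono[OF c] proj_le_id orth_family_sum_proj[OF h]) (auto simp: mem_rules)
  also have "adj (y ** e i) ** \<I> ** (y ** e i) = e i ** (adj y ** y) ** e i"
   using E(3)[OF i] by (simp add: adj_rules op_simps proj_simps)
  also have "f (adj (y ** e i) ** (\<Sum>j\<in>J. h j) ** (y ** e i)) = (\<Sum>j\<in>J. f (adj (y ** e i) ** h j ** (y ** e i)))"
   by (rule pfun_sum[OF c]) (rule H(2))
  also have "... = (\<Sum>j\<in>J. f (adj (h j ** y ** e i) ** (h j ** y ** e i)))"
   using H(3) by (intro sum.cong refl) (simp add: adj_rules op_simps proj_simps proj_idem)
  finally show ?thesis .
 qed
 then have "(\<Sum>i\<in>I. \<Sum>j\<in>J. f (adj (h j ** y ** e i) ** (h j ** y ** e i))) <= (\<Sum>i\<in>I. f (e i ** (adj y ** y) ** e i))" by (rule sum_mono)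
 also have "... <= f (adj y ** y)" using y by (intro orth_family_sum_le[OF f e]) (auto simp: mem_rules psd_square)
 finally show ?thesis .
qed

text \<open>The operators \<open>h j ** e i\<close> are orthogonal for the form
  \<open>f (adj x ** y)\<close>, since e i' can be moved around cyclically under f.\<close>

lemma orth_family_product:
 assumes f: "pfun f" and e: "orth_family f I e" and h: "orth_family g J h" and i: "i \<in> I" "i' \<in> I" and j: "j \<in> J" "j' \<in> J"
 shows "f (adj (h j ** e i) ** (h j' ** e i')) = (if i = i' \<and> j = j' then f (e i ** h j) else 0)"
proof -
 note E = orth_familyD[OF e] and H = orth_familyD[OF h]
 have "adj (h j ** e i) ** (h j' ** e i') = (e i ** (h j ** h j')) ** e i'"
  using E(3)[OF i(1)] H(3)[OF j(1)] by (simp add: adj_rules proj_simps op_simps)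
 also have "f ... = f ((e i' ** e i) ** (h j ** h j'))"
  using E(5)[OF i(2), of "e i ** (h j ** h j')"] E(2)[OF i(1)] H(2) j by (simp add: mem_rules op_simps)
 finally show ?thesis using E(4)[OF i(2,1)] E(3)[OF i(1)] H(4)[OF j] H(3)[OF j(1)]
  by (auto simp: proj_simps op_simps(12,13) pfun_zero[OF f])
qed

lemma orth_square_sum:
 assumes f: "pfun f" and P: "finite P" "!!p. p \<in> P ==> u p \<in> M"
  and orth: "!!p q. p \<in> P ==> q \<in> P ==> f (adj (u p) ** u q) = (if p = q then w p else 0)"
 shows "f (adj (\<Sum>p\<in>P. c p *\<^sub>R u p) ** (\<Sum>p\<in>P. c p *\<^sub>R u p)) = (\<Sum>p\<in>P. (c p)\<^sup>2 * w p)"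
proof -
 have "f (adj (\<Sum>p\<in>P. c p *\<^sub>R u p) ** (\<Sum>p\<in>P. c p *\<^sub>R u p)) = f (\<Sum>p\<in>P. \<Sum>q\<in>P. (c p * c q) *\<^sub>R (adj (u p) ** u q))"
  by (simp add: adj_rules op_sum op_simps scaleR_sum_right)
   (subst sum.swap, simp add: mult.commute)
 also have "... = (\<Sum>p\<in>P. \<Sum>q\<in>P. (c p * c q) * f (adj (u p) ** u q))"
  using P by (simp add: pfun_sum[OF f] pfun_scaleR[OF f] mem_rules)
 also have "... = (\<Sum>p\<in>P. \<Sum>q\<in>P. if p = q then (c p)\<^sup>2 * w p else 0)"
  by (intro sum.cong refl) (auto simp: orth power2_eq_square)
 also have "... = (\<Sum>p\<in>P. (c p)\<^sup>2 * w p)" using P by simp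
 finally show ?thesis .
qed

end

context traced_algebra
begin

text \<open>Expresses that the density of f is at most T on the corner of p, without reference to
  the density.\<close>

definition dominated :: "('h op => real) => 'h op => real => bool"
 where "dominated f p T \<longleftrightarrow> (\<forall>c\<in>M. psd c --> p ** c ** p = c --> ennreal (f c) <= ennreal T * \<tau> c)"

definition dominates :: "('h op => real) => 'h op => real => bool"
 where "dominates f p T \<longleftrightarrow> (\<forall>c\<in>M. psd c --> p ** c ** p = c --> ennreal T * \<tau> c <= ennreal (f c))"

text \<open>The trace is the bridge between the two functionals: \<open>adj b ** b\<close> lies
  under p, \<open>b ** adj b\<close> lies under q, and the two have equal trace.\<close>

lemma transfer_square:
 assumes f: "pfun f" and g: "pfun g" and p: "proj p" "p \<in> M" "proj q" "q \<in> M"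
  and T: "0 < T" "dominated f p T" and S: "0 <= S" "dominates g q S"
  and b: "b \<in> M" "b ** p = b" "q ** b = b"
 shows "S / T * f (adj b ** b) <= g (b ** adj b)"
proof -
 have b': "p ** adj b = adj b" "adj b ** q = adj b"
  using arg_cong[OF b(2), of adj] arg_cong[OF b(3), of adj] p by (simp_all add: adj_rules proj_simps)
 have 1: "ennreal (f (adj b ** b)) <= ennreal T * \<tau> (adj b ** b)"
 proof -
  have "p ** (adj b ** b) ** p = (p ** adj b) ** (b ** p)" by (simp only: op_simps(1))
  then have "p ** (adj b ** b) ** p = adj b ** b" by (simp only: b b')
  then show ?thesis using T b unfolding dominated_def by (simp add: mem_rules psd_square)
 qed
 have 2: "ennreal S * \<tau> (b ** adj b) <= ennreal (g (b ** adj b))"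
 proof -
  have "q ** (b ** adj b) ** q = (q ** b) ** (adj b ** q)" by (simp only: op_simps(1))
  then have "q ** (b ** adj b) ** q = b ** adj b" by (simp only: b b')
  then show ?thesis using S b unfolding dominates_def by (simp add: mem_rules psd_square)
 qed
 have "ennreal S * ennreal (f (adj b ** b)) <= ennreal S * (ennreal T * \<tau> (adj b ** b))" using 1 by (rule mult_left_mono) simp
 also have "... = ennreal T * (ennreal S * \<tau> (b ** adj b))" using tau_square[OF b(1)] by (simp add: mult.left_commute)
 also have "... <= ennreal T * ennreal (g (b ** adj b))" using 2 by (rule mult_left_mono) simp
 finally have "ennreal (S * f (adj b ** b)) <= ennreal (T * g (b ** adj b))"
  using S T pfun_nonneg[OF f] pfun_nonneg[OF g] b by (simp add: ennreal_mult mem_rules psd_square)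
 then have "S * f (adj b ** b) <= T * g (b ** adj b)"
  using T pfun_nonneg[OF g] b by (subst (asm) ennreal_le_iff) (auto simp: mem_rules psd_square)
 then show ?thesis using T by (simp add: field_simps)
qed

text \<open>1 - x and x are cut into blocks A and B with A + B = \<open>h j ** e i\<close>.
  \<open>transfer_square\<close> bounds the g-square of B below by l = S j / T i times its f-square;
  then |A|^2 + t |B|^2 >= t / (1 + t) |A + B|^2 with t = l / r.\<close>

lemma kform_lower:
 assumes f: "pfun f" and g: "pfun g" and e: "orth_family f I e" and h: "orth_family g J h"
  and T: "!!i. i \<in> I ==> 0 < T i" "!!i. i \<in> I ==> dominated f (e i) (T i)"
  and S: "!!j. j \<in> J ==> 0 <= S j" "!!j. j \<in> J ==> dominates g (h j) (S j)"
  and x: "x \<in> M" and r: "r > 0"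
 shows "(\<Sum>i\<in>I. \<Sum>j\<in>J. f (e i ** h j) * ((S j / T i) / (r + S j / T i))) <= kform f g r x"
proof -
 note E = orth_familyD[OF e] and H = orth_familyD[OF h]
 define y where "y = \<I> - x"
 have y: "y \<in> M" using x by (simp add: y_def mem_rules)
 define a where "a i j = h j ** y ** e i" for i j
 define b where "b i j = h j ** x ** e i" for i j
 have ab: "a i j \<in> M" "b i j \<in> M" if "i \<in> I" "j \<in> J" for i j
  using E(2)[OF that(1)] H(2)[OF that(2)] x y by (auto simp: a_def b_def mem_rules)
 have 1: "(\<Sum>i\<in>I. \<Sum>j\<in>J. f (adj (a i j) ** a i j)) <= f (adj y ** y)"
  unfolding a_def by (rule orth_family_double_sum[OF f e h y])
 have "(\<Sum>j\<in>J. \<Sum>i\<in>I. g (adj (adj (b i j)) ** adj (b i j))) = (\<Sum>j\<in>J. \<Sum>i\<in>I. g (adj (e i ** adj x ** h j) ** (e i ** adj x ** h j)))"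
  using E(3) H(3) by (intro sum.cong refl arg_cong[where f = g]) (simp add: b_def adj_rules op_simps proj_simps)
 also have "... <= g (adj (adj x) ** adj x)" using x by (intro orth_family_double_sum[OF g h e]) (simp add: mem_rules)
 finally have 2: "(\<Sum>i\<in>I. \<Sum>j\<in>J. g (b i j ** adj (b i j))) <= g (x ** adj x)" by (subst sum.swap) simp
 have summand: "f (e i ** h j) * ((S j / T i) / (r + S j / T i)) <= f (adj (a i j) ** a i j) + g (b i j ** adj (b i j)) / r"
  if i: "i \<in> I" and j: "j \<in> J" for i j
 proof -
  define l where "l = S j / T i"
  have l: "0 <= l" using S(1)[OF j] T(1)[OF i] by (simp add: l_def)
  define A B where "A = a i j" and "B = b i j"
  have AB: "A \<in> M" "B \<in> M" using ab[OF i j] by (auto simp: A_def B_def)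
  have sum: "A + B = h j ** e i" by (simp add: A_def B_def a_def b_def y_def op_simps)
  have "f (e i ** h j) = f (e i ** h j ** e i)" using orth_family_compress[OF e i H(2)[OF j]] by simp
  also have "e i ** h j ** e i = adj (A + B) ** (A + B)"
   unfolding sum using E(3)[OF i] H(3)[OF j] by (simp add: adj_rules op_simps proj_simps proj_idem)
  also have "f ... = f (adj A ** A) + 2 * f (adj A ** B) + f (adj B ** B)"
  proof -
   have "f (adj B ** A) = f (adj A ** B)" using pfun_adj[OF f, of "adj A ** B"] AB by (simp add: mem_rules adj_rules)
   then show ?thesis using AB by (simp add: adj_rules op_simps pfun_add[OF f] mem_rules)
  qed
  finally have w: "f (e i ** h j) = f (adj A ** A) + 2 * f (adj A ** B) + f (adj B ** B)" .
  \<comment> \<open>\<open>A - t *\<^sub>R B\<close> vanishes at the optimal splitting of A + B; its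
    square is 1 + t times the gap in the bound.\<close>
  define t where "t = l / r"
  have "0 <= f (adj (A - t *\<^sub>R B) ** (A - t *\<^sub>R B))" using AB by (intro pfun_nonneg[OF f] psd_square) (auto simp: mem_rules)
  also have "... = f (adj A ** A) - 2 * t * f (adj A ** B) + t\<^sup>2 * f (adj B ** B)"
  proof -
   have "f (adj B ** A) = f (adj A ** B)" using pfun_adj[OF f, of "adj A ** B"] AB by (simp add: mem_rules adj_rules)
   then show ?thesis using AB by (simp add: adj_rules op_simps pfun_rules[OF f] mem_rules power2_eq_square algebra_simps)
  qed
  finally have q: "0 <= f (adj A ** A) - 2 * t * f (adj A ** B) + t\<^sup>2 * f (adj B ** B)" .
  have t: "l = r * t" "0 <= t" using r l by (auto simp: t_def)
  have frac: "l / (r + l) = t / (1 + t)" unfolding t(1) using r t(2)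
   by (metis distrib_left mult.right_neutral mult_divide_mult_cancel_left order_less_irrefl)
  have "f (e i ** h j) * (l / (r + l)) <= f (adj A ** A) + t * f (adj B ** B)"
  proof -
   have "f (e i ** h j) * t <= (f (adj A ** A) + t * f (adj B ** B)) * (1 + t)"
    using q unfolding w by (simp add: algebra_simps power2_eq_square)
   then show ?thesis unfolding frac using t(2) by (simp add: pos_divide_le_eq)
  qed
  also have "t * f (adj B ** B) = (l * f (adj B ** B)) / r" by (simp add: t_def)
  also have "... <= g (B ** adj B) / r" unfolding l_def using r AB E(2,3)[OF i] H(2,3)[OF j] T[OF i] S[OF j]
   by (intro divide_right_mono transfer_square[OF f g, of "e i" "h j"])
    (auto simp: B_def b_def op_simps proj_simps proj_idem)
  finally show ?thesis by (simp add: l_def A_def B_def)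
 qed
 have "(\<Sum>i\<in>I. \<Sum>j\<in>J. f (e i ** h j) * ((S j / T i) / (r + S j / T i)))
   <= (\<Sum>i\<in>I. \<Sum>j\<in>J. f (adj (a i j) ** a i j) + g (b i j ** adj (b i j)) / r)" by (intro sum_mono summand)
 also have "... = (\<Sum>i\<in>I. \<Sum>j\<in>J. f (adj (a i j) ** a i j)) + (\<Sum>i\<in>I. \<Sum>j\<in>J. g (b i j ** adj (b i j))) / r"
  by (simp add: sum.distrib sum_divide_distrib)
 also have "... <= kform f g r x" unfolding kform_def y_def[symmetric] using 1 2 r by (intro add_mono divide_right_mono) auto
 finally show ?thesis .
qed

text \<open>The trial operator is the sum of the blocks \<open>h j ** e i\<close> with coefficients
  d = r / (r + l), which minimize (1 - d)^2 + d^2 l / r. The blocks are orthogonal for both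
  functionals, and f does not see 1 - p.\<close>

lemma kval_upper:
 assumes f: "pfun f" and g: "pfun g" and e: "orth_family f I e" and h: "orth_family g J h"
  and p: "(\<Sum>i\<in>I. e i) = p" "(\<Sum>j\<in>J. h j) = p" "f (\<I> - p) = 0"
  and T: "!!i. i \<in> I ==> 0 < T i" "!!i. i \<in> I ==> dominates f (e i) (T i)"
  and S: "!!j. j \<in> J ==> 0 < S j" "!!j. j \<in> J ==> dominated g (h j) (S j)"
  and r: "r > 0"
 shows "kval f g r <= (\<Sum>i\<in>I. \<Sum>j\<in>J. f (e i ** h j) * ((S j / T i) / (r + S j / T i)))"
proof -
 note E = orth_familyD[OF e] and H = orth_familyD[OF h]
 define P where "P = I \<times> J"
 define u where "u q = h (snd q) ** e (fst q)" for q
 define l where "l q = S (snd q) / T (fst q)" for q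
 define w where "w q = f (e (fst q) ** h (snd q))" for q
 define v where "v q = g (h (snd q) ** e (fst q))" for q
 define d where "d q = r / (r + l q)" for q
 have finP: "finite P" using E H by (simp add: P_def)
 have uM: "u q \<in> M" if "q \<in> P" for q using that E H by (auto simp: u_def P_def mem_rules)
 have lp: "l q > 0" if "q \<in> P" for q using that T(1) S(1) by (auto simp: l_def P_def)
 have of: "f (adj (u q) ** u q') = (if q = q' then w q else 0)" if "q \<in> P" "q' \<in> P" for q q'
  using that orth_family_product[OF f e h, of "fst q" "fst q'" "snd q" "snd q'"] by (auto simp: u_def w_def P_def prod_eq_iff)
 have au: "adj (u q) = e (fst q) ** h (snd q)" if "q \<in> P" for q using that E(3) H(3) by (auto simp: u_def P_def adj_rules proj_simps)
 have og: "g (adj (adj (u q)) ** adj (u q')) = (if q = q' then v q else 0)" if "q \<in> P" "q' \<in> P" for q q'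
  using that orth_family_product[OF g h e, of "snd q" "snd q'" "fst q" "fst q'"] unfolding au[OF that(1)] au[OF that(2)]
  by (auto simp: v_def P_def prod_eq_iff)
 define x where "x = (\<Sum>q\<in>P. d q *\<^sub>R u q)"
 have xM: "x \<in> M" using uM by (auto simp: x_def mem_rules)
 have pp: "proj p" "p \<in> M" using orth_family_sum_proj[OF e] sum_mem[of I e, OF E(2)] unfolding p(1) by simp_all
 have usum: "(\<Sum>q\<in>P. u q) = p"
 proof -
  have "(\<Sum>q\<in>P. u q) = (\<Sum>j\<in>J. h j) ** (\<Sum>i\<in>I. e i)"
   unfolding P_def u_def by (simp add: op_sum sum.cartesian_product split_def)
  then show ?thesis using pp by (simp add: p proj_simps)
 qed
 define c where "c q = l q / (r + l q)" for q
 have dc: "1 - d q = c q" if "q \<in> P" for q using lp[OF that] r by (simp add: d_def c_def field_simps)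
 define z where "z = (\<Sum>q\<in>P. c q *\<^sub>R u q)"
 have zM: "z \<in> M" using uM by (auto simp: z_def mem_rules)
 have Ix: "\<I> - x = (\<I> - p) + z"
 proof -
  have "z = (\<Sum>q\<in>P. u q - d q *\<^sub>R u q)" unfolding z_def by (intro sum.cong refl) (simp add: dc[symmetric] scaleR_diff_left)
  then show ?thesis by (simp add: sum_subtractf usum x_def)
 qed
 have pz: "p ** z = z"
 proof -
  have "p ** u q = u q" if "q \<in> P" for q
  proof -
   have j: "snd q \<in> J" using that by (auto simp: P_def)
   have "p ** h (snd q) = (\<Sum>j\<in>J. if j = snd q then h (snd q) else 0)"
    unfolding p(2)[symmetric] op_sum using H(3,4) j by (intro sum.cong refl) (auto simp: proj_simps)
   then have "p ** h (snd q) = h (snd q)" using H(1) j by simp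
   then show ?thesis by (simp add: u_def op_simps(1)[symmetric])
  qed
  then show ?thesis by (simp add: z_def op_sum op_simps)
 qed
 have zp: "adj z ** p = adj z" using arg_cong[OF pz, of adj] pp by (simp add: adj_rules proj_simps)
 have ff: "f (adj (\<I> - x) ** (\<I> - x)) = (\<Sum>q\<in>P. (c q)\<^sup>2 * w q)"
 proof -
  have "adj (\<I> - x) ** (\<I> - x) = (\<I> - p) + adj z ** z" unfolding Ix using pp by (simp add: adj_rules op_simps proj_simps pz zp)
  then have "f (adj (\<I> - x) ** (\<I> - x)) = f (adj z ** z)" using pp zM p(3) by (simp add: pfun_add[OF f] mem_rules)
  then show ?thesis unfolding z_def using orth_square_sum[OF f finP uM of] by simp
 qed
 have gg: "g (x ** adj x) = (\<Sum>q\<in>P. (d q)\<^sup>2 * v q)"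
 proof -
  have "adj x = (\<Sum>q\<in>P. d q *\<^sub>R adj (u q))" by (simp add: x_def adj_rules)
  moreover have "x = adj (adj x)" by simp
  ultimately show ?thesis using orth_square_sum[OF g finP _ og, of d] uM by (simp add: mem_rules)
 qed
 \<comment> \<open>\<open>transfer_square\<close> with the roles of f and g exchanged bounds the
   weights of g by those of f.\<close>
 have vw: "v q <= l q * w q" if q: "q \<in> P" for q
 proof -
  obtain i j where ij: "q = (i, j)" "i \<in> I" "j \<in> J" using q by (auto simp: P_def)
  note e' = E(2,3)[OF ij(2)] and h' = H(2,3)[OF ij(3)]
  have u: "u q = h j ** e i" "adj (u q) = e i ** h j" using e' h' by (simp_all add: u_def ij adj_rules proj_simps)
  have "dominates f (e i) (T i)" "dominated g (h j) (S j)" using T S ij by auto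
  then have "T i / S j * g (adj (e i ** h j) ** (e i ** h j)) <= f ((e i ** h j) ** adj (e i ** h j))"
   using e' h' T(1)[OF ij(2)] S(1)[OF ij(3)]
   by (intro transfer_square[OF g f, of "h j" "e i"]) (auto simp: mem_rules op_simps proj_simps proj_idem)
  moreover have "g (adj (e i ** h j) ** (e i ** h j)) = v q" using og[OF q q] unfolding u(2) by simp
  moreover have "f ((e i ** h j) ** adj (e i ** h j)) = w q" using of[OF q q] u(2) by (metis adj_simps(1))
  ultimately show ?thesis using T(1)[OF ij(2)] S(1)[OF ij(3)] by (simp add: l_def ij field_simps)
 qed
 have "kval f g r <= kform f g r x" by (rule kval_le[OF f g xM r])
 also have "... = (\<Sum>q\<in>P. (c q)\<^sup>2 * w q + (d q)\<^sup>2 * v q / r)"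
  by (simp add: kform_def ff gg sum.distrib sum_divide_distrib)
 also have "... <= (\<Sum>q\<in>P. w q * (l q / (r + l q)))"
 proof (rule sum_mono)
  fix q assume q: "q \<in> P"
  have d0: "r + l q > 0" using lp[OF q] r by simp
  have "(d q)\<^sup>2 * v q / r <= (d q)\<^sup>2 * (l q * w q) / r" using r vw[OF q] by (intro divide_right_mono mult_left_mono) auto
  moreover have "(c q)\<^sup>2 * w q + (d q)\<^sup>2 * (l q * w q) / r = w q * (l q / (r + l q))"
  proof -
   have "(d q)\<^sup>2 * (l q * w q) / r = r * l q * w q / (r + l q)\<^sup>2" using r by (simp add: d_def power_divide power2_eq_square)
   then have "(c q)\<^sup>2 * w q + (d q)\<^sup>2 * (l q * w q) / r = ((l q)\<^sup>2 * w q + r * l q * w q) / (r + l q)\<^sup>2"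
    by (simp add: c_def power_divide add_divide_distrib)
   also have "(l q)\<^sup>2 * w q + r * l q * w q = w q * l q * (r + l q)" by (simp add: power2_eq_square algebra_simps)
   also have "w q * l q * (r + l q) / (r + l q)\<^sup>2 = w q * (l q / (r + l q))" using d0 by (simp add: power2_eq_square)
   finally show ?thesis .
  qed
  ultimately show "(c q)\<^sup>2 * w q + (d q)\<^sup>2 * v q / r <= w q * (l q / (r + l q))" by simp
 qed
 also have "... = (\<Sum>i\<in>I. \<Sum>j\<in>J. f (e i ** h j) * ((S j / T i) / (r + S j / T i)))"
  unfolding P_def w_def l_def by (simp add: sum.cartesian_product split_def)
 finally show ?thesis .
qed

lemma density_orth_family:
 assumes d: "has_density e f" and f: "pfun f" and I: "finite I"
  and A: "!!i. i \<in> I ==> A i \<in> sets borel" "!!i k. i \<in> I ==> k \<in> I ==> i ~= k ==> A i \<inter> A k = {}"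
 shows "orth_family f I (\<lambda>i. e (A i))" unfolding orth_family_def
 using I psr_mem[OF density_psr[OF d]] psr_proj[OF density_psr[OF d]] density_commute[OF d f] A
 by (auto simp: psr_Int[OF density_psr[OF d]] psr_empty[OF density_psr[OF d]])

lemma density_dominated:
 assumes d: "has_density e f" and A: "A \<in> sets borel" "A \<subseteq> {a..b}" "0 <= a"
 shows "dominates f (e A) a" "dominated f (e A) b" unfolding dominates_def dominated_def using density_bounds[OF d A] by blast+

end

section \<open>The logarithmic integral over the joint spectral measure compared with the
  variational form\<close>

section \<open>The relative entropy dominates its variational form\<close>

text \<open>\<lambda> / (r + \<lambda>) for \<lambda> = s / t, where (t, s) are values of the two
  densities; the fraction is expanded by t and set to 0 off the open quadrant.\<close>

definition modular_kernel :: "real => real \<times> real => real"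
 where "modular_kernel r q = (if 0 < fst q \<and> 0 < snd q then snd q / (r * fst q + snd q) else 0)"

lemma modular_kernel_measurable [measurable]: "case_prod modular_kernel \<in> borel_measurable (borel \<Otimes>\<^sub>M (borel \<Otimes>\<^sub>M borel))"
 unfolding modular_kernel_def by measurable

lemma modular_kernel_measurable1 [measurable]: "modular_kernel r \<in> borel_measurable (borel \<Otimes>\<^sub>M borel)"
 unfolding modular_kernel_def by measurable

lemma modular_kernel_nonneg: "r > 0 ==> 0 <= modular_kernel r q" by (simp add: modular_kernel_def)

lemma modular_kernel_pos: "t > 0 ==> s > 0 ==> r > 0 ==> modular_kernel r (t, s) = (s / t) / (r + s / t)"
proof -
 assume a: "t > 0" "s > 0" "r > 0"
 then have "r + s / t = (r * t + s) / t" by (simp add: field_simps)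
 then show ?thesis using a by (simp add: modular_kernel_def)
qed

text \<open>Replacing t by the upper and s by the lower end of its cell loses at most a factor
  \<theta> each in s / t.\<close>

lemma modular_kernel_geo:
 assumes th: "\<theta> > 1" and t: "t \<in> geo \<theta> k" and s: "s \<in> geo \<theta> l" and r: "r > 0"
 defines "T \<equiv> \<theta> powr (real_of_int k + 1)" and "S \<equiv> \<theta> powr real_of_int l"
 shows "modular_kernel r (t, s) <= \<theta>\<^sup>2 * ((S / T) / (r + S / T))"
proof -
 have pos: "t > 0" "s > 0" "T > 0" "S > 0" using geo_pos th t s by (auto simp: T_def S_def)
 have tT: "T <= \<theta> * t" using t th by (simp add: geo_def T_def powr_add)
 have sS: "s <= \<theta> * S" using s th by (simp add: geo_def S_def powr_add mult.commute)
 have "s * (r * T + S) <= (\<theta>\<^sup>2 * S) * (r * t + s)"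
 proof -
  have "s * (r * T) <= (\<theta> * S) * (r * (\<theta> * t))" using pos tT sS th r by (intro mult_mono) auto
  moreover have "s * S <= (\<theta>\<^sup>2 * S) * s" using pos th by (simp add: mult.commute)
  ultimately show ?thesis by (simp add: power2_eq_square algebra_simps)
 qed
 moreover have "(S / T) / (r + S / T) = S / (r * T + S)" using pos by (simp add: field_simps)
 moreover have "r * T + S > 0" "r * t + s > 0" using pos r by (simp_all add: add_pos_pos)
 ultimately show ?thesis using pos by (simp add: modular_kernel_def pos_divide_le_eq pos_le_divide_eq)
qed

lemma entropy_density_integral:
 fixes l :: real assumes l: "l > 0"
 shows "(\<integral>\<^sup>+ r. ennreal ((1 / (1 + r) - l / (r + l)) / r) * indicator {0<..} r \<partial>lborel) = ennreal (- ln l)"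
  and "(\<integral>\<^sup>+ r. ennreal (- ((1 / (1 + r) - l / (r + l)) / r)) * indicator {0<..} r \<partial>lborel) = ennreal (ln l)"
proof -
 define G where "G r = (1 / (r + l) - 1 / (1 + r)) * indicator {0<..} r" for r :: real
 have G: "has_bochner_integral lborel G (- ln l)" unfolding G_def by (rule log_integral[OF l])
 have eq: "(\<integral>\<^sup>+ r. ennreal ((1 / (1 + r) - l / (r + l)) / r) * indicator {0<..} r \<partial>lborel) = (\<integral>\<^sup>+ r. ennreal (G r) \<partial>lborel)"
  "(\<integral>\<^sup>+ r. ennreal (- ((1 / (1 + r) - l / (r + l)) / r)) * indicator {0<..} r \<partial>lborel) = (\<integral>\<^sup>+ r. ennreal (- G r) \<partial>lborel)"
  by (intro nn_integral_cong; auto simp: G_def log_integrand l split: split_indicator)+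
 consider "l <= 1" | "1 <= l" by linarith
 then have "(\<integral>\<^sup>+ r. ennreal (G r) \<partial>lborel) = ennreal (- ln l) \<and> (\<integral>\<^sup>+ r. ennreal (- G r) \<partial>lborel) = ennreal (ln l)"
 proof cases
  case 1
  have "0 <= G r" for r using 1 l by (auto simp: G_def split: split_indicator intro!: divide_left_mono)
  moreover from this have "(\<integral>\<^sup>+ r. ennreal (G r) \<partial>lborel) = ennreal (- ln l)"
   using nn_integral_eq_integral[of lborel G] G by (simp add: has_bochner_integral_iff)
  ultimately show ?thesis using 1 l by (simp add: ennreal_neg)
 next
  case 2
  have "0 <= - G r" for r using 2 l by (auto simp: G_def split: split_indicator intro!: divide_left_mono)
  moreover from this have "(\<integral>\<^sup>+ r. ennreal (- G r) \<partial>lborel) = ennreal (ln l)"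
   using nn_integral_eq_integral[of lborel "\<lambda>r. - G r"] G by (simp add: has_bochner_integral_iff)
  ultimately show ?thesis using 2 l by (simp add: ennreal_neg)
 qed
 then show "(\<integral>\<^sup>+ r. ennreal ((1 / (1 + r) - l / (r + l)) / r) * indicator {0<..} r \<partial>lborel) = ennreal (- ln l)"
  "(\<integral>\<^sup>+ r. ennreal (- ((1 / (1 + r) - l / (r + l)) / r)) * indicator {0<..} r \<partial>lborel) = ennreal (ln l)"
  using eq by simp_all
qed

context traced_algebra
begin

text \<open>Nonnegativity: since e A commutes with f, the value equals that of the positive
  compression \<open>e A ** h B ** e A\<close>.\<close>

lemma density_bimeasure:
 assumes f: "nfun f" and d: "has_density e f" and h: "psr h"
 shows "bimeasure (\<lambda>A B. f (e A ** h B))"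
proof
 note pf = nfun_pfun[OF f] and e = density_psr[OF d]
 fix A B :: "real set" assume AB: "A \<in> sets borel" "B \<in> sets borel"
 have "f (e A ** h B) = f (e A ** h B ** e A)" using density_compress[OF d pf AB(1) psr_mem[OF h AB(2)]] by simp
 then show "0 <= f (e A ** h B)" using psr_mem[OF e AB(1)] psr_mem[OF h AB(2)] psr_psd[OF h AB(2)] psr_proj[OF e AB(1)]
  by (auto intro!: pfun_nonneg[OF pf] psd_conj_sa proj_simps simp: mem_rules)
next
 note pf = nfun_pfun[OF f] and e = density_psr[OF d]
 fix A :: "nat => real set" and B :: "real set"
 assume A: "range A \<subseteq> sets borel" "disjoint_family A" and B: "B \<in> sets borel"
 show "(\<lambda>k. f (e (A k) ** h B)) sums f (e (\<Union>k. A k) ** h B)" by (rule nfun_psr_sums[OF f e A psr_mem[OF h B]])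
next
 note pf = nfun_pfun[OF f] and e = density_psr[OF d]
 fix A :: "real set" and B :: "nat => real set"
 assume A: "A \<in> sets borel" and B: "range B \<subseteq> sets borel" "disjoint_family B"
 have BB: "B k \<in> sets borel" for k using B by auto
 then have U: "(\<Union>k<n. B k) \<in> sets borel" "(\<Union>k. B k) \<in> sets borel" for n by auto
 have "(\<lambda>n. f (e A ** h (\<Union>k<n. B k))) \<longlonglongrightarrow> f (e A ** h (\<Union>k. B k))"
 proof (rule nfun_wcont[OF f sequentially_bot])
  show "e A ** h (\<Union>k<n. B k) \<in> M" for n using psr_mem[OF e A] psr_mem[OF h U(1)] by (simp add: mem_rules)
  show "norm (e A ** h (\<Union>k<n. B k)) <= 1 * 1" for n
   by (intro order_trans[OF norm_blinfun_compose] mult_mono psr_norm[OF e A] psr_norm[OF h U(1)]) auto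
  show "wlim sequentially (\<lambda>n. e A ** h (\<Union>k<n. B k)) (e A ** h (\<Union>k. B k))"
   by (rule wlim_compose_left[OF psr_wlim[OF h B]])
 qed
 moreover have "f (e A ** h (\<Union>k<n. B k)) = (\<Sum>k<n. f (e A ** h (B k)))" for n using B psr_mem[OF e A] psr_mem[OF h BB]
  by (subst psr_finite_UN[OF h]) (auto simp: op_sum pfun_sum[OF pf] mem_rules intro: disjoint_family_on_mono)
 ultimately show "(\<lambda>k. f (e A ** h (B k))) sums f (e A ** h (\<Union>k. B k))" by (simp add: sums_def)
qed

text \<open>On a product of cells the kernel is at most \<theta>^2 times the summand of
  \<open>kform_lower\<close>, which bounds every finite part of the integral; then \<theta> ->
  1.\<close>

lemma kernel_integral_le:
 assumes fg: "nfun f" "nfun g" and d: "has_density e f" "has_density h g" and r: "r > 0"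
  and nu: "sets \<nu> = sets borel" "!!A B. A \<in> sets borel ==> B \<in> sets borel ==> emeasure \<nu> (A \<times> B) = ennreal (f (e A ** h B))"
 shows "(\<integral>\<^sup>+ q. ennreal (modular_kernel r q) \<partial>\<nu>) <= ennreal (kval f g r)"
proof -
 note pf = nfun_pfun[OF fg(1)] and pg = nfun_pfun[OF fg(2)]
 note e = density_psr[OF d(1)] and h = density_psr[OF d(2)]
 interpret bimeasure "\<lambda>A B. f (e A ** h B)" by (rule density_bimeasure[OF fg(1) d(1) h])
 note [measurable_cong] = nu(1)[unfolded borel_prod[symmetric]]
 have step: "(\<integral>\<^sup>+ q. ennreal (modular_kernel r q) \<partial>\<nu>) <= ennreal (\<theta>\<^sup>2 * kval f g r)" if th: "\<theta> > 1" for \<theta>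
 proof -
  define G where "G n = geo \<theta> (int_decode n)" for n
  define T where "T n = \<theta> powr (real_of_int (int_decode n) + 1)" for n
  define S where "S n = \<theta> powr real_of_int (int_decode n)" for n
  have TS: "T n > 0" "S n > 0" for n using th by (auto simp: T_def S_def)
  define c where "c i j = (S j / T i) / (r + S j / T i)" for i j
  have c0: "0 <= c i j" for i j using TS(1)[of i] TS(2)[of j] r by (simp add: c_def)
  have GB: "G n \<in> sets borel" for n by (simp add: G_def)
  have GI: "G n \<subseteq> {S n..T n}" for n by (auto simp: G_def geo_def S_def T_def)
  have Gd: "G i \<inter> G k = {}" if "i ~= k" for i k
   using geo_disjoint[OF th, of "int_decode i" "int_decode k"] that by (simp add: G_def inj_eq[OF inj_int_decode])
  define i where "i p = fst (prod_decode p)" for p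
  define j where "j p = snd (prod_decode p)" for p
  have "(\<integral>\<^sup>+ q. ennreal (modular_kernel r q) \<partial>\<nu>) <=
    (\<integral>\<^sup>+ q. (\<Sum>p. ennreal (\<theta>\<^sup>2 * c (i p) (j p)) * indicator (G (i p) \<times> G (j p)) q) \<partial>\<nu>)"
  proof (rule nn_integral_mono)
   fix q :: "real \<times> real"
   show "ennreal (modular_kernel r q) <= (\<Sum>p. ennreal (\<theta>\<^sup>2 * c (i p) (j p)) * indicator (G (i p) \<times> G (j p)) q)"
   proof (cases "0 < fst q \<and> 0 < snd q")
    case True
    obtain k where k: "fst q \<in> geo \<theta> k" using geo_cover[OF th] True by blast
    obtain l where l: "snd q \<in> geo \<theta> l" using geo_cover[OF th] True by blast
    define p where "p = prod_encode (int_encode k, int_encode l)"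
    have p: "i p = int_encode k" "j p = int_encode l" by (simp_all add: i_def j_def p_def)
    have "modular_kernel r q <= \<theta>\<^sup>2 * c (i p) (j p)" using modular_kernel_geo[OF th k l r] by (simp add: c_def S_def T_def p)
    then have "ennreal (modular_kernel r q) <= ennreal (\<theta>\<^sup>2 * c (i p) (j p)) * indicator (G (i p) \<times> G (j p)) q"
     using k l by (simp add: p G_def indicator_def mem_Times_iff ennreal_leI)
    also have "... <= (\<Sum>p. ennreal (\<theta>\<^sup>2 * c (i p) (j p)) * indicator (G (i p) \<times> G (j p)) q)"
    proof -
     have "X p <= suminf X" for X :: "nat => ennreal" using sum_le_suminf[of X "{p}"] by simp
     then show ?thesis .
    qed
    finally show ?thesis .
   qed (auto simp: modular_kernel_def)
  qed
  also have "... = (\<Sum>p. \<integral>\<^sup>+ q. ennreal (\<theta>\<^sup>2 * c (i p) (j p)) * indicator (G (i p) \<times> G (j p)) q \<partial>\<nu>)"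
   using GB by (intro nn_integral_suminf) simp
  also have "... = (\<Sum>p. ennreal (\<theta>\<^sup>2 * (f (e (G (i p)) ** h (G (j p))) * c (i p) (j p))))"
  proof (rule suminf_cong)
   fix p
   have "G (i p) \<times> G (j p) \<in> sets \<nu>" using GB by measurable
   then show "(\<integral>\<^sup>+ q. ennreal (\<theta>\<^sup>2 * c (i p) (j p)) * indicator (G (i p) \<times> G (j p)) q \<partial>\<nu>) =
     ennreal (\<theta>\<^sup>2 * (f (e (G (i p)) ** h (G (j p))) * c (i p) (j p)))"
    using c0 GB by (subst nn_integral_cmult_indicator) (simp_all add: nu(2) nonneg ennreal_mult[symmetric] mult_ac)
  qed
  also have "... <= ennreal (\<theta>\<^sup>2 * kval f g r)"
  proof (rule suminf_le_const[OF summableI])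
   fix N
   define I where "I = i ` {..<N}"
   define J where "J = j ` {..<N}"
   have inj: "inj_on (\<lambda>p. (i p, j p)) {..<N}" by (rule inj_onI) (metis i_def j_def prod.collapse prod_decode_inverse)
   have "(\<Sum>p<N. f (e (G (i p)) ** h (G (j p))) * c (i p) (j p)) =
     (\<Sum>q\<in>(\<lambda>p. (i p, j p)) ` {..<N}. f (e (G (fst q)) ** h (G (snd q))) * c (fst q) (snd q))"
    by (subst sum.reindex[OF inj]) simp
   \<comment> \<open>\<open>kform_lower\<close> needs a full product of index sets, so the first N
     pairs are enlarged to one.\<close>
   also have "... <= (\<Sum>q\<in>I \<times> J. f (e (G (fst q)) ** h (G (snd q))) * c (fst q) (snd q))"
    using c0 GB by (intro sum_mono2) (auto simp: I_def J_def nonneg)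
   also have "... = (\<Sum>i\<in>I. \<Sum>j\<in>J. f (e (G i) ** h (G j)) * c i j)" by (simp add: sum.cartesian_product split_def)
   also have "... <= kval f g r"
   proof (rule kval_ge)
    fix x assume x: "x \<in> M"
    show "(\<Sum>i\<in>I. \<Sum>j\<in>J. f (e (G i) ** h (G j)) * c i j) <= kform f g r x" unfolding c_def
    proof (rule kform_lower[OF pf pg _ _ _ _ _ _ x r])
     show "orth_family f I (\<lambda>i. e (G i))" "orth_family g J (\<lambda>j. h (G j))"
      by (rule density_orth_family[OF d(1) pf], auto simp: I_def GB Gd)
       (rule density_orth_family[OF d(2) pg], auto simp: J_def GB Gd)
     show "dominated f (e (G i)) (T i)" for i by (rule density_dominated(2)[OF d(1) GB GI less_imp_le[OF TS(2)]])
     show "dominates g (h (G j)) (S j)" for j by (rule density_dominated(1)[OF d(2) GB GI less_imp_le[OF TS(2)]])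
    qed (use TS in \<open>auto intro: less_imp_le\<close>)
   qed
   finally have "(\<Sum>p<N. f (e (G (i p)) ** h (G (j p))) * c (i p) (j p)) <= kval f g r" .
   then have "ennreal (\<theta>\<^sup>2 * (\<Sum>p<N. f (e (G (i p)) ** h (G (j p))) * c (i p) (j p))) <= ennreal (\<theta>\<^sup>2 * kval f g r)"
    by (intro ennreal_leI mult_left_mono) auto
   then show "(\<Sum>p<N. ennreal (\<theta>\<^sup>2 * (f (e (G (i p)) ** h (G (j p))) * c (i p) (j p)))) <= ennreal (\<theta>\<^sup>2 * kval f g r)"
    using c0 GB by (subst sum_ennreal) (auto simp: sum_distrib_left nonneg)
  qed
  finally show ?thesis .
 qed
 have "(\<lambda>n. ennreal ((1 + 1 / real (Suc n))\<^sup>2 * kval f g r)) \<longlonglongrightarrow> ennreal ((1 + 0)\<^sup>2 * kval f g r)"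
  by (intro tendsto_ennrealI tendsto_intros LIMSEQ_Suc[OF lim_const_over_n])
 then have "(\<integral>\<^sup>+ q. ennreal (modular_kernel r q) \<partial>\<nu>) <= ennreal ((1 + 0)\<^sup>2 * kval f g r)"
  by (rule LIMSEQ_le_const) (intro exI allI impI step; simp)
 then show ?thesis by simp
qed

text \<open>Tonelli's theorem applied to log t - log s as an integral over r. Positive and negative
  parts are kept on opposite sides, so that nothing infinite is subtracted.\<close>

lemma var_entropy_le_integral:
 assumes fg: "nstate f" "nstate g" and d: "has_density e f" "has_density h g"
  and nu: "sets \<nu> = sets borel" "!!A B. A \<in> sets borel ==> B \<in> sets borel ==> emeasure \<nu> (A \<times> B) = ennreal (f (e A ** h B))"
 shows "(\<integral>\<^sup>+ (t, s). e2ennreal (elog s - elog t) \<partial>\<nu>) + var_entropy f g <= (\<integral>\<^sup>+ (t, s). e2ennreal (elog t - elog s) \<partial>\<nu>)"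
proof -
 note pf = nstate_pfun[OF fg(1)] and pg = nstate_pfun[OF fg(2)]
 note e = density_psr[OF d(1)] and h = density_psr[OF d(2)]
 note [measurable_cong] = nu(1)[unfolded borel_prod[symmetric]]
 have sp: "space \<nu> = UNIV" using sets_eq_imp_space_eq[OF nu(1)] by simp
 have tot: "emeasure \<nu> UNIV = 1" using nu(2)[of UNIV UNIV] psr_UNIV[OF e] psr_UNIV[OF h] by (simp add: op_simps nstate_id[OF fg(1)])
 interpret fin: finite_measure \<nu> by (rule finite_measureI) (simp add: sp tot)
 interpret pair_sigma_finite \<nu> lborel ..
 define psi where "psi r q = (1 / (1 + r) - modular_kernel r q) / r" for r q
 have [measurable]: "case_prod psi \<in> borel_measurable (borel \<Otimes>\<^sub>M (borel \<Otimes>\<^sub>M borel))"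
  unfolding psi_def by measurable
 have [measurable]: "psi r \<in> borel_measurable (borel \<Otimes>\<^sub>M borel)" for r unfolding psi_def by measurable
 have inner: "(\<integral>\<^sup>+ q. ennreal (- psi r q) \<partial>\<nu>) + ennreal ((1 / (1 + r) - kval f g r) / r) <= (\<integral>\<^sup>+ q. ennreal (psi r q) \<partial>\<nu>)"
  if r: "r > 0" for r
 proof -
  have k: "0 <= kval f g r" "kval f g r <= 1 / (1 + r)" using kval_nonneg[OF pf pg r] kval_scalar[OF fg r] by auto
  have "(\<integral>\<^sup>+ q. ennreal (- psi r q) \<partial>\<nu>) + ennreal (1 / (1 + r) / r) =
    (\<integral>\<^sup>+ q. ennreal (- psi r q) + ennreal (1 / (1 + r) / r) \<partial>\<nu>)" by (subst nn_integral_add) (auto simp: sp tot)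
  also have "... = (\<integral>\<^sup>+ q. ennreal (psi r q) + ennreal (1 / r) * ennreal (modular_kernel r q) \<partial>\<nu>)"
  proof (rule nn_integral_cong)
   fix q
   define a b where "a = 1 / (1 + r) / r" and "b = modular_kernel r q / r"
   have ab: "0 <= a" "0 <= b" "psi r q = a - b"
    using r modular_kernel_nonneg[OF r] by (simp_all add: a_def b_def psi_def diff_divide_distrib)
   have "ennreal (- (a - b)) + ennreal a = ennreal (a - b) + ennreal b"
   proof (cases "a <= b")
    case True then show ?thesis using ab(1,2) by (simp add: ennreal_neg flip: ennreal_plus)
   next
    case False then show ?thesis using ab(1,2) by (simp add: ennreal_neg flip: ennreal_plus)
   qed
   moreover have "ennreal b = ennreal (1 / r) * ennreal (modular_kernel r q)"
    using r modular_kernel_nonneg[OF r] by (simp add: b_def flip: ennreal_mult)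
   ultimately show "ennreal (- psi r q) + ennreal (1 / (1 + r) / r) = ennreal (psi r q) + ennreal (1 / r) * ennreal (modular_kernel r q)"
    by (simp add: ab(3) a_def)
  qed
  also have "... = (\<integral>\<^sup>+ q. ennreal (psi r q) \<partial>\<nu>) + ennreal (1 / r) * (\<integral>\<^sup>+ q. ennreal (modular_kernel r q) \<partial>\<nu>)"
   by (subst nn_integral_add) (auto simp: nn_integral_cmult)
  also have "... <= (\<integral>\<^sup>+ q. ennreal (psi r q) \<partial>\<nu>) + ennreal (1 / r) * ennreal (kval f g r)"
   by (intro add_left_mono mult_left_mono kernel_integral_le[OF nstate_nfun[OF fg(1)] nstate_nfun[OF fg(2)] d r nu]) auto
  finally have "(\<integral>\<^sup>+ q. ennreal (- psi r q) \<partial>\<nu>) + ennreal (1 / (1 + r) / r) <= (\<integral>\<^sup>+ q. ennreal (psi r q) \<partial>\<nu>) + ennreal (kval f g r / r)"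
   using r k by (simp flip: ennreal_mult)
  moreover have "ennreal (1 / (1 + r) / r) = ennreal ((1 / (1 + r) - kval f g r) / r) + ennreal (kval f g r / r)"
  proof -
   have "ennreal ((1 / (1 + r) - kval f g r) / r) + ennreal (kval f g r / r) = ennreal ((1 / (1 + r) - kval f g r) / r + kval f g r / r)"
    using r k by (intro ennreal_plus[symmetric]) auto
   then show ?thesis by (simp add: diff_divide_distrib)
  qed
  ultimately have "ennreal (kval f g r / r) + ((\<integral>\<^sup>+ q. ennreal (- psi r q) \<partial>\<nu>) + ennreal ((1 / (1 + r) - kval f g r) / r))
    <= ennreal (kval f g r / r) + (\<integral>\<^sup>+ q. ennreal (psi r q) \<partial>\<nu>)" by (simp add: add_ac)
  then show ?thesis by (simp add: ennreal_add_left_cancel_le)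
 qed
 \<comment> \<open>The joint measure does not charge t <= 0, because f vanishes on
   \<open>e {..0}\<close>.\<close>
 have pos: "AE q in \<nu>. 0 < fst q"
 proof -
  have "{..0} \<times> UNIV \<in> null_sets \<nu>"
  proof (rule null_setsI)
   show "emeasure \<nu> ({..0} \<times> UNIV) = 0"
    using nu(2)[of "{..0}" UNIV] psr_UNIV[OF h] density_nonpos[OF d(1) pf] by (simp add: op_simps)
   show "{..0} \<times> UNIV \<in> sets \<nu>" by measurable
  qed
  then show ?thesis by (rule AE_I') auto
 qed
 have elogs: "e2ennreal (elog t - elog s) = ennreal (- ln (s / t))" "e2ennreal (elog s - elog t) = ennreal (ln (s / t))"
  if "t > 0" "s > 0" for t s using that by (simp_all add: elog_def ln_div e2ennreal_ereal)
 have "(\<integral>\<^sup>+ (t, s). e2ennreal (elog s - elog t) \<partial>\<nu>) <= (\<integral>\<^sup>+ q. (\<integral>\<^sup>+ r. ennreal (- psi r q) * indicator {0<..} r \<partial>lborel) \<partial>\<nu>)"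
 proof (rule nn_integral_mono_AE, rule AE_mp[OF pos], rule AE_I2, rule impI)
  fix q :: "real \<times> real" assume q: "0 < fst q"
  show "(case q of (t, s) => e2ennreal (elog s - elog t)) <= (\<integral>\<^sup>+ r. ennreal (- psi r q) * indicator {0<..} r \<partial>lborel)"
  proof (cases "0 < snd q")
   case True
   define l where "l = snd q / fst q"
   have l: "l > 0" using q True by (simp add: l_def)
   have "(\<integral>\<^sup>+ r. ennreal (- psi r q) * indicator {0<..} r \<partial>lborel) =
     (\<integral>\<^sup>+ r. ennreal (- ((1 / (1 + r) - l / (r + l)) / r)) * indicator {0<..} r \<partial>lborel)"
    using modular_kernel_pos[OF q True] by (intro nn_integral_cong) (auto simp: psi_def l_def split: split_indicator)
   also have "... = ennreal (ln l)" by (rule entropy_density_integral[OF l])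
   finally show ?thesis using elogs(2)[OF q True] by (simp add: split_def l_def)
  next
   case False
   then show ?thesis using q by (simp add: split_def elog_def e2ennreal_neg)
  qed
 qed
 then have "(\<integral>\<^sup>+ (t, s). e2ennreal (elog s - elog t) \<partial>\<nu>) + var_entropy f g <=
   (\<integral>\<^sup>+ q. (\<integral>\<^sup>+ r. ennreal (- psi r q) * indicator {0<..} r \<partial>lborel) \<partial>\<nu>) + var_entropy f g"
  by (rule add_right_mono)
 also have "(\<integral>\<^sup>+ q. (\<integral>\<^sup>+ r. ennreal (- psi r q) * indicator {0<..} r \<partial>lborel) \<partial>\<nu>) =
   (\<integral>\<^sup>+ r. (\<integral>\<^sup>+ q. ennreal (- psi r q) * indicator {0<..} r \<partial>\<nu>) \<partial>lborel)"
  by (rule Fubini'[symmetric]) measurable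
 also have "... + var_entropy f g = (\<integral>\<^sup>+ r. (\<integral>\<^sup>+ q. ennreal (- psi r q) * indicator {0<..} r \<partial>\<nu>) +
   ennreal ((1 / (1 + r) - kval f g r) / r) * indicator {0<..} r \<partial>lborel)" unfolding var_entropy_def
 proof (rule nn_integral_add[symmetric])
  show "(\<lambda>r. \<integral>\<^sup>+ q. ennreal (- psi r q) * indicator {0<..} r \<partial>\<nu>) \<in> borel_measurable lborel"
   by (rule fin.borel_measurable_nn_integral) measurable
  show "(\<lambda>r. ennreal ((1 / (1 + r) - kval f g r) / r) * indicator {0<..} r) \<in> borel_measurable lborel"
   using var_entropy_measurable[OF fg] by simp
 qed
 also have "... <= (\<integral>\<^sup>+ r. (\<integral>\<^sup>+ q. ennreal (psi r q) * indicator {0<..} r \<partial>\<nu>) \<partial>lborel)"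
  using inner by (intro nn_integral_mono) (auto split: split_indicator)
 also have "... = (\<integral>\<^sup>+ q. (\<integral>\<^sup>+ r. ennreal (psi r q) * indicator {0<..} r \<partial>lborel) \<partial>\<nu>)"
  by (rule Fubini') measurable
 also have "... <= (\<integral>\<^sup>+ (t, s). e2ennreal (elog t - elog s) \<partial>\<nu>)"
 proof (rule nn_integral_mono_AE, rule AE_mp[OF pos], rule AE_I2, rule impI)
  fix q :: "real \<times> real" assume q: "0 < fst q"
  show "(\<integral>\<^sup>+ r. ennreal (psi r q) * indicator {0<..} r \<partial>lborel) <= (case q of (t, s) => e2ennreal (elog t - elog s))"
  proof (cases "0 < snd q")
   case True
   define l where "l = snd q / fst q"
   have l: "l > 0" using q True by (simp add: l_def)
   have "(\<integral>\<^sup>+ r. ennreal (psi r q) * indicator {0<..} r \<partial>lborel) =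
     (\<integral>\<^sup>+ r. ennreal ((1 / (1 + r) - l / (r + l)) / r) * indicator {0<..} r \<partial>lborel)"
    using modular_kernel_pos[OF q True] by (intro nn_integral_cong) (auto simp: psi_def l_def split: split_indicator)
   also have "... = ennreal (- ln l)" by (rule entropy_density_integral[OF l])
   finally show ?thesis using elogs(1)[OF q True] by (simp add: split_def l_def)
  next
   \<comment> \<open>For s <= 0 the right-hand side is infinite, by the value of
     \<open>elog\<close>.\<close>
   case False
   then show ?thesis using q by (simp add: split_def elog_def)
  qed
 qed
 finally show ?thesis .
qed

lemma joint_spectral_measure:
 assumes f: "nfun (\<lambda>x. Re (\<rho> x))" and d: "has_density e (\<lambda>x. Re (\<rho> x))" and h: "psr h"
 shows "sets (joint_spectral_measure \<rho> e h) = sets borel"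
  "!!A B. A \<in> sets borel ==> B \<in> sets borel ==> emeasure (joint_spectral_measure \<rho> e h) (A \<times> B) = ennreal (Re (\<rho> (e A ** h B)))"
proof -
 interpret bimeasure "\<lambda>A B. Re (\<rho> (e A ** h B))" by (rule density_bimeasure[OF f d h])
 have "joint_spectral_measure \<rho> e h = ext" unfolding joint_spectral_measure_def ext_def ..
 then show "sets (joint_spectral_measure \<rho> e h) = sets borel"
  "!!A B. A \<in> sets borel ==> B \<in> sets borel ==> emeasure (joint_spectral_measure \<rho> e h) (A \<times> B) = ennreal (Re (\<rho> (e A ** h B)))"
  using ext by simp_all
qed

lemma density_of: "nfun (\<lambda>x. Re (\<rho> x)) ==> has_density (density_of M \<tau> \<rho>) (\<lambda>x. Re (\<rho> x))"
 unfolding density_of_def is_density_iff by (rule someI_ex[where P = "\<lambda>e. has_density e (\<lambda>x. Re (\<rho> x))"]) (rule density_exists)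

theorem relative_entropy_ge:
 assumes "nstate (\<lambda>x. Re (\<rho> x))" "nstate (\<lambda>x. Re (\<sigma> x))"
 shows "enn2ereal (var_entropy (\<lambda>x. Re (\<rho> x)) (\<lambda>x. Re (\<sigma> x))) <= relative_entropy M \<tau> \<rho> \<sigma>"
proof -
 note n = nstate_nfun[OF assms(1)] nstate_nfun[OF assms(2)]
 note d = density_of[OF n(1)] density_of[OF n(2)]
 note J = joint_spectral_measure[OF n(1) d(1) density_psr[OF d(2)]]
 define a where "a = (\<integral>\<^sup>+ (t, s). e2ennreal (elog t - elog s) \<partial>joint_spectral_measure \<rho> (density_of M \<tau> \<rho>) (density_of M \<tau> \<sigma>))"
 define b where "b = (\<integral>\<^sup>+ (t, s). e2ennreal (elog s - elog t) \<partial>joint_spectral_measure \<rho> (density_of M \<tau> \<rho>) (density_of M \<tau> \<sigma>))"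
 have le: "b + var_entropy (\<lambda>x. Re (\<rho> x)) (\<lambda>x. Re (\<sigma> x)) <= a"
  unfolding a_def b_def by (rule var_entropy_le_integral[OF assms d J])
 have "relative_entropy M \<tau> \<rho> \<sigma> = enn2ereal a - enn2ereal b" by (simp add: relative_entropy_def a_def b_def Let_def)
 moreover have "enn2ereal v <= enn2ereal a - enn2ereal b" if "b + v <= a" for v
 proof (cases "b = \<infinity>")
  \<comment> \<open>Then a is infinite too, and \<infinity> - \<infinity> is \<infinity> in
    \<open>ereal\<close>.\<close>
  case True
  then have "a = \<infinity>" using that by (simp add: top_unique)
  then show ?thesis using True by simp
 next
  case False
  then have "enn2ereal v = enn2ereal (b + v) - enn2ereal b"  by (cases b; cases v) (auto simp: enn2ereal_ennreal plus_ennreal.rep_eq)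
  also have "... <= enn2ereal a - enn2ereal b" using that by (intro ereal_minus_mono) (simp_all add: less_eq_ennreal.rep_eq)
  finally show ?thesis .
 qed
 ultimately show ?thesis using le by simp
qed

end

section \<open>Donald's inequality and the chain rule for conditional expectations\<close>

section \<open>Donald's inequality\<close>

text \<open>Infima over tails increase with the index, so their suprema can be added.\<close>

lemma liminf_pair_le:
 fixes a b :: "nat => ennreal"
 assumes X: "X <= liminf a" and Y: "Y <= liminf b" and R: "!!n. a n + c * b n <= R"
 shows "X + c * Y <= R"
proof -
 define A where "A n = (INF m\<in>{n..}. a m)" for n
 define B where "B n = (INF m\<in>{n..}. b m)" for n
 have mono: "incseq A" "incseq B" by (auto simp: incseq_def A_def B_def intro!: INF_superset_mono)
 have le: "A n <= a n" "B n <= b n" for n by (auto simp: A_def B_def intro: INF_lower)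
 have "X + c * Y <= (SUP n. A n) + c * (SUP n. B n)" using X Y by (intro add_mono mult_left_mono) (auto simp: liminf_SUP_INF A_def B_def)
 also have "... = (SUP n. A n) + (SUP n. c * B n)" by (simp add: SUP_mult_left_ennreal)
 also have "... = (SUP n. A n + c * B n)" using mono by (intro ennreal_SUP_add[symmetric]) (auto simp: incseq_def intro: mult_left_mono)
 also have "... <= R" by (intro SUP_least) (rule order_trans[OF add_mono[OF le(1) mult_left_mono[OF le(2)]] R], simp)
 finally show ?thesis .
qed

context vn_algebra
begin

lemma var_entropy_cong:
 assumes "!!x. x \<in> M ==> f x = f' x" "!!x. x \<in> M ==> g x = g' x"
 shows "var_entropy f g = var_entropy f' g'"
proof -
 have "kval f g r = kval f' g' r" for r unfolding kval_def kform_def by (intro INF_cong refl) (simp add: assms mem_rules)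
 then show ?thesis by (simp add: var_entropy_def)
qed

end

context traced_algebra
begin

text \<open>T i is the value of the density on e i up to the factor \<theta>, so the sum of the
  \<open>ln (T i) *\<^sub>R e i\<close> approximates the logarithm of the density within ln
  \<theta>.\<close>

definition spectral_partition :: "'h op => ('h op => real) => real => 'i set => ('i => 'h op) => ('i => real) => bool"
 where "spectral_partition p f \<theta> I e T \<longleftrightarrow> orth_family f I e \<and> (\<Sum>i\<in>I. e i) = p \<and>
  (\<forall>i\<in>I. 0 < T i \<and> dominates f (e i) (T i) \<and> dominated f (e i) (\<theta> * T i))"

text \<open>On p the density lies between \<alpha> and \<beta>, so only finitely many cells carry a
  nonzero projection. That \<open>e {0<..}\<close> is p itself uses that f vanishes off p and
  dominates \<alpha> \<tau> on it.\<close>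

lemma spectral_partition_exists:
 assumes f: "nfun f" and p: "proj p" "p \<in> M" "f (\<I> - p) = 0"
  and a: "\<alpha> > 0" "dominates f p \<alpha>" and b: "dominated f p \<beta>" and th: "\<theta> > 1"
 shows "\<exists>I e T. spectral_partition p f \<theta> (I :: int set) e T"
proof -
 note pf = nfun_pfun[OF f]
 obtain e where d: "has_density e f" using density_exists[OF f] by blast
 note e = density_psr[OF d]
 have e0: "e {..0} ** p = 0"
 proof -
  define q where "q = e {..0}"
  have q: "q \<in> M" "proj q" "psd q" using psr_mem[OF e] psr_proj[OF e] psr_psd[OF e] by (auto simp: q_def)
  have c: "p ** q ** p \<in> M" "psd (p ** q ** p)" using p q by (auto simp: mem_rules psd_conj_sa proj_simps)
  have f0: "f (p ** q ** p) = 0" using support_eq(3)[OF pf p q(1)] density_nonpos[OF d pf] by (simp add: q_def)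
  have "p ** (p ** q ** p) ** p = p ** q ** p" using p by (simp add: op_simps proj_simps proj_idem)
  then have "ennreal \<alpha> * \<tau> (p ** q ** p) <= ennreal (f (p ** q ** p))" using a(2) c unfolding dominates_def by blast
  then have "\<tau> (p ** q ** p) = 0" unfolding f0 using a(1) by simp
  then have "p ** q ** p = 0" using tau_faithful c by blast
  moreover have "adj (q ** p) ** (q ** p) = p ** q ** p" using p q by (simp add: adj_rules proj_simps op_simps proj_idem)
  ultimately show ?thesis unfolding q_def by (metis square_zero)
 qed
 have e1: "e {0<..} ** (\<I> - p) = 0"
 proof -
  define u where "u = \<I> - p"
  have u: "u \<in> M" "psd u" "proj u" using p by (auto simp: u_def mem_rules proj_psd proj_compl)
  have E: "e {0<..} \<in> M" "proj (e {0<..})" using psr_mem[OF e] psr_proj[OF e] by auto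
  have "(\<integral>\<^sup>+ t. ennreal t \<partial>spec_measure e u) = 0" using d u p(3) by (simp add: has_density_def u_def)
  then have "AE t in spec_measure e u. ennreal t = 0" by (subst (asm) nn_integral_0_iff_AE) auto
  then have "AE t in spec_measure e u. t \<notin> {0<..}" by eventually_elim (simp add: ennreal_eq_0_iff)
  then have "emeasure (spec_measure e u) {0<..} = 0" by (subst (asm) AE_iff_measurable[where N = "{0<..}"]) auto
  then have "\<tau> (e {0<..} ** u ** e {0<..}) = 0" using emeasure_spec_measure[OF e u(1,2)] by simp
  moreover have "e {0<..} ** u ** e {0<..} \<in> M" "psd (e {0<..} ** u ** e {0<..})"
   using u E by (auto simp: mem_rules psd_conj_sa proj_simps)
  ultimately have "e {0<..} ** u ** e {0<..} = 0" using tau_faithful by blast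
  moreover have "adj (u ** e {0<..}) ** (u ** e {0<..}) = e {0<..} ** u ** e {0<..}"
   using u E by (simp add: adj_rules proj_simps op_simps proj_idem)
  ultimately have "u ** e {0<..} = 0" by (metis square_zero)
  from arg_cong[OF this, of adj] show ?thesis using u E by (simp add: adj_rules proj_simps flip: u_def)
 qed
 have ep: "e {0<..} = p"
 proof -
  have "e {0<..} = \<I> - e {..0}" using psr_Compl[OF e, of "{..0}"] by (simp add: Compl_atMost)
  then have "e {0<..} ** p = p" using e0 by (simp add: op_simps)
  then show ?thesis using e1 by (simp add: op_simps)
 qed
 \<comment> \<open>Indices of the cells that can meet the interval from \<alpha> to \<beta>.\<close>
 define K where "K = {k. \<alpha> <= \<theta> powr (real_of_int k + 1) \<and> \<theta> powr real_of_int k <= \<beta>}"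
 have finK: "finite K"
 proof (rule finite_subset)
  show "K \<subseteq> {\<lfloor>log \<theta> \<alpha>\<rfloor> - 1..\<lceil>log \<theta> \<beta>\<rceil>}"
  proof
   fix k assume k: "k \<in> K"
   then have "\<beta> > 0" using th by (auto simp: K_def intro: less_le_trans[rotated])
   then have "log \<theta> \<alpha> <= real_of_int k + 1" "real_of_int k <= log \<theta> \<beta>"
    using k a(1) th by (auto simp: K_def log_le_iff le_log_iff)
   then show "k \<in> {\<lfloor>log \<theta> \<alpha>\<rfloor> - 1..\<lceil>log \<theta> \<beta>\<rceil>}" by (auto; linarith)
  qed
 qed simp
 have zero: "e (geo \<theta> k) = 0" if k: "k \<notin> K" for k
 proof -
  define u where "u = e (geo \<theta> k)"
  have u: "u \<in> M" "psd u" "proj u" using psr_mem[OF e] psr_psd[OF e] psr_proj[OF e] by (auto simp: u_def)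
  have sub: "geo \<theta> k \<inter> {0<..} = geo \<theta> k" using geo_pos[OF th] by auto
  have pu: "p ** u = u" "u ** p = u"
   using psr_Int[OF e, of "geo \<theta> k" "{0<..}"] psr_Int[OF e, of "{0<..}" "geo \<theta> k"] sub by (simp_all add: ep u_def Int_commute)
  have pup: "p ** u ** p = u" by (simp add: pu)
  have uu: "e (geo \<theta> k) ** u ** e (geo \<theta> k) = u" using u by (simp add: u_def[symmetric] proj_simps)
  have 1: "ennreal \<alpha> * \<tau> u <= ennreal (f u)" "ennreal (f u) <= ennreal \<beta> * \<tau> u"
   using a(2) b u pup unfolding dominates_def dominated_def by auto
  have sub': "geo \<theta> k \<subseteq> {\<theta> powr real_of_int k..\<theta> powr (real_of_int k + 1)}" by (auto simp: geo_def)
  have 2: "ennreal (\<theta> powr real_of_int k) * \<tau> u <= ennreal (f u)" "ennreal (f u) <= ennreal (\<theta> powr (real_of_int k + 1)) * \<tau> u"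
   using density_bounds[OF d geo_borel sub' _ u(1,2) uu] by auto
  have fin: "\<tau> u ~= \<infinity>" using 1(1) a(1) by (auto simp: ennreal_mult_top top_unique)
  have "\<tau> u = 0"
  proof (rule ccontr)
   assume "\<tau> u ~= 0"
   then have "x <= y" if "x * \<tau> u <= y * \<tau> u" for x y
    using that ennreal_mult_le_mult_iff[of "\<tau> u" x y] fin by (simp add: mult.commute[of _ "\<tau> u"])
   from this[OF order_trans[OF 1(1) 2(2)]] this[OF order_trans[OF 2(1) 1(2)]]
   show False using k th by (auto simp: K_def ennreal_le_iff2)
  qed
  then have "u = 0" using tau_faithful u by blast
  then show ?thesis by (simp add: u_def)
 qed
 have disj: "disjoint_family_on (geo \<theta>) K" using geo_disjoint[OF th] by (auto simp: disjoint_family_on_def)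
 \<comment> \<open>The cells outside K, indexed by all naturals with empty sets in between, so that
   countable additivity applies.\<close>
 define R where "R n = (if int_decode n \<in> K then {} else geo \<theta> (int_decode n))" for n
 have R: "range R \<subseteq> sets borel" "disjoint_family R" using geo_disjoint_family[OF th] by (auto simp: R_def disjoint_family_on_def)
 have "e (\<Union>n. R n) = 0"
 proof (rule blinfun_eqI)
  fix v
  have "(\<lambda>k. e (R k) v) sums e (\<Union>n. R n) v" by (rule psr_sums[OF e R])
  moreover have "e (R k) = 0" for k by (simp add: R_def zero psr_empty[OF e])
  ultimately show "e (\<Union>n. R n) v = (0 :: 'h op) v" by (simp add: sums_unique[symmetric] sums_iff)
 qed
 moreover have "{0<..} = (\<Union>k\<in>K. geo \<theta> k) \<union> (\<Union>n. R n)"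
 proof (intro equalityI subsetI)
  fix t :: real assume "t \<in> {0<..}"
  then obtain k where k: "t \<in> geo \<theta> k" using geo_cover[OF th] by auto
  show "t \<in> (\<Union>k\<in>K. geo \<theta> k) \<union> (\<Union>n. R n)"
  proof (cases "k \<in> K")
   case False
   then have "t \<in> R (int_encode k)" using k by (simp add: R_def)
   then show ?thesis by blast
  qed (use k in auto)
 qed (use geo_pos[OF th] in \<open>auto simp: R_def split: if_splits\<close>)
 moreover have "(\<Union>k\<in>K. geo \<theta> k) \<inter> (\<Union>n. R n) = {}"
 proof -
  have "geo \<theta> k \<inter> R n = {}" if "k \<in> K" for k n using geo_disjoint[OF th, of k "int_decode n"] that by (auto simp: R_def)
  then show ?thesis by blast
 qed
 moreover have "(\<Union>k\<in>K. geo \<theta> k) \<in> sets borel" "(\<Union>n. R n) \<in> sets borel" using finK R by (auto intro!: sets.finite_UN)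
 ultimately have "e {0<..} = e (\<Union>k\<in>K. geo \<theta> k)" using psr_Un[OF e] by simp
 then have sum: "(\<Sum>k\<in>K. e (geo \<theta> k)) = p" using psr_finite_UN[OF e _ disj finK] ep by simp
 have "spectral_partition p f \<theta> K (\<lambda>k. e (geo \<theta> k)) (\<lambda>k. \<theta> powr real_of_int k)"
  unfolding spectral_partition_def
 proof (intro conjI ballI)
  show "orth_family f K (\<lambda>k. e (geo \<theta> k))" using geo_disjoint[OF th] by (intro density_orth_family[OF d pf finK]) auto
  have s: "geo \<theta> k \<subseteq> {\<theta> powr real_of_int k..\<theta> * \<theta> powr real_of_int k}" for k
   using th by (auto simp: geo_def powr_add mult.commute)
  show "dominates f (e (geo \<theta> k)) (\<theta> powr real_of_int k)" "dominated f (e (geo \<theta> k)) (\<theta> * \<theta> powr real_of_int k)" for k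
   using density_dominated[OF d geo_borel s] by auto
 qed (use th sum in auto)
 then show ?thesis by blast
qed

text \<open>\<open>kval_upper\<close> and \<open>kform_lower\<close> enclose the integrand between
  two finite sums whose ratios differ from S j / T i by the factor \<theta>; the logarithmic
  integral of such a sum is, up to ln \<theta>, linear in the two approximate logarithms.\<close>

lemma partition_entropy:
 assumes fg: "nstate f" "nstate g" and p: "proj p" "p \<in> M" "f (\<I> - p) = 0" and th: "\<theta> > 1"
  and e: "spectral_partition p f \<theta> I e T" and h: "spectral_partition p g \<theta> J h S"
 shows "\<exists>v\<ge>0. var_entropy f g = ennreal v \<and>
  \<bar>v - (f (\<Sum>i\<in>I. ln (T i) *\<^sub>R e i) - f (\<Sum>j\<in>J. ln (S j) *\<^sub>R h j))\<bar> <= ln \<theta>"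
proof -
 note pf = nstate_pfun[OF fg(1)] and pg = nstate_pfun[OF fg(2)]
 have oe: "orth_family f I e" and pe: "(\<Sum>i\<in>I. e i) = p" and T: "!!i. i \<in> I ==> 0 < T i"
  "!!i. i \<in> I ==> dominates f (e i) (T i)" "!!i. i \<in> I ==> dominated f (e i) (\<theta> * T i)"
  using e unfolding spectral_partition_def by auto
 have oh: "orth_family g J h" and ph: "(\<Sum>j\<in>J. h j) = p" and S: "!!i. i \<in> J ==> 0 < S i"
  "!!i. i \<in> J ==> dominates g (h i) (S i)" "!!i. i \<in> J ==> dominated g (h i) (\<theta> * S i)"
  using h unfolding spectral_partition_def by auto
 note E = orth_familyD[OF oe] and H = orth_familyD[OF oh]
 define P where "P = I \<times> J"
 define w where "w q = f (e (fst q) ** h (snd q))" for q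
 define D where "D = f (\<Sum>i\<in>I. ln (T i) *\<^sub>R e i) - f (\<Sum>j\<in>J. ln (S j) *\<^sub>R h j)"
 have finP: "finite P" using E H by (simp add: P_def)
 have psum: "(\<Sum>i\<in>I. \<Sum>j\<in>J. f (e i ** h j) * c i j) = (\<Sum>q\<in>P. w q * c (fst q) (snd q))" for c
  by (simp add: P_def w_def sum.cartesian_product split_def)
 have bil: "(\<Sum>q\<in>P. w q * (a (fst q) * b (snd q))) = f ((\<Sum>i\<in>I. a i *\<^sub>R e i) ** (\<Sum>j\<in>J. b j *\<^sub>R h j))" for a b
 proof -
  have "f ((\<Sum>i\<in>I. a i *\<^sub>R e i) ** (\<Sum>j\<in>J. b j *\<^sub>R h j)) = f (\<Sum>i\<in>I. \<Sum>j\<in>J. (a i * b j) *\<^sub>R (e i ** h j))"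
   by (simp add: op_sum op_simps scaleR_sum_right mult.commute) (subst sum.swap, simp)
  also have "... = (\<Sum>i\<in>I. \<Sum>j\<in>J. f (e i ** h j) * (a i * b j))"
   using E(2) H(2) by (simp add: pfun_sum[OF pf] pfun_scaleR[OF pf] mem_rules mult.commute)
  finally show ?thesis by (simp add: psum)
 qed
 have fp: "f p = 1" using p(3) p(2) by (simp add: pfun_diff[OF pf] mem_rules nstate_id[OF fg(1)])
 have w1: "(\<Sum>q\<in>P. w q) = 1" using bil[of "\<lambda>_. 1" "\<lambda>_. 1"] pe ph p fp by (simp add: proj_simps)
 have wT: "(\<Sum>q\<in>P. w q * ln (T (fst q))) = f (\<Sum>i\<in>I. ln (T i) *\<^sub>R e i)"
 proof -
  have "(\<Sum>i\<in>I. ln (T i) *\<^sub>R e i) \<in> M" using E(2) by (auto simp: mem_rules)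
  then show ?thesis using bil[of "\<lambda>i. ln (T i)" "\<lambda>_. 1"] support_eq(2)[OF pf p] by (simp add: ph)
 qed
 have wS: "(\<Sum>q\<in>P. w q * ln (S (snd q))) = f (\<Sum>j\<in>J. ln (S j) *\<^sub>R h j)"
 proof -
  have "(\<Sum>j\<in>J. ln (S j) *\<^sub>R h j) \<in> M" using H(2) by (auto simp: mem_rules)
  then show ?thesis using bil[of "\<lambda>_. 1" "\<lambda>j. ln (S j)"] support_eq(1)[OF pf p] by (simp add: pe)
 qed
 have val: "(\<Sum>q\<in>P. w q * (- ln (l q))) = D - c" if "!!q. q \<in> P ==> - ln (l q) = ln (T (fst q)) - ln (S (snd q)) - c" for l c
 proof -
  have "(\<Sum>q\<in>P. w q * (- ln (l q))) = (\<Sum>q\<in>P. w q * ln (T (fst q)) - w q * ln (S (snd q)) - c * w q)"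
   by (intro sum.cong refl) (simp only: that, simp add: algebra_simps)
  then show ?thesis by (simp add: sum_subtractf wT wS w1 D_def flip: sum_distrib_left)
 qed
 have pos: "0 < T (fst q)" "0 < S (snd q)" if "q \<in> P" for q using that T S by (auto simp: P_def)
 \<comment> \<open>The uncertainty \<theta> is put on S for the lower bound of the entropy and on T
   for the upper one.\<close>
 define l1 where "l1 q = (\<theta> * S (snd q)) / T (fst q)" for q
 define l2 where "l2 q = S (snd q) / (\<theta> * T (fst q))" for q
 have lower: "ennreal (D - ln \<theta>) <= var_entropy f g"
 proof -
  have "ennreal (\<Sum>q\<in>P. w q * (- ln (l1 q))) <= var_entropy f g"
  proof (rule var_entropy_ge[OF fg finP _ w1])
   show "kval f g r <= (\<Sum>q\<in>P. w q * (l1 q / (r + l1 q)))" if r: "r > 0" for r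
   proof -
    have "kval f g r <= (\<Sum>i\<in>I. \<Sum>j\<in>J. f (e i ** h j) * (((\<theta> * S j) / T i) / (r + (\<theta> * S j) / T i)))"
     by (rule kval_upper[OF pf pg oe oh pe ph p(3) T(1,2) _ S(3) r]) (use S(1) th in auto)
    then show ?thesis unfolding psum l1_def .
   qed
  qed (use pos th in \<open>auto simp: l1_def\<close>)
  also have "(\<Sum>q\<in>P. w q * (- ln (l1 q))) = D - ln \<theta>"
  proof (rule val)
   fix q assume "q \<in> P"
   then show "- ln (l1 q) = ln (T (fst q)) - ln (S (snd q)) - ln \<theta>" using pos[of q] th by (simp add: l1_def ln_div ln_mult)
  qed
  finally show ?thesis .
 qed
 have ge: "(\<Sum>q\<in>P. w q * (l2 q / (r + l2 q))) <= kval f g r" if r: "r > 0" for r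
 proof (rule kval_ge)
  fix x assume x: "x \<in> M"
  have "(\<Sum>i\<in>I. \<Sum>j\<in>J. f (e i ** h j) * ((S j / (\<theta> * T i)) / (r + S j / (\<theta> * T i)))) <= kform f g r x"
   by (rule kform_lower[OF pf pg oe oh _ T(3) _ S(2) x r]) (use S(1) T(1) th in \<open>auto intro: less_imp_le\<close>)
  then show "(\<Sum>q\<in>P. w q * (l2 q / (r + l2 q))) <= kform f g r x" unfolding psum l2_def .
 qed
 have l2: "l2 q > 0" if "q \<in> P" for q using pos[OF that] th by (simp add: l2_def)
 have val2: "(\<Sum>q\<in>P. w q * (- ln (l2 q))) = D + ln \<theta>"
 proof -
  have "- ln (l2 q) = ln (T (fst q)) - ln (S (snd q)) - - ln \<theta>" if "q \<in> P" for q
   using pos[OF that] th by (simp add: l2_def ln_div ln_mult)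
  from val[OF this] show ?thesis by simp
 qed
 have upper: "var_entropy f g <= ennreal (D + ln \<theta>)" "0 <= D + ln \<theta>"
  using var_entropy_le[OF fg finP l2 w1 ge] unfolding val2 by auto
 then obtain v where v: "var_entropy f g = ennreal v" "0 <= v" by (cases "var_entropy f g") (auto simp: top_unique)
 have "v <= D + ln \<theta>" using upper v by (simp add: ennreal_le_iff)
 moreover have "D - ln \<theta> <= v" using lower v(2) unfolding v(1) by (subst (asm) ennreal_le_iff) auto
 ultimately show ?thesis using v unfolding D_def[symmetric] by (intro exI[of _ v]) auto
qed

text \<open>The density is bounded and bounded away from 0 on its support p, so its logarithm is
  bounded there.\<close>

definition nice :: "'h op => ('h op => real) => bool"
 where "nice p f \<longleftrightarrow> nstate f \<and> f (\<I> - p) = 0 \<and> (\<exists>\<alpha>>0. dominates f p \<alpha>) \<and> (\<exists>\<beta>\<ge>0. dominated f p \<beta>)"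

lemma nice_convex:
 assumes r: "nice p r" and w: "nice p w" and t: "0 < t" "t < 1"
 shows "nice p (\<lambda>x. (1 - t) * r x + t * w x)"
proof -
 obtain a b where ab: "a > 0" "dominates r p a" "b \<ge> 0" "dominated r p b" using r unfolding nice_def by blast
 obtain c d where cd: "c > 0" "dominates w p c" "d \<ge> 0" "dominated w p d" using w unfolding nice_def by blast
 have st: "nstate r" "nstate w" using r w by (auto simp: nice_def)
 have n: "nstate (\<lambda>x. (1 - t) * r x + t * w x)" using st t by (auto simp: nstate_def intro!: nfun_add nfun_scale)
 have nn: "0 <= r x" "0 <= w x" if "x \<in> M" "psd x" for x using pfun_nonneg[OF nstate_pfun] st that by auto
 have split: "ennreal ((1 - t) * r x + t * w x) = ennreal (1 - t) * ennreal (r x) + ennreal t * ennreal (w x)" if "x \<in> M" "psd x" for x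
  using t nn[OF that] by (simp add: ennreal_mult)
 have "dominates (\<lambda>x. (1 - t) * r x + t * w x) p ((1 - t) * a + t * c)" unfolding dominates_def
 proof (intro ballI impI)
  fix x assume x: "x \<in> M" "psd x" "p ** x ** p = x"
  have "ennreal (1 - t) * (ennreal a * \<tau> x) + ennreal t * (ennreal c * \<tau> x) <= ennreal (1 - t) * ennreal (r x) + ennreal t * ennreal (w x)"
   using ab cd x unfolding dominates_def by (intro add_mono mult_left_mono) auto
  then show "ennreal ((1 - t) * a + t * c) * \<tau> x <= ennreal ((1 - t) * r x + t * w x)"
   unfolding split[OF x(1,2)] using t ab cd by (simp add: ennreal_mult distrib_right mult.assoc)
 qed
 moreover have "dominated (\<lambda>x. (1 - t) * r x + t * w x) p ((1 - t) * b + t * d)" unfolding dominated_def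
 proof (intro ballI impI)
  fix x assume x: "x \<in> M" "psd x" "p ** x ** p = x"
  have "ennreal (1 - t) * ennreal (r x) + ennreal t * ennreal (w x) <= ennreal (1 - t) * (ennreal b * \<tau> x) + ennreal t * (ennreal d * \<tau> x)"
   using ab cd x unfolding dominated_def by (intro add_mono mult_left_mono) auto
  then show "ennreal ((1 - t) * r x + t * w x) <= ennreal ((1 - t) * b + t * d) * \<tau> x"
   unfolding split[OF x(1,2)] using t ab cd by (simp add: ennreal_mult distrib_right mult.assoc)
 qed
 moreover have "(1 - t) * a + t * c > 0" "(1 - t) * b + t * d \<ge> 0" using t ab cd by (auto intro!: add_pos_pos)
 ultimately show ?thesis using n r w unfolding nice_def by auto
qed

text \<open>For states with bounded logarithms both sides are, up to a multiple of \<open>ln \<theta>\<close>, linear in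
 the logarithms of the densities, and the inequality is an identity between them.\<close>

lemma donald_nice:
 assumes p: "proj p" "p \<in> M" and nice: "nice p r" "nice p w" "nice p s" and t: "0 < t" "t < 1"
 defines "m \<equiv> \<lambda>x. (1 - t) * r x + t * w x"
 shows "var_entropy m s + ennreal (1 - t) * var_entropy r m <= ennreal (1 - t) * var_entropy r s + ennreal t * var_entropy w s"
proof -
 have nm: "nice p m" unfolding m_def by (rule nice_convex[OF nice(1,2) t])
 have part: "\<exists>L\<in>M. \<exists>I e T. spectral_partition p f \<theta> (I :: int set) e T \<and> L = (\<Sum>i\<in>I. ln (T i) *\<^sub>R e i)"
  if f: "nice p f" and th: "\<theta> > 1" for f \<theta>
 proof -
  obtain I :: "int set" and e T where e: "spectral_partition p f \<theta> I e T"
   using f spectral_partition_exists[OF nstate_nfun p _ _ _ _ th, of f] unfolding nice_def by blast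
  then have "(\<Sum>i\<in>I. ln (T i) *\<^sub>R e i) \<in> M"
   unfolding spectral_partition_def by (auto intro!: sum_mem scaleR_mem dest: orth_familyD(2))
  then show ?thesis using e by blast
 qed
 have st: "nstate f" "f (\<I> - p) = 0" if "nice p f" for f using that by (auto simp: nice_def)
 have ent: "\<exists>v\<ge>0. var_entropy f g = ennreal v \<and> \<bar>v - (f Lf - f Lg)\<bar> <= ln \<theta>"
  if "nice p f" "nice p g" "\<theta> > 1" "\<exists>I e T. spectral_partition p f \<theta> (I :: int set) e T \<and> Lf = (\<Sum>i\<in>I. ln (T i) *\<^sub>R e i)"
   "\<exists>I e T. spectral_partition p g \<theta> (I :: int set) e T \<and> Lg = (\<Sum>i\<in>I. ln (T i) *\<^sub>R e i)" for f g \<theta> Lf Lg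
  using that partition_entropy[OF st(1)[OF that(1)] st(1)[OF that(2)] p st(2)[OF that(1)] that(3)] by blast
 have fin: "\<exists>v\<ge>0. var_entropy f g = ennreal v" if "nice p f" "nice p g" for f g
  using part[OF that(1), of 2] part[OF that(2), of 2] ent[OF that, of 2] by fastforce
 obtain vms where vms: "vms \<ge> 0" "var_entropy m s = ennreal vms" using fin nm nice by blast
 obtain vrm where vrm: "vrm \<ge> 0" "var_entropy r m = ennreal vrm" using fin nm nice by blast
 obtain vrs where vrs: "vrs \<ge> 0" "var_entropy r s = ennreal vrs" using fin nm nice by blast
 obtain vws where vws: "vws \<ge> 0" "var_entropy w s = ennreal vws" using fin nm nice by blast
 have main: "vms + (1 - t) * vrm <= (1 - t) * vrs + t * vws + 4 * ln \<theta>" if th: "\<theta> > 1" for \<theta>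
 proof -
  obtain Lr where Lr: "Lr \<in> M" "\<exists>I e T. spectral_partition p r \<theta> (I :: int set) e T \<and> Lr = (\<Sum>i\<in>I. ln (T i) *\<^sub>R e i)"
   using part[OF nice(1) th] by blast
  obtain Lw where Lw: "Lw \<in> M" "\<exists>I e T. spectral_partition p w \<theta> (I :: int set) e T \<and> Lw = (\<Sum>i\<in>I. ln (T i) *\<^sub>R e i)"
   using part[OF nice(2) th] by blast
  obtain Ls where Ls: "Ls \<in> M" "\<exists>I e T. spectral_partition p s \<theta> (I :: int set) e T \<and> Ls = (\<Sum>i\<in>I. ln (T i) *\<^sub>R e i)"
   using part[OF nice(3) th] by blast
  obtain Lm where Lm: "Lm \<in> M" "\<exists>I e T. spectral_partition p m \<theta> (I :: int set) e T \<and> Lm = (\<Sum>i\<in>I. ln (T i) *\<^sub>R e i)"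
   using part[OF nm th] by blast
  have 1: "\<bar>vms - (m Lm - m Ls)\<bar> <= ln \<theta>" using ent[OF nm nice(3) th Lm(2) Ls(2)] vms by auto
  have 2: "\<bar>vrm - (r Lr - r Lm)\<bar> <= ln \<theta>" using ent[OF nice(1) nm th Lr(2) Lm(2)] vrm by auto
  have 3: "\<bar>vrs - (r Lr - r Ls)\<bar> <= ln \<theta>" using ent[OF nice(1,3) th Lr(2) Ls(2)] vrs by auto
  have 4: "\<bar>vws - (w Lw - w Ls)\<bar> <= ln \<theta>" using ent[OF nice(2,3) th Lw(2) Ls(2)] vws by auto
  \<comment> \<open>The identity also contains t V(w|m), which is dropped because it is
    nonnegative.\<close>
  have 5: "w Lw - w Lm \<ge> - ln \<theta>" using ent[OF nice(2) nm th Lw(2) Lm(2)] by auto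
  have l: "0 <= ln \<theta>" using th by simp
  have "(1 - t) * vrm <= (1 - t) * (r Lr - r Lm + ln \<theta>)" using 2 t by (intro mult_left_mono) auto
  moreover have "(1 - t) * (r Lr - r Ls - ln \<theta>) <= (1 - t) * vrs" using 3 t by (intro mult_left_mono) auto
  moreover have "t * (w Lw - w Ls - ln \<theta>) <= t * vws" using 4 t by (intro mult_left_mono) auto
  moreover have "t * (- ln \<theta>) <= t * (w Lw - w Lm)" using 5 t by (intro mult_left_mono) auto
  moreover have "vms <= m Lm - m Ls + ln \<theta>" using 1 by linarith
  moreover have "t * ln \<theta> <= ln \<theta>" using mult_right_mono[of t 1 "ln \<theta>"] t l by simp
  ultimately show ?thesis using l unfolding m_def by (simp add: algebra_simps)
 qed
 have "vms + (1 - t) * vrm <= (1 - t) * vrs + t * vws"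
 proof (rule field_le_epsilon)
  fix d :: real assume "d > 0"
  then show "vms + (1 - t) * vrm <= (1 - t) * vrs + t * vws + d" using main[of "exp (d / 4)"] by simp
 qed
 then show ?thesis unfolding vms vrm vrs vws using t vms vrm vrs vws by (simp add: ennreal_leI flip: ennreal_mult ennreal_plus)
qed

end

context vn_algebra
begin

lemma schwarz_mapI:
 assumes "!!x. x \<in> M ==> \<Phi> x \<in> M" "!!x. x \<in> M ==> \<Phi> (\<I> - x) = \<I> - \<Phi> x" "!!x. x \<in> M ==> \<Phi> (adj x) = adj (\<Phi> x)"
  and "!!x. x \<in> M ==> psd (\<Phi> (adj x ** x) - adj (\<Phi> x) ** \<Phi> x)"
 shows "schwarz_map \<Phi>" unfolding schwarz_map_def
proof (intro ballI conjI)
 fix x assume x: "x \<in> M"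
 show "psd (\<Phi> (x ** adj x) - \<Phi> x ** adj (\<Phi> x))" using assms(4)[of "adj x"] assms(3)[OF x] x by (simp add: mem_rules)
qed (use assms in auto)

text \<open>Composed with a state f it gives a f (p x p) + (1 - a f p) \<psi> x: the compression to
  p, completed to a state by \<psi>. It is written on the algebra so that
  \<open>data_processing\<close> applies.\<close>

definition corner_map :: "'h op => ('h op => real) => real => 'h op => 'h op"
 where "corner_map p \<psi> a x = a *\<^sub>R (p ** x ** p) + \<psi> x *\<^sub>R (\<I> - a *\<^sub>R p)"

text \<open>The defect in the Schwarz inequality is a sum of three positive terms: a times the
  defect of the compression, the variance of \<psi> times 1 - a p, and a (1 - a) times the square of
  the difference between the compression and the scalar value on p.\<close>

lemma corner_map_schwarz:
 assumes p: "proj p" "p \<in> M" and \<psi>: "nstate \<psi>" and a: "0 <= a" "a <= 1"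
 shows "schwarz_map (corner_map p \<psi> a)"
proof (rule schwarz_mapI)
 note pf = nstate_pfun[OF \<psi>]
 fix x assume x: "x \<in> M"
 show "corner_map p \<psi> a x \<in> M" using x p by (simp add: corner_map_def mem_rules)
 show "corner_map p \<psi> a (\<I> - x) = \<I> - corner_map p \<psi> a x"
 proof -
  have px: "p ** (\<I> - x) ** p = p - p ** x ** p" using p by (simp add: op_simps proj_simps)
  have \<psi>x: "\<psi> (\<I> - x) = 1 - \<psi> x" using x by (simp add: pfun_diff[OF pf] mem_rules nstate_id[OF \<psi>])
  show ?thesis unfolding corner_map_def px \<psi>x by (rule op_ext_inner) (simp add: bilinear_simps algebra_simps)
 qed
 show "corner_map p \<psi> a (adj x) = adj (corner_map p \<psi> a x)"
  using p x by (simp add: corner_map_def adj_rules proj_simps pfun_adj[OF pf] op_simps)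
 define z where "z = p ** x ** p"
 define y where "y = p ** adj x ** p"
 define W where "W = p ** (adj x ** x) ** p"
 define s where "s = \<psi> x"
 define s2 where "s2 = \<psi> (adj x ** x)"
 have adjz: "adj z = y" using p by (simp add: z_def y_def adj_rules proj_simps op_simps)
 have yz: "y ** z = W - p ** adj x ** (\<I> - p) ** x ** p" using p by (simp add: z_def y_def W_def op_simps proj_idem)
 have pz: "p ** z = z" and yp: "y ** p = y" and pp: "p ** p = p" using p by (simp_all add: z_def y_def op_simps proj_simps proj_idem)
 have app: "blinfun_apply p (blinfun_apply z v) = blinfun_apply z v" "blinfun_apply y (blinfun_apply p v) = blinfun_apply y v"
  "blinfun_apply p (blinfun_apply p v) = blinfun_apply p v" for v using pz yp pp by (metis blinfun_apply_blinfun_compose)+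
 have "(a *\<^sub>R W + s2 *\<^sub>R (\<I> - a *\<^sub>R p)) - (a *\<^sub>R y + s *\<^sub>R (\<I> - a *\<^sub>R p)) ** (a *\<^sub>R z + s *\<^sub>R (\<I> - a *\<^sub>R p))
   = a *\<^sub>R (W - y ** z) + (s2 - s\<^sup>2) *\<^sub>R (\<I> - a *\<^sub>R p) + (a * (1 - a)) *\<^sub>R ((y - s *\<^sub>R p) ** (z - s *\<^sub>R p))"
  by (rule op_ext_inner) (simp add: app bilinear_simps power2_eq_square algebra_simps)
 moreover have "adj (corner_map p \<psi> a x) = a *\<^sub>R y + s *\<^sub>R (\<I> - a *\<^sub>R p)"
  using p by (simp add: corner_map_def s_def adj_rules proj_simps op_simps y_def)
 moreover have "y - s *\<^sub>R p = adj (z - s *\<^sub>R p)" using p by (simp add: adj_rules adjz proj_simps)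
 ultimately have eq: "corner_map p \<psi> a (adj x ** x) - adj (corner_map p \<psi> a x) ** corner_map p \<psi> a x
   = a *\<^sub>R (W - y ** z) + (s2 - s\<^sup>2) *\<^sub>R (\<I> - a *\<^sub>R p) + (a * (1 - a)) *\<^sub>R (adj (z - s *\<^sub>R p) ** (z - s *\<^sub>R p))"
  by (simp add: corner_map_def s_def s2_def z_def W_def)
 have "W - y ** z = adj (x ** p) ** (\<I> - p) ** (x ** p)" unfolding yz using p by (simp add: adj_rules proj_simps op_simps)
 then have 1: "psd (W - y ** z)" using p by (simp add: psd_conj proj_psd proj_compl)
 have 2: "psd (\<I> - a *\<^sub>R p)"
 proof -
  have "\<I> - a *\<^sub>R p = (1 - a) *\<^sub>R \<I> + a *\<^sub>R (\<I> - p)" by (simp add: scaleR_diff_left scaleR_diff_right)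
  then show ?thesis using a p by (simp add: psd_add psd_scaleR proj_psd proj_compl)
 qed
 have 3: "s\<^sup>2 <= s2" using pfun_cauchy_schwarz[OF pf id_mem x] nstate_id[OF \<psi>] by (simp add: s_def s2_def op_simps adj_rules)
 show "psd (corner_map p \<psi> a (adj x ** x) - adj (corner_map p \<psi> a x) ** corner_map p \<psi> a x)"
  unfolding eq using 1 2 3 a by (intro psd_add psd_scaleR psd_square) auto
qed

lemma corner_map_apply:
 assumes f: "nstate f" and p: "p \<in> M" and x: "x \<in> M"
 shows "f (corner_map p \<psi> a x) = a * f (p ** x ** p) + (1 - a * f p) * \<psi> x"
 using p x by (simp add: corner_map_def pfun_rules[OF nstate_pfun[OF f]] mem_rules nstate_id[OF f] mult.commute)

text \<open>Each of the two error terms has a factor 1 - p on one side, and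
  \<open>pfun_right_bound\<close> turns it into the square root of f (1 - p).\<close>

lemma compress_close:
 assumes f: "nstate f" and p: "proj p" "p \<in> M" and x: "x \<in> M"
 shows "\<bar>f x - f (p ** x ** p)\<bar> <= 2 * norm x * sqrt (1 - f p)"
proof -
 note pf = nstate_pfun[OF f]
 define q where "q = \<I> - p"
 have q: "q \<in> M" "psd q" "norm q <= 1" "proj q" using p by (auto simp: q_def mem_rules proj_psd proj_compl intro: proj_norm)
 have fq: "f q = 1 - f p" using p by (simp add: q_def pfun_diff[OF pf] mem_rules nstate_id[OF f])
 have nx: "norm (p ** x) <= norm x" using norm_blinfun_compose[of p x] mult_right_mono[OF proj_norm[OF p(1)], of "norm x"] by simp
 have 1: "\<bar>f (adj x ** q)\<bar> <= norm x * sqrt (1 - f p)"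
  using pfun_right_bound[OF pf _ _ q(1-3), of "adj x" "norm x"] x by (simp add: mem_rules fq nstate_id[OF f])
 have 2: "\<bar>f (p ** x ** q)\<bar> <= norm x * sqrt (1 - f p)"
  using pfun_right_bound[OF pf _ nx q(1-3)] x p by (simp add: mem_rules fq nstate_id[OF f])
 have "f (q ** x) = f (adj x ** q)" using pfun_adj[OF pf, of "adj x ** q"] q x by (simp add: mem_rules adj_rules proj_simps)
 moreover have "f x - f (p ** x ** p) = f (q ** x) + f (p ** x ** q)" using p x by (simp add: q_def op_simps pfun_diff[OF pf] mem_rules)
 ultimately show ?thesis using 1 2 by linarith
qed

lemma truncation_tendsto:
 assumes f: "nstate f" and p: "!!n. proj (p n)" "!!n. p n \<in> M" "(\<lambda>n. f (p n)) \<longlonglongrightarrow> 1"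
  and \<psi>: "!!n. nstate (\<psi> n)" and a: "a \<longlonglongrightarrow> 1" and x: "x \<in> M"
 shows "(\<lambda>n. a n * f (p n ** x ** p n) + (1 - a n * f (p n)) * \<psi> n x) \<longlonglongrightarrow> f x"
proof -
 have "(\<lambda>n. f x - f (p n ** x ** p n)) \<longlonglongrightarrow> 0"
 proof (rule Lim_null_comparison)
  show "\<forall>\<^sub>F n in sequentially. norm (f x - f (p n ** x ** p n)) <= 2 * norm x * sqrt (1 - f (p n))"
   using compress_close[OF f p(1,2) x] by simp
  have "(\<lambda>n. 2 * norm x * sqrt (1 - f (p n))) \<longlonglongrightarrow> 2 * norm x * sqrt (1 - 1)" by (intro tendsto_intros p(3))
  then show "(\<lambda>n. 2 * norm x * sqrt (1 - f (p n))) \<longlonglongrightarrow> 0" by simp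
 qed
 then have "(\<lambda>n. f x - (f x - f (p n ** x ** p n))) \<longlonglongrightarrow> f x - 0" by (intro tendsto_intros)
 then have 1: "(\<lambda>n. f (p n ** x ** p n)) \<longlonglongrightarrow> f x" by simp
 have 2: "(\<lambda>n. (1 - a n * f (p n)) * \<psi> n x) \<longlonglongrightarrow> 0"
 proof (rule Lim_null_comparison)
  have "\<bar>\<psi> n x\<bar> <= norm x" for n
   using pfun_abs_bound[OF nstate_pfun[OF \<psi>] x] nstate_id[OF \<psi>] by (metis mult.right_neutral)
  then show "\<forall>\<^sub>F n in sequentially. norm ((1 - a n * f (p n)) * \<psi> n x) <= \<bar>1 - a n * f (p n)\<bar> * norm x"
   by (simp add: abs_mult mult_left_mono)
  have "(\<lambda>n. \<bar>1 - a n * f (p n)\<bar> * norm x) \<longlonglongrightarrow> \<bar>1 - 1 * 1\<bar> * norm x"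
   by (intro tendsto_intros p(3) a)
  then show "(\<lambda>n. \<bar>1 - a n * f (p n)\<bar> * norm x) \<longlonglongrightarrow> 0" by simp
 qed
 have "(\<lambda>n. a n * f (p n ** x ** p n) + (1 - a n * f (p n)) * \<psi> n x) \<longlonglongrightarrow> 1 * f x + 0"
  by (intro tendsto_intros a 1 2)
 then show ?thesis by simp
qed

end

context traced_algebra
begin

lemma tracial_state_exists:
 assumes p: "proj p" "p \<in> M" "p ~= 0" "\<tau> p < \<infinity>"
 shows "\<exists>T>0. \<exists>\<psi>. nstate \<psi> \<and> (\<forall>x\<in>M. psd x --> ennreal (T * \<psi> x) = \<tau> (p ** x ** p))"
proof -
 have pp: "psd p" using p by (simp add: proj_psd)
 obtain f where f: "nfun f" "!!x. x \<in> M ==> psd x ==> ennreal (f x) = \<tau> (root_op p ** x ** root_op p)"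
  using trace_functional[OF p(2) pp p(4)] by blast
 have fx: "ennreal (f x) = \<tau> (p ** x ** p)" if "x \<in> M" "psd x" for x
  using f(2)[OF that] tau_swap[OF p(2) pp that] tau_proj_swap[OF p(1,2) that] by simp
 have fI: "ennreal (f \<I>) = \<tau> p" using fx[of \<I>] p by (simp add: mem_rules op_simps proj_simps)
 have "f \<I> > 0"
 proof (rule ccontr)
  assume "\<not> f \<I> > 0"
  then have "\<tau> p = 0" unfolding fI[symmetric] by (simp add: ennreal_neg)
  then show False using tau_faithful p pp by blast
 qed
 moreover have "nstate (\<lambda>x. (1 / f \<I>) * f x)"
  using \<open>f \<I> > 0\<close> nfun_scale[OF f(1), of "1 / f \<I>"] by (simp add: nstate_def)
 ultimately show ?thesis using fx by (intro exI[of _ "f \<I>"] conjI exI[of _ "\<lambda>x. (1 / f \<I>) * f x"]) auto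
qed

text \<open>With a < 1 the tracial state keeps a positive weight, which bounds the density away from
  0 on p.\<close>

lemma truncation_nice:
 assumes f: "nstate f" and p: "proj p" "p \<in> M" and b: "dominated f p b" "0 <= b"
  and \<psi>: "nstate \<psi>" "T > 0" "!!x. x \<in> M ==> psd x ==> ennreal (T * \<psi> x) = \<tau> (p ** x ** p)" and a: "0 <= a" "a < 1"
 shows "nice p (\<lambda>x. a * f (p ** x ** p) + (1 - a * f p) * \<psi> x)"
proof -
 note pf = nstate_pfun[OF f] and q = nstate_pfun[OF \<psi>(1)]
 have fp: "0 <= f p" "f p <= 1"
  using pfun_nonneg[OF pf p(2)] pfun_mono[OF pf p(2) id_mem] p by (auto simp: proj_psd proj_compl nstate_id[OF f])
 have "a * f p <= a * 1" using a fp by (intro mult_left_mono) auto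
 then have c: "1 - a * f p > 0" using a by simp
 define c where "c = 1 - a * f p"
 have c0: "c > 0" using c by (simp add: c_def)
 have nn: "0 <= f (p ** x ** p)" "0 <= \<psi> x" if "x \<in> M" "psd x" for x
  using pfun_nonneg[OF pf, of "p ** x ** p"] pfun_nonneg[OF q that] p that by (auto simp: mem_rules psd_conj_sa proj_simps)
 have "nfun (\<lambda>x. f (p ** x ** p))" using nfun_conj[OF nstate_nfun[OF f] p(2)] p by (simp add: proj_simps)
 then have "nstate (\<lambda>x. a * f (p ** x ** p) + c * \<psi> x)" using a c0 p nstate_id[OF \<psi>(1)]
  by (auto simp: nstate_def op_simps proj_simps c_def intro!: nfun_add nfun_scale nstate_nfun[OF \<psi>(1)])
 moreover have "a * f (p ** (\<I> - p) ** p) + c * \<psi> (\<I> - p) = 0"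
 proof -
  have z: "p ** (\<I> - p) ** p = 0" using p by (simp add: op_simps proj_simps)
  have u: "\<I> - p \<in> M" "psd (\<I> - p)" using p by (auto simp: mem_rules proj_psd proj_compl)
  have "ennreal (T * \<psi> (\<I> - p)) = 0" using \<psi>(3)[OF u] z by simp
  then have "T * \<psi> (\<I> - p) <= 0" by (simp only: ennreal_eq_0_iff)
  then have "\<psi> (\<I> - p) <= 0" using \<psi>(2) by (simp add: mult_le_0_iff)
  then have "\<psi> (\<I> - p) = 0" using nn(2)[OF u] by simp
  then show ?thesis using z by (simp add: pfun_zero[OF pf])
 qed
 moreover have "dominates (\<lambda>x. a * f (p ** x ** p) + c * \<psi> x) p (c / T)" unfolding dominates_def
 proof (intro ballI impI)
  fix x assume x: "x \<in> M" "psd x" "p ** x ** p = x"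
  have "ennreal (c / T) * \<tau> x = ennreal (c * \<psi> x)"
   using \<psi>(2) \<psi>(3)[OF x(1,2)] x(3) c0 nn[OF x(1,2)] ennreal_mult[of "c / T" "T * \<psi> x"] by simp
  also have "... <= ennreal (a * f (p ** x ** p) + c * \<psi> x)" using a nn[OF x(1,2)] by (intro ennreal_leI) simp
  finally show "ennreal (c / T) * \<tau> x <= ennreal (a * f (p ** x ** p) + c * \<psi> x)" .
 qed
 moreover have "dominated (\<lambda>x. a * f (p ** x ** p) + c * \<psi> x) p (b + c / T)" unfolding dominated_def
 proof (intro ballI impI)
  fix x assume x: "x \<in> M" "psd x" "p ** x ** p = x"
  have fx: "ennreal (f x) <= ennreal b * \<tau> x" using b(1) x unfolding dominated_def by blast
  have tx: "ennreal (c / T) * \<tau> x = ennreal (c * \<psi> x)"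
   using \<psi>(2) \<psi>(3)[OF x(1,2)] x(3) c0 nn[OF x(1,2)] ennreal_mult[of "c / T" "T * \<psi> x"] by simp
  have "a * f x <= 1 * f x" using a nn(1)[OF x(1,2)] x(3) by (intro mult_right_mono) auto
  then have "ennreal (a * f (p ** x ** p) + c * \<psi> x) <= ennreal (f x + c * \<psi> x)" unfolding x(3) by (intro ennreal_leI) simp
  also have "... = ennreal (f x) + ennreal (c * \<psi> x)" using nn[OF x(1,2)] x(3) c0 by simp
  also have "... <= ennreal b * \<tau> x + ennreal (c / T) * \<tau> x" unfolding tx by (intro add_right_mono fx)
  also have "... = ennreal (b + c / T) * \<tau> x" using b(2) c0 \<psi>(2) by (simp add: distrib_right)
  finally show "ennreal (a * f (p ** x ** p) + c * \<psi> x) <= ennreal (b + c / T) * \<tau> x" .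
 qed
 moreover have "c / T > 0" "b + c / T \<ge> 0" using c0 \<psi>(2) b(2) by auto
 ultimately show ?thesis unfolding nice_def c_def[symmetric] by blast
qed

text \<open>p n belongs to the first n cells, where the density of f lies in a compact interval of
  positive numbers; the lower end makes the trace finite. A functional below f vanishes on the
  kernel projection, so the p n exhaust it.\<close>

lemma corner_exists:
 assumes f: "nfun f"
 shows "\<exists>p. (\<forall>n::nat. proj (p n) \<and> p n \<in> M \<and> \<tau> (p n) < \<infinity> \<and> (\<exists>b\<ge>0. dominated f (p n) b)) \<and>
  (\<forall>g. nfun g --> (\<forall>x\<in>M. psd x --> g x <= f x) --> (\<lambda>n. g (p n)) \<longlonglongrightarrow> g \<I>)"
proof -
 note pf = nfun_pfun[OF f]
 obtain e where d: "has_density e f" using density_exists[OF f] by blast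
 note e = density_psr[OF d]
 define G where "G n = geo 2 (int_decode n)" for n
 have G: "range G \<subseteq> sets borel" "disjoint_family G" using geo_disjoint_family[of 2] by (auto simp: G_def[abs_def])
 define A where "A n = (\<Union>k<n. G k)" for n
 have AB: "A n \<in> sets borel" for n using G(1) by (auto simp: A_def)
 have AI: "\<exists>a b. 0 < a \<and> a <= b \<and> A n \<subseteq> {a..b}" for n
 proof (induction n)
  case 0 show ?case by (intro exI[of _ 1]) (auto simp: A_def)
 next
  case (Suc n)
  then obtain a b where ab: "0 < a" "a <= b" "A n \<subseteq> {a..b}" by blast
  define k where "k = int_decode n"
  have Gk: "G n \<subseteq> {2 powr real_of_int k..2 powr (real_of_int k + 1)}" by (auto simp: G_def geo_def k_def)
  have "A (Suc n) = A n \<union> G n" by (auto simp: A_def less_Suc_eq)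
  then have "A (Suc n) \<subseteq> {min a (2 powr real_of_int k)..max b (2 powr (real_of_int k + 1))}" using ab Gk by fastforce
  moreover have "0 < min a (2 powr real_of_int k)" "min a (2 powr real_of_int k) <= max b (2 powr (real_of_int k + 1))" using ab by auto
  ultimately show ?case by blast
 qed
 have P: "proj (e (A n))" "e (A n) \<in> M" "psd (e (A n))" for n using psr_proj[OF e AB] psr_mem[OF e AB] psr_psd[OF e AB] by auto
 have fin: "\<tau> (e (A n)) < \<infinity> \<and> (\<exists>b\<ge>0. dominated f (e (A n)) b)" for n
 proof -
  obtain a b where ab: "0 < a" "a <= b" "A n \<subseteq> {a..b}" using AI by blast
  have "dominates f (e (A n)) a" "dominated f (e (A n)) b" using density_dominated[OF d AB ab(3)] ab by auto
  moreover have "e (A n) ** e (A n) ** e (A n) = e (A n)" using P by (simp add: proj_simps)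
  ultimately have "ennreal a * \<tau> (e (A n)) <= ennreal (f (e (A n)))" unfolding dominates_def using P by blast
  then have "\<tau> (e (A n)) ~= \<infinity>" using ab by (auto simp: ennreal_mult_top top_unique)
  then show ?thesis using \<open>dominated f (e (A n)) b\<close> ab by (auto simp: less_top intro!: exI[of _ b])
 qed
 have lim: "(\<lambda>n. g (e (A n))) \<longlonglongrightarrow> g \<I>" if g: "nfun g" and le: "\<forall>x\<in>M. psd x --> g x <= f x" for g
 proof -
  note pg = nfun_pfun[OF g]
  have "wlim sequentially (\<lambda>n. e (A n)) (e (\<Union>n. G n))" unfolding A_def by (rule psr_wlim[OF e G])
  also have "(\<Union>n. G n) = {0<..}" unfolding G_def by (rule geo_UN) simp
  finally have "(\<lambda>n. g (e (A n))) \<longlonglongrightarrow> g (e {0<..})"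
   by (rule nfun_wcont[OF g sequentially_bot P(2) psr_norm[OF e AB]])
  moreover have "e {0<..} = \<I> - e {..0}" using psr_Compl[OF e, of "{..0}"] by (simp add: Compl_atMost)
  moreover have "g (e {..0}) = 0"
   using density_nonpos[OF d pf] le pfun_nonneg[OF pg, of "e {..0}"] psr_mem[OF e, of "{..0}"] psr_psd[OF e, of "{..0}"]
   by (metis atMost_borel dual_order.antisym)
  ultimately show ?thesis using psr_mem[OF e, of "{..0}"] by (simp add: pfun_diff[OF pg] mem_rules)
 qed
 show ?thesis using P fin lim by (intro exI[of _ "\<lambda>n. e (A n)"]) blast
qed

text \<open>All states are truncated by one \<open>corner_map\<close>, which respects convex
  combinations. Data processing controls the right-hand side of \<open>donald_nice\<close>, lower
  semicontinuity the left-hand side.\<close>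

theorem donald:
 assumes st: "nstate r" "nstate w" "nstate s" and t: "0 < t" "t < 1"
 defines "m \<equiv> \<lambda>x. (1 - t) * r x + t * w x"
 shows "var_entropy m s + ennreal (1 - t) * var_entropy r m <= ennreal (1 - t) * var_entropy r s + ennreal t * var_entropy w s"
proof -
 have sm: "nstate m" using st t by (auto simp: nstate_def m_def intro!: nfun_add nfun_scale)
 \<comment> \<open>The sum dominates the three states, so its corners serve them all.\<close>
 have \<chi>: "nfun (\<lambda>x. r x + w x + s x)" using st by (auto simp: nstate_def intro!: nfun_add)
 obtain p0 where p0: "!!n::nat. proj (p0 n)" "!!n. p0 n \<in> M" "!!n. \<tau> (p0 n) < \<infinity>" "!!n. \<exists>b\<ge>0. dominated (\<lambda>x. r x + w x + s x) (p0 n) b"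
  "!!g. nfun g ==> (\<forall>x\<in>M. psd x --> g x <= r x + w x + s x) ==> (\<lambda>n. g (p0 n)) \<longlonglongrightarrow> g \<I>"
  using corner_exists[OF \<chi>] by blast
 have nn: "0 <= f x" if "nstate f" "x \<in> M" "psd x" for f x using pfun_nonneg nstate_pfun that by blast
 define F where "F = {r, w, s}"
 have F: "nstate f" "!!x. x \<in> M ==> psd x ==> f x <= r x + w x + s x" if "f \<in> F" for f
  using that st nn[OF st(1)] nn[OF st(2)] nn[OF st(3)] by (auto simp: F_def)
 have lim0: "(\<lambda>n. f (p0 n)) \<longlonglongrightarrow> 1" if "f \<in> F" for f
  using p0(5)[of f] F[OF that] nstate_nfun nstate_id by metis
 have "\<forall>\<^sub>F n in sequentially. 0 < r (p0 n)" using order_tendstoD(1)[OF lim0[of r], of 0] by (simp add: F_def)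
 \<comment> \<open>The first corners may be 0 and carry no tracial state; they are skipped.\<close>
 then obtain N where N: "!!n. n \<ge> N ==> 0 < r (p0 n)" unfolding eventually_sequentially by blast
 define p where "p n = p0 (n + N)" for n
 have p: "proj (p n)" "p n \<in> M" "\<tau> (p n) < \<infinity>" "p n ~= 0" for n
  using p0 N[of "n + N"] pfun_zero[OF nstate_pfun[OF st(1)]] by (auto simp: p_def)
 have lim: "(\<lambda>n. f (p n)) \<longlonglongrightarrow> 1" if "f \<in> F" for f
  unfolding p_def by (rule LIMSEQ_ignore_initial_segment[OF lim0[OF that]])
 have dom: "\<exists>b\<ge>0. dominated f (p n) b" if f: "f \<in> F" for f n
 proof -
  obtain b where b: "b \<ge> 0" "dominated (\<lambda>x. r x + w x + s x) (p n) b" using p0(4)[of "n + N"] by (auto simp: p_def)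
  have "dominated f (p n) b" unfolding dominated_def
  proof (intro ballI impI)
   fix c assume c: "c \<in> M" "psd c" "p n ** c ** p n = c"
   have "ennreal (f c) <= ennreal (r c + w c + s c)" by (intro ennreal_leI F(2)[OF f] c)
   also have "... <= ennreal b * \<tau> c" using b(2) c unfolding dominated_def by blast
   finally show "ennreal (f c) <= ennreal b * \<tau> c" .
  qed
  then show ?thesis using b by blast
 qed
 have "\<exists>\<psi>. \<exists>T>0. nstate \<psi> \<and> (\<forall>x\<in>M. psd x --> ennreal (T * \<psi> x) = \<tau> (p n ** x ** p n))" for n
  using tracial_state_exists[OF p(1,2,4,3)] by blast
 then obtain \<psi> where \<psi>: "!!n. nstate (\<psi> n)" "!!n. \<exists>T>0. \<forall>x\<in>M. psd x --> ennreal (T * \<psi> n x) = \<tau> (p n ** x ** p n)"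
  by metis
 \<comment> \<open>Tends to 1 but stays below it, as \<open>truncation_nice\<close>
   requires.\<close>
 define a where "a n = 1 - 1 / real (n + 2)" for n
 have a: "0 <= a n" "a n < 1" for n by (auto simp: a_def field_simps)
 have a1: "a \<longlonglongrightarrow> 1"
 proof -
  have "(\<lambda>n. 1 / real (n + 2)) \<longlonglongrightarrow> 0" by (rule LIMSEQ_ignore_initial_segment[OF lim_const_over_n])
  then have "(\<lambda>n. 1 - 1 / real (n + 2)) \<longlonglongrightarrow> 1 - 0" by (intro tendsto_intros)
  then show ?thesis by (simp add: a_def[abs_def])
 qed
 define tr where "tr n f x = a n * f (p n ** x ** p n) + (1 - a n * f (p n)) * \<psi> n x" for n and f :: "'h op => real" and x
 have nice: "nice (p n) (tr n f)" if f: "f \<in> F" for f n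
 proof -
  obtain b where "b \<ge> 0" "dominated f (p n) b" using dom[OF f] by blast
  moreover obtain T where "T > 0" "\<forall>x\<in>M. psd x --> ennreal (T * \<psi> n x) = \<tau> (p n ** x ** p n)" using \<psi>(2) by blast
  ultimately show ?thesis unfolding tr_def using F(1)[OF f] p \<psi>(1) a by (intro truncation_nice) auto
 qed
 have trm: "tr n m = (\<lambda>x. (1 - t) * tr n r x + t * tr n w x)" for n by (rule ext) (simp add: tr_def m_def algebra_simps)
 have tlim: "(\<lambda>n. tr n f x) \<longlonglongrightarrow> f x" if "f \<in> F" "x \<in> M" for f x
  unfolding tr_def by (rule truncation_tendsto[OF F(1)[OF that(1)] p(1,2) lim[OF that(1)] \<psi>(1) a1 that(2)])
 have tlimm: "(\<lambda>n. tr n m x) \<longlonglongrightarrow> m x" if "x \<in> M" for x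
 proof -
  have "(\<lambda>n. (1 - t) * tr n r x + t * tr n w x) \<longlonglongrightarrow> (1 - t) * r x + t * w x"
   using that by (intro tendsto_intros tlim) (auto simp: F_def)
  then show ?thesis unfolding trm by (simp add: m_def)
 qed
 have nicem: "nice (p n) (tr n m)" for n unfolding trm by (rule nice_convex[OF nice nice t]) (auto simp: F_def)
 have trst: "nstate (tr n f)" if "f \<in> F" for f n using nice[OF that] by (auto simp: nice_def)
 have trstm: "nstate (tr n m)" for n using nicem by (auto simp: nice_def)
 have FF: "r \<in> F" "w \<in> F" "s \<in> F" by (auto simp: F_def)
 have dpi: "var_entropy (tr n f) (tr n g) <= var_entropy f g" if "f \<in> F" "g \<in> F" for f g n
 proof -
  have "var_entropy (tr n f) (tr n g) = var_entropy (\<lambda>x. f (corner_map (p n) (\<psi> n) (a n) x)) (\<lambda>x. g (corner_map (p n) (\<psi> n) (a n) x))"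
   using that F(1) p by (intro var_entropy_cong) (auto simp: corner_map_apply tr_def)
  also have "... <= var_entropy f g"
   using F(1)[OF that(1)] F(1)[OF that(2)] p \<psi>(1) a by (intro data_processing nstate_pfun corner_map_schwarz) (auto intro: less_imp_le)
  finally show ?thesis .
 qed
 show ?thesis
 proof (rule liminf_pair_le)
  show "var_entropy m s <= liminf (\<lambda>n. var_entropy (tr n m) (tr n s))"
   using trstm trst[OF FF(3)] sm st(3) tlimm tlim[OF FF(3)] by (intro var_entropy_lsc)
  show "var_entropy r m <= liminf (\<lambda>n. var_entropy (tr n r) (tr n m))"
   using trstm trst[OF FF(1)] sm st(1) tlimm tlim[OF FF(1)] by (intro var_entropy_lsc)
  fix n
  have "var_entropy (tr n m) (tr n s) + ennreal (1 - t) * var_entropy (tr n r) (tr n m) <=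
    ennreal (1 - t) * var_entropy (tr n r) (tr n s) + ennreal t * var_entropy (tr n w) (tr n s)"
   unfolding trm by (rule donald_nice[OF p(1,2) nice[OF FF(1)] nice[OF FF(2)] nice[OF FF(3)] t])
  also have "... <= ennreal (1 - t) * var_entropy r s + ennreal t * var_entropy w s" by (intro add_mono mult_left_mono dpi FF) auto
  finally show "var_entropy (tr n m) (tr n s) + ennreal (1 - t) * var_entropy (tr n r) (tr n m) <=
    ennreal (1 - t) * var_entropy r s + ennreal t * var_entropy w s" .
 qed
qed

text \<open>Infinite entropy is split off because the argument subtracts t V(f o E|s) and cancels
  the factor 1 - t, both in the reals.\<close>

theorem entropy_chain:
 assumes st: "nstate f" "nstate s" "nstate (\<lambda>x. f (E x))" and E: "schwarz_map E"
  and EE: "!!x. x \<in> M ==> E (E x) = E x" and sE: "!!x. x \<in> M ==> s (E x) = s x"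
  and a: "a \<in> M" "psd a" "psd (\<I> - a)"
 shows "var_entropy (\<lambda>x. f (E x)) s + ennreal (2 * (f a - f (E a))\<^sup>2) <= var_entropy f s"
proof -
 define w where "w x = f (E x)" for x
 have w: "nstate w" using st(3) by (simp add: w_def[abs_def])
 have EM: "E x \<in> M" if "x \<in> M" for x using E that unfolding schwarz_map_def by blast
 have dpi: "var_entropy w s <= var_entropy g s" if g: "nstate g" "!!x. x \<in> M ==> g (E x) = w x" for g
 proof -
  have "var_entropy w s = var_entropy (\<lambda>x. g (E x)) (\<lambda>x. s (E x))" using g sE by (intro var_entropy_cong) auto
  also have "... <= var_entropy g s" using g st E by (intro data_processing nstate_pfun)
  finally show ?thesis .
 qed
 have ws: "var_entropy w s <= var_entropy f s" by (rule dpi[OF st(1)]) (simp add: w_def)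
 show ?thesis
 proof (cases "var_entropy f s = \<infinity>")
  case False
  then obtain u where u: "var_entropy f s = ennreal u" "0 <= u" by (cases "var_entropy f s") auto
  then obtain v where v: "var_entropy w s = ennreal v" "0 <= v" using ws by (cases "var_entropy w s") (auto simp: top_unique)
  define D where "D = f a - w a"
  have step: "v + 2 * (t * D)\<^sup>2 <= u" if t: "0 < t" "t < 1" for t
  proof -
   define m where "m x = (1 - t) * f x + t * w x" for x
   have m: "nstate m" using st(1) w t by (auto simp: nstate_def m_def[abs_def] intro!: nfun_add nfun_scale)
   have "ennreal v <= var_entropy m s" unfolding v(1)[symmetric] by (rule dpi[OF m]) (simp add: m_def w_def EE EM algebra_simps)
   moreover have "ennreal (2 * (t * D)\<^sup>2) <= var_entropy f m"
   proof -
    have "f a - m a = t * D" by (simp add: m_def D_def algebra_simps)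
    then show ?thesis using pinsker[OF st(1) m a] by simp
   qed
   ultimately have "ennreal v + ennreal (1 - t) * ennreal (2 * (t * D)\<^sup>2) <= var_entropy m s + ennreal (1 - t) * var_entropy f m"
    by (intro add_mono mult_left_mono) auto
   also have "... <= ennreal (1 - t) * ennreal u + ennreal t * ennreal v" using donald[OF st(1) w st(2) t] unfolding u v m_def .
   finally have "ennreal (v + (1 - t) * (2 * (t * D)\<^sup>2)) <= ennreal ((1 - t) * u + t * v)" using t u v by (simp add: ennreal_mult)
   then have "v + (1 - t) * (2 * (t * D)\<^sup>2) <= (1 - t) * u + t * v" using t u v by (subst (asm) ennreal_le_iff) auto
   then have "(1 - t) * (v + 2 * (t * D)\<^sup>2) <= (1 - t) * u" by (simp add: algebra_simps)
   then show ?thesis using t by simp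
  qed
  \<comment> \<open>The parameters t = 1 - 1 / (n + 2) lie strictly between 0 and 1 and tend to
    1.\<close>
  have "(\<lambda>n. v + 2 * ((1 - 1 / real (n + 2)) * D)\<^sup>2) \<longlonglongrightarrow> v + 2 * ((1 - 0) * D)\<^sup>2"
   by (intro tendsto_intros LIMSEQ_ignore_initial_segment[OF lim_const_over_n])
  then have "v + 2 * ((1 - 0) * D)\<^sup>2 <= u" by (rule LIMSEQ_le_const2) (intro exI allI impI step; simp)
  then have "ennreal v + ennreal (2 * D\<^sup>2) <= ennreal u" using v by (simp add: ennreal_leI flip: ennreal_plus)
  then show ?thesis using u(1) v(1) by (simp add: D_def w_def[abs_def])
 qed simp
qed

end

section \<open>Normal states and conditional expectations in terms of real parts\<close>

section \<open>Normal states and conditional expectations\<close>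

lemma norm_scalar_compose: "norm (scalar_op a ** x) <= cmod a * norm (x :: 'h::chilbert_space op)"
proof -
 have "norm (scalar_op a :: 'h op) <= cmod a" by (rule norm_blinfun_bound) (simp_all add: norm_scaleC)
 then show ?thesis by (intro order_trans[OF norm_blinfun_compose] mult_right_mono) auto
qed

context vn_algebra
begin

lemma nfun_cong:
 assumes f: "nfun f" and eq: "!!x. x \<in> M ==> f x = g x" shows "nfun g"
proof -
 have "pfun g" using nfun_pfun[OF f] unfolding pfun_def by (simp add: mem_rules flip: eq)
 then show ?thesis unfolding nfun_def
 proof (intro conjI allI impI)
  fix A s and d :: real
  assume A: "A \<subseteq> M" "\<forall>x\<in>A. psd x" "directed_ops A" "s \<in> M" "form_sup A s" "d > 0"
  then obtain x where "x \<in> A" "f s - d < f x" using nfunD[OF f, of A s d] by blast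
  then show "\<exists>x\<in>A. g s - d < g x" using eq A by (metis subsetD)
 qed
qed

lemma nfun_zero: "nfun (\<lambda>x. 0)" by (auto simp: nfun_def pfun_def directed_ops_def)

lemma nfun_sum: "(!!i. i \<in> I ==> nfun (f i)) ==> nfun (\<lambda>x. \<Sum>i\<in>I. f i x)"
 by (induction I rule: infinite_finite_induct) (auto simp: nfun_zero intro: nfun_add)

lemma scaleR_scalar: "r *\<^sub>R x = scalar_op (complex_of_real r) ** (x :: 'h op)" by (simp add: scalar_op_simps op_simps)

lemma adj_imaginary:
 assumes h: "h \<in> M" "adj h = h" shows "adj (scalar_op \<i> ** h) = - (scalar_op \<i> ** h)"
proof -
 have "scalar_op (- \<i>) = - (scalar_op \<i> :: 'h op)"
  using scalar_op_simps(3)[of "- \<i>" \<i>, where 'h = 'h] by (simp add: scalar_op_simps eq_neg_iff_add_eq_0)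
 moreover have "h ** scalar_op \<i> = scalar_op \<i> ** h" using clinear[OF h(1)] by (simp add: clinear_comm)
 ultimately show ?thesis using h(2) by (simp add: adj_rules adj_scalar_op op_simps)
qed

lemma cartesian_decomposition:
 assumes x: "x \<in> M"
 obtains h k where "h \<in> M" "adj h = h" "k \<in> M" "adj k = k" "x = h + scalar_op \<i> ** k" "adj x = h - scalar_op \<i> ** k"
proof -
 define h where "h = (1 / 2) *\<^sub>R (x + adj x)"
 define k where "k = scalar_op (- \<i>) ** ((1 / 2) *\<^sub>R (x - adj x))"
 have h: "h \<in> M" "adj h = h" and k: "k \<in> M" using x by (auto simp: h_def k_def mem_rules scalar_mem adj_rules add.commute)
 have "scalar_op 1 = (\<I> :: 'h op)" using scalar_op_simps(2)[of 1, where 'h = 'h] by simp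
 then have ik: "scalar_op \<i> ** k = (1 / 2) *\<^sub>R (x - adj x)"
  unfolding k_def op_simps(1)[symmetric] scalar_op_simps(4) by (simp add: op_simps)
 have "adj k = scalar_op (- \<i>) ** ((1 / 2) *\<^sub>R (x - adj x))"
 proof -
  have c: "y ** scalar_op a = scalar_op a ** y" if "y \<in> M" for y a using clinear[OF that] by (simp add: clinear_comm)
  have m: "scalar_op (- \<i>) = - (scalar_op \<i> :: 'h op)"
   using scalar_op_simps(3)[of "- \<i>" \<i>, where 'h = 'h] by (simp add: scalar_op_simps eq_neg_iff_add_eq_0)
  show ?thesis using c[OF x] c[OF adj_mem[OF x]] by (simp add: k_def adj_rules adj_scalar_op m op_simps algebra_simps)
 qed
 then have "adj k = k" by (simp add: k_def)
 moreover have "x = h + scalar_op \<i> ** k" "adj x = h - scalar_op \<i> ** k"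
  unfolding ik h_def by (rule op_ext_inner, simp add: bilinear_simps field_simps)+
 ultimately show thesis using that h k by blast
qed

text \<open>In one direction, adding |h| 1 to a self-adjoint h shows that its value is real, so the
  real part respects adjoints. In the other, i h is skew for positive h, so the real part vanishes
  on it, and this is minus the imaginary part at h.\<close>

lemma normal_state_iff:
 "normal_state M \<omega> \<longleftrightarrow> (\<forall>x\<in>M. \<forall>y\<in>M. \<omega> (x + y) = \<omega> x + \<omega> y) \<and>
  (\<forall>x\<in>M. \<forall>a. \<omega> (scalar_op a ** x) = a * \<omega> x) \<and> nstate (\<lambda>x. Re (\<omega> x))" (is "?L \<longleftrightarrow> ?R")
proof
 assume w: ?L
 have add: "\<omega> (x + y) = \<omega> x + \<omega> y" if "x \<in> M" "y \<in> M" for x y using w that unfolding normal_state_def by blast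
 have sc: "\<omega> (scalar_op a ** x) = a * \<omega> x" if "x \<in> M" for x a using w that unfolding normal_state_def by blast
 have pos: "Im (\<omega> x) = 0" "0 <= Re (\<omega> x)" if "x \<in> M" "psd x" for x
  using w that pos_part_iff unfolding normal_state_def by blast+
 have scR: "\<omega> (r *\<^sub>R x) = complex_of_real r * \<omega> x" if "x \<in> M" for x r using sc[OF that] by (simp add: scaleR_scalar)
 have one: "\<omega> \<I> = 1" using w unfolding normal_state_def by blast
 have diff: "\<omega> (x - y) = \<omega> x - \<omega> y" if "x \<in> M" "y \<in> M" for x y
  using add[OF that(1), of "(-1) *\<^sub>R y"] scR[OF that(2), of "-1"] that by (simp add: mem_rules)
 have sa: "Im (\<omega> h) = 0" if h: "h \<in> M" "adj h = h" for h
 proof -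
  have z: "norm h *\<^sub>R \<I> + h \<in> M" "psd (norm h *\<^sub>R \<I> + h)" using h psd_norm_bound(2)[OF h(2) order_refl] by (auto simp: mem_rules)
  have "\<omega> (norm h *\<^sub>R \<I> + h) = complex_of_real (norm h) + \<omega> h" using h by (simp add: add scR one mem_rules)
  then show ?thesis using pos(1)[OF z] by simp
 qed
 have adj: "Re (\<omega> (adj x)) = Re (\<omega> x)" if x: "x \<in> M" for x
 proof -
  obtain h k where hk: "h \<in> M" "adj h = h" "k \<in> M" "adj k = k" "x = h + scalar_op \<i> ** k" "adj x = h - scalar_op \<i> ** k"
   using cartesian_decomposition[OF x] .
  show ?thesis unfolding hk(6) unfolding hk(5) using sa[OF hk(3,4)] hk(1,3) by (simp add: add diff sc mem_rules scalar_mem)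
 qed
 have pf: "pfun (\<lambda>x. Re (\<omega> x))" unfolding pfun_def using add scR adj pos by simp
 have "nfun (\<lambda>x. Re (\<omega> x))" unfolding nfun_def
 proof (intro conjI allI impI pf)
  fix A s and d :: real
  assume A: "A \<subseteq> M" "\<forall>x\<in>A. psd x" "directed_ops A" "s \<in> M" "form_sup A s" "d > 0"
  have A': "A \<subseteq> pos_part M" "op_directed A" using A by (auto simp: pos_part_iff directed_iff)
  then have "is_op_lub M A s" using is_op_lub_iff A by blast
  then have "(SUP x\<in>A. ereal (Re (\<omega> x))) = ereal (Re (\<omega> s))" using w A' unfolding normal_state_def by blast
  moreover have "ereal (Re (\<omega> s) - d) < ereal (Re (\<omega> s))" using A by simp
  ultimately have "ereal (Re (\<omega> s) - d) < (SUP x\<in>A. ereal (Re (\<omega> x)))" by simp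
  then show "\<exists>x\<in>A. Re (\<omega> s) - d < Re (\<omega> x)" by (auto simp: less_SUP_iff)
 qed
 then show ?R using add sc one by (simp add: nstate_def)
next
 assume w: ?R
 have add: "\<omega> (x + y) = \<omega> x + \<omega> y" if "x \<in> M" "y \<in> M" for x y using w that by blast
 have sc: "\<omega> (scalar_op a ** x) = a * \<omega> x" if "x \<in> M" for x a using w that by blast
 have st: "nstate (\<lambda>x. Re (\<omega> x))" using w by blast
 note pf = nstate_pfun[OF st]
 have im: "Im (\<omega> h) = 0" if h: "h \<in> M" "psd h" for h
 proof -
  have m: "scalar_op \<i> ** h \<in> M" using h by (simp add: mem_rules scalar_mem)
  have "adj (scalar_op \<i> ** h) = - (scalar_op \<i> ** h)" by (rule adj_imaginary[OF h(1) psd_sa[OF h(2)]])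
  then have "Re (\<omega> (scalar_op \<i> ** h)) = - Re (\<omega> (scalar_op \<i> ** h))"
   using pfun_adj[OF pf m] pfun_minus[OF pf m] by simp
  then show ?thesis using sc[OF h(1), of \<i>] by simp
 qed
 have "(SUP x\<in>A. ereal (Re (\<omega> x))) = ereal (Re (\<omega> s))"
  if A: "A \<subseteq> pos_part M" "op_directed A" and s: "is_op_lub M A s" for A s
 proof (rule antisym)
  have fs: "form_sup A s" "s \<in> M" and AM: "A \<subseteq> M" "!!x. x \<in> A ==> psd x" using A s is_op_lub_iff by (auto simp: pos_part_iff)
  show "(SUP x\<in>A. ereal (Re (\<omega> x))) <= ereal (Re (\<omega> s))"
   using fs AM unfolding form_sup_def by (intro SUP_least) (auto intro!: pfun_mono[OF pf])
  show "ereal (Re (\<omega> s)) <= (SUP x\<in>A. ereal (Re (\<omega> x)))"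
  proof (rule ereal_le_epsilon2)
   fix d :: real assume "d > 0"
   then obtain x where x: "x \<in> A" "Re (\<omega> s) - d < Re (\<omega> x)"
    using nfunD[OF nstate_nfun[OF st] AM _ fs(2,1), of d] A directed_iff[OF AM(1)] by blast
   have "ereal (Re (\<omega> s)) <= ereal (Re (\<omega> x)) + ereal d" using x by simp
   also have "... <= (SUP x\<in>A. ereal (Re (\<omega> x))) + ereal d" by (intro add_right_mono SUP_upper x)
   finally show "ereal (Re (\<omega> s)) <= (SUP x\<in>A. ereal (Re (\<omega> x))) + ereal d" .
  qed
 qed
 moreover have "\<omega> \<I> = 1" using nstate_id[OF st] im[of \<I>] by (simp add: complex_eq_iff)
 ultimately show ?L unfolding normal_state_def using add sc im pfun_nonneg[OF pf] by (auto simp: pos_part_iff)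
qed

lemma normal_state_nstate: "normal_state M \<omega> ==> nstate (\<lambda>x. Re (\<omega> x))"
 and normal_state_add: "normal_state M \<omega> ==> x \<in> M ==> y \<in> M ==> \<omega> (x + y) = \<omega> x + \<omega> y"
 and normal_state_scaleC: "normal_state M \<omega> ==> x \<in> M ==> \<omega> (scalar_op a ** x) = a * \<omega> x"
 by (simp_all add: normal_state_iff)

lemma normal_state_scaleR: "normal_state M \<omega> ==> x \<in> M ==> \<omega> (r *\<^sub>R x) = complex_of_real r * \<omega> x"
 by (simp add: scaleR_scalar normal_state_scaleC)

lemma normal_state_sum: "normal_state M \<omega> ==> (!!i. i \<in> I ==> x i \<in> M) ==> \<omega> (\<Sum>i\<in>I. x i) = (\<Sum>i\<in>I. \<omega> (x i))"
 using normal_state_scaleR[of \<omega> 0 0] by (induction I rule: infinite_finite_induct) (auto simp: normal_state_add sum_mem)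

text \<open>A crude bound that serves to make the supremum in \<open>predual_norm\<close>
  bounded.\<close>

lemma normal_state_cmod_le:
 assumes w: "normal_state M \<omega>" and x: "x \<in> M" shows "cmod (\<omega> x) <= 2 * norm x"
proof -
 note st = normal_state_nstate[OF w]
 have b: "\<bar>Re (\<omega> y)\<bar> <= norm y" if "y \<in> M" for y
  using pfun_abs_bound[OF nstate_pfun[OF st] that] nstate_id[OF st] by simp
 have "\<bar>Im (\<omega> x)\<bar> <= norm x"
  using b[of "scalar_op \<i> ** x"] norm_scalar_compose[of \<i> x] x by (simp add: normal_state_scaleC[OF w] mem_rules scalar_mem)
 then show ?thesis using b[OF x] cmod_le[of "\<omega> x"] by linarith
qed

lemma predual_norm_ge:
 assumes w: "normal_state M \<omega>" "normal_state M \<omega>'" and x: "x \<in> M" "norm x <= 1"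
 shows "cmod (\<omega> x - \<omega>' x) <= predual_norm M (\<lambda>x. \<omega> x - \<omega>' x)" unfolding predual_norm_def
proof (rule cSUP_upper)
 show "bdd_above ((\<lambda>x. cmod (\<omega> x - \<omega>' x)) ` {x \<in> M. norm x <= 1})"
 proof (rule bdd_aboveI2)
  fix y assume "y \<in> {x \<in> M. norm x <= 1}"
  then show "cmod (\<omega> y - \<omega>' y) <= 4"
   using normal_state_cmod_le[OF w(1), of y] normal_state_cmod_le[OF w(2), of y] norm_triangle_ineq4[of "\<omega> y" "\<omega>' y"] by auto
 qed
qed (use x in auto)

text \<open>A phase makes the difference at x real and nonnegative, the self-adjoint part h keeps
  it, and h = 2 a - 1 with 0 <= a <= 1; this is the factor 2.\<close>

lemma predual_norm_le:
 assumes w: "normal_state M \<omega>" "normal_state M \<omega>'"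
  and d: "!!a. a \<in> M ==> psd a ==> psd (\<I> - a) ==> \<bar>Re (\<omega> a) - Re (\<omega>' a)\<bar> <= d"
 shows "predual_norm M (\<lambda>x. \<omega> x - \<omega>' x) <= 2 * d" unfolding predual_norm_def
proof (rule cSUP_least)
 have "0 \<in> {x \<in> M. norm x <= 1}" by simp
 then show "{x \<in> M. norm x <= 1} ~= {}" by blast
 fix x assume "x \<in> {x \<in> M. norm x <= 1}"
 then have x: "x \<in> M" "norm x <= 1" by auto
 have d0: "0 <= d" using d[of 0] by simp
 define z where "z = \<omega> x - \<omega>' x"
 show "cmod (\<omega> x - \<omega>' x) <= 2 * d"
 proof (cases "z = 0")
  case False
  define c where "c = cnj z / complex_of_real (cmod z)"
  have c: "cmod c = 1" using False by (simp add: c_def norm_divide)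
  have "c * z = complex_of_real (cmod z)"
  proof -
   have "z * cnj z = complex_of_real (cmod z) * complex_of_real (cmod z)" using complex_norm_square[of z] by (simp add: power2_eq_square)
   then have "z * cnj z / complex_of_real (cmod z) = complex_of_real (cmod z)" using False by simp
   then show ?thesis by (simp add: c_def mult.commute)
  qed
  define y where "y = scalar_op c ** x"
  have y: "y \<in> M" "norm y <= 1" using x norm_scalar_compose[of c x] c by (auto simp: y_def mem_rules scalar_mem)
  have val: "Re (\<omega> y) - Re (\<omega>' y) = cmod z"
  proof -
   have "\<omega> y - \<omega>' y = c * z" using x by (simp add: y_def z_def normal_state_scaleC[OF w(1)] normal_state_scaleC[OF w(2)] right_diff_distrib)
   then show ?thesis unfolding \<open>c * z = complex_of_real (cmod z)\<close> by (metis Re_complex_of_real minus_complex.sel(1))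
  qed
  define h where "h = (1 / 2) *\<^sub>R (y + adj y)"
  have h: "h \<in> M" "adj h = h" using y by (auto simp: h_def mem_rules adj_rules add.commute)
  have "norm (y + adj y) <= 2" using norm_triangle_ineq[of y "adj y"] y by simp
  then have hn: "norm h <= 1" by (simp add: h_def)
  define a where "a = (1 / 2) *\<^sub>R (\<I> + h)"
  have "\<I> - a = (1 / 2) *\<^sub>R (1 *\<^sub>R \<I> - h)" by (rule op_ext_inner) (simp add: a_def bilinear_simps field_simps)
  then have a: "a \<in> M" "psd a" "psd (\<I> - a)" using h psd_norm_bound[OF h(2) hn] by (auto simp: a_def mem_rules intro!: psd_scaleR)
  have Re: "Re (f a) = (1 + Re (f y)) / 2" if f: "normal_state M f" for f
  proof -
   note pf = nstate_pfun[OF normal_state_nstate[OF f]] and one = nstate_id[OF normal_state_nstate[OF f]]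
   have "Re (f h) = Re (f y)"
    using y pfun_scaleR[OF pf, of "y + adj y" "1/2"] pfun_add[OF pf, of y "adj y"] pfun_adj[OF pf y(1)] by (simp add: h_def mem_rules)
   then show ?thesis using h pfun_scaleR[OF pf, of "\<I> + h" "1/2"] pfun_add[OF pf id_mem h(1)] one by (simp add: a_def mem_rules)
  qed
  have "cmod z = 2 * (Re (\<omega> a) - Re (\<omega>' a))" using val by (simp add: Re[OF w(1)] Re[OF w(2)] field_simps)
  then show ?thesis using d[OF a] by (simp add: z_def)
 qed (use d0 in \<open>simp add: z_def\<close>)
qed

lemma conditional_expectation_basic:
 assumes ce: "normal_conditional_expectation M N E"
 shows "N \<subseteq> M" "\<I> \<in> N" "!!x. x \<in> M ==> E x \<in> N" "!!x. x \<in> M ==> E x \<in> M" "!!x. x \<in> N ==> E x = x"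
  "!!x y. x \<in> M ==> y \<in> M ==> E (x + y) = E x + E y"
  "!!x a. x \<in> M ==> E (scalar_op a ** x) = scalar_op a ** E x"
  "!!x. x \<in> M ==> psd x ==> psd (E x)"
  "!!a b x. a \<in> N ==> b \<in> N ==> x \<in> M ==> E (a ** x ** b) = a ** E x ** b"
proof -
 note D0 = ce[unfolded normal_conditional_expectation_def]
 note D1 = D0[THEN conjunct2] note D2 = D1[THEN conjunct2] note D3 = D2[THEN conjunct2] note D4 = D3[THEN conjunct2]
 note D5 = D4[THEN conjunct2] note D6 = D5[THEN conjunct2] note D7 = D6[THEN conjunct2]
 interpret N: vn_algebra N by (rule vn_algebra.intro[OF D0[THEN conjunct1]])
 show NM: "N \<subseteq> M" by (rule D1[THEN conjunct1])
 show "\<I> \<in> N" by (rule N.id_mem)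
 show EN: "E x \<in> N" if "x \<in> M" for x by (rule D2[THEN conjunct1, THEN bspec, OF that])
 show EM: "E x \<in> M" if "x \<in> M" for x using EN[OF that] NM by (rule subsetD[rotated])
 show "E x = x" if "x \<in> N" for x by (rule D3[THEN conjunct1, THEN bspec, OF that])
 show "E (x + y) = E x + E y" if "x \<in> M" "y \<in> M" for x y by (rule D4[THEN conjunct1, THEN bspec, THEN bspec, OF that])
 show "E (scalar_op a ** x) = scalar_op a ** E x" if "x \<in> M" for x a by (rule D5[THEN conjunct1, THEN bspec, THEN spec, OF that])
 show "psd (E x)" if "x \<in> M" "psd x" for x
 proof -
  have "x \<in> pos_part M" using that by (simp add: pos_part_iff)
  then have "op_pos (E x)" by (rule D6[THEN conjunct1, THEN bspec])
  then show ?thesis using op_pos_psd[OF EM[OF that(1)]] by simp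
 qed
 show "E (a ** x ** b) = a ** E x ** b" if "a \<in> N" "b \<in> N" "x \<in> M" for a b x
  by (rule D7[THEN conjunct1, THEN bspec, THEN bspec, THEN bspec, OF that])
qed

lemma conditional_expectation_linear:
 assumes ce: "normal_conditional_expectation M N E"
 shows "!!x r. x \<in> M ==> E (r *\<^sub>R x) = r *\<^sub>R E x" "!!x. x \<in> M ==> E (- x) = - E x"
  "!!x y. x \<in> M ==> y \<in> M ==> E (x - y) = E x - E y" "!!x. x \<in> M ==> E (adj x) = adj (E x)"
proof -
 note B = conditional_expectation_basic[OF ce]
 show sc: "E (r *\<^sub>R x) = r *\<^sub>R E x" if "x \<in> M" for x r using B(7)[OF that] by (simp add: scaleR_scalar)
 show mi: "E (- x) = - E x" if "x \<in> M" for x using sc[OF that, of "-1"] by simp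
 show di: "E (x - y) = E x - E y" if "x \<in> M" "y \<in> M" for x y using B(6)[of x "- y"] mi that by (simp add: mem_rules)
 have sa: "adj (E h) = E h" if h: "h \<in> M" "adj h = h" for h
 proof -
  have "psd (norm h *\<^sub>R \<I> + h)" by (rule psd_norm_bound(2)[OF h(2) order_refl])
  then have "psd (E (norm h *\<^sub>R \<I> + h))" using B(8) h by (simp add: mem_rules)
  moreover have "E (norm h *\<^sub>R \<I> + h) = norm h *\<^sub>R \<I> + E h" using h B(2,5) by (simp add: B(6) sc mem_rules)
  ultimately have "adj (norm h *\<^sub>R \<I> + E h) = norm h *\<^sub>R \<I> + E h" using psd_sa by metis
  then show ?thesis by (simp add: adj_rules)
 qed
 show "E (adj x) = adj (E x)" if x: "x \<in> M" for x
 proof -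
  obtain h k where hk: "h \<in> M" "adj h = h" "k \<in> M" "adj k = k" "x = h + scalar_op \<i> ** k" "adj x = h - scalar_op \<i> ** k"
   using cartesian_decomposition[OF x] .
  have "E x = E h + scalar_op \<i> ** E k" unfolding hk(5) using hk(1,3) by (simp add: B(6,7) mem_rules scalar_mem)
  moreover have "E (adj x) = E h - scalar_op \<i> ** E k" unfolding hk(6) using hk(1,3) by (simp add: di B(7) mem_rules scalar_mem)
  ultimately show ?thesis using sa hk adj_imaginary[OF B(4)[OF hk(3)] sa[OF hk(3,4)]] by (simp add: adj_rules)
 qed
qed

text \<open>E is positive on the square of x - E x, and by the bimodule property the terms other
  than \<open>E (adj x ** x)\<close> are all \<open>adj (E x) ** E x\<close> up to sign.\<close>

lemma conditional_expectation_schwarz: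
 assumes ce: "normal_conditional_expectation M N E" shows "schwarz_map E"
proof (rule schwarz_mapI)
 note B = conditional_expectation_basic[OF ce] and L = conditional_expectation_linear[OF ce]
 fix x assume x: "x \<in> M"
 show "E x \<in> M" by (rule B(4)[OF x])
 show "E (\<I> - x) = \<I> - E x" using x B(2,5) by (simp add: L(3))
 show "E (adj x) = adj (E x)" by (rule L(4)[OF x])
 define y where "y = x - E x"
 have Ex: "E x \<in> M" "E x \<in> N" "adj (E x) \<in> N" using B(3,4)[OF x] B(3)[of "adj x"] L(4)[OF x] x by (auto simp: mem_rules)
 have y: "y \<in> M" using x Ex by (simp add: y_def mem_rules)
 have 1: "E (adj x ** E x) = adj (E x) ** E x" using B(9)[OF B(2) Ex(2), of "adj x"] x by (simp add: op_simps mem_rules L(4))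
 have 2: "E (adj (E x) ** x) = adj (E x) ** E x" using B(9)[OF Ex(3) B(2), of x] x by (simp add: op_simps)
 have 3: "E (adj (E x) ** E x) = adj (E x) ** E x" using B(9)[OF Ex(3) Ex(2), of \<I>] B(2,5) by (simp add: op_simps)
 have "adj y ** y = (adj x ** x - adj x ** E x) - (adj (E x) ** x - adj (E x) ** E x)" by (simp add: y_def adj_rules op_simps)
 then have "E (adj y ** y) = E (adj x ** x) - adj (E x) ** E x" using x Ex by (simp add: L(3) 1 2 3 mem_rules)
 then show "psd (E (adj x ** x) - adj (E x) ** E x)" using B(8)[of "adj y ** y"] y psd_square by (metis adj_mem compose_mem)
qed

lemma nfun_conditional_expectation:
 assumes ce: "normal_conditional_expectation M N E" and f: "nfun f"
 shows "nfun (\<lambda>x. f (E x))"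
proof -
 note B = conditional_expectation_basic[OF ce] and L = conditional_expectation_linear[OF ce]
 note pf = nfun_pfun[OF f]
 have "pfun (\<lambda>x. f (E x))" unfolding pfun_def using B L by (auto simp: pfun_rules[OF pf] pfun_adj[OF pf] intro: pfun_nonneg[OF pf])
 then show ?thesis unfolding nfun_def
 proof (intro conjI allI impI)
  fix A s and d :: real
  assume A: "A \<subseteq> M" "\<forall>x\<in>A. psd x" "directed_ops A" "s \<in> M" "form_sup A s" "d > 0"
  have A': "A \<subseteq> pos_part M" "op_directed A" using A by (auto simp: pos_part_iff directed_iff)
  then have "is_op_lub M A s" using is_op_lub_iff A by blast
  then have lub: "is_op_lub M (E ` A) (E s)" using ce A' unfolding normal_conditional_expectation_def by blast
  have EA: "E ` A \<subseteq> M" "\<forall>x\<in>E ` A. psd x" using A B by auto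
  have "directed_ops (E ` A)" unfolding directed_ops_def
  proof (intro conjI ballI)
   show "E ` A ~= {}" using A by (auto simp: directed_ops_def)
   fix x' y' assume "x' \<in> E ` A" "y' \<in> E ` A"
   then obtain x y where xy: "x \<in> A" "y \<in> A" "x' = E x" "y' = E y" by blast
   then obtain z where z: "z \<in> A" "psd (z - x)" "psd (z - y)" using A(3) unfolding directed_ops_def by blast
   have "psd (E z - E x)" "psd (E z - E y)"
    using B(8)[of "z - x"] B(8)[of "z - y"] xy z A(1) L(3)[of z x] L(3)[of z y] by (auto simp: mem_rules subset_iff)
   then show "\<exists>z'\<in>E ` A. psd (z' - x') \<and> psd (z' - y')" using z xy by blast
  qed
  moreover from this have "form_sup (E ` A) (E s)"
   using is_op_lub_iff[of "E ` A" "E s"] lub EA by (auto simp: pos_part_iff directed_iff subset_iff)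
  ultimately have "\<exists>x\<in>E ` A. f (E s) - d < f x" using EA B(4)[OF A(4)] A(6) by (intro nfunD[OF f]) auto
  then show "\<exists>x\<in>A. f (E s) - d < f (E x)" by blast
 qed
qed

lemma nstate_conditional_expectation:
 assumes ce: "normal_conditional_expectation M N E" and f: "nstate f"
 shows "nstate (\<lambda>x. f (E x))"
 using nfun_conditional_expectation[OF ce nstate_nfun[OF f]] conditional_expectation_basic(2,5)[OF ce] nstate_id[OF f]
 by (simp add: nstate_def)

lemma normal_state_conditional_expectation:
 assumes ce: "normal_conditional_expectation M N E" and w: "normal_state M \<omega>"
 shows "normal_state M (\<omega> \<circ> E)" unfolding normal_state_iff
 using w nstate_conditional_expectation[OF ce normal_state_nstate[OF w]] conditional_expectation_basic[OF ce]
 by (auto simp: normal_state_iff)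

end

section \<open>Transportation costs along words of conditional expectations and along powers of
  P\<close>

section \<open>Transportation costs\<close>

lemma transportation_cost_le_iff:
 "transportation_cost B \<omega> \<omega>' <= K \<longleftrightarrow> (\<forall>(x, y)\<in>B. ereal (Re (\<omega> x) - Re (\<omega>' y)) <= K)"
 unfolding transportation_cost_def SUP_le_iff by (simp add: split_def)

text \<open>Cauchy-Schwarz for one further summand: it merges the cost of one step with that of s
  later steps.\<close>

lemma sqrt_add_le:
 fixes b Y s :: real assumes "0 <= b" "0 <= Y" "0 <= s"
 shows "sqrt b + sqrt (s * Y) <= sqrt ((s + 1) * (b + Y))"
proof (rule real_le_rsqrt)
 have "2 * (sqrt b * sqrt (s * Y)) <= s * b + Y"
 proof -
  have "0 <= (sqrt (s * b) - sqrt Y)\<^sup>2" by simp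
  also have "... = s * b + Y - 2 * (sqrt (s * b) * sqrt Y)" using assms by (simp add: power2_diff)
  finally show ?thesis by (simp add: real_sqrt_mult mult_ac)
 qed
 then show "(sqrt b + sqrt (s * Y))\<^sup>2 <= (s + 1) * (b + Y)" using assms by (simp add: power2_sum algebra_simps)
qed

locale curvature_setting = traced_algebra M \<tau>
 for M :: "'h::chilbert_space op set" and \<tau> +
 fixes N :: "'h op set" and n :: nat and Ni :: "nat => 'h op set" and E :: "nat => 'h op => 'h op"
  and P EN :: "'h op => 'h op" and B :: "('h op \<times> 'h op) set" and \<kappa> C :: real
 assumes n: "1 <= n"
  and ce: "!!i. i \<in> {1..n} ==> normal_conditional_expectation M (Ni i) (E i)"
  and P: "!!x. P x = (1 / real n) *\<^sub>R (\<Sum>i=1..n. E i x)"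
  and invariant: "N = {x \<in> M. P x = x}"
  and ceN: "normal_conditional_expectation M N EN"
  and compatible: "!!i x. i \<in> {1..n} ==> x \<in> M ==> EN (E i x) = EN x"
  and metric: "transportation_metric M B"
  and kappa: "0 < \<kappa>" and denominator: "(1 - \<kappa>) ^ n < 1"
  and ricci: "coarse_ricci_lower_bound M EN B P \<kappa>"
  and triangle: "cost_triangle_inequality M B"
  and cost_norm: "!!i \<rho>. i \<in> {1..n} ==> normal_state M \<rho> ==>
   transportation_cost B \<rho> (\<rho> \<circ> E i) <= ereal (C * predual_norm M (\<lambda>x. \<rho> x - (\<rho> \<circ> E i) x))"
begin

abbreviation T where "T \<equiv> transportation_cost B"

lemma B_mem: "(x, y) \<in> B ==> x \<in> M" "(x, y) \<in> B ==> y \<in> M" "(x, y) \<in> B ==> adj x = x" "(x, y) \<in> B ==> adj y = y"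
proof -
 have "B \<subseteq> sa_part M \<times> sa_part M" using metric by (simp add: transportation_metric_def)
 then show "(x, y) \<in> B ==> x \<in> M" "(x, y) \<in> B ==> y \<in> M" "(x, y) \<in> B ==> adj x = x" "(x, y) \<in> B ==> adj y = y"
  unfolding sa_part_def using is_adjoint_adj by fastforce+
qed

lemma cost_cong:
 assumes "!!x. x \<in> M ==> adj x = x ==> Re (\<omega>' x) = Re (\<rho>' x)"
 shows "T \<omega> \<omega>' = T \<omega> \<rho>'" unfolding transportation_cost_def using B_mem assms by (intro SUP_cong refl) auto

lemma cost_nonneg:
 assumes "normal_state M \<omega>" "normal_state M \<omega>'" shows "0 <= T \<omega> \<omega>'"
proof -
 obtain x y where xy: "(x, y) \<in> B" "0 <= Re (\<omega> x) - Re (\<omega>' y)"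
  using metric assms unfolding transportation_metric_def by blast
 have "ereal (Re (\<omega> x) - Re (\<omega>' y)) <= T \<omega> \<omega>'"
  using transportation_cost_le_iff[of B \<omega> \<omega>' "T \<omega> \<omega>'"] xy by auto
 then show ?thesis using xy(2) by (meson ereal_less_eq(5) order_trans)
qed

lemma cost_self:
 assumes w: "normal_state M \<omega>" shows "T \<omega> \<omega> <= 0" unfolding transportation_cost_le_iff
proof (safe)
 fix x y assume xy: "(x, y) \<in> B"
 have "op_le x y" using metric xy unfolding transportation_metric_def by blast
 then have "psd (y - x)" using op_le_psd B_mem[OF xy] by blast
 then have "Re (\<omega> x) <= Re (\<omega> y)" using pfun_mono[OF nstate_pfun[OF normal_state_nstate[OF w]]] B_mem[OF xy] by blast
 then show "ereal (Re (\<omega> x) - Re (\<omega> y)) <= 0" by simp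
qed

lemma cost_triangle:
 "normal_state M \<omega> ==> normal_state M \<rho> ==> normal_state M \<sigma> ==> T \<omega> \<sigma> <= T \<omega> \<rho> + T \<rho> \<sigma>"
 using triangle unfolding cost_triangle_inequality_def by blast

text \<open>For fixed \<omega> the cost is a supremum of expressions affine in the second state, so
  it is convex there.\<close>

lemma cost_average:
 assumes le: "!!i. i \<in> {1..n} ==> T \<omega> (\<rho> i) <= ereal K"
  and av: "!!x. x \<in> M ==> \<rho>' x = (1 / real n) *\<^sub>R (\<Sum>i=1..n. \<rho> i x)"
 shows "T \<omega> \<rho>' <= ereal K" unfolding transportation_cost_le_iff
proof safe
 fix x y assume xy: "(x, y) \<in> B"
 have "Re (\<omega> x) - K <= Re (\<rho> i y)" if "i \<in> {1..n}" for i
  using le[OF that] xy unfolding transportation_cost_le_iff by fastforce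
 then have "(\<Sum>i=1..n. Re (\<omega> x) - K) <= (\<Sum>i=1..n. Re (\<rho> i y))" by (rule sum_mono)
 then have "real n * (Re (\<omega> x) - K) <= (\<Sum>i=1..n. Re (\<rho> i y))" by simp
 moreover have "Re (\<rho>' y) = (\<Sum>i=1..n. Re (\<rho> i y)) / real n" using av B_mem[OF xy] by (simp add: Re_sum)
 ultimately have "Re (\<omega> x) - K <= Re (\<rho>' y)" using n by (simp add: pos_le_divide_eq mult.commute)
 then show "ereal (Re (\<omega> x) - Re (\<rho>' y)) <= ereal K" by simp
qed

lemmas ceB = conditional_expectation_basic[OF ce] and ceL = conditional_expectation_linear[OF ce]
lemmas ceNB = conditional_expectation_basic[OF ceN] and ceNL = conditional_expectation_linear[OF ceN]

lemma P_mem: "x \<in> M ==> P x \<in> M" unfolding P using ceB(4) by (intro scaleR_mem sum_mem) auto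

lemma P_add: "x \<in> M ==> y \<in> M ==> P (x + y) = P x + P y" using ceB(6) by (simp add: P sum.distrib scaleR_add_right)

lemma P_scaleR: "x \<in> M ==> P (r *\<^sub>R x) = r *\<^sub>R P x" using ceL(1) by (simp add: P scaleR_sum_right mult.commute)

lemma P_sum: "(!!i. i \<in> I ==> x i \<in> M) ==> P (\<Sum>i\<in>I. x i) = (\<Sum>i\<in>I. P (x i))"
 using P_scaleR[of 0 0] by (induction I rule: infinite_finite_induct) (auto simp: P_add sum_mem)

lemma P_diff: "x \<in> M ==> y \<in> M ==> P (x - y) = P x - P y"
proof -
 assume "x \<in> M" "y \<in> M"
 then show ?thesis using P_add[of "x - y" y] by (simp add: mem_rules)
qed

lemma state_P_apply:
 assumes w: "normal_state M \<omega>" and y: "y \<in> M"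
 shows "\<omega> (P y) = (1 / real n) *\<^sub>R (\<Sum>i=1..n. \<omega> (E i y))"
proof -
 have m: "E i y \<in> M" if "i \<in> {1..n}" for i using ceB(4)[OF that y] .
 have "\<omega> (P y) = complex_of_real (1 / real n) * \<omega> (\<Sum>i=1..n. E i y)"
  unfolding P by (rule normal_state_scaleR[OF w sum_mem]) (rule m)
 also have "\<omega> (\<Sum>i=1..n. E i y) = (\<Sum>i=1..n. \<omega> (E i y))" by (rule normal_state_sum[OF w m])
 finally show ?thesis by (simp only: scaleR_conv_of_real)
qed

lemma P_adj: "x \<in> M ==> P (adj x) = adj (P x)" using ceL(4) by (simp add: P adj_rules)

lemma P_psd: "x \<in> M ==> psd x ==> psd (P x)" unfolding P using ceB(8) by (intro psd_scaleR psd_sum) auto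

lemma P_N: "x \<in> N ==> P x = x" using invariant by blast

lemma P_EN: "x \<in> M ==> P (EN x) = EN x" using P_N ceNB(3) by blast

lemma EN_sum: "(!!i. i \<in> I ==> x i \<in> M) ==> EN (\<Sum>i\<in>I. x i) = (\<Sum>i\<in>I. EN (x i))"
 using ceNL(1)[of 0 0] by (induction I rule: infinite_finite_induct) (auto simp: ceNB(6) sum_mem)

lemma EN_P: "x \<in> M ==> EN (P x) = EN x"
proof -
 assume x: "x \<in> M"
 have m: "E i x \<in> M" if "i \<in> {1..n}" for i using ceB(4)[OF that x] .
 have "EN (P x) = (1 / real n) *\<^sub>R EN (\<Sum>i=1..n. E i x)" unfolding P by (rule ceNL(1)[OF sum_mem]) (rule m)
 also have "EN (\<Sum>i=1..n. E i x) = (\<Sum>i=1..n. EN (E i x))" by (rule EN_sum[OF m])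
 also have "(\<Sum>i=1..n. EN (E i x)) = real n *\<^sub>R EN x" using compatible x by (simp add: sum_constant_scaleR)
 finally show ?thesis using n by simp
qed

lemma nfun_P: assumes f: "nfun f" shows "nfun (\<lambda>x. f (P x))"
proof (rule nfun_cong)
 show "nfun (\<lambda>x. (1 / real n) * (\<Sum>i=1..n. f (E i x)))"
  by (intro nfun_scale nfun_sum nfun_conditional_expectation[OF ce f]) auto
 fix x assume x: "x \<in> M"
 have m: "E i x \<in> M" if "i \<in> {1..n}" for i using ceB(4)[OF that x] .
 have "f (P x) = (1 / real n) * f (\<Sum>i=1..n. E i x)" unfolding P by (rule pfun_scaleR[OF nfun_pfun[OF f] sum_mem]) (rule m)
 also have "f (\<Sum>i=1..n. E i x) = (\<Sum>i=1..n. f (E i x))" by (rule pfun_sum[OF nfun_pfun[OF f] m])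
 finally show "(1 / real n) * (\<Sum>i=1..n. f (E i x)) = f (P x)" ..
qed

lemma state_P: assumes w: "normal_state M \<omega>" shows "normal_state M (\<omega> \<circ> P)"
proof -
 have m: "(\<Sum>i=1..n. E i x) \<in> M" if "x \<in> M" for x using ceB(4) that by (intro sum_mem) auto
 have P: "P (scalar_op a ** x) = scalar_op a ** P x" if "x \<in> M" for a x using ceB(7) that by (simp add: P op_sum op_simps)
 have "P \<I> = \<I>" using P_N ceNB(2) by blast
 then have "nstate (\<lambda>x. Re ((\<omega> \<circ> P) x))"
  using nfun_P[OF nstate_nfun[OF normal_state_nstate[OF w]]] nstate_id[OF normal_state_nstate[OF w]] by (simp add: nstate_def)
 then show ?thesis unfolding normal_state_iff using P_add P_mem P by (auto simp: normal_state_add[OF w] normal_state_scaleC[OF w])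
qed

lemma Pow_mem: "x \<in> M ==> (P ^^ m) x \<in> M" by (induction m) (auto simp: P_mem)

lemma state_Pow: "normal_state M \<omega> ==> normal_state M (\<omega> \<circ> P ^^ m)"
proof (induction m)
 case (Suc m)
 then have "normal_state M ((\<omega> \<circ> P ^^ m) \<circ> P)" by (intro state_P)
 also have "(\<omega> \<circ> P ^^ m) \<circ> P = \<omega> \<circ> P ^^ Suc m" by (simp add: fun_eq_iff funpow_swap1)
 finally show ?case .
qed (simp add: comp_def)

lemma state_E: "i \<in> {1..n} ==> normal_state M \<omega> ==> normal_state M (\<omega> \<circ> E i)"
 by (rule normal_state_conditional_expectation[OF ce])

lemma state_EN: "normal_state M \<omega> ==> normal_state M (\<omega> \<circ> EN)" by (rule normal_state_conditional_expectation[OF ceN])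

lemma E_N: "i \<in> {1..n} ==> x \<in> M ==> E i (E i x) = E i x" using ceB(3,5) by blast

text \<open>The chain rule gives |f a - f (E i a)| <= sqrt ((v - v') / 2) for 0 <= a <= 1, which
  \<open>predual_norm_le\<close> doubles to sqrt (2 (v - v')). The alternative C = 0 covers states
  of infinite entropy, for which the assumed cost bound by itself makes the cost
  nonpositive.\<close>

lemma cost_step:
 assumes w: "normal_state M \<omega>" and \<sigma>: "normal_state M \<sigma>" "!!i x. i \<in> {1..n} ==> x \<in> M ==> \<sigma> (E i x) = \<sigma> x"
  and i: "i \<in> {1..n}" and C: "0 <= C"
  and v: "v \<ge> 0" "C = 0 \<or> var_entropy (\<lambda>x. Re (\<omega> x)) (\<lambda>x. Re (\<sigma> x)) = ennreal v"
 shows "\<exists>v'\<ge>0. v' <= v \<and> (C = 0 \<or> var_entropy (\<lambda>x. Re ((\<omega> \<circ> E i) x)) (\<lambda>x. Re (\<sigma> x)) = ennreal v') \<and>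
  T \<omega> (\<omega> \<circ> E i) <= ereal (C * sqrt (2 * (v - v')))"
proof (cases "C = 0")
 case True
 then show ?thesis using cost_norm[OF i w] v(1) by (intro exI[of _ v]) simp
next
 case False
 then have v: "v \<ge> 0" "var_entropy (\<lambda>x. Re (\<omega> x)) (\<lambda>x. Re (\<sigma> x)) = ennreal v" using v by auto
 define f where "f x = Re (\<omega> x)" for x
 define s where "s x = Re (\<sigma> x)" for x
 have st: "nstate f" "nstate s" using normal_state_nstate w \<sigma>(1) by (auto simp: f_def[abs_def] s_def[abs_def])
 have stE: "nstate (\<lambda>x. f (E i x))" by (rule nstate_conditional_expectation[OF ce[OF i] st(1)])
 have chain: "var_entropy (\<lambda>x. f (E i x)) s + ennreal (2 * (f a - f (E i a))\<^sup>2) <= ennreal v"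
  if "a \<in> M" "psd a" "psd (\<I> - a)" for a unfolding v(2)[symmetric] f_def[symmetric] s_def[symmetric]
  using \<sigma>(2)[OF i] E_N[OF i] by (intro entropy_chain st stE that conditional_expectation_schwarz[OF ce[OF i]]) (auto simp: s_def)
 have "var_entropy (\<lambda>x. f (E i x)) s <= ennreal v" using chain[of 0] by (simp add: pfun_zero[OF nstate_pfun[OF st(1)]] pfun_zero[OF nstate_pfun[OF stE]])
 then obtain v' where v': "var_entropy (\<lambda>x. f (E i x)) s = ennreal v'" "0 <= v'" "v' <= v"
  using v(1) by (cases "var_entropy (\<lambda>x. f (E i x)) s") (auto simp: top_unique)
 have "\<bar>f a - f (E i a)\<bar> <= sqrt ((v - v') / 2)" if "a \<in> M" "psd a" "psd (\<I> - a)" for a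
 proof (rule real_le_rsqrt)
  have "ennreal (v' + 2 * (f a - f (E i a))\<^sup>2) <= ennreal v" using chain[OF that] v' by simp
  then have "v' + 2 * (f a - f (E i a))\<^sup>2 <= v" using v(1) by simp
  then show "\<bar>f a - f (E i a)\<bar>\<^sup>2 <= (v - v') / 2" by simp
 qed
 then have "predual_norm M (\<lambda>x. \<omega> x - (\<omega> \<circ> E i) x) <= 2 * sqrt ((v - v') / 2)"
  by (intro predual_norm_le w state_E i) (auto simp: f_def)
 also have "... = sqrt (2 * (v - v'))"
 proof -
  have "2 * sqrt ((v - v') / 2) = sqrt (4 * ((v - v') / 2))" unfolding real_sqrt_mult by simp
  then show ?thesis by (simp add: field_simps)
 qed
 finally have "C * predual_norm M (\<lambda>x. \<omega> x - (\<omega> \<circ> E i) x) <= C * sqrt (2 * (v - v'))" using C by (rule mult_left_mono)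
 then have "T \<omega> (\<omega> \<circ> E i) <= ereal (C * sqrt (2 * (v - v')))"
  using cost_norm[OF i w] by (meson ereal_less_eq(3) order_trans)
 then show ?thesis using v' by (auto simp: f_def s_def[abs_def])
qed

text \<open>Induction along words, first letter first: \<omega> is the state reached so far, k the
  cost accumulated, v the entropy left. Averaging over the first letter turns the words into a power
  of P.\<close>

lemma cost_entropy:
 assumes C: "0 <= C" and \<rho>: "normal_state M \<rho>" and \<sigma>: "normal_state M \<sigma>" "!!i x. i \<in> {1..n} ==> x \<in> M ==> \<sigma> (E i x) = \<sigma> x"
  and w: "normal_state M \<omega>" and v: "v \<ge> 0" "C = 0 \<or> var_entropy (\<lambda>x. Re (\<omega> x)) (\<lambda>x. Re (\<sigma> x)) = ennreal v"
  and k: "T \<rho> \<omega> <= ereal k"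
 shows "T \<rho> (\<omega> \<circ> P ^^ m) <= ereal (k + C * sqrt (2 * (real m * v)))" using w v k
proof (induction m arbitrary: \<omega> v k)
 case (Suc m)
 show ?case
 proof (rule cost_average)
  fix i assume i: "i \<in> {1..n}"
  obtain v' where v': "v' \<ge> 0" "v' <= v" "C = 0 \<or> var_entropy (\<lambda>x. Re ((\<omega> \<circ> E i) x)) (\<lambda>x. Re (\<sigma> x)) = ennreal v'"
   "T \<omega> (\<omega> \<circ> E i) <= ereal (C * sqrt (2 * (v - v')))"
   using cost_step[OF Suc.prems(1) \<sigma> i C Suc.prems(2,3)] by blast
  have "T \<rho> (\<omega> \<circ> E i) <= T \<rho> \<omega> + T \<omega> (\<omega> \<circ> E i)" using Suc.prems \<rho> i by (intro cost_triangle state_E)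
  also have "... <= ereal k + ereal (C * sqrt (2 * (v - v')))" by (intro add_mono Suc.prems v')
  finally have "T \<rho> (\<omega> \<circ> E i) <= ereal (k + C * sqrt (2 * (v - v')))" by simp
  then have "T \<rho> ((\<omega> \<circ> E i) \<circ> P ^^ m) <= ereal ((k + C * sqrt (2 * (v - v'))) + C * sqrt (2 * (real m * v')))"
   by (intro Suc.IH state_E i Suc.prems v')
  also have "... <= ereal (k + C * sqrt (2 * (real (Suc m) * v)))"
  proof -
   \<comment> \<open>One step that uses up v - v' and m later steps with v' merge into m + 1 steps
     with v.\<close>
   have "sqrt (2 * (v - v')) + sqrt (real m * (2 * v')) <= sqrt ((real m + 1) * (2 * (v - v') + 2 * v'))"
    using v' by (intro sqrt_add_le) auto
   also have "(real m + 1) * (2 * (v - v') + 2 * v') = 2 * (real (Suc m) * v)" by (simp add: algebra_simps)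
   finally have "C * (sqrt (2 * (v - v')) + sqrt (2 * (real m * v'))) <= C * sqrt (2 * (real (Suc m) * v))"
    using C by (intro mult_left_mono) (auto simp: mult.left_commute)
   then show ?thesis by (simp add: distrib_left)
  qed
  finally show "T \<rho> ((\<omega> \<circ> E i) \<circ> P ^^ m) <= ereal (k + C * sqrt (2 * (real (Suc m) * v)))" .
 next
  fix x assume x: "x \<in> M"
  have y: "(P ^^ m) x \<in> M" by (rule Pow_mem[OF x])
  have "(\<omega> \<circ> P ^^ Suc m) x = \<omega> (P ((P ^^ m) x))" by simp
  also have "... = (1 / real n) *\<^sub>R (\<Sum>i=1..n. \<omega> (E i ((P ^^ m) x)))" by (rule state_P_apply[OF Suc.prems(1) y])
  finally show "(\<omega> \<circ> P ^^ Suc m) x = (1 / real n) *\<^sub>R (\<Sum>i=1..n. ((\<omega> \<circ> E i) \<circ> P ^^ m) x)" by simp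
 qed
qed (simp add: comp_def)

lemma contraction:
 assumes "normal_state M \<omega>" "normal_state M \<omega>'" "!!x. x \<in> M ==> \<omega> (EN x) = \<omega>' (EN x)"
 shows "T (\<omega> \<circ> P) (\<omega>' \<circ> P) <= ereal (1 - \<kappa>) * T \<omega> \<omega>'"
 using ricci assms unfolding coarse_ricci_lower_bound_def by simp

text \<open>P fixes the range of EN, so the two states keep agreeing there at every step. \<kappa>
  <= 1 makes the factor nonnegative, as iterating the inequality requires.\<close>

lemma contraction_Pow:
 assumes st: "normal_state M \<omega>" "normal_state M \<omega>'" "!!x. x \<in> M ==> \<omega> (EN x) = \<omega>' (EN x)"
  and k: "\<kappa> <= 1" and le: "T \<omega> \<omega>' <= ereal a"
 shows "T (\<omega> \<circ> P ^^ m) (\<omega>' \<circ> P ^^ m) <= ereal ((1 - \<kappa>) ^ m * a)"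
proof (induction m)
 case (Suc m)
 have fix_EN: "(P ^^ m) (EN x) = EN x" if "x \<in> M" for x using P_EN[OF that] by (induction m) auto
 have eq: "\<rho> \<circ> P ^^ Suc m = (\<rho> \<circ> P ^^ m) \<circ> P" for \<rho> :: "'h op => complex" by (simp add: fun_eq_iff funpow_swap1)
 have "T (\<omega> \<circ> P ^^ Suc m) (\<omega>' \<circ> P ^^ Suc m) <= ereal (1 - \<kappa>) * T (\<omega> \<circ> P ^^ m) (\<omega>' \<circ> P ^^ m)"
  unfolding eq using st by (intro contraction state_Pow) (auto simp: fix_EN)
 also have "... <= ereal (1 - \<kappa>) * ereal ((1 - \<kappa>) ^ m * a)" using k by (intro ereal_mult_left_mono Suc.IH) auto
 finally show ?case by (simp add: mult.assoc comp_def)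
qed (use le in \<open>simp add: comp_def\<close>)

text \<open>The geometric series appears through its fixed point A + q A / (1 - q) = A / (1 - q):
  the first n steps cost at most A, the remaining m - n are the contracted cost of a shorter
  walk.\<close>

lemma cost_Pow_bound:
 assumes C: "0 <= C" and \<rho>: "normal_state M \<rho>" and k: "\<kappa> <= 1"
  and v: "v \<ge> 0" "C = 0 \<or> var_entropy (\<lambda>x. Re (\<rho> x)) (\<lambda>x. Re (\<rho> (EN x))) = ennreal v"
 shows "T \<rho> (\<rho> \<circ> P ^^ m) <= ereal (C * sqrt (2 * real n * v) / (1 - (1 - \<kappa>) ^ n))"
proof -
 define q where "q = (1 - \<kappa>) ^ n"
 define A where "A = C * sqrt (2 * real n * v)"
 have q: "0 <= q" "q < 1" using k denominator by (auto simp: q_def)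
 have A: "0 <= A" using C v by (simp add: A_def)
 have AK: "A <= A / (1 - q)" using A q by (simp add: pos_le_divide_eq mult_left_le)
 have short: "T \<rho> (\<rho> \<circ> P ^^ l) <= ereal A" if "l <= n" for l
 proof -
  have "T \<rho> (\<rho> \<circ> P ^^ l) <= ereal (0 + C * sqrt (2 * (real l * v)))" using cost_self[OF \<rho>] compatible v
   by (intro cost_entropy[OF C \<rho> state_EN[OF \<rho>] _ \<rho>]) (auto simp: zero_ereal_def)
  also have "... <= ereal A" unfolding A_def using C v that by (auto intro!: mult_left_mono mult_right_mono)
  finally show ?thesis .
 qed
 show ?thesis unfolding q_def[symmetric] A_def[symmetric]
 proof (induction m rule: less_induct)
  case (less m)
  show ?case
  proof (cases "m <= n")
   case True
   then show ?thesis using short[OF True] AK by (meson ereal_less_eq(3) order_trans)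
  next
   case False
   define l where "l = m - n"
   have m: "m = n + l" "l < m" using False n by (auto simp: l_def)
   have eq: "\<rho> \<circ> P ^^ m = (\<rho> \<circ> P ^^ l) \<circ> P ^^ n" unfolding m(1) by (simp add: fun_eq_iff) (metis add.commute comp_apply funpow_add)
   have fix_EN: "(P ^^ l) (EN x) = EN x" if "x \<in> M" for x using P_EN[OF that] by (induction l) auto
   have "T \<rho> (\<rho> \<circ> P ^^ m) <= T \<rho> (\<rho> \<circ> P ^^ n) + T (\<rho> \<circ> P ^^ n) (\<rho> \<circ> P ^^ m)"
    by (intro cost_triangle state_Pow \<rho>)
   also have "... <= ereal A + ereal (q * (A / (1 - q)))" unfolding eq q_def
    by (intro add_mono short order_refl contraction_Pow \<rho> state_Pow k) (use less.IH[OF m(2)] in \<open>simp_all add: comp_def fix_EN q_def\<close>)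
   also have "... = ereal (A / (1 - q))" using q by (simp add: field_simps)
   finally show ?thesis .
  qed
 qed
qed

definition mean :: "'h op => nat => 'h op"
 where "mean y m = (1 / real (Suc m)) *\<^sub>R (\<Sum>j<Suc m. (P ^^ j) y)"

text \<open>P moves a mean by at most 2 |y| / (m + 1), so a weak cluster point is fixed by P and
  lies in N. EN is constant on the means and normal, hence the cluster point is EN y.\<close>

lemma mean_ergodic:
 assumes y: "y \<in> M" "adj y = y"
 shows "\<exists>F. F ~= bot \<and> (\<forall>f. nfun f --> ((\<lambda>m. f (mean y m)) \<longlongrightarrow> f (EN y)) F)"
proof -
 define k where "k = norm y"
 have PI: "P \<I> = \<I>" using P_N ceNB(2) by blast
 have Pow: "(P ^^ j) y \<in> M \<and> adj ((P ^^ j) y) = (P ^^ j) y \<and> psd (k *\<^sub>R \<I> - (P ^^ j) y) \<and> psd (k *\<^sub>R \<I> + (P ^^ j) y)" for j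
 proof (induction j)
  case 0 show ?case using y psd_norm_bound[OF y(2), of k] by (simp add: k_def)
 next
  case (Suc j)
  then have z: "(P ^^ j) y \<in> M" by blast
  have e: "P (k *\<^sub>R \<I> + (P ^^ j) y) = k *\<^sub>R \<I> + P ((P ^^ j) y)" "P (k *\<^sub>R \<I> - (P ^^ j) y) = k *\<^sub>R \<I> - P ((P ^^ j) y)"
   using z by (simp_all add: P_add P_diff P_scaleR PI mem_rules)
  have "psd (P (k *\<^sub>R \<I> + (P ^^ j) y))" "psd (P (k *\<^sub>R \<I> - (P ^^ j) y))"
   using Suc.IH z by (auto intro!: P_psd simp: mem_rules)
  moreover have "adj (P ((P ^^ j) y)) = P ((P ^^ j) y)" using P_adj[OF z] Suc.IH by metis
  ultimately show ?case using P_mem[OF z] unfolding e funpow.simps comp_apply by blast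
 qed
 have Pn: "norm ((P ^^ j) y) <= k" for j using Pow[of j] by (intro norm_le_of_psd) (auto simp: k_def)
 have mM: "mean y m \<in> M" for m unfolding mean_def using Pow by (intro scaleR_mem sum_mem) blast
 have mn: "norm (mean y m) <= k" for m
 proof -
  have "norm (\<Sum>j<Suc m. (P ^^ j) y) <= real (card {..<Suc m}) * k" by (rule sum_norm_bound) (rule Pn)
  then have "1 / real (Suc m) * norm (\<Sum>j<Suc m. (P ^^ j) y) <= 1 / real (Suc m) * (real (Suc m) * k)" by (intro mult_left_mono) auto
  then show ?thesis by (simp add: mean_def del: sum.lessThan_Suc of_nat_Suc)
 qed
 have msa: "adj (mean y m) = mean y m" for m
  unfolding mean_def adj_rules by (intro arg_cong2[where f = scaleR] sum.cong refl) (use Pow in blast)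
 obtain F z where F: "F ~= bot" "F <= sequentially" and z: "z \<in> M" "wlim F (mean y) z" using weak_cluster[of "mean y" k] mM mn by blast
 have zsa: "adj z = z" using wlim_unique[OF F(1) _ z(2), of "adj z"] wlim_adj[OF z(2)] by (simp add: msa)
 have lim: "((\<lambda>m. f (mean y m)) \<longlongrightarrow> f z) F" if "nfun f" for f by (rule nfun_wcont[OF that F(1) mM mn z(2)])
 have shift: "(\<lambda>m. P (mean y m) - mean y m) \<longlonglongrightarrow> 0"
 proof (rule Lim_null_comparison)
  have eq: "P (mean y m) - mean y m = (1 / real (Suc m)) *\<^sub>R ((P ^^ Suc m) y - y)" for m
  proof -
   have "(\<Sum>j<Suc m. (P ^^ j) y) \<in> M" using Pow by (intro sum_mem) blast
   then have "P (mean y m) = (1 / real (Suc m)) *\<^sub>R (\<Sum>j<Suc m. (P ^^ Suc j) y)"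
    unfolding mean_def using Pow by (subst P_scaleR) (auto simp: P_sum simp del: sum.lessThan_Suc)
   then have "P (mean y m) - mean y m = (1 / real (Suc m)) *\<^sub>R (\<Sum>j<Suc m. (P ^^ Suc j) y - (P ^^ j) y)"
    by (simp add: mean_def sum_subtractf scaleR_diff_right)
   also have "(\<Sum>j<Suc m. (P ^^ Suc j) y - (P ^^ j) y) = (P ^^ Suc m) y - (P ^^ 0) y" by (rule sum_lessThan_telescope)
   finally show ?thesis by simp
  qed
  show "\<forall>\<^sub>F m in sequentially. norm (P (mean y m) - mean y m) <= 2 * k * (1 / real (Suc m))"
  proof (rule always_eventually, rule allI)
   fix m
   have "norm ((P ^^ Suc m) y - y) <= norm ((P ^^ Suc m) y) + norm y" by (rule norm_triangle_ineq4)
   also have "... <= 2 * k" using Pn[of "Suc m"] by (simp add: k_def)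
   finally have "1 / real (Suc m) * norm ((P ^^ Suc m) y - y) <= 1 / real (Suc m) * (2 * k)" by (rule mult_left_mono) simp
   then show "norm (P (mean y m) - mean y m) <= 2 * k * (1 / real (Suc m))" unfolding eq by (simp add: mult.commute)
  qed
  have "(\<lambda>m. 2 * k * (1 / real (Suc m))) \<longlonglongrightarrow> 2 * k * 0" by (intro tendsto_intros LIMSEQ_Suc[OF lim_const_over_n])
  then show "(\<lambda>m. 2 * k * (1 / real (Suc m))) \<longlonglongrightarrow> 0" by simp
 qed
 have PEN: "g z = g' z" if "nfun g" "nfun g'" "((\<lambda>m. g (mean y m) - g' (mean y m)) \<longlongrightarrow> 0) F" for g g'
  using tendsto_unique[OF F(1) that(3) tendsto_diff[OF lim[OF that(1)] lim[OF that(2)]]] by simp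
 have Pz: "P z = z"
 proof (rule sa_eqI)
  show "adj (P z) = P z" using P_adj[OF z(1)] zsa by simp
  fix u
  show "inner u (blinfun_apply (P z) u) = inner u (blinfun_apply z u)"
  proof (rule PEN[of "\<lambda>x. inner u (blinfun_apply (P x) u)" "\<lambda>x. inner u (blinfun_apply x u)"])
   have "((\<lambda>m. inner u (blinfun_apply (P (mean y m) - mean y m) u)) \<longlongrightarrow> inner u (blinfun_apply 0 u)) F"
    by (intro tendsto_intros tendsto_mono[OF F(2) shift])
   then show "((\<lambda>m. inner u (blinfun_apply (P (mean y m)) u) - inner u (blinfun_apply (mean y m) u)) \<longlongrightarrow> 0) F"
    by (simp add: bilinear_simps)
  qed (rule nfun_P[OF vector_nfun], rule vector_nfun)
 qed (rule zsa)
 have EP: "EN ((P ^^ j) y) = EN y" for j by (induction j) (use Pow in \<open>auto simp: EN_P\<close>)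
 have ENm: "EN (mean y m) = EN y" for m
 proof -
  have "(\<Sum>j<Suc m. (P ^^ j) y) \<in> M" using Pow by (intro sum_mem) blast
  then have "EN (mean y m) = (1 / real (Suc m)) *\<^sub>R (\<Sum>j<Suc m. EN y)"
   unfolding mean_def using Pow by (subst ceNL(1)) (auto simp: EN_sum EP simp del: sum.lessThan_Suc)
  also have "... = EN y" by (simp add: sum_constant_scaleR del: sum.lessThan_Suc of_nat_Suc)
  finally show ?thesis .
 qed
 have "EN y = EN z"
 proof (rule sa_eqI)
  show "adj (EN y) = EN y" "adj (EN z) = EN z" using ceNL(4)[OF y(1)] ceNL(4)[OF z(1)] y zsa by simp_all
  fix u
  have "((\<lambda>m. inner u (blinfun_apply (EN (mean y m)) u)) \<longlongrightarrow> inner u (blinfun_apply (EN z) u)) F"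
   by (rule lim[OF nfun_conditional_expectation[OF ceN vector_nfun]])
  then show "inner u (blinfun_apply (EN y) u) = inner u (blinfun_apply (EN z) u)" unfolding ENm using F(1) tendsto_const_iff by metis
 qed
 also have "EN z = z" using ceNB(5) invariant z(1) Pz by blast
 finally show ?thesis using F lim by (intro exI[of _ F]) simp
qed

text \<open>For each pair in B the bound is an affine condition on the second state; it survives
  averaging over the powers and the weak limit.\<close>

lemma cost_limit:
 assumes \<rho>: "normal_state M \<rho>" and le: "!!m. T \<rho> (\<rho> \<circ> P ^^ m) <= ereal K"
 shows "T \<rho> (\<rho> \<circ> EN) <= ereal K" unfolding transportation_cost_le_iff
proof safe
 fix x y assume xy: "(x, y) \<in> B"
 note y = B_mem(2,4)[OF xy] and st = normal_state_nstate[OF \<rho>]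
 obtain F where F: "F ~= bot" "((\<lambda>m. Re (\<rho> (mean y m))) \<longlongrightarrow> Re (\<rho> (EN y))) F"
  using mean_ergodic[OF y] nstate_nfun[OF st] by blast
 have ge: "Re (\<rho> x) - K <= Re (\<rho> (mean y m))" for m
 proof -
  have "Re (\<rho> x) - K <= Re (\<rho> ((P ^^ j) y))" for j using le[of j] xy unfolding transportation_cost_le_iff by fastforce
  then have "(\<Sum>j<Suc m. Re (\<rho> x) - K) <= (\<Sum>j<Suc m. Re (\<rho> ((P ^^ j) y)))" by (intro sum_mono)
  then have "real (Suc m) * (Re (\<rho> x) - K) <= (\<Sum>j<Suc m. Re (\<rho> ((P ^^ j) y)))" by (simp del: sum.lessThan_Suc of_nat_Suc)
  moreover have "Re (\<rho> (mean y m)) = (\<Sum>j<Suc m. Re (\<rho> ((P ^^ j) y))) / real (Suc m)"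
  proof -
   have S: "(\<Sum>j<Suc m. (P ^^ j) y) \<in> M" using Pow_mem[OF y(1)] by (rule sum_mem)
   have "Re (\<rho> (\<Sum>j<Suc m. (P ^^ j) y)) = (\<Sum>j<Suc m. Re (\<rho> ((P ^^ j) y)))"
    using pfun_sum[OF nstate_pfun[OF st], of "{..<Suc m}" "\<lambda>j. (P ^^ j) y"] Pow_mem[OF y(1)] by blast
   then show ?thesis unfolding mean_def pfun_scaleR[OF nstate_pfun[OF st] S] by simp
  qed
  ultimately show ?thesis by (simp add: pos_le_divide_eq mult.commute del: sum.lessThan_Suc of_nat_Suc)
 qed
 have "Re (\<rho> x) - K <= Re (\<rho> (EN y))" by (rule tendsto_lowerbound[OF F(2) _ F(1)]) (use ge in simp)
 then show "ereal (Re (\<rho> x) - Re ((\<rho> \<circ> EN) y)) <= ereal K" by simp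
qed

text \<open>Costs are nonnegative, so a negative C forces a normal state to be invariant under each
  E i, hence under P and its means.\<close>

lemma EN_invisible:
 assumes C: "C < 0" and \<rho>: "normal_state M \<rho>" and y: "y \<in> M" "adj y = y"
 shows "Re (\<rho> (EN y)) = Re (\<rho> y)"
proof -
 have E: "\<rho> (E i z) = \<rho> z" if i: "i \<in> {1..n}" and z: "z \<in> M" for i z
 proof -
  define p where "p = predual_norm M (\<lambda>x. \<rho> x - (\<rho> \<circ> E i) x)"
  have "0 <= ereal (C * p)" using cost_nonneg[OF \<rho> state_E[OF i \<rho>]] cost_norm[OF i \<rho>] unfolding p_def by (rule order_trans)
  then have p: "p <= 0" using C by (simp add: zero_le_mult_iff)
  define r where "r = 1 / (norm z + 1)"
  have nz: "norm z + 1 > 0" using norm_ge_zero[of z] by linarith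
  then have r: "r > 0" by (simp add: r_def)
  have rz: "r *\<^sub>R z \<in> M" "norm (r *\<^sub>R z) <= 1" using z nz by (auto simp: mem_rules r_def)
  have "cmod (\<rho> (r *\<^sub>R z) - (\<rho> \<circ> E i) (r *\<^sub>R z)) <= p"
   unfolding p_def by (rule predual_norm_ge[OF \<rho> state_E[OF i \<rho>] rz])
  then have "cmod (\<rho> (r *\<^sub>R z) - (\<rho> \<circ> E i) (r *\<^sub>R z)) <= 0" using p by linarith
  then show ?thesis using r normal_state_scaleR[OF \<rho> z, of r] normal_state_scaleR[OF state_E[OF i \<rho>] z, of r] by simp
 qed
 have P: "\<rho> (P z) = \<rho> z" if z: "z \<in> M" for z using E[OF _ z] n by (simp add: state_P_apply[OF \<rho> z] scaleR_conv_of_real)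
 have Pow: "\<rho> ((P ^^ j) y) = \<rho> y" for j by (induction j) (simp_all add: P Pow_mem[OF y(1)])
 have m: "(\<Sum>j<Suc m. (P ^^ j) y) \<in> M" for m using Pow_mem[OF y(1)] by (rule sum_mem)
 have "\<rho> (\<Sum>j<Suc m. (P ^^ j) y) = (\<Sum>j<Suc m. \<rho> ((P ^^ j) y))" for m
  by (rule normal_state_sum[OF \<rho> Pow_mem[OF y(1)]])
 then have mean: "\<rho> (mean y m) = \<rho> y" for m
  unfolding mean_def normal_state_scaleR[OF \<rho> m] by (simp add: Pow del: sum.lessThan_Suc of_nat_Suc)
 obtain F where F: "F ~= bot" "((\<lambda>m. Re (\<rho> (mean y m))) \<longlongrightarrow> Re (\<rho> (EN y))) F"
  using mean_ergodic[OF y] nstate_nfun[OF normal_state_nstate[OF \<rho>]] by blast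
 then show ?thesis unfolding mean by (simp add: tendsto_const_iff)
qed

end

context traced_algebra
begin

text \<open>Both states get the same chosen density, so the joint measure lives on the diagonal: off
  it a pair is separated by a rational, and the countably many rectangles are null. This settles
  negative C in the transport bound.\<close>

lemma relative_entropy_self:
 assumes \<rho>: "nstate (\<lambda>x. Re (\<rho> x))" and eq: "!!x. x \<in> M ==> psd x ==> Re (\<rho> x) = Re (\<sigma> x)"
 shows "relative_entropy M \<tau> \<rho> \<sigma> = 0"
proof -
 define e where "e = density_of M \<tau> \<rho>"
 have "is_density M \<tau> \<rho> = is_density M \<tau> \<sigma>" unfolding is_density_def using eq by (intro ext) (simp add: pos_part_iff)
 then have "density_of M \<tau> \<sigma> = e" by (simp add: density_of_def e_def)
 define \<nu> where "\<nu> = joint_spectral_measure \<rho> e e"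
 note n = nstate_nfun[OF \<rho>] and pf = nstate_pfun[OF \<rho>]
 have d: "has_density e (\<lambda>x. Re (\<rho> x))" unfolding e_def by (rule density_of[OF n])
 note p = density_psr[OF d]
 note J = joint_spectral_measure[OF n d p, folded \<nu>_def]
 note [measurable_cong] = J(1)[unfolded borel_prod[symmetric]]
 have null: "A \<times> B \<in> null_sets \<nu>" if "A \<in> sets borel" "B \<in> sets borel" "A \<inter> B = {}" for A B
 proof (rule null_setsI)
  show "emeasure \<nu> (A \<times> B) = 0" using J(2)[OF that(1,2)] psr_Int[OF p that(1,2)] that(3) by (simp add: psr_empty[OF p] pfun_zero[OF pf])
  show "A \<times> B \<in> sets \<nu>" using that by measurable
 qed
 have "{..0} \<times> UNIV \<in> null_sets \<nu>"
 proof (rule null_setsI)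
  show "emeasure \<nu> ({..0} \<times> UNIV) = 0" using J(2)[of "{..0}" UNIV] psr_UNIV[OF p] density_nonpos[OF d pf] by (simp add: op_simps)
  show "{..0} \<times> UNIV \<in> sets \<nu>" by measurable
 qed
 moreover have "(\<Union>q\<in>\<rat>. {..<q} \<times> {q..}) \<in> null_sets \<nu>"
  by (rule null_sets_UN') (auto simp: countable_rat intro!: null)
 moreover have "(\<Union>q\<in>\<rat>. {q..} \<times> {..<q}) \<in> null_sets \<nu>"
  by (rule null_sets_UN') (auto simp: countable_rat intro!: null)
 ultimately have N: "({..0} \<times> UNIV) \<union> (\<Union>q\<in>\<rat>. {..<q} \<times> {q..}) \<union> (\<Union>q\<in>\<rat>. {q..} \<times> {..<q}) \<in> null_sets \<nu>"
  by (intro null_sets.Un)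
 have diag: "AE z in \<nu>. 0 < fst z \<and> fst z = snd z"
 proof (rule AE_I'[OF N], rule subsetI)
  fix z :: "real \<times> real" assume "z \<in> {z \<in> space \<nu>. \<not> (0 < fst z \<and> fst z = snd z)}"
  then consider "fst z <= 0" | "fst z < snd z" | "snd z < fst z" by force
  then show "z \<in> ({..0} \<times> UNIV) \<union> (\<Union>q\<in>\<rat>. {..<q} \<times> {q..}) \<union> (\<Union>q\<in>\<rat>. {q..} \<times> {..<q})"
  proof cases
   case 1 then show ?thesis by (cases z) auto
  next
   case 2
   then obtain q where "q \<in> \<rat>" "fst z < q" "q < snd z" using Rats_dense_in_real by blast
   then show ?thesis by (cases z) force
  next
   case 3
   then obtain q where "q \<in> \<rat>" "snd z < q" "q < fst z" using Rats_dense_in_real by blast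
   then show ?thesis by (cases z) force
  qed
 qed
 have "(\<integral>\<^sup>+ (t, s). e2ennreal (elog t - elog s) \<partial>\<nu>) = (\<integral>\<^sup>+ z. 0 \<partial>\<nu>)"
  by (rule nn_integral_cong_AE, rule AE_mp[OF diag], rule AE_I2) (auto simp: elog_def split_def e2ennreal_neg simp flip: zero_ereal_def)
 moreover have "(\<integral>\<^sup>+ (t, s). e2ennreal (elog s - elog t) \<partial>\<nu>) = (\<integral>\<^sup>+ z. 0 \<partial>\<nu>)"
  by (rule nn_integral_cong_AE, rule AE_mp[OF diag], rule AE_I2) (auto simp: elog_def split_def e2ennreal_neg simp flip: zero_ereal_def)
 ultimately show ?thesis
  using \<open>density_of M \<tau> \<sigma> = e\<close> by (simp add: relative_entropy_def Let_def flip: e_def \<nu>_def)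
qed

end

context curvature_setting
begin

lemma transport_bound:
 assumes \<rho>: "normal_state M \<rho>"
 shows "T \<rho> (\<rho> \<circ> EN) <= ereal (C / (1 - (1 - \<kappa>) ^ n)) *
   esqrt (ereal (2 * real n) * relative_entropy M \<tau> \<rho> (\<rho> \<circ> EN))"
proof -
 define D where "D = relative_entropy M \<tau> \<rho> (\<rho> \<circ> EN)"
 define den where "den = 1 - (1 - \<kappa>) ^ n"
 have den: "den > 0" using denominator by (simp add: den_def)
 define V where "V = var_entropy (\<lambda>x. Re (\<rho> x)) (\<lambda>x. Re (\<rho> (EN x)))"
 have VD: "enn2ereal V <= D"
  using relative_entropy_ge[of \<rho> "\<rho> \<circ> EN"] normal_state_nstate[OF \<rho>] normal_state_nstate[OF state_EN[OF \<rho>]]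
  by (simp add: V_def D_def)
 have D0: "0 <= D" by (rule order_trans[OF enn2ereal_nonneg VD])
 have rhs0: "0 <= esqrt (ereal (2 * real n) * D)"
 proof -
  have "0 <= ereal (2 * real n) * D" using D0 by (intro ereal_0_le_mult) auto
  then have "0 <= real_of_ereal (ereal (2 * real n) * D)" by (rule real_of_ereal_pos)
  then show ?thesis unfolding esqrt_def by simp
 qed
 have "T \<rho> (\<rho> \<circ> EN) <= ereal (C / den) * esqrt (ereal (2 * real n) * D)"
 proof (cases "C < 0")
  \<comment> \<open>With a negative constant the state is invariant, and both sides are 0.\<close>
  case True
  have "T \<rho> (\<rho> \<circ> EN) = T \<rho> \<rho>" using EN_invisible[OF True \<rho>] by (intro cost_cong) simp
  moreover have "D = 0"
   unfolding D_def by (intro relative_entropy_self normal_state_nstate \<rho>) (simp add: EN_invisible[OF True \<rho> _ psd_sa])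
  ultimately show ?thesis using cost_self[OF \<rho>] by (simp add: esqrt_def zero_ereal_def)
 next
  case False
  then have C: "0 <= C" by simp
  have rhs: "0 <= ereal (C / den) * esqrt (ereal (2 * real n) * D)" using rhs0 C den by (intro ereal_0_le_mult) auto
  show ?thesis
  proof (cases "\<kappa> <= 1")
   \<comment> \<open>For \<kappa> > 1 the curvature factor is negative while the cost after one step
     is nonnegative, which forces the original cost to be nonpositive.\<close>
   case False
   have "0 <= T (\<rho> \<circ> P) ((\<rho> \<circ> EN) \<circ> P)" by (intro cost_nonneg state_P state_EN \<rho>)
   also have "... <= ereal (1 - \<kappa>) * T \<rho> (\<rho> \<circ> EN)" using ceNB by (intro contraction \<rho> state_EN) auto
   finally have "T \<rho> (\<rho> \<circ> EN) <= 0" using False by (cases "T \<rho> (\<rho> \<circ> EN)") (auto simp: zero_le_mult_iff)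
   then show ?thesis using rhs by (rule order_trans)
  next
   case k: True
   show ?thesis
   proof (cases "D = \<infinity> \<and> C ~= 0")
    \<comment> \<open>The right-hand side is infinite; C > 0 matters because 0 times \<infinity> is
      0.\<close>
    case True
    then obtain c where c: "C / den = c" "c > 0" using C den by simp
    show ?thesis unfolding c(1) using True n c(2) by (simp add: esqrt_def)
   next
    case False
    define v where "v = enn2real V"
    \<comment> \<open>Infinite entropy occurs here only with C = 0, where the real number v is
      multiplied by 0.\<close>
    have "C = 0 \<or> V = ennreal v" using False VD by (cases V) (auto simp: v_def)
    then have le: "T \<rho> (\<rho> \<circ> EN) <= ereal (C * sqrt (2 * real n * v) / den)"
     unfolding den_def V_def by (intro cost_limit[OF \<rho>] cost_Pow_bound C \<rho> k) (simp_all add: v_def)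
    show ?thesis
    proof (cases "C = 0")
     case True
     then show ?thesis using le rhs by (auto simp: zero_ereal_def intro: order_trans)
    next
     case C0: False
     then obtain d where d: "D = ereal d" "0 <= d" using False D0 by (cases D) auto
     have "v <= d" using VD d by (cases V) (auto simp: v_def)
     then have "ereal (C * sqrt (2 * real n * v) / den) <= ereal (C * sqrt (2 * real n * d) / den)"
      using C den by (auto intro!: divide_right_mono mult_left_mono)
     also have "... = ereal (C / den) * esqrt (ereal (2 * real n) * D)" by (simp add: d esqrt_def)
     finally show ?thesis using le by (rule order_trans[rotated])
    qed
   qed
  qed
 qed
 then show ?thesis by (simp add: D_def den_def)
qed

end

theorem theorem4p11:
  fixes M N :: "'h::chilbert_space op set"
    and \<tau> :: "'h op \<Rightarrow> ennreal"
    and n :: nat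
    and Ni :: "nat \<Rightarrow> 'h op set"
    and E :: "nat \<Rightarrow> 'h op \<Rightarrow> 'h op"
    and P E\<^sub>N :: "'h op \<Rightarrow> 'h op"
    and B :: "('h op \<times> 'h op) set"
    and \<kappa> C :: real
  assumes "von_neumann_algebra M"
    and "nfs_trace M \<tau>"
    and "1 \<le> n"
    and "\<And>i. i \<in> {1..n} \<Longrightarrow> normal_conditional_expectation M (Ni i) (E i)"
    and P: "\<And>x. P x = (1 / real n) *\<^sub>R (\<Sum>i=1..n. E i x)"
    and "N = (\<Inter>i\<in>{1..n}. Ni i)"
    and invariant: "N = {x \<in> M. P x = x}"
    and "normal_conditional_expectation M N E\<^sub>N"
    and compatible: "\<And>i x. i \<in> {1..n} \<Longrightarrow> x \<in> M \<Longrightarrow> E\<^sub>N (E i x) = E\<^sub>N x"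
    and "transportation_metric M B"
    and "0 < \<kappa>"
    and denominator: "(1 - \<kappa>) ^ n < 1"
    and "coarse_ricci_lower_bound M E\<^sub>N B P \<kappa>"
    and "cost_triangle_inequality M B"
    and "\<And>i \<rho>. i \<in> {1..n} \<Longrightarrow> normal_state M \<rho> \<Longrightarrow>
      transportation_cost B \<rho> (\<rho> \<circ> E i) \<le> ereal (C * predual_norm M (\<lambda>x. \<rho> x - (\<rho> \<circ> E i) x))"
  shows "\<forall>\<rho>. normal_state M \<rho> \<longrightarrow>
    transportation_cost B \<rho> (\<rho> \<circ> E\<^sub>N) \<le>
      ereal (C / (1 - (1 - \<kappa>) ^ n)) *
      esqrt (ereal (2 * real n) * relative_entropy M \<tau> \<rho> (\<rho> \<circ> E\<^sub>N))"
proof -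
  interpret curvature_setting M \<tau> N n Ni E P E\<^sub>N B \<kappa> C
    by unfold_locales (fact assms)+
  show ?thesis using transport_bound by blast
qed

end
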